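(* Let $n\ge2$, $1<p<2$, $0<s<1$, $sp>p-1$. Let $U$ be a globally $L$-Lipschitz entire weak solution of $\operatorname{P.V.}\int_{\mathbb R^n}J_p(U(x)-U(y))|x-y|^{-n-sp}\,dy=0$ in $\mathbb R^n$. Suppose that, for some $q\in\mathbb R^n\setminus\{0\}$, $e=q/|q|$, $r_0>0$ and $\alpha\in(0,1)$, $$U\in C^{1,\alpha}(B_{2r_0}),\qquad\|\nabla U-q\|_{L^\infty(B_{2r_0})}\le\tfrac14|q|.$$ In particular $\partial_eU\ge\lambda_0:=3|q|/4$ in $B_{2r_0}$. Set $\tau:=sp-p+2$ and $$J_U(x,y):=(p-1)\frac{|U(x)-U(y)|^{p-2}}{|x-y|^{n+sp}},$$ with $J_U(x,y)=0$ where $U(x)=U(y)$. Then $J_U$ is locally a well-defined symmetric Dirichlet kernel, and the following hold. (1) If $B_r(x_0)\subset B_{r_0/2}$ and $A_U(x):=\int_{\mathbb R^n\setminus B_{r_0}}J_U(x,y)\,dy$, then $$\int_{B_r(x_0)}A_U(x)\,dx\le Cr^{n+p-2},$$ with $C$ independent of $x_0$ and $r$. More generally, for every $D_0\Subset B_{r_0}$ the same estimate holds for balls $B_r(x_0)\subset D_0$, with a constant which may also depend on $\operatorname{dist}(D_0,\partial B_{r_0})$. In particular, $A_U$ is a Morrey--Kato absorption for the regional order $\tau$, since $\tau-(2-p)=sp>0$. (2) The a.e. directional derivative $w=\partial_eU$ belongs to $\mathcal F_{J_U,\mathrm{loc}}(B_{r_0})$ and satisfies $$\iint_{\mathbb R^n\times\mathbb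 R^n}J_U(x,y)\,\delta w(x,y)\,\delta\varphi(x,y)\,dx\,dy=0$$ for every $\varphi\in C_c^\infty(B_{r_0})$. The identity extends to every $\varphi\in\mathcal F_{J_U,c}(B_{r_0})$.
   Context: $B_r$ denotes the ball of radius $r$ centered at $0$; $\delta w(x,y):=w(x)-w(y)$; $J_p(t):=|t|^{p-2}t$. The space $L^{p-1}_{sp}(\mathbb R^n)$ consists of $v\in L^{p-1}_{\rm loc}(\mathbb R^n)$ with $\int|v(y)|^{p-1}(1+|y|)^{-n-sp}dy<\infty$. An entire weak solution is $U\in W^{s,p}_{\rm loc}(\mathbb R^n)\cap L^{p-1}_{sp}(\mathbb R^n)$ with $\iint J_p(U(x)-U(y))(\varphi(x)-\varphi(y))|x-y|^{-n-sp}dx\,dy=0$ for all $\varphi\in C_c^\infty(\mathbb R^n)$. For a symmetric kernel $K\ge0$ on $D\times D$, $\mathcal F_K(D)$ is the closure of $C_c^\infty(D)$ under the norm $\|\phi\|^2_{\mathcal F_K(D)}:=\|\phi\|_{L^2(D)}^2+\iint_{D\times D}K(x,y)|\delta\phi(x,y)|^2dx\,dy$. One writes $z\in\mathcal F_{K,\rm loc}(D)$ if $\eta z\in\mathcal F_K(D)$ for every $\eta\in C_c^\infty(D)$, and $\mathcal F_{K,c}(D)$ for the elements of $\mathcal F_K(D)$ with compact support in $D$; such elements are extended by zero outside $D$ when inserted in full-space integrals. A function $A\ge0$ is called a Morrey--Kato absorption for order $\tau$ if, locally uniformly, $\int_{B_r(x)}A\,dy\le Mr^{n-\kappa}$ for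 some $M<\infty$ and some $0<\kappa<\tau$ (here $\kappa=2-p$). *)

theory Defs
  imports "HOL-Analysis.Analysis"
begin

section \<open>Derivatives and function classes\<close>

text \<open>As with the library constant \<open>deriv\<close>, the values of \<open>grad\<close> and \<open>dir_deriv\<close> are arbitrary
  at points where the respective derivative does not exist.\<close>

definition grad :: "('a::euclidean_space \<Rightarrow> real) \<Rightarrow> 'a \<Rightarrow> 'a" where
  "grad u x = (SOME D. GDERIV u x :> D)"

definition dir_deriv :: "('a::euclidean_space \<Rightarrow> real) \<Rightarrow> 'a \<Rightarrow> 'a \<Rightarrow> real" where
  "dir_deriv u e x = deriv (\<lambda>t. u (x + t *\<^sub>R e)) 0"

primrec Ck :: "nat \<Rightarrow> ('a::euclidean_space \<Rightarrow> real) \<Rightarrow> bool" where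
  "Ck 0 f \<longleftrightarrow> continuous_on UNIV f"
| "Ck (Suc k) f \<longleftrightarrow> (\<forall>x. f differentiable (at x)) \<and>
     (\<forall>b\<in>Basis. Ck k (\<lambda>x. frechet_derivative f (at x) b))"

text \<open>\<open>C\<^sub>c\<^sup>\<infinity>(D)\<close>; its elements are functions on the whole space vanishing outside \<open>D\<close>.\<close>

definition test_functions :: "'a::euclidean_space set \<Rightarrow> ('a \<Rightarrow> real) set" where
  "test_functions D = {\<phi>. (\<forall>k. Ck k \<phi>) \<and>
     compact (closure {x. \<phi> x \<noteq> 0}) \<and> closure {x. \<phi> x \<noteq> 0} \<subseteq> D}"

definition compactly_inside :: "'a::euclidean_space set \<Rightarrow> 'a set \<Rightarrow> bool" (infix \<open>\<Subset>\<close> 50) where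
  "D0 \<Subset> D \<longleftrightarrow> compact (closure D0) \<and> closure D0 \<subseteq> D"

text \<open>\<open>C\<^sup>1\<^sup>,\<^sup>\<alpha>(D)\<close> for open \<open>D\<close>, with the gradient Hoelder continuous on compact subsets of \<open>D\<close>.
  This contains the functions whose gradient is uniformly Hoelder continuous on \<open>D\<close>. Continuity of
  the gradient is implied when \<open>\<alpha> > 0\<close>.\<close>

definition C1_holder :: "real \<Rightarrow> 'a::euclidean_space set \<Rightarrow> ('a \<Rightarrow> real) set" where
  "C1_holder \<alpha> D = {u. (\<forall>x\<in>D. u differentiable (at x)) \<and>
     (\<forall>S. compact S \<and> S \<subseteq> D \<longrightarrow>
       (\<exists>C. \<forall>x\<in>S. \<forall>y\<in>S. norm (grad u x - grad u y) \<le> C * norm (x - y) powr \<alpha>))}"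

section \<open>Entire weak solutions\<close>

definition Jp :: "real \<Rightarrow> real \<Rightarrow> real" where
  "Jp p t = \<bar>t\<bar> powr (p - 2) * t"

text \<open>Functions are represented by Borel measurable representatives.\<close>

definition frac_sobolev :: "real \<Rightarrow> real \<Rightarrow> 'a::euclidean_space set \<Rightarrow> ('a \<Rightarrow> real) set" where
  "frac_sobolev s p D = {u. set_borel_measurable lborel D u \<and>
     (\<integral>\<^sup>+x\<in>D. ennreal (\<bar>u x\<bar> powr p) \<partial>lborel) < \<infinity> \<and>
     (\<integral>\<^sup>+z\<in>D \<times> D. ennreal (\<bar>u (fst z) - u (snd z)\<bar> powr p
        / norm (fst z - snd z) powr (real DIM('a) + s * p)) \<partial>(lborel \<Otimes>\<^sub>M lborel)) < \<infinity>}"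

definition frac_sobolev_loc :: "real \<Rightarrow> real \<Rightarrow> ('a::euclidean_space \<Rightarrow> real) set" where
  "frac_sobolev_loc s p = {u. \<forall>D. open D \<and> bounded D \<longrightarrow> u \<in> frac_sobolev s p D}"

definition tail_space :: "real \<Rightarrow> real \<Rightarrow> ('a::euclidean_space \<Rightarrow> real) set" where
  "tail_space s p = {v. v \<in> borel_measurable lborel \<and>
     (\<forall>S. compact S \<longrightarrow> (\<integral>\<^sup>+x\<in>S. ennreal (\<bar>v x\<bar> powr (p - 1)) \<partial>lborel) < \<infinity>) \<and>
     (\<integral>\<^sup>+y. ennreal (\<bar>v y\<bar> powr (p - 1)
        * (1 + norm y) powr (- real DIM('a) - s * p)) \<partial>lborel) < \<infinity>}"

text \<open>Absolute convergence of the double integral, which is part of \<open>has_bochner_integral\<close>, is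
  automatic for functions in the two spaces.\<close>

definition entire_weak_solution :: "real \<Rightarrow> real \<Rightarrow> ('a::euclidean_space \<Rightarrow> real) \<Rightarrow> bool" where
  "entire_weak_solution s p U \<longleftrightarrow> U \<in> frac_sobolev_loc s p \<inter> tail_space s p \<and>
     (\<forall>\<phi>\<in>test_functions UNIV.
        has_bochner_integral (lborel \<Otimes>\<^sub>M lborel)
          (\<lambda>(x, y). Jp p (U x - U y) * (\<phi> x - \<phi> y)
             / norm (x - y) powr (real DIM('a) + s * p)) 0)"

section \<open>Energy spaces of symmetric kernels\<close>

text \<open>The square of the norm of \<open>\<F>\<^sub>K(D)\<close>; only the values of the functions on \<open>D\<close> matter.\<close>

definition energy_norm2 ::
    "('a::euclidean_space \<Rightarrow> 'a \<Rightarrow> real) \<Rightarrow> 'a set \<Rightarrow> ('a \<Rightarrow> real) \<Rightarrow> ennreal" where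
  "energy_norm2 K D \<phi> = (\<integral>\<^sup>+x\<in>D. ennreal ((\<phi> x)\<^sup>2) \<partial>lborel) +
     (\<integral>\<^sup>+z\<in>D \<times> D. ennreal (K (fst z) (snd z) * (\<phi> (fst z) - \<phi> (snd z))\<^sup>2) \<partial>(lborel \<Otimes>\<^sub>M lborel))"

text \<open>The last condition says that the norm is finite on \<open>C\<^sub>c\<^sup>\<infinity>(D)\<close>, so that the closure
  \<open>\<F>\<^sub>K(D)\<close> makes sense.\<close>

definition symmetric_Dirichlet_kernel ::
    "'a::euclidean_space set \<Rightarrow> ('a \<Rightarrow> 'a \<Rightarrow> real) \<Rightarrow> bool" where
  "symmetric_Dirichlet_kernel D K \<longleftrightarrow>
     set_borel_measurable (lborel \<Otimes>\<^sub>M lborel) (D \<times> D) (\<lambda>(x, y). K x y) \<and>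
     (\<forall>x\<in>D. \<forall>y\<in>D. 0 \<le> K x y \<and> K x y = K y x) \<and>
     (\<forall>\<phi>\<in>test_functions D. energy_norm2 K D \<phi> < \<infinity>)"

definition energy_space ::
    "('a::euclidean_space \<Rightarrow> 'a \<Rightarrow> real) \<Rightarrow> 'a set \<Rightarrow> ('a \<Rightarrow> real) set" where
  "energy_space K D = {z. set_borel_measurable lborel D z \<and> energy_norm2 K D z < \<infinity> \<and>
     (\<forall>\<epsilon>>0. \<exists>\<phi>\<in>test_functions D. energy_norm2 K D (\<lambda>x. z x - \<phi> x) < \<epsilon>)}"

definition energy_space_loc ::
    "('a::euclidean_space \<Rightarrow> 'a \<Rightarrow> real) \<Rightarrow> 'a set \<Rightarrow> ('a \<Rightarrow> real) set" where
  "energy_space_loc K D = {z. \<forall>\<eta>\<in>test_functions D. (\<lambda>x. \<eta> x * z x) \<in> energy_space K D}"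

text \<open>Elements are classes modulo null sets, so compact support is meant in the essential sense.\<close>

definition energy_space_c ::
    "('a::euclidean_space \<Rightarrow> 'a \<Rightarrow> real) \<Rightarrow> 'a set \<Rightarrow> ('a \<Rightarrow> real) set" where
  "energy_space_c K D = {z \<in> energy_space K D.
     \<exists>S. compact S \<and> S \<subseteq> D \<and> (AE x in lborel. x \<in> D - S \<longrightarrow> z x = 0)}"

definition zero_extension :: "'a set \<Rightarrow> ('a \<Rightarrow> real) \<Rightarrow> 'a \<Rightarrow> real" where
  "zero_extension D z x = (if x \<in> D then z x else 0)"

definition morrey_kato_absorption ::
    "'a::euclidean_space set \<Rightarrow> real \<Rightarrow> real \<Rightarrow> ('a \<Rightarrow> ennreal) \<Rightarrow> bool" where
  "morrey_kato_absorption D \<tau> \<kappa> A \<longleftrightarrow> 0 < \<kappa> \<and> \<kappa> < \<tau> \<and>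
     (\<lambda>x. indicator D x * A x) \<in> borel_measurable lborel \<and>
     (\<forall>D0. D0 \<Subset> D \<longrightarrow> (\<exists>M::real. \<forall>x r. 0 < r \<and> ball x r \<subseteq> D0 \<longrightarrow>
        (\<integral>\<^sup>+y\<in>ball x r. A y \<partial>lborel) \<le> ennreal (M * r powr (real DIM('a) - \<kappa>))))"

section \<open>The linearised kernel\<close>

definition JU :: "real \<Rightarrow> real \<Rightarrow> ('a::euclidean_space \<Rightarrow> real) \<Rightarrow> 'a \<Rightarrow> 'a \<Rightarrow> real" where
  "JU s p U x y = (if U x = U y then 0
     else (p - 1) * \<bar>U x - U y\<bar> powr (p - 2) / norm (x - y) powr (real DIM('a) + s * p))"

definition AU ::
    "real \<Rightarrow> real \<Rightarrow> ('a::euclidean_space \<Rightarrow> real) \<Rightarrow> real \<Rightarrow> 'a \<Rightarrow> ennreal" where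
  "AU s p U r0 x = (\<integral>\<^sup>+y\<in>- ball 0 r0. ennreal (JU s p U x y) \<partial>lborel)"

end

theory Submission
  imports Defs
begin

text \<open>
  In the slab where \<open>U\<close> increases along \<open>e\<close> with slope at least \<open>\<lambda>\<^sub>0\<close>, each line parallel to \<open>e\<close> meets
  \<open>{\<bar>U - c\<bar> < t}\<close> in a set of length \<open>O(t)\<close>, and \<open>p - 2 > -1\<close>. Fubini and a dyadic summation
  bound the integral of \<open>\<bar>U - c\<bar>\<^sup>p\<^sup>-\<^sup>2\<close> over a ball of radius \<open>r\<close> by \<open>C r\<^sup>n\<^sup>+\<^sup>p\<^sup>-\<^sup>2\<close>; this gives part (1) and
  the integrability of \<open>J\<^sub>U min(1, \<bar>x - y\<bar>\<^sup>2)\<close> near the ball.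

  The difference quotient \<open>W\<^sub>h\<close> of \<open>U\<close> solves a linear equation whose kernel \<open>K\<^sub>h\<close> is the secant slope of
  \<open>J\<^sub>p\<close>. Since \<open>J\<^sub>p'\<close> is decreasing in the modulus, \<open>K\<^sub>h\<close> is bounded by a multiple of \<open>J\<^sub>U\<close>, whatever the
  translated increment is. A Caccioppoli estimate makes the energy of \<open>\<eta> W\<^sub>h\<close> bounded in \<open>h\<close>, so \<open>h \<rightarrow> 0\<close>
  is possible both in the energy (Fatou) and in the equation (uniform integrability).

  Density of test functions: \<open>J\<^sub>U\<close> dominates a multiple of \<open>\<bar>x - y\<bar>\<^sup>-\<^sup>n\<^sup>-\<^sup>\<tau>\<close> because \<open>U\<close> is Lipschitz;
  conversely, inserting an average over intermediate points bounds the energy of \<open>J\<^sub>U\<close> by the Gagliardo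
  energy of order \<open>\<tau> / 2\<close>, for which mollification converges. For the extension to the energy space,
  the far interaction is a pairing with a measure of Morrey type, and the same Gagliardo energy
  controls it.
\<close>

section \<open>Integrals of powers of the norm\<close>

text \<open>Outside the ball \<open>U\<close> is merely Lipschitz, so for fixed \<open>x\<close>
  nothing bounds the integral of \<open>J x y\<close> over \<open>y\<close>: values of
  \<open>U\<close> may crowd around \<open>U x\<close>. The direction of increase helps only in the
  variable that lies in the ball, but there uniformly in the level \<open>c = U y\<close>. Hence far
  estimates integrate first over the variable in the ball, and every majorant asks that one of the
  two points lie there. The order \<tau> = sp - p + 2 exceeds 1 because sp > p - 1. A bounded
  increment of the difference quotient times a Lipschitz increment of a test function is then not
  integrable near the diagonal by size alone, and the Lipschitz constant of the quotient blows up
  like 1 / h. So an energy bound has to precede the limit, and a splitting with a free parameter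
  \<open>T\<close> takes the place of dominated convergence. The condition sp > p - 1 also makes the
  weak form converge at infinity for a Lipschitz \<open>U\<close>, while sp < p gives convergence on
  the diagonal. The exponent \<open>N - p + 2\<close> met throughout is n + \<tau>.\<close>

lemma pred_mem_cball [measurable (raw)]:
  fixes f g :: "'b \<Rightarrow> 'a::euclidean_space" and h :: "'b \<Rightarrow> real"
  assumes [measurable]: "f \<in> borel_measurable M" "g \<in> borel_measurable M" "h \<in> borel_measurable M"
  shows "Measurable.pred M (\<lambda>x. f x \<in> cball (g x) (h x))"
  unfolding mem_cball by measurable

lemma pred_mem_ball [measurable (raw)]:
  fixes f g :: "'b \<Rightarrow> 'a::euclidean_space" and h :: "'b \<Rightarrow> real"
  assumes [measurable]: "f \<in> borel_measurable M" "g \<in> borel_measurable M" "h \<in> borel_measurable M"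
  shows "Measurable.pred M (\<lambda>x. f x \<in> ball (g x) (h x))"
  unfolding mem_ball by measurable

lemma cball_sets_borel [measurable]: "cball y r \<in> sets borel"
  and ball_sets_borel [measurable]: "ball y r \<in> sets borel"
  by auto

lemma sum_le_suminf_ennreal: "f k \<le> (\<Sum>i. f i :: ennreal)"
  using sum_le_suminf[of f "{k}"] by simp

lemma power_powr_swap: "0 \<le> x \<Longrightarrow> (x ^ k) powr c = (x powr c) ^ k" for x c :: real
  by (induction k) (auto simp: powr_mult)

text \<open>Dyadic shells around \<open>y\<close>: where |x - y| lies between
  \<open>\<rho> (Suc k)\<close> and \<open>\<rho> k\<close> the weight is at most (\<rho> k /
  2)^(-b), while the ball has mass at most M (\<rho> k)^a. Since b < a the products form a geometric
  series of ratio 2^(b - a). A growth bound of Morrey type on \<open>g\<close> thus suffices to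
  integrate a singular power against it.\<close>

lemma nn_integral_powr_dyadic:
  fixes g :: "'a::euclidean_space \<Rightarrow> ennreal" and y :: 'a
  assumes [measurable]: "g \<in> borel_measurable borel"
    and R: "0 < R" and b: "0 \<le> b" "b < a" and M: "0 \<le> M"
    and g: "\<And>\<rho>. 0 < \<rho> \<Longrightarrow> \<rho> \<le> R \<Longrightarrow> (\<integral>\<^sup>+x\<in>cball y \<rho>. g x \<partial>lborel) \<le> ennreal (M * \<rho> powr a)"
  shows "(\<integral>\<^sup>+x\<in>cball y R. g x * ennreal (norm (x - y) powr (- b)) \<partial>lborel)
    \<le> ennreal (M * (2 powr b / (1 - 2 powr (b - a))) * R powr (a - b))"
proof -
  define \<rho> where "\<rho> k = R * (1/2)^k" for k :: nat
  have \<rho>: "0 < \<rho> k" "\<rho> k \<le> R" for k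
    using R by (auto simp: \<rho>_def power_le_one)
  \<comment> \<open>At x = y the left side is 0 because \<open>0 powr (- b)\<close> is 0; otherwise
    the least \<open>k\<close> with \<open>\<rho> (Suc k) < norm (x - y)\<close> names the shell of
    \<open>x\<close>.\<close>
  have pt: "g x * ennreal (norm (x - y) powr (- b)) * indicator (cball y R) x
      \<le> (\<Sum>k. ennreal (\<rho> k powr (- b) * 2 powr b) * (g x * indicator (cball y (\<rho> k)) x))" for x
  proof (cases "x = y \<or> x \<notin> cball y R")
    case True
    then show ?thesis by auto
  next
    case False
    define d where "d = norm (x - y)"
    have d: "0 < d" "d \<le> R"
      using False by (auto simp: d_def dist_norm norm_minus_commute)
    obtain k0 where "(1/2::real)^k0 < d / R"
      using real_arch_pow_inv[of "d/R" "1/2"] d R by auto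
    then have ex: "\<exists>k. \<rho> (Suc k) < d"
      using R d(1) by (intro exI[of _ k0]) (auto simp: \<rho>_def field_simps)
    define k where "k = (LEAST k. \<rho> (Suc k) < d)"
    have k1: "\<rho> (Suc k) < d"
      unfolding k_def using ex by (rule LeastI_ex)
    have k2: "d \<le> \<rho> k"
    proof (cases k)
      case 0
      then show ?thesis using d by (simp add: \<rho>_def)
    next
      case (Suc j)
      then have "\<not> \<rho> (Suc j) < d"
        unfolding k_def using not_less_Least[of j "\<lambda>k. \<rho> (Suc k) < d"] by simp
      then show ?thesis using Suc by simp
    qed
    have "d powr (- b) \<le> (\<rho> k / 2) powr (- b)"
      using k1 \<rho>[of k] b by (intro powr_mono2') (auto simp: \<rho>_def)
    also have "\<dots> = \<rho> k powr (- b) * 2 powr b"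
      using \<rho>[of k] by (simp add: powr_divide powr_minus field_simps)
    finally have "g x * ennreal (norm (x - y) powr (- b)) * indicator (cball y R) x
        \<le> ennreal (\<rho> k powr (- b) * 2 powr b) * (g x * indicator (cball y (\<rho> k)) x)"
      using k2 d by (auto simp: d_def indicator_def dist_norm norm_minus_commute mult.commute
          intro!: mult_left_mono ennreal_leI)
    also have "\<dots> \<le> (\<Sum>k. ennreal (\<rho> k powr (- b) * 2 powr b) * (g x * indicator (cball y (\<rho> k)) x))"
      by (rule sum_le_suminf_ennreal)
    finally show ?thesis .
  qed
  have "(\<integral>\<^sup>+x\<in>cball y R. g x * ennreal (norm (x - y) powr (- b)) \<partial>lborel)
     \<le> (\<integral>\<^sup>+x. (\<Sum>k. ennreal (\<rho> k powr (- b) * 2 powr b) * (g x * indicator (cball y (\<rho> k)) x)) \<partial>lborel)"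
    by (intro nn_integral_mono pt)
  also have "\<dots> = (\<Sum>k. \<integral>\<^sup>+x. ennreal (\<rho> k powr (- b) * 2 powr b) * (g x * indicator (cball y (\<rho> k)) x) \<partial>lborel)"
    by (intro nn_integral_suminf) measurable
  also have "\<dots> = (\<Sum>k. ennreal (\<rho> k powr (- b) * 2 powr b) * (\<integral>\<^sup>+x\<in>cball y (\<rho> k). g x \<partial>lborel))"
    by (intro suminf_cong nn_integral_cmult) measurable
  also have "\<dots> \<le> (\<Sum>k. ennreal (\<rho> k powr (- b) * 2 powr b) * ennreal (M * \<rho> k powr a))"
    by (intro suminf_le mult_left_mono g \<rho>) auto
  also have "\<dots> = (\<Sum>k. ennreal (M * 2 powr b * R powr (a - b) * (2 powr (b - a)) ^ k))"
  proof (intro suminf_cong)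
    fix k
    have "\<rho> k powr (- b) * 2 powr b * (M * \<rho> k powr a) = M * 2 powr b * \<rho> k powr (a - b)"
      using \<rho>[of k] by (simp add: powr_diff powr_minus field_simps)
    also have "\<rho> k powr (a - b) = R powr (a - b) * (2 powr (b - a)) ^ k"
      using R powr_minus_divide[of 2 "a - b"]
      by (simp add: \<rho>_def powr_mult power_powr_swap powr_divide)
    finally show "ennreal (\<rho> k powr (- b) * 2 powr b) * ennreal (M * \<rho> k powr a)
        = ennreal (M * 2 powr b * R powr (a - b) * (2 powr (b - a)) ^ k)"
      using M by (subst ennreal_mult[symmetric]) (auto simp: mult.assoc)
  qed
  also have "\<dots> = ennreal (M * 2 powr b * R powr (a - b) * (1 / (1 - 2 powr (b - a))))"
  proof -
    have "(2::real) powr (b - a) < 2 powr 0"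
      using b by (intro powr_less_mono) auto
    then have "(\<lambda>k. M * 2 powr b * R powr (a - b) * (2 powr (b - a)) ^ k) sums
        (M * 2 powr b * R powr (a - b) * (1 / (1 - 2 powr (b - a))))"
      by (intro sums_mult geometric_sums) auto
    then show ?thesis
      using M by (intro suminf_ennreal_eq) auto
  qed
  finally show ?thesis by (simp add: field_simps)
qed

text \<open>The case of constant density, whose growth exponent is the dimension.\<close>

lemma nn_integral_powr_cball:
  fixes y :: "'a::euclidean_space" and b R :: real
  assumes R: "0 < R" and b: "0 \<le> b" "b < DIM('a)"
  shows "(\<integral>\<^sup>+x\<in>cball y R. ennreal (norm (x - y) powr (- b)) \<partial>lborel)
    \<le> ennreal (unit_ball_vol DIM('a) * (2 powr b / (1 - 2 powr (b - DIM('a)))) * R powr (DIM('a) - b))"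
proof -
  have "(\<integral>\<^sup>+x\<in>cball y R. 1 * ennreal (norm (x - y) powr (- b)) \<partial>lborel)
    \<le> ennreal (unit_ball_vol DIM('a) * (2 powr b / (1 - 2 powr (b - real DIM('a)))) * R powr (real DIM('a) - b))"
    by (rule nn_integral_powr_dyadic[OF _ R b]) (auto simp: emeasure_cball powr_realpow)
  then show ?thesis by simp
qed

text \<open>The shells now run outwards from the sphere of radius \<open>R\<close>: the volume of
  order (R 2^k)^n against (R 2^k)^(-b) gives a geometric series of ratio 2^(n - b).\<close>

lemma nn_integral_powr_outside_ball:
  fixes b R :: real
  assumes R: "0 < R" and b: "real DIM('a) < b"
  shows "(\<integral>\<^sup>+x\<in>- ball (0::'a::euclidean_space) R. ennreal (norm x powr (- b)) \<partial>lborel) < \<infinity>"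
proof -
  let ?n = "DIM('a)" and ?c = "unit_ball_vol (real DIM('a))"
  have pt: "ennreal (norm x powr (- b)) * indicator (- ball 0 R) x
     \<le> (\<Sum>k. ennreal ((R * 2^k) powr (- b)) * indicator (cball 0 (R * 2 ^ Suc k)) x)" for x :: 'a
  proof (cases "x \<in> - ball 0 R")
    case True
    define d where "d = norm x"
    have d: "R \<le> d" "0 < d" using True R by (auto simp: d_def)
    obtain k0 where "d / R < 2^k0"
      using real_arch_pow[of 2 "d/R"] by auto
    also have "\<dots> \<le> 2^Suc k0" by simp
    finally have ex: "\<exists>k. d < R * 2^Suc k"
      using R by (intro exI[of _ k0]) (auto simp: field_simps)
    define k where "k = (LEAST k. d < R * 2^Suc k)"
    have k1: "d < R * 2^Suc k"
      unfolding k_def using ex by (rule LeastI_ex)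
    have k2: "R * 2^k \<le> d"
    proof (cases k)
      case 0
      then show ?thesis using d by simp
    next
      case (Suc j)
      then have "\<not> d < R * 2^Suc j"
        unfolding k_def using not_less_Least[of j "\<lambda>k. d < R * 2^Suc k"] by simp
      then show ?thesis using Suc by simp
    qed
    have "ennreal (norm x powr (- b)) * indicator (- ball 0 R) x
        \<le> ennreal ((R * 2^k) powr (- b)) * indicator (cball 0 (R * 2 ^ Suc k)) x"
      using k1 k2 R b by (auto simp: indicator_def d_def intro!: ennreal_leI powr_mono2')
    also have "\<dots> \<le> (\<Sum>k. ennreal ((R * 2^k) powr (- b)) * indicator (cball 0 (R * 2 ^ Suc k)) x)"
      by (rule sum_le_suminf_ennreal)
    finally show ?thesis .
  qed auto
  have "(\<integral>\<^sup>+x\<in>- ball (0::'a) R. ennreal (norm x powr (- b)) \<partial>lborel)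
     \<le> (\<integral>\<^sup>+x. (\<Sum>k. ennreal ((R * 2^k) powr (- b)) * indicator (cball (0::'a) (R * 2 ^ Suc k)) x) \<partial>lborel)"
    by (intro nn_integral_mono pt)
  also have "\<dots> = (\<Sum>k. ennreal ((R * 2^k) powr (- b)) * emeasure lborel (cball (0::'a) (R * 2 ^ Suc k)))"
  proof (subst nn_integral_suminf)
    show "(\<lambda>x. ennreal ((R * 2^k) powr (- b)) * indicator (cball (0::'a) (R * 2 ^ Suc k)) x) \<in> borel_measurable lborel" for k
      by measurable
  qed (simp add: nn_integral_cmult_indicator)
  also have "\<dots> = (\<Sum>k. ennreal (R powr (- b) * ?c * (2 * R) ^ ?n * (2 powr (?n - b)) ^ k))"
  proof (intro suminf_cong)
    fix k :: nat
    have "(R * 2^k) powr (- b) * (?c * (R * 2 ^ Suc k) ^ ?n) = R powr (- b) * ?c * (2 * R) ^ ?n * (2 powr (?n - b)) ^ k"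
    proof -
      have "(R * 2^k) powr (- b) = R powr (- b) * (2 powr (- b)) ^ k"
        using R by (simp add: powr_mult power_powr_swap)
      moreover have "(R * 2 ^ Suc k) ^ ?n = (2 * R) ^ ?n * (2 ^ ?n) ^ k"
        by (simp add: power_mult_distrib power_commutes mult_ac flip: power_mult)
      moreover have "(2 powr (?n - b)) ^ k = (2 powr (- b)) ^ k * (2 ^ ?n) ^ k"
      proof -
        have "(2::real) powr (?n - b) = 2 powr (- b) * 2 ^ ?n"
          by (simp add: powr_diff powr_minus_divide powr_realpow)
        then show ?thesis by (simp only: power_mult_distrib)
      qed
      ultimately show ?thesis by (simp only: mult_ac)
    qed
    then show "ennreal ((R * 2^k) powr (- b)) * emeasure lborel (cball (0::'a) (R * 2 ^ Suc k))
        = ennreal (R powr (- b) * ?c * (2 * R) ^ ?n * (2 powr (?n - b)) ^ k)"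
      using R by (subst emeasure_cball) (auto simp: ennreal_mult[symmetric] simp del: power_Suc)
  qed
  also have "\<dots> = ennreal (R powr (- b) * ?c * (2 * R) ^ ?n * (1 / (1 - 2 powr (?n - b))))"
  proof -
    have "(2::real) powr (?n - b) < 2 powr 0"
      using b by (intro powr_less_mono) auto
    then have "(\<lambda>k. R powr (- b) * ?c * (2 * R) ^ ?n * (2 powr (?n - b)) ^ k) sums
        (R powr (- b) * ?c * (2 * R) ^ ?n * (1 / (1 - 2 powr (?n - b))))"
      by (intro sums_mult geometric_sums) auto
    then show ?thesis
      using R by (intro suminf_ennreal_eq) auto
  qed
  finally show ?thesis by (simp add: order_le_less_trans)
qed

lemma nn_integral_translate:
  fixes f :: "'a::euclidean_space \<Rightarrow> ennreal"
  assumes [measurable]: "f \<in> borel_measurable borel"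
  shows "(\<integral>\<^sup>+x. f (x + c) \<partial>lborel) = (\<integral>\<^sup>+x. f x \<partial>lborel)"
proof -
  have "(\<integral>\<^sup>+x. f x \<partial>lborel) = (\<integral>\<^sup>+x. f x \<partial>distr lborel borel ((+) c))"
    by (simp add: lborel_distr_plus)
  also have "\<dots> = (\<integral>\<^sup>+x. f (c + x) \<partial>lborel)"
    by (subst nn_integral_distr) auto
  finally show ?thesis by (simp add: add.commute)
qed

lemma has_bochner_integral_translate:
  fixes f :: "'a::euclidean_space \<Rightarrow> real"
  assumes "has_bochner_integral lborel f I"
  shows "has_bochner_integral lborel (\<lambda>x. f (x + c)) I"
proof -
  have [measurable]: "f \<in> borel_measurable borel"
    using assms by (auto simp: has_bochner_integral_iff)
  have "has_bochner_integral (distr lborel borel ((+) c)) f I"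
    using assms by (simp add: lborel_distr_plus)
  then have "has_bochner_integral lborel (\<lambda>x. f (c + x)) I"
    by (auto simp: has_bochner_integral_iff integrable_distr_eq integral_distr)
  then show ?thesis by (simp add: add.commute)
qed

text \<open>Let \<open>t0\<close> minimise the modulus of \<open>g\<close> on \<open>T\<close>. Then
  lam |t - t0| <= |g t| + |g t0| <= 2 |g t|, so |g|^(p - 2) is dominated by a power singular at
  \<open>t0\<close>, integrable as p - 2 > -1. The minimiser stands in for a zero, which
  \<open>g\<close> may lack; this makes the bound uniform in the level later subtracted from
  \<open>U\<close>.\<close>

lemma nn_integral_powr_expanding:
  fixes g :: "real \<Rightarrow> real"
  assumes p: "1 < p" "p < 2" and r: "0 < r" and lam: "0 < lam"
    and T: "compact T" "T \<subseteq> {-r..r}" and cont: "continuous_on T g"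
    and g: "\<And>t u. t \<in> T \<Longrightarrow> u \<in> T \<Longrightarrow> lam * \<bar>t - u\<bar> \<le> \<bar>g t - g u\<bar>"
  shows "(\<integral>\<^sup>+t\<in>T. ennreal (\<bar>g t\<bar> powr (p - 2)) \<partial>lborel)
    \<le> ennreal ((lam / 2) powr (p - 2) * (2 * (2 powr (2 - p) / (1 - 2 powr (1 - p)))) * (2 * r) powr (p - 1))"
proof (cases "T = {}")
  case False
  obtain t0 where t0: "t0 \<in> T" "\<And>t. t \<in> T \<Longrightarrow> \<bar>g t0\<bar> \<le> \<bar>g t\<bar>"
    using continuous_attains_inf[OF T(1) False continuous_on_rabs[OF cont]] by auto
  \<comment> \<open>The point \<open>t0\<close> is excluded: there the majorant is 0 by the
    convention for \<open>0 powr\<close>, while the left side may be positive.\<close>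
  have pt: "ennreal (\<bar>g t\<bar> powr (p - 2)) * indicator T t
     \<le> ennreal ((lam / 2) powr (p - 2)) * (ennreal (norm (t - t0) powr (- (2 - p))) * indicator (cball t0 (2 * r)) t)"
    if "t \<noteq> t0" for t
  proof (cases "t \<in> T")
    case True
    have "lam * \<bar>t - t0\<bar> \<le> 2 * \<bar>g t\<bar>"
      using g[OF True t0(1)] t0(2)[OF True] by linarith
    then have "\<bar>g t\<bar> powr (p - 2) \<le> (lam / 2 * \<bar>t - t0\<bar>) powr (p - 2)"
      using that lam p by (intro powr_mono2') auto
    moreover have "t \<in> cball t0 (2 * r)"
      using subsetD[OF T(2) True] subsetD[OF T(2) t0(1)] by (auto simp: dist_real_def)
    ultimately show ?thesis
      using True lam powr_mult[of "lam / 2" "\<bar>t - t0\<bar>" "p - 2"]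
      by (auto simp: ennreal_mult[symmetric] simp del: times_divide_eq_left intro!: ennreal_leI)
  qed auto
  have "(\<integral>\<^sup>+t\<in>T. ennreal (\<bar>g t\<bar> powr (p - 2)) \<partial>lborel)
    \<le> (\<integral>\<^sup>+t. ennreal ((lam / 2) powr (p - 2)) * (ennreal (norm (t - t0) powr (- (2 - p))) * indicator (cball t0 (2 * r)) t) \<partial>lborel)"
  proof (rule nn_integral_mono_AE)
    show "AE t in lborel. ennreal (\<bar>g t\<bar> powr (p - 2)) * indicator T t
     \<le> ennreal ((lam / 2) powr (p - 2)) * (ennreal (norm (t - t0) powr (- (2 - p))) * indicator (cball t0 (2 * r)) t)"
      using AE_lborel_singleton[of t0] by eventually_elim (rule pt)
  qed
  also have "\<dots> = ennreal ((lam / 2) powr (p - 2)) * (\<integral>\<^sup>+t\<in>cball t0 (2 * r). ennreal (norm (t - t0) powr (- (2 - p))) \<partial>lborel)"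
    by (rule nn_integral_cmult) simp
  also have "\<dots> \<le> ennreal ((lam / 2) powr (p - 2)) * ennreal (2 * (2 powr (2 - p) / (1 - 2 powr (1 - p))) * (2 * r) powr (p - 1))"
    using nn_integral_powr_cball[of "2 * r" "2 - p" t0] r p
    by (intro mult_left_mono) (auto simp: unit_ball_vol_1 algebra_simps)
  also have "\<dots> = ennreal ((lam / 2) powr (p - 2) * (2 * (2 powr (2 - p) / (1 - 2 powr (1 - p))) * (2 * r) powr (p - 1)))"
    by (subst ennreal_mult') auto
  finally show ?thesis by (simp add: mult.assoc)
qed auto

section \<open>Directional derivatives of Lipschitz functions\<close>

lemma lipschitz_UNIV_D: "L-lipschitz_on UNIV f \<Longrightarrow> \<bar>f x - f y\<bar> \<le> L * norm (x - y)"
  for f :: "'a::real_normed_vector \<Rightarrow> real"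
  by (simp add: lipschitz_on_def dist_norm)

text \<open>Vitali covering: the short intervals of slope at most \<open>P\<close> inside an open
  \<open>G\<close> containing \<open>E\<close> form a fine cover, and countably many disjoint ones
  exhaust \<open>E\<close> up to a null set. Their images have total length at most \<open>P\<close>
  times the measure of \<open>G\<close>; the image of the remainder is null because \<open>f\<close>
  is Lipschitz. Outer regularity brings \<open>G\<close> down to \<open>E\<close>. The point may sit
  anywhere in its interval, so quotients with increments of either sign qualify.\<close>

lemma emeasure_image_small_slope:
  fixes f :: "real \<Rightarrow> real"
  assumes E: "E \<in> sets borel" and fE: "f ` E \<in> sets borel"
    and mono: "strict_mono f" and lip: "L-lipschitz_on UNIV f" and P: "0 \<le> P"
    and slope: "\<And>x d. x \<in> E \<Longrightarrow> 0 < d \<Longrightarrow>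
      \<exists>u v. u \<le> x \<and> x \<le> v \<and> u < v \<and> v - u < d \<and> f v - f u \<le> P * (v - u)"
  shows "emeasure lborel (f ` E) \<le> ennreal P * emeasure lborel E"
proof (rule ennreal_le_epsilon)
  fix \<epsilon> :: real
  assume \<epsilon>: "0 < \<epsilon>"
  obtain G where G: "open G" "E \<subseteq> G" "emeasure lborel (G - E) \<le> ennreal (\<epsilon> / (P + 1))"
    using outer_regular_lborel_le[OF E, of "\<epsilon> / (P + 1)"] \<epsilon> P by auto
  have [measurable]: "G \<in> sets borel" "E \<in> sets borel" using G(1) E by auto
  \<comment> \<open>Intervals are indexed by their endpoints; \<open>a\<close> and \<open>r\<close>
    restate them as balls, the form in which the covering theorem is available.\<close>
  define K where "K = {(u, v). u < v \<and> {u..v} \<subseteq> G \<and> f v - f u \<le> P * (v - u)}"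
  define a r where "a i = (fst i + snd i) / 2" and "r i = (snd i - fst i) / 2" for i :: "real \<times> real"
  have cb: "cball (a i) (r i) = {fst i..snd i}" for i
    by (auto simp: a_def r_def cball_eq_atLeastAtMost field_simps)
  obtain C where C: "countable C" "C \<subseteq> K"
     "pairwise (\<lambda>i j. disjnt (cball (a i) (r i)) (cball (a j) (r j))) C"
     "negligible (E - (\<Union>i \<in> C. cball (a i) (r i)))"
  proof (rule Vitali_covering_theorem_cballs[of K r E a])
    show "0 < r i" if "i \<in> K" for i using that by (auto simp: K_def r_def)
    fix x d :: real assume x: "x \<in> E" and d: "0 < d"
    obtain \<delta> where \<delta>: "0 < \<delta>" "cball x \<delta> \<subseteq> G"
      using open_contains_cball G x by blast
    obtain u v where uv: "u \<le> x" "x \<le> v" "u < v" "v - u < min \<delta> d" "f v - f u \<le> P * (v - u)"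
      using slope[OF x, of "min \<delta> d"] \<delta> d by auto
    have "{u..v} \<subseteq> cball x \<delta>" using uv by (auto simp: dist_real_def)
    then have "(u, v) \<in> K" using uv \<delta> by (auto simp: K_def)
    moreover have "x \<in> cball (a (u, v)) (r (u, v))" using uv by (simp add: cb)
    moreover have "r (u, v) < d" using uv by (simp add: r_def)
    ultimately show "\<exists>i. i \<in> K \<and> x \<in> cball (a i) (r i) \<and> r i < d" by blast
  qed
  define N where "N = E - (\<Union>i\<in>C. cball (a i) (r i))"
  have "negligible (f ` N)"
  proof (rule negligible_locally_Lipschitz_image)
    show "\<exists>T B. open T \<and> x \<in> T \<and> (\<forall>y\<in>N \<inter> T. norm (f y - f x) \<le> B * norm (y - x))" for x
      using lip by (intro exI[of _ UNIV] exI[of _ L]) (auto simp: lipschitz_on_def dist_norm)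
  qed (use C in \<open>auto simp: N_def\<close>)
  then have fN: "f ` N \<in> null_sets lebesgue" by (simp add: negligible_iff_null_sets)
  have mono': "f x < f y \<longleftrightarrow> x < y" for x y
    using mono by (simp add: strict_mono_less)
  have sub: "f ` E \<subseteq> f ` N \<union> (\<Union>i\<in>C. {f (fst i)..f (snd i)})"
  proof (rule image_subsetI)
    fix x assume "x \<in> E"
    then consider "x \<in> N" | i where "i \<in> C" "x \<in> {fst i..snd i}" unfolding N_def cb by blast
    then show "f x \<in> f ` N \<union> (\<Union>i\<in>C. {f (fst i)..f (snd i)})"
      by cases (use mono in \<open>auto simp: strict_mono_less_eq\<close>)
  qed
  have disj: "disjoint_family_on (\<lambda>i. {fst i..snd i}) C"
    using C(3) by (auto simp: disjoint_family_on_def pairwise_def cb disjnt_def)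
  have disj': "disjoint_family_on (\<lambda>i. {f (fst i)..f (snd i)}) C"
    unfolding disjoint_family_on_def
  proof (intro ballI impI)
    fix i j assume ij: "i \<in> C" "j \<in> C" "i \<noteq> j"
    then have "{fst i..snd i} \<inter> {fst j..snd j} = {}" "fst i < snd i" "fst j < snd j"
      using disj C(2) by (auto simp: disjoint_family_on_def K_def)
    then have "snd i < fst j \<or> snd j < fst i" by (auto simp: not_less)
    then have "f (snd i) < f (fst j) \<or> f (snd j) < f (fst i)" by (simp add: mono')
    then show "{f (fst i)..f (snd i)} \<inter> {f (fst j)..f (snd j)} = {}" by auto
  qed
  have "emeasure lborel (f ` E) = emeasure lebesgue (f ` E)" using fE by simp
  also have "\<dots> \<le> emeasure lebesgue (f ` N \<union> (\<Union>i\<in>C. {f (fst i)..f (snd i)}))"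
    using fN C(1) by (intro emeasure_mono[OF sub] sets.Un sets.countable_UN') auto
  also have "\<dots> = emeasure lebesgue (\<Union>i\<in>C. {f (fst i)..f (snd i)})"
    using fN C(1) by (subst Un_commute, intro emeasure_Un_null_set sets.countable_UN') auto
  also have "\<dots> = emeasure lborel (\<Union>i\<in>C. {f (fst i)..f (snd i)})"
  proof -
    have "(\<Union>i\<in>C. {f (fst i)..f (snd i)}) \<in> sets borel"
      using C(1) by (intro sets.countable_UN') auto
    then show ?thesis by simp
  qed
  also have "\<dots> = (\<integral>\<^sup>+i. emeasure lborel {f (fst i)..f (snd i)} \<partial>count_space C)"
    by (intro emeasure_UN_countable C(1) disj') auto
  also have "\<dots> \<le> (\<integral>\<^sup>+i. ennreal P * emeasure lborel {fst i..snd i} \<partial>count_space C)"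
  proof (rule nn_integral_mono)
    fix i assume "i \<in> space (count_space C)"
    then have i: "fst i < snd i" "f (snd i) - f (fst i) \<le> P * (snd i - fst i)"
      using C(2) by (auto simp: K_def)
    then have "f (fst i) < f (snd i)" by (simp add: mono')
    then show "emeasure lborel {f (fst i)..f (snd i)} \<le> ennreal P * emeasure lborel {fst i..snd i}"
      using i P by (simp add: ennreal_mult[symmetric])
  qed
  also have "\<dots> = ennreal P * (\<integral>\<^sup>+i. emeasure lborel {fst i..snd i} \<partial>count_space C)"
    by (rule nn_integral_cmult) auto
  also have "(\<integral>\<^sup>+i. emeasure lborel {fst i..snd i} \<partial>count_space C) = emeasure lborel (\<Union>i\<in>C. {fst i..snd i})"
    by (intro emeasure_UN_countable[symmetric] C(1) disj) auto
  also have "\<dots> \<le> emeasure lborel G"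
    using C(2) by (intro emeasure_mono UN_least) (auto simp: K_def subset_iff)
  also have "emeasure lborel G \<le> emeasure lborel E + emeasure lborel (G - E)"
    using emeasure_subadditive[of E lborel "G - E"] G(2) by (simp add: Un_absorb1)
  also have "ennreal P * \<dots> \<le> ennreal P * emeasure lborel E + ennreal P * ennreal (\<epsilon> / (P + 1))"
    using G(3) by (simp add: distrib_left mult_left_mono add_left_mono)
  also have "ennreal P * ennreal (\<epsilon> / (P + 1)) \<le> ennreal \<epsilon>"
    using P \<epsilon> by (subst ennreal_mult[symmetric]) (auto intro!: ennreal_leI simp: field_simps)
  finally show "emeasure lborel (f ` E) \<le> ennreal P * emeasure lborel E + ennreal \<epsilon>"
    by (simp add: mult_left_mono add_left_mono)
qed

text \<open>Lipschitz quotients are bounded, so without a derivative their lower and upper limits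
  differ and two rationals fit between. Rational increments suffice by continuity; they turn the
  exceptional sets below into countable combinations of Borel conditions.\<close>

lemma difference_quotient_gap:
  fixes f :: "real \<Rightarrow> real"
  assumes lip: "L-lipschitz_on UNIV f" and nd: "\<not> f differentiable (at x)"
  obtains P Q :: rat where "P < Q"
    "\<And>d. 0 < d \<Longrightarrow> \<exists>t::rat. t \<noteq> 0 \<and> \<bar>real_of_rat t\<bar> < d \<and> (f (x + of_rat t) - f x) / of_rat t < of_rat P"
    "\<And>d. 0 < d \<Longrightarrow> \<exists>t::rat. t \<noteq> 0 \<and> \<bar>real_of_rat t\<bar> < d \<and> (f (x + of_rat t) - f x) / of_rat t > of_rat Q"
proof -
  define S where "S t = (f (x + t) - f x) / t" for t
  have Sb: "\<bar>S t\<bar> \<le> L" if "t \<noteq> 0" for t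
  proof -
    have "\<bar>f (x + t) - f x\<bar> \<le> L * \<bar>t\<bar>"
      using lipschitz_UNIV_D[OF lip, of "x + t" x] by simp
    then show ?thesis using that by (simp add: S_def field_simps)
  qed
  have contf: "continuous_on UNIV f"
    using lip lipschitz_on_continuous_on by blast
  have rat: "\<exists>q::rat. q \<noteq> 0 \<and> \<bar>real_of_rat q\<bar> < d \<and> S (of_rat q) \<in> V"
    if V: "open V" "S t \<in> V" and t: "t \<noteq> 0" "\<bar>t\<bar> < d" for t d V
  proof -
    have c: "continuous_on (- {0}) S"
      unfolding S_def by (intro continuous_intros continuous_on_compose2[OF contf]) auto
    have "open (S -` V \<inter> - {0})"
      by (rule continuous_on_open_vimage[THEN iffD1, rule_format, OF _ c V(1)]) auto
    then have o: "open (S -` V \<inter> - {0} \<inter> ball 0 d)" by auto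
    moreover have "t \<in> S -` V \<inter> - {0} \<inter> ball 0 d" using V t by auto
    ultimately obtain \<epsilon> where \<epsilon>: "0 < \<epsilon>" "ball t \<epsilon> \<subseteq> S -` V \<inter> - {0} \<inter> ball 0 d"
      using openE by blast
    obtain q :: rat where "t < of_rat q" "of_rat q < t + \<epsilon>"
      using of_rat_dense[of t "t + \<epsilon>"] \<epsilon> by auto
    then have "of_rat q \<in> ball t \<epsilon>" by (auto simp: dist_real_def)
    then show ?thesis using \<epsilon> by (intro exI[of _ q]) auto
  qed
  have "\<exists>P Q::rat. P < Q \<and> (\<forall>d>0. \<exists>t. t \<noteq> 0 \<and> \<bar>t\<bar> < d \<and> S t < of_rat P)
     \<and> (\<forall>d>0. \<exists>t. t \<noteq> 0 \<and> \<bar>t\<bar> < d \<and> S t > of_rat Q)"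
  proof (rule ccontr)
    assume no: "\<not> ?thesis"
    \<comment> \<open>\<open>A\<close> collects the eventual lower bounds of the quotient, so
      \<open>Sup A\<close> is its lower limit; if there is no gap, the quotient converges to
      it.\<close>
    define A where "A = {P. \<exists>d>0. \<forall>t. t \<noteq> 0 \<and> \<bar>t\<bar> < d \<longrightarrow> P \<le> S t}"
    have "- L \<in> A" unfolding A_def using Sb by (force simp: abs_le_iff intro!: exI[of _ 1])
    moreover have ub: "P \<le> L" if "P \<in> A" for P
    proof -
      from that obtain d where d: "d > 0" "\<And>t. t \<noteq> 0 \<and> \<bar>t\<bar> < d \<Longrightarrow> P \<le> S t" by (auto simp: A_def)
      have "P \<le> S (d/2)" using d by auto
      also have "\<dots> \<le> L" using Sb[of "d/2"] d by auto
      finally show ?thesis .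
    qed
    ultimately have A: "A \<noteq> {}" "bdd_above A" by (auto simp: bdd_above_def)
    have "S \<midarrow>0\<rightarrow> Sup A"
    proof (rule LIM_I)
      fix \<epsilon> :: real assume \<epsilon>: "0 < \<epsilon>"
      obtain P where "P \<in> A" "Sup A - \<epsilon> < P"
        using less_cSup_iff[OF A, of "Sup A - \<epsilon>"] \<epsilon> by auto
      then obtain d1 where d1: "d1 > 0" "\<And>t. t \<noteq> 0 \<and> \<bar>t\<bar> < d1 \<Longrightarrow> Sup A - \<epsilon> < S t"
        unfolding A_def by force
      obtain Q :: rat where Q: "Sup A < of_rat Q" "of_rat Q < Sup A + \<epsilon>"
        using of_rat_dense[of "Sup A" "Sup A + \<epsilon>"] \<epsilon> by auto
      \<comment> \<open>\<open>P'\<close> lies strictly between the lower limit and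
        \<open>Q\<close>: the quotient falls below \<open>P'\<close> at every scale, so the absence
        of a gap for the pair \<open>P'\<close>, \<open>Q\<close> bounds it eventually by
        \<open>Q\<close>.\<close>
      obtain P' :: rat where P': "Sup A < of_rat P'" "real_of_rat P' < of_rat Q"
        using of_rat_dense[OF Q(1)] by auto
      have "real_of_rat P' \<notin> A" using cSup_upper[OF _ A(2), of "of_rat P'"] P' by auto
      then have "\<forall>d>0. \<exists>t. t \<noteq> 0 \<and> \<bar>t\<bar> < d \<and> S t < of_rat P'"
        by (auto simp: A_def not_le)
      moreover have "P' < Q" using P'(2) by (simp add: of_rat_less)
      ultimately obtain d2 where d2: "d2 > 0" "\<And>t. t \<noteq> 0 \<and> \<bar>t\<bar> < d2 \<Longrightarrow> S t \<le> of_rat Q"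
        using no by (meson not_le)
      show "\<exists>s>0. \<forall>t. t \<noteq> 0 \<and> norm (t - 0) < s \<longrightarrow> norm (S t - Sup A) < \<epsilon>"
      proof (intro exI[of _ "min d1 d2"] conjI allI impI)
        fix t :: real assume t: "t \<noteq> 0 \<and> norm (t - 0) < min d1 d2"
        then have "Sup A - \<epsilon> < S t" "S t \<le> of_rat Q" using d1 d2 by auto
        then show "norm (S t - Sup A) < \<epsilon>" using Q by auto
      qed (use d1 d2 in auto)
    qed
    then have "DERIV f x :> Sup A" unfolding DERIV_def S_def .
    then show False using nd real_differentiable_def by blast
  qed
  then obtain P Q :: rat where PQ: "P < Q" "\<And>d. d>0 \<Longrightarrow> \<exists>t. t \<noteq> 0 \<and> \<bar>t\<bar> < d \<and> S t < of_rat P"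
     "\<And>d. d>0 \<Longrightarrow> \<exists>t. t \<noteq> 0 \<and> \<bar>t\<bar> < d \<and> S t > of_rat Q" by blast
  show ?thesis
  proof (rule that[OF PQ(1)])
    fix d :: real assume "0 < d"
    show "\<exists>t::rat. t \<noteq> 0 \<and> \<bar>real_of_rat t\<bar> < d \<and> (f (x + of_rat t) - f x) / of_rat t < of_rat P"
      using PQ(2)[OF \<open>0 < d\<close>] rat[of "{..<of_rat P}"] by (auto simp: S_def)
    show "\<exists>t::rat. t \<noteq> 0 \<and> \<bar>real_of_rat t\<bar> < d \<and> (f (x + of_rat t) - f x) / of_rat t > of_rat Q"
      using PQ(3)[OF \<open>0 < d\<close>] rat[of "{of_rat Q<..}"] by (auto simp: S_def)
  qed
qed

text \<open>Increments of at least y - x make \<open>f\<close> a bijection of the line with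
  1-Lipschitz inverse. On a bounded set E where the quotient falls below \<open>P\<close> and
  exceeds \<open>Q\<close> at every scale, the covering estimate gives |f(E)| <= P |E|, and applied
  to the inverse |E| <= |f(E)| / Q. As P < Q and |E| is finite, |E| = 0. Countably many such sets
  contain every point without derivative.\<close>

lemma negligible_nondifferentiable_bilipschitz:
  fixes f :: "real \<Rightarrow> real"
  assumes lip: "L-lipschitz_on UNIV f"
    and low: "\<And>x y. x < y \<Longrightarrow> y - x \<le> f y - f x"
  shows "negligible {x. \<not> f differentiable (at x)}"
proof -
  have contf: "continuous_on UNIV f"
    using lip lipschitz_on_continuous_on by blast
  have mono: "strict_mono f" by (rule strict_monoI) (use low in force)
  have low': "\<bar>x - y\<bar> \<le> \<bar>f x - f y\<bar>" for x y
    using low[of x y] low[of y x] by (cases x y rule: linorder_cases) auto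
  have surj: "\<exists>x. f x = y" for y
  proof -
    \<comment> \<open>Slopes of at least 1 carry the values of \<open>f\<close> at - c and c to the
      two sides of \<open>y\<close>.\<close>
    define c where "c = \<bar>y - f 0\<bar> + 1"
    have "f (- c) \<le> y" "y \<le> f c" using low[of "-c" 0] low[of 0 c] by (auto simp: c_def abs_if split: if_splits)
    then show ?thesis
      using IVT'[of f "-c" y c] contf by (auto simp: c_def intro: continuous_on_subset)
  qed
  define g where "g = inv f"
  have inj: "inj f" using mono strict_mono_imp_inj_on by blast
  have gf: "g (f x) = x" and fg: "f (g x) = x" for x
    using inj surj by (auto simp: g_def f_inv_into_f image_iff) (metis f_inv_into_f rangeI)
  have monog: "strict_mono g"
    by (rule strict_monoI) (metis fg mono strict_mono_less)
  have lipg: "1-lipschitz_on UNIV g"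
    using low' by (intro lipschitz_onI) (metis dist_real_def fg mult_1, auto)
  have [measurable]: "f \<in> borel_measurable borel" "g \<in> borel_measurable borel"
    using contf lipg lipschitz_on_continuous_on by (auto intro!: borel_measurable_continuous_onI)
  \<comment> \<open>Scales 1 / (k + 1) and rational increments keep the set Borel; the bound by
    \<open>N\<close> keeps its measure finite, as the final cancellation demands.\<close>
  define E where "E P Q N = {x. \<bar>x\<bar> \<le> real N \<and> (\<forall>k::nat.
     (\<exists>t::rat. t \<noteq> 0 \<and> \<bar>real_of_rat t\<bar> < 1 / real (Suc k) \<and> (f (x + of_rat t) - f x) / of_rat t < of_rat P) \<and>
     (\<exists>t::rat. t \<noteq> 0 \<and> \<bar>real_of_rat t\<bar> < 1 / real (Suc k) \<and> (f (x + of_rat t) - f x) / of_rat t > of_rat Q))}"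
    for P Q :: rat and N :: nat
  have E0: "negligible (E P Q N)" if PQ: "P < Q" for P Q N
  proof (cases "E P Q N = {}")
    case False
    define p q where "p = real_of_rat P" and "q = real_of_rat Q"
    have pq: "p < q" using PQ by (simp add: p_def q_def of_rat_less)
    have quot: "1 \<le> (f (x + t) - f x) / t" if "t \<noteq> 0" for x t
    proof (cases "0 < t")
      case True
      then show ?thesis using low[of x "x + t"] by (simp add: field_simps)
    next
      case False
      then show ?thesis using low[of "x + t" x] that by (simp add: field_simps)
    qed
    \<comment> \<open>A point of the set serves to show 1 < p: every quotient of \<open>f\<close> is
      at least 1, and one of them is below \<open>p\<close>.\<close>
    obtain x where "x \<in> E P Q N" using False by blast
    then have "\<exists>t::rat. t \<noteq> 0 \<and> \<bar>real_of_rat t\<bar> < 1 / real (Suc 0) \<and> (f (x + of_rat t) - f x) / of_rat t < of_rat P"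
      unfolding E_def by blast
    then obtain t where t: "t \<noteq> 0" "(f (x + real_of_rat t) - f x) / of_rat t < p"
      unfolding p_def by blast
    have p1: "1 < p"
      using quot[of "real_of_rat t" x] t by simp
    have [measurable]: "E P Q N \<in> sets borel" unfolding E_def by measurable
    have "f ` E P Q N = g -` E P Q N"
      by (rule set_eqI) (metis fg gf image_iff vimage_eq)
    then have fE [measurable]: "f ` E P Q N \<in> sets borel"
      using measurable_sets_borel[of g borel "E P Q N"] by simp
    have gfE: "g ` f ` E P Q N = E P Q N" by (simp add: image_image gf)
    have iv: "\<exists>u v. u \<le> x \<and> x \<le> v \<and> u < v \<and> v - u = \<bar>t\<bar> \<and> f v - f u = \<bar>t\<bar> * ((f (x + t) - f x) / t)"
      if "t \<noteq> 0" for x t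
    proof (cases "0 < t")
      case True
      then show ?thesis by (intro exI[of _ x] exI[of _ "x + t"]) auto
    next
      case False
      then show ?thesis using that by (intro exI[of _ "x + t"] exI[of _ x]) (auto simp: field_simps)
    qed
    have 1: "emeasure lborel (f ` E P Q N) \<le> ennreal p * emeasure lborel (E P Q N)"
    proof (rule emeasure_image_small_slope[OF _ fE mono lip])
      fix x d :: real assume x: "x \<in> E P Q N" and d: "0 < d"
      obtain k where k: "1 / real (Suc k) < d" using nat_approx_posE[OF d] by auto
      obtain t :: rat where t: "t \<noteq> 0" "\<bar>real_of_rat t\<bar> < 1 / real (Suc k)"
          "(f (x + of_rat t) - f x) / of_rat t < p"
        using x by (auto simp: E_def p_def)
      obtain u v where uv: "u \<le> x" "x \<le> v" "u < v" "v - u = \<bar>real_of_rat t\<bar>"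
          "f v - f u = \<bar>real_of_rat t\<bar> * ((f (x + of_rat t) - f x) / of_rat t)"
        using iv[of "of_rat t" x] t(1) by auto
      have "f v - f u \<le> p * (v - u)"
        unfolding uv(4,5) using mult_left_mono[OF less_imp_le[OF t(3)], of "\<bar>real_of_rat t\<bar>"] by (simp add: mult.commute)
      then show "\<exists>u v. u \<le> x \<and> x \<le> v \<and> u < v \<and> v - u < d \<and> f v - f u \<le> p * (v - u)"
        using uv t k by (intro exI[of _ u] exI[of _ v]) auto
    qed (use p1 in auto)
    have L0: "0 < L"
      using lipschitz_UNIV_D[OF lip, of 1 0] low[of 0 1] by simp
    have "emeasure lborel (g ` f ` E P Q N) \<le> ennreal (1 / q) * emeasure lborel (f ` E P Q N)"
    proof (rule emeasure_image_small_slope[OF fE _ monog lipg])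
      show "g ` f ` E P Q N \<in> sets borel" unfolding gfE by measurable
      fix y d :: real assume "y \<in> f ` E P Q N" and d: "0 < d"
      then obtain x where x: "x \<in> E P Q N" "y = f x" by auto
      \<comment> \<open>A quotient of \<open>f\<close> above \<open>q\<close> is one of the inverse
        below 1 / q. An interval is stretched by at most \<open>L\<close> under \<open>f\<close>,
        hence the scale d / L.\<close>
      obtain k where k: "1 / real (Suc k) < d / L" using nat_approx_posE[of "d / L"] d L0 by auto
      obtain t :: rat where t: "t \<noteq> 0" "\<bar>real_of_rat t\<bar> < 1 / real (Suc k)"
          "(f (x + of_rat t) - f x) / of_rat t > q"
        using x by (auto simp: E_def q_def)
      obtain u v where uv: "u \<le> x" "x \<le> v" "u < v" "v - u = \<bar>real_of_rat t\<bar>"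
          "f v - f u = \<bar>real_of_rat t\<bar> * ((f (x + of_rat t) - f x) / of_rat t)"
        using iv[of "of_rat t" x] t(1) by auto
      have 1: "q * (v - u) \<le> f v - f u"
        unfolding uv(4,5) using mult_left_mono[OF less_imp_le[OF t(3)], of "\<bar>real_of_rat t\<bar>"] by (simp add: mult.commute)
      have "f v - f u \<le> L * (v - u)"
        using lipschitz_UNIV_D[OF lip, of v u] uv(3) by simp
      also have "v - u < d / L" using uv t k by linarith
      then have "L * (v - u) < d" using L0 by (simp add: field_simps)
      finally have 2: "f v - f u < d" .
      have "g (f v) - g (f u) \<le> 1 / q * (f v - f u)"
        using 1 p1 pq by (simp add: gf field_simps)
      then show "\<exists>u v. u \<le> y \<and> y \<le> v \<and> u < v \<and> v - u < d \<and> g v - g u \<le> 1 / q * (v - u)"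
        using uv 2 mono x(2)
        by (intro exI[of _ "f u"] exI[of _ "f v"]) (auto simp: strict_mono_less strict_mono_less_eq)
    qed (use p1 pq in auto)
    also have "\<dots> \<le> ennreal (1 / q) * (ennreal p * emeasure lborel (E P Q N))"
      by (intro mult_left_mono 1) auto
    finally have le: "emeasure lborel (E P Q N) \<le> ennreal (p / q) * emeasure lborel (E P Q N)"
      using p1 pq by (simp add: gfE ennreal_mult[symmetric] mult.assoc[symmetric])
    have "emeasure lborel (E P Q N) \<le> emeasure lborel (cball (0::real) (real N))"
      by (intro emeasure_mono) (auto simp: E_def)
    also have "\<dots> < \<infinity>" by (simp add: emeasure_cball)
    finally obtain m where m: "emeasure lborel (E P Q N) = ennreal m" "0 \<le> m"
      by (cases "emeasure lborel (E P Q N)") auto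
    have "m \<le> p / q * m" using le m p1 pq by (simp add: ennreal_mult[symmetric])
    then have "m * (1 - p / q) \<le> 0" by (simp add: algebra_simps)
    moreover have "0 < 1 - p / q" using p1 pq by (simp add: field_simps)
    ultimately have "m = 0" using m by (simp add: mult_le_0_iff)
    then have "E P Q N \<in> null_sets lborel" using m by (auto simp: null_sets_def)
    then show ?thesis using negligible_iff_null_sets null_sets_completionI by blast
  qed auto
  have "{x. \<not> f differentiable (at x)} \<subseteq> (\<Union>(P, Q, N)\<in>{(P, Q, N). P < Q}. E P Q N)"
  proof
    fix x assume "x \<in> {x. \<not> f differentiable (at x)}"
    then have "\<not> f differentiable (at x)" by simp
    from difference_quotient_gap[OF lip this] obtain P Q :: rat where PQ: "P < Q"
      "\<And>d. 0 < d \<Longrightarrow> \<exists>t::rat. t \<noteq> 0 \<and> \<bar>real_of_rat t\<bar> < d \<and> (f (x + of_rat t) - f x) / of_rat t < of_rat P"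
      "\<And>d. 0 < d \<Longrightarrow> \<exists>t::rat. t \<noteq> 0 \<and> \<bar>real_of_rat t\<bar> < d \<and> (f (x + of_rat t) - f x) / of_rat t > of_rat Q"
      by metis
    obtain N :: nat where "\<bar>x\<bar> \<le> real N" using real_arch_simple by blast
    then have "x \<in> E P Q N" unfolding E_def using PQ(2,3) by auto
    then show "x \<in> (\<Union>(P, Q, N)\<in>{(P, Q, N). P < Q}. E P Q N)" using PQ(1) by auto
  qed
  moreover have "negligible (\<Union>(P, Q, N)\<in>{(P, Q, N). P < Q}. E P Q N)"
  proof (rule negligible_countable_Union)
    show "countable ((\<lambda>(P, Q, N). E P Q N) ` {(P, Q, N). P < Q})" by (intro countable_image countableI_type)
  qed (use E0 in auto)
  ultimately show ?thesis by (rule negligible_subset[rotated])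
qed

text \<open>Adding (L + 1) x raises all difference quotients to at least 1 and leaves
  differentiability unchanged.\<close>

lemma negligible_nondifferentiable_lipschitz:
  fixes f :: "real \<Rightarrow> real"
  assumes lip: "L-lipschitz_on UNIV f"
  shows "negligible {x. \<not> f differentiable (at x)}"
proof -
  define g where "g x = f x + (L + 1) * x" for x
  have L: "0 \<le> L" using lip by (rule lipschitz_on_nonneg)
  have 1: "\<bar>f x - f y\<bar> \<le> L * \<bar>x - y\<bar>" for x y
    using lipschitz_UNIV_D[OF lip, of x y] by simp
  have "(L + (L + 1))-lipschitz_on UNIV g"
  proof (rule lipschitz_onI)
    fix x y
    have "g x - g y = (f x - f y) + (L + 1) * (x - y)" by (simp add: g_def algebra_simps)
    then have "\<bar>g x - g y\<bar> \<le> \<bar>f x - f y\<bar> + \<bar>(L + 1) * (x - y)\<bar>" by (simp only: abs_triangle_ineq)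
    also have "\<dots> \<le> L * \<bar>x - y\<bar> + (L + 1) * \<bar>x - y\<bar>" using 1[of x y] L by (simp add: abs_mult)
    finally show "dist (g x) (g y) \<le> (L + (L + 1)) * dist x y" by (simp add: dist_real_def distrib_right)
  qed (use L in auto)
  moreover have "y - x \<le> g y - g x" if "x < y" for x y
  proof -
    have "g y - g x = (f y - f x) + L * (y - x) + (y - x)" by (simp add: g_def algebra_simps)
    then show ?thesis using 1[of y x] that by (simp add: abs_le_iff)
  qed
  ultimately have "negligible {x. \<not> g differentiable (at x)}"
    by (rule negligible_nondifferentiable_bilipschitz)
  moreover have "{x. \<not> f differentiable (at x)} \<subseteq> {x. \<not> g differentiable (at x)}"
  proof -
    have "f differentiable (at x)" if "g differentiable (at x)" for x
    proof -
      have "(\<lambda>x. g x - (L + 1) * x) differentiable (at x)" using that by simp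
      then show ?thesis by (simp add: g_def)
    qed
    then show ?thesis by blast
  qed
  ultimately show ?thesis by (rule negligible_subset)
qed

text \<open>The Cauchy criterion for the difference quotient. It does not name the limit and has
  only countable quantifiers, which makes the set of points of differentiability Borel.\<close>

lemma differentiable_at_0_iff_Cauchy:
  fixes f :: "real \<Rightarrow> real"
  assumes cont: "continuous_on UNIV f"
  shows "f differentiable (at 0) \<longleftrightarrow> (\<forall>k::nat. \<exists>j::nat. \<forall>t u::rat. t \<noteq> 0 \<and> \<bar>real_of_rat t\<bar> < 1 / real (Suc j)
     \<and> u \<noteq> 0 \<and> \<bar>real_of_rat u\<bar> < 1 / real (Suc j) \<longrightarrow>
     \<bar>(f (of_rat t) - f 0) / of_rat t - (f (of_rat u) - f 0) / of_rat u\<bar> \<le> 1 / real (Suc k))" (is "_ \<longleftrightarrow> ?R")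
proof
  define S where "S t = (f t - f 0) / t" for t
  have D: "DERIV f 0 :> c \<longleftrightarrow> S \<midarrow>0\<rightarrow> c" for c unfolding DERIV_def S_def by simp
  { assume "f differentiable (at 0)"
    then obtain c where c: "S \<midarrow>0\<rightarrow> c" using D real_differentiable_def by blast
    show ?R
    proof
      fix k :: nat
      obtain d where d: "d > 0" "\<And>t. t \<noteq> 0 \<Longrightarrow> \<bar>t\<bar> < d \<Longrightarrow> \<bar>S t - c\<bar> < 1 / real (Suc k) / 2"
        using LIM_D[OF c, of "1 / real (Suc k) / 2"] by auto
      obtain j where j: "1 / real (Suc j) < d" using nat_approx_posE[OF d(1)] by auto
      have "\<bar>S t - S u\<bar> \<le> 1 / real (Suc k)"
        if "t \<noteq> 0" "\<bar>t\<bar> < 1 / real (Suc j)" "u \<noteq> 0" "\<bar>u\<bar> < 1 / real (Suc j)" for t u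
      proof -
        have "\<bar>S t - c\<bar> < 1 / real (Suc k) / 2" "\<bar>S u - c\<bar> < 1 / real (Suc k) / 2"
          using d(2)[of t] d(2)[of u] that j by (meson order.strict_trans)+
        then show ?thesis by (auto simp: abs_le_iff abs_less_iff field_simps)
      qed
      then show "\<exists>j::nat. \<forall>t u::rat. t \<noteq> 0 \<and> \<bar>real_of_rat t\<bar> < 1 / real (Suc j)
         \<and> u \<noteq> 0 \<and> \<bar>real_of_rat u\<bar> < 1 / real (Suc j) \<longrightarrow>
         \<bar>(f (of_rat t) - f 0) / of_rat t - (f (of_rat u) - f 0) / of_rat u\<bar> \<le> 1 / real (Suc k)"
        unfolding S_def by (intro exI[of _ j]) (metis of_rat_eq_0_iff)
    qed }
  { assume ?R
    have contS: "continuous_on (- {0}) S"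
      unfolding S_def by (intro continuous_intros continuous_on_subset[OF cont]) auto
    have appr: "\<exists>q. (\<forall>i. q i \<noteq> (0::rat)) \<and> (\<lambda>i. real_of_rat (q i)) \<longlonglongrightarrow> t" if "t \<noteq> 0" for t :: real
    proof -
      have "\<exists>q::rat. q \<noteq> 0 \<and> \<bar>real_of_rat q - t\<bar> < 1 / real (Suc i)" for i
      proof -
        have "t < t + min (1 / real (Suc i)) \<bar>t\<bar>" using that by simp
        then obtain q :: rat where "t < of_rat q" "of_rat q < t + min (1 / real (Suc i)) \<bar>t\<bar>"
          using of_rat_dense by blast
        then show ?thesis by (intro exI[of _ q]) (auto simp: abs_if split: if_splits)
      qed
      then obtain q where q: "\<And>i. q i \<noteq> (0::rat)" "\<And>i. \<bar>real_of_rat (q i) - t\<bar> < 1 / real (Suc i)"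
        by metis
      have "(\<lambda>i. real_of_rat (q i)) \<longlonglongrightarrow> t"
      proof (rule LIM_zero_cancel, rule Lim_null_comparison)
        show "\<forall>\<^sub>F i in sequentially. norm (real_of_rat (q i) - t) \<le> 1 / real (Suc i)"
          using q(2) by (intro always_eventually allI) (simp add: less_imp_le)
        show "(\<lambda>i. 1 / real (Suc i)) \<longlonglongrightarrow> 0" using lim_1_over_n LIMSEQ_Suc by blast
      qed
      then show ?thesis using q(1) by blast
    qed
    \<comment> \<open>The quotient is continuous away from 0, so the bound for rational increments
      passes to all real ones.\<close>
    have ext: "\<exists>d>0. \<forall>t u. t \<noteq> 0 \<and> \<bar>t\<bar> < d \<and> u \<noteq> 0 \<and> \<bar>u\<bar> < d \<longrightarrow> \<bar>S t - S u\<bar> \<le> 1 / real (Suc k)" for k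
    proof -
      obtain j :: nat where j: "\<And>t u::rat. t \<noteq> 0 \<and> \<bar>real_of_rat t\<bar> < 1 / real (Suc j)
         \<and> u \<noteq> 0 \<and> \<bar>real_of_rat u\<bar> < 1 / real (Suc j) \<Longrightarrow>
         \<bar>S (of_rat t) - S (of_rat u)\<bar> \<le> 1 / real (Suc k)" using \<open>?R\<close> unfolding S_def by meson
      show ?thesis
      proof (intro exI[of _ "1 / real (Suc j)"] conjI allI impI)
        fix t u :: real
        assume tu: "t \<noteq> 0 \<and> \<bar>t\<bar> < 1 / real (Suc j) \<and> u \<noteq> 0 \<and> \<bar>u\<bar> < 1 / real (Suc j)"
        obtain a where a: "\<And>i. a i \<noteq> (0::rat)" "(\<lambda>i. real_of_rat (a i)) \<longlonglongrightarrow> t" using appr tu by blast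
        obtain b where b: "\<And>i. b i \<noteq> (0::rat)" "(\<lambda>i. real_of_rat (b i)) \<longlonglongrightarrow> u" using appr tu by blast
        have iso: "isCont S t" "isCont S u"
          using contS tu by (auto simp: continuous_on_eq_continuous_at open_Compl)
        have lim: "(\<lambda>i. \<bar>S (of_rat (a i)) - S (of_rat (b i))\<bar>) \<longlonglongrightarrow> \<bar>S t - S u\<bar>"
          by (rule tendsto_rabs[OF tendsto_diff[OF isCont_tendsto_compose[OF iso(1) a(2)] isCont_tendsto_compose[OF iso(2) b(2)]]])
        have ea: "\<forall>\<^sub>F i in sequentially. \<bar>real_of_rat (a i)\<bar> < 1 / real (Suc j)"
          using order_tendstoD(2)[OF tendsto_rabs[OF a(2)]] tu by blast
        have eb: "\<forall>\<^sub>F i in sequentially. \<bar>real_of_rat (b i)\<bar> < 1 / real (Suc j)"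
          using order_tendstoD(2)[OF tendsto_rabs[OF b(2)]] tu by blast
        have "\<forall>\<^sub>F i in sequentially. \<bar>S (of_rat (a i)) - S (of_rat (b i))\<bar> \<le> 1 / real (Suc k)"
          using ea eb by eventually_elim (use j a(1) b(1) in blast)
        then show "\<bar>S t - S u\<bar> \<le> 1 / real (Suc k)"
          by (rule tendsto_upperbound[OF lim]) simp
      qed simp
    qed
    have "\<exists>c. S \<midarrow>0\<rightarrow> c"
    proof -
      define x where "x i = S (1 / real (Suc i))" for i
      have lim0: "(\<lambda>i. 1 / real (Suc i)) \<longlonglongrightarrow> 0" using lim_1_over_n LIMSEQ_Suc by blast
      have "Cauchy x"
      proof (rule metric_CauchyI)
        fix \<epsilon> :: real assume "0 < \<epsilon>"
        then obtain k where k: "1 / real (Suc k) < \<epsilon>" using nat_approx_posE by metis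
        obtain d where d: "d > 0" "\<And>t u. t \<noteq> 0 \<and> \<bar>t\<bar> < d \<and> u \<noteq> 0 \<and> \<bar>u\<bar> < d \<Longrightarrow> \<bar>S t - S u\<bar> \<le> 1 / real (Suc k)"
          using ext by blast
        obtain n where n: "1 / real (Suc n) < d" using nat_approx_posE[OF d(1)] by metis
        have n': "1 / real (Suc i) < d" if "n \<le> i" for i
          using that n order.strict_trans1[of "1 / real (Suc i)" "1 / real (Suc n)"] by (simp add: frac_le)
        show "\<exists>M. \<forall>m\<ge>M. \<forall>n\<ge>M. dist (x m) (x n) < \<epsilon>"
        proof (intro exI[of _ n] allI impI)
          fix i l assume "n \<le> i" "n \<le> l"
          then have "\<bar>x i - x l\<bar> \<le> 1 / real (Suc k)" unfolding x_def using n' by (intro d(2)) auto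
          then show "dist (x i) (x l) < \<epsilon>" using k by (simp add: dist_real_def)
        qed
      qed
      then obtain c where c: "x \<longlonglongrightarrow> c" using Cauchy_convergent convergent_def by blast
      have "S \<midarrow>0\<rightarrow> c"
      proof (rule LIM_I)
        fix \<epsilon> :: real assume "0 < \<epsilon>"
        then obtain k where k: "1 / real (Suc k) < \<epsilon>" using nat_approx_posE by metis
        obtain d where d: "d > 0" "\<And>t u. t \<noteq> 0 \<and> \<bar>t\<bar> < d \<and> u \<noteq> 0 \<and> \<bar>u\<bar> < d \<Longrightarrow> \<bar>S t - S u\<bar> \<le> 1 / real (Suc k)"
          using ext by blast
        show "\<exists>s>0. \<forall>t. t \<noteq> 0 \<and> norm (t - 0) < s \<longrightarrow> norm (S t - c) < \<epsilon>"
        proof (intro exI[of _ d] conjI allI impI d(1))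
          fix t :: real assume t: "t \<noteq> 0 \<and> norm (t - 0) < d"
          have lim: "(\<lambda>i. \<bar>S t - x i\<bar>) \<longlonglongrightarrow> \<bar>S t - c\<bar>" by (intro tendsto_intros c)
          have "\<forall>\<^sub>F i in sequentially. 1 / real (Suc i) < d"
            using order_tendstoD(2)[OF lim0 d(1)] .
          then have "\<forall>\<^sub>F i in sequentially. \<bar>S t - x i\<bar> \<le> 1 / real (Suc k)"
            unfolding x_def by eventually_elim (use t in \<open>intro d(2), auto\<close>)
          then have "\<bar>S t - c\<bar> \<le> 1 / real (Suc k)"
            by (rule tendsto_upperbound[OF lim]) simp
          then show "norm (S t - c) < \<epsilon>" using k by simp
        qed
      qed
      then show ?thesis by blast
    qed
    then show "f differentiable (at 0)" using D real_differentiable_def by blast }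
qed

section \<open>Measurability and almost everywhere existence of directional derivatives\<close>

lemma continuous_on_line:
  fixes U :: "'a::real_normed_vector \<Rightarrow> real"
  assumes "continuous_on UNIV U"
  shows "continuous_on UNIV (\<lambda>t. U (x + t *\<^sub>R e))"
  by (intro continuous_on_compose2[OF assms] continuous_intros) auto

lemma pred_dir_differentiable:
  fixes U :: "'a::euclidean_space \<Rightarrow> real"
  assumes cont: "continuous_on UNIV U"
  shows "Measurable.pred borel (\<lambda>x. (\<lambda>t. U (x + t *\<^sub>R e)) differentiable (at 0))"
proof -
  have [measurable]: "U \<in> borel_measurable borel"
    using cont by (rule borel_measurable_continuous_onI)
  show ?thesis
    unfolding differentiable_at_0_iff_Cauchy[OF continuous_on_line[OF cont]] by measurable
qed

text \<open>Where the derivative exists it is the limit of the quotients with increments 1 / (k +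
  1). Where it does not, the predicate behind the choice in \<open>deriv\<close> is false for every
  candidate, so the value is the same constant \<open>SOME D. False\<close> at all such
  points.\<close>

lemma borel_measurable_dir_deriv:
  fixes U :: "'a::euclidean_space \<Rightarrow> real"
  assumes cont: "continuous_on UNIV U"
  shows "dir_deriv U e \<in> borel_measurable borel"
proof -
  have U [measurable]: "U \<in> borel_measurable borel"
    using cont by (rule borel_measurable_continuous_onI)
  note [measurable] = pred_dir_differentiable[OF cont]
  define S where "S k x = (U (x + (1 / real (Suc k)) *\<^sub>R e) - U x) / (1 / real (Suc k))" for k x
  have [measurable]: "S k \<in> borel_measurable borel" for k
    unfolding S_def by measurable
  have "dir_deriv U e = (\<lambda>x. if (\<lambda>t. U (x + t *\<^sub>R e)) differentiable (at 0) then lim (\<lambda>k. S k x) else (SOME D. False))"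
  proof
    fix x
    show "dir_deriv U e x = (if (\<lambda>t. U (x + t *\<^sub>R e)) differentiable (at 0) then lim (\<lambda>k. S k x) else (SOME D. False))"
    proof (cases "(\<lambda>t. U (x + t *\<^sub>R e)) differentiable (at 0)")
      case True
      then have "DERIV (\<lambda>t. U (x + t *\<^sub>R e)) 0 :> dir_deriv U e x"
        unfolding dir_deriv_def using DERIV_deriv_iff_real_differentiable by blast
      then have "(\<lambda>t. (U (x + t *\<^sub>R e) - U x) / t) \<midarrow>0\<rightarrow> dir_deriv U e x"
        by (simp add: DERIV_def)
      then have "(\<lambda>k. (U (x + (1 / real (Suc k)) *\<^sub>R e) - U x) / (1 / real (Suc k))) \<longlonglongrightarrow> dir_deriv U e x"
      proof (rule tendsto_compose_eventually[unfolded o_def])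
        show "(\<lambda>i. 1 / real (Suc i)) \<longlonglongrightarrow> 0" using lim_1_over_n LIMSEQ_Suc by blast
      qed auto
      then show ?thesis using True unfolding S_def by (simp only: limI if_True)
    next
      case False
      then have "\<not> DERIV (\<lambda>t. U (x + t *\<^sub>R e)) 0 :> D" for D
        using real_differentiable_def by blast
      then show ?thesis using False by (simp add: dir_deriv_def deriv_def)
    qed
  qed
  moreover have "(\<lambda>x. if (\<lambda>t. U (x + t *\<^sub>R e)) differentiable (at 0) then lim (\<lambda>k. S k x) else (SOME D. False)) \<in> borel_measurable borel"
    by measurable
  ultimately show ?thesis by simp
qed

text \<open>The exceptional set \<open>N\<close> is Borel and meets each line parallel to
  \<open>e\<close> in a null set of parameters. Averaging its measure over the translates by t e
  with t in [0, 1] and exchanging the integrals gives 0 without coordinates adapted to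
  \<open>e\<close>.\<close>

lemma AE_dir_differentiable:
  fixes U :: "'a::euclidean_space \<Rightarrow> real"
  assumes lip: "L-lipschitz_on UNIV U"
  shows "AE x in lborel. (\<lambda>t. U (x + t *\<^sub>R e)) differentiable (at 0)"
proof -
  have cont: "continuous_on UNIV U" using lip lipschitz_on_continuous_on by blast
  note [measurable] = pred_dir_differentiable[OF cont]
  define N where "N = {x. \<not> (\<lambda>t. U (x + t *\<^sub>R e)) differentiable (at 0)}"
  have [measurable]: "N \<in> sets borel" unfolding N_def by measurable
  have line: "(\<integral>\<^sup>+t\<in>{0..1}. indicator N (x + t *\<^sub>R e) \<partial>lborel) = 0" for x
  proof -
    have "(L * norm e)-lipschitz_on UNIV (\<lambda>t. U (x + t *\<^sub>R e))"
    proof (rule lipschitz_onI)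
      fix t u
      show "dist (U (x + t *\<^sub>R e)) (U (x + u *\<^sub>R e)) \<le> L * norm e * dist t u"
        using lipschitz_UNIV_D[OF lip, of "x + t *\<^sub>R e" "x + u *\<^sub>R e"]
        by (simp add: dist_real_def mult_ac flip: scaleR_left_diff_distrib)
    qed (use lipschitz_on_nonneg[OF lip] in auto)
    from negligible_nondifferentiable_lipschitz[OF this]
    have n: "{t. \<not> (\<lambda>t. U (x + t *\<^sub>R e)) differentiable (at t)} \<in> null_sets lebesgue"
      by (simp add: negligible_iff_null_sets)
    have eq: "{t. \<not> (\<lambda>t. U (x + t *\<^sub>R e)) differentiable (at t)} = {t. x + t *\<^sub>R e \<in> N}"
    proof (rule Collect_cong)
      fix t
      have "DERIV (\<lambda>u. U (x + t *\<^sub>R e + u *\<^sub>R e)) 0 :> D \<longleftrightarrow> DERIV (\<lambda>u. U (x + u *\<^sub>R e)) t :> D" for D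
        by (simp add: DERIV_def algebra_simps)
      then have "(\<lambda>u. U (x + t *\<^sub>R e + u *\<^sub>R e)) differentiable (at 0) \<longleftrightarrow> (\<lambda>u. U (x + u *\<^sub>R e)) differentiable (at t)"
        by (simp add: real_differentiable_def)
      then show "(\<not> (\<lambda>t. U (x + t *\<^sub>R e)) differentiable (at t)) = (x + t *\<^sub>R e \<in> N)"
        by (simp add: N_def)
    qed
    have "{t. x + t *\<^sub>R e \<in> N} \<in> sets borel" by measurable
    then have nn: "{t. x + t *\<^sub>R e \<in> N} \<in> null_sets lborel"
      using n unfolding eq by (simp add: null_sets_def)
    have "AE t in lborel. indicator N (x + t *\<^sub>R e) * indicator {0..1} t = (0::ennreal)"
      using AE_not_in[OF nn] by eventually_elim (simp add: indicator_def)
    then show ?thesis by (subst nn_integral_0_iff_AE) auto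
  qed
  have "emeasure lborel N = (\<integral>\<^sup>+t\<in>{0..1::real}. emeasure lborel N \<partial>lborel)"
    by (simp add: nn_integral_cmult_indicator)
  also have "\<dots> = (\<integral>\<^sup>+t\<in>{0..1::real}. (\<integral>\<^sup>+x. indicator N (x + t *\<^sub>R e) \<partial>lborel) \<partial>lborel)"
  proof -
    have "(\<integral>\<^sup>+x. indicator N (x + t *\<^sub>R e) \<partial>lborel) = emeasure lborel N" for t
      using nn_integral_translate[of "indicator N" "t *\<^sub>R e"] by simp
    then show ?thesis by (simp only:)
  qed
  also have "\<dots> = (\<integral>\<^sup>+t. (\<integral>\<^sup>+x. indicator N (x + t *\<^sub>R e) * indicator {0..1::real} t \<partial>lborel) \<partial>lborel)"
    by (intro nn_integral_cong nn_integral_multc[symmetric]) measurable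
  also have "\<dots> = (\<integral>\<^sup>+x. (\<integral>\<^sup>+t. indicator N (x + t *\<^sub>R e) * indicator {0..1::real} t \<partial>lborel) \<partial>lborel)"
    by (intro lborel_pair.Fubini') measurable
  also have "\<dots> = 0" by (simp add: line)
  finally have "N \<in> null_sets lborel" by (auto simp: null_sets_def)
  then show ?thesis unfolding N_def by (auto dest: AE_not_in)
qed

section \<open>Mollification\<close>

text \<open>A class of differentiable functions closed under partial derivatives lies in every
  \<open>Ck k\<close>, so no higher derivative has to be computed. It is applied to convolutions of
  a fixed function with bump functions.\<close>

lemma Ck_if_closed_under_partials:
  assumes "P f"
    and "\<And>f. P f \<Longrightarrow> \<exists>f'. (\<forall>x. (f has_derivative f' x) (at x)) \<and> (\<forall>b\<in>Basis. P (\<lambda>x. f' x b))"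
  shows "Ck k f"
  using assms(1)
proof (induction k arbitrary: f)
  case 0
  then have "\<forall>x. f differentiable (at x)"
    using assms(2) differentiable_def by blast
  then show ?case
    by (auto simp: continuous_on_eq_continuous_at differentiable_imp_continuous_within)
next
  case (Suc k)
  obtain f' where f': "\<And>x. (f has_derivative f' x) (at x)" "\<And>b. b \<in> Basis \<Longrightarrow> P (\<lambda>x. f' x b)"
    using assms(2)[OF Suc.prems] by blast
  then have "frechet_derivative f (at x) = f' x" for x
    using frechet_derivative_at by metis
  then show ?case
    using f' Suc.IH by (auto simp: differentiable_def)
qed

text \<open>The classical flat function exp(-1/t), extended by 0, with a polynomial in 1/t in front
  so that the family is closed under differentiation.\<close>

definition exp_inv :: "real poly \<Rightarrow> real \<Rightarrow> real" where
  "exp_inv Q t = (if 0 < t then poly Q (1 / t) * exp (- 1 / t) else 0)"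

lemma tendsto_poly_div_exp: "((\<lambda>x. poly Q x / exp x) \<longlongrightarrow> (0::real)) at_top"
proof -
  have "((\<lambda>x. \<Sum>i\<le>degree Q. coeff Q i * (x ^ i / exp x)) \<longlongrightarrow> (\<Sum>i\<le>degree Q. coeff Q i * 0)) at_top"
    by (intro tendsto_intros tendsto_power_div_exp_0)
  then show ?thesis by (simp add: poly_altdef sum_divide_distrib)
qed

text \<open>For t > 0 the derivative of Q(1/t) exp(-1/t) is (Q - Q')(1/t) t^(-2) exp(-1/t), and
  \<open>[:0, 0, 1:]\<close> encodes the factor t^(-2). At 0 the quotient from the right tends to 0
  because the exponential beats every polynomial in 1/t.\<close>

lemma exp_inv_has_derivative:
  "(exp_inv Q has_real_derivative exp_inv ((Q - pderiv Q) * [:0, 0, 1:]) t) (at t)"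
proof -
  consider "t > 0" | "t < 0" | "t = 0" by linarith
  then show ?thesis
  proof cases
    case 1
    have "((\<lambda>t. poly Q (1 / t) * exp (- 1 / t)) has_real_derivative
        exp_inv ((Q - pderiv Q) * [:0, 0, 1:]) t) (at t)"
      using 1 by (auto intro!: derivative_eq_intros DERIV_chain2[OF poly_DERIV]
          simp: exp_inv_def field_simps power2_eq_square)
    then show ?thesis
      by (rule has_field_derivative_transform_within[where d = t]) (use 1 in \<open>auto simp: exp_inv_def dist_real_def\<close>)
  next
    case 2
    have "((\<lambda>t. 0) has_real_derivative exp_inv ((Q - pderiv Q) * [:0, 0, 1:]) t) (at t)"
      using 2 by (simp add: exp_inv_def)
    then show ?thesis
      by (rule has_field_derivative_transform_within[where d = "- t"]) (use 2 in \<open>auto simp: exp_inv_def dist_real_def\<close>)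
  next
    case 3
    have "((\<lambda>t. exp_inv Q t / t) \<longlongrightarrow> 0) (at_right 0)"
    proof -
      have "((\<lambda>t. poly (Q * [:0, 1:]) (inverse t) / exp (inverse t)) \<longlongrightarrow> 0) (at_right (0::real))"
        using filterlim_compose[OF tendsto_poly_div_exp filterlim_inverse_at_top_right] .
      moreover have "\<forall>\<^sub>F t in at_right 0. poly (Q * [:0, 1:]) (inverse t) / exp (inverse t) = exp_inv Q t / t"
        unfolding eventually_at_right_field
        by (intro exI[of _ 1]) (auto simp: exp_inv_def exp_minus field_simps)
      ultimately show ?thesis by (rule Lim_transform_eventually)
    qed
    moreover have "((\<lambda>t. exp_inv Q t / t) \<longlongrightarrow> 0) (at_left 0)"
    proof (rule Lim_transform_eventually[OF tendsto_const])
      show "\<forall>\<^sub>F t in at_left 0. 0 = exp_inv Q t / t"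
        unfolding eventually_at_left_field by (intro exI[of _ "- 1"]) (auto simp: exp_inv_def)
    qed
    ultimately have "(\<lambda>t. exp_inv Q t / t) \<midarrow>0\<rightarrow> 0" using filterlim_split_at by blast
    then show ?thesis using 3 by (simp add: DERIV_def exp_inv_def)
  qed
qed

text \<open>Closed under partial derivatives by design: the chain rule for \<open>base\<close>
  produces a factor x \<bullet> b, which \<open>coord\<close> supplies, and the product rule for
  \<open>coord\<close> calls for \<open>add\<close> and \<open>scale\<close>.\<close>

inductive bump_fun :: "('a::euclidean_space \<Rightarrow> real) \<Rightarrow> bool" where
  base: "bump_fun (\<lambda>x. exp_inv Q (1 - c * (x \<bullet> x)))"
| add: "bump_fun f \<Longrightarrow> bump_fun g \<Longrightarrow> bump_fun (\<lambda>x. f x + g x)"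
| coord: "bump_fun f \<Longrightarrow> bump_fun (\<lambda>x. (x \<bullet> b) * f x)"
| scale: "bump_fun f \<Longrightarrow> bump_fun (\<lambda>x. a * f x)"

lemma bump_fun_has_derivative:
  assumes "bump_fun f"
  shows "\<exists>G. (\<forall>x. (f has_derivative (\<lambda>h. G x \<bullet> h)) (at x)) \<and> (\<forall>b. bump_fun (\<lambda>x. G x \<bullet> b))"
  using assms
proof induction
  case (base Q c)
  let ?D = "\<lambda>x. exp_inv ((Q - pderiv Q) * [:0, 0, 1:]) (1 - c * (x \<bullet> x))"
  have "((\<lambda>x. exp_inv Q (1 - c * (x \<bullet> x))) has_derivative (\<lambda>h. ((- 2 * c * ?D x) *\<^sub>R x) \<bullet> h)) (at x)" for x
  proof -
    have "((\<lambda>x. exp_inv Q (1 - c * (x \<bullet> x))) has_derivative (\<lambda>h. ?D x * (- (c * (x \<bullet> h + h \<bullet> x))))) (at x)"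
      by (rule has_derivative_compose[OF _ has_field_derivative_imp_has_derivative[OF exp_inv_has_derivative]])
         (auto intro!: derivative_eq_intros)
    moreover have "(\<lambda>h. ?D x * (- (c * (x \<bullet> h + h \<bullet> x)))) = (\<lambda>h. ((- 2 * c * ?D x) *\<^sub>R x) \<bullet> h)"
      by (auto simp: inner_commute algebra_simps)
    ultimately show ?thesis by simp
  qed
  moreover have "bump_fun (\<lambda>x. ((- 2 * c * ?D x) *\<^sub>R x) \<bullet> b)" for b
    using bump_fun.scale[OF bump_fun.coord[OF bump_fun.base], of "- 2 * c" b] by (simp add: mult_ac)
  ultimately show ?case by (intro exI[of _ "\<lambda>x. (- 2 * c * ?D x) *\<^sub>R x"]) blast
next
  case (add f g)
  then obtain F G where "\<And>x. (f has_derivative (\<lambda>h. F x \<bullet> h)) (at x)" "\<And>b. bump_fun (\<lambda>x. F x \<bullet> b)"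
    "\<And>x. (g has_derivative (\<lambda>h. G x \<bullet> h)) (at x)" "\<And>b. bump_fun (\<lambda>x. G x \<bullet> b)" by blast
  then show ?case
    by (intro exI[of _ "\<lambda>x. F x + G x"])
       (auto simp: inner_add_left intro!: derivative_eq_intros bump_fun.add)
next
  case (coord f c)
  then obtain F where F: "\<And>x. (f has_derivative (\<lambda>h. F x \<bullet> h)) (at x)" "\<And>b. bump_fun (\<lambda>x. F x \<bullet> b)" by blast
  have "((\<lambda>x. (x \<bullet> c) * f x) has_derivative (\<lambda>h. (f x *\<^sub>R c + (x \<bullet> c) *\<^sub>R F x) \<bullet> h)) (at x)" for x
  proof -
    have "((\<lambda>x. (x \<bullet> c) * f x) has_derivative (\<lambda>h. (x \<bullet> c) * (F x \<bullet> h) + (h \<bullet> c) * f x)) (at x)"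
      by (intro derivative_intros F)
    moreover have "(\<lambda>h. (x \<bullet> c) * (F x \<bullet> h) + (h \<bullet> c) * f x) = (\<lambda>h. (f x *\<^sub>R c + (x \<bullet> c) *\<^sub>R F x) \<bullet> h)"
      by (auto simp: inner_simps inner_commute)
    ultimately show ?thesis by simp
  qed
  moreover have "bump_fun (\<lambda>x. (f x *\<^sub>R c + (x \<bullet> c) *\<^sub>R F x) \<bullet> b)" for b
    using bump_fun.add[OF bump_fun.scale[OF coord.hyps, of "c \<bullet> b"] bump_fun.coord[OF F(2), of c b]]
    by (simp add: inner_add_left mult_ac)
  ultimately show ?case by (intro exI[of _ "\<lambda>x. f x *\<^sub>R c + (x \<bullet> c) *\<^sub>R F x"]) blast
next
  case (scale f a)
  then obtain F where F: "\<And>x. (f has_derivative (\<lambda>h. F x \<bullet> h)) (at x)" "\<And>b. bump_fun (\<lambda>x. F x \<bullet> b)" by blast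
  have "((\<lambda>x. a * f x) has_derivative (\<lambda>h. (a *\<^sub>R F x) \<bullet> h)) (at x)" for x
    using has_derivative_mult_right[OF F(1), of a] by simp
  moreover have "bump_fun (\<lambda>x. (a *\<^sub>R F x) \<bullet> b)" for b
    using bump_fun.scale[OF F(2)] by simp
  ultimately show ?case by (intro exI[of _ "\<lambda>x. a *\<^sub>R F x"]) blast
qed

lemma bump_fun_continuous: "bump_fun f \<Longrightarrow> continuous_on A f"
  using bump_fun_has_derivative[of f]
  by (meson has_derivative_continuous_on has_derivative_at_withinI)

text \<open>Only the bump factor depends on \<open>x\<close>, so the derivative falls on it and the
  partial derivatives are again convolutions of the same \<open>z\<close> with bump functions. The
  box makes the domain compact for differentiation under the integral.\<close>

lemma convolution_bump_has_derivative:
  fixes z \<psi> :: "'a::euclidean_space \<Rightarrow> real"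
  assumes z: "continuous_on (cbox a b) z" and \<psi>: "bump_fun \<psi>"
  shows "\<exists>G. (\<forall>x. ((\<lambda>x. integral (cbox a b) (\<lambda>y. z y * \<psi> (x - y))) has_derivative
        (\<lambda>h. integral (cbox a b) (\<lambda>y. z y * (G (x - y) \<bullet> h)))) (at x))
     \<and> (\<forall>b. bump_fun (\<lambda>x. G x \<bullet> b))"
proof -
  obtain G where G: "\<And>x. (\<psi> has_derivative (\<lambda>h. G x \<bullet> h)) (at x)" "\<And>b. bump_fun (\<lambda>x. G x \<bullet> b)"
    using bump_fun_has_derivative[OF \<psi>] by blast
  have contG: "continuous_on A G" for A
    by (subst continuous_on_componentwise) (auto intro: bump_fun_continuous G)
  have cont\<psi>: "continuous_on A \<psi>" for A by (rule bump_fun_continuous[OF \<psi>])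
  let ?fx = "\<lambda>x y. blinfun_inner_right (z y *\<^sub>R G (x - y))"
  have "((\<lambda>x. integral (cbox a b) (\<lambda>y. z y * \<psi> (x - y))) has_derivative
        blinfun_apply (integral (cbox a b) (?fx x))) (at x)" for x
  proof (rule leibniz_rule[where U = UNIV and fx = ?fx])
    show "((\<lambda>x. z t * \<psi> (x - t)) has_derivative blinfun_apply (blinfun_inner_right (z t *\<^sub>R G (x - t)))) (at x within UNIV)" for x t
    proof -
      have "((\<lambda>x. \<psi> (x - t)) has_derivative (\<lambda>h. G (x - t) \<bullet> h)) (at x)"
        by (rule has_derivative_compose[OF _ G(1), of "\<lambda>x. x - t" "\<lambda>h. h"]) (auto intro!: derivative_eq_intros)
      from has_derivative_mult_right[OF this, of "z t"] show ?thesis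
        by (simp add: inner_scaleR_left[abs_def] fun_eq_iff has_derivative_eq_rhs)
    qed
    show "(\<lambda>y. z y * \<psi> (x - y)) integrable_on cbox a b" for x
      by (intro integrable_continuous continuous_intros z continuous_on_compose2[OF cont\<psi>]) auto
    show "continuous_on (UNIV \<times> cbox a b) (\<lambda>(x, t). blinfun_inner_right (z t *\<^sub>R G (x - t)))"
      unfolding split_beta
      by (intro continuous_intros continuous_on_compose2[OF z] continuous_on_compose2[OF contG[of UNIV]]
           bounded_linear.continuous_on[OF bounded_linear_blinfun_inner_right]) auto
  qed auto
  moreover have "blinfun_apply (integral (cbox a b) (?fx x)) = (\<lambda>h. integral (cbox a b) (\<lambda>y. z y * (G (x - y) \<bullet> h)))" for x
  proof
    fix h
    have "?fx x integrable_on cbox a b"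
      by (intro integrable_continuous bounded_linear.continuous_on[OF bounded_linear_blinfun_inner_right]
           continuous_intros z continuous_on_compose2[OF contG[of UNIV]]) auto
    then show "blinfun_apply (integral (cbox a b) (?fx x)) h = integral (cbox a b) (\<lambda>y. z y * (G (x - y) \<bullet> h))"
      by (simp add: blinfun_apply_integral)
  qed
  ultimately show ?thesis using G(2) by (intro exI[of _ G]) simp
qed

lemma Ck_convolution_bump:
  fixes z \<psi> :: "'a::euclidean_space \<Rightarrow> real"
  assumes z: "continuous_on (cbox a b) z" and \<psi>: "bump_fun \<psi>"
  shows "Ck k (\<lambda>x. integral (cbox a b) (\<lambda>y. z y * \<psi> (x - y)))"
proof (rule Ck_if_closed_under_partials[where
    P = "\<lambda>f. \<exists>\<psi>. bump_fun \<psi> \<and> f = (\<lambda>x. integral (cbox a b) (\<lambda>y. z y * \<psi> (x - y)))"])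
  show "\<exists>\<psi>'. bump_fun \<psi>' \<and> (\<lambda>x. integral (cbox a b) (\<lambda>y. z y * \<psi> (x - y))) = (\<lambda>x. integral (cbox a b) (\<lambda>y. z y * \<psi>' (x - y)))"
    using \<psi> by blast
next
  fix f :: "'a \<Rightarrow> real"
  assume "\<exists>\<psi>. bump_fun \<psi> \<and> f = (\<lambda>x. integral (cbox a b) (\<lambda>y. z y * \<psi> (x - y)))"
  then obtain \<psi> where \<psi>: "bump_fun \<psi>" "f = (\<lambda>x. integral (cbox a b) (\<lambda>y. z y * \<psi> (x - y)))" by blast
  from convolution_bump_has_derivative[OF z \<psi>(1)] obtain G where
    G: "\<And>x. (f has_derivative (\<lambda>h. integral (cbox a b) (\<lambda>y. z y * (G (x - y) \<bullet> h)))) (at x)"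
      "\<And>b. bump_fun (\<lambda>x. G x \<bullet> b)" using \<psi>(2) by blast
  then show "\<exists>f'. (\<forall>x. (f has_derivative f' x) (at x)) \<and>
      (\<forall>c\<in>Basis. \<exists>\<psi>. bump_fun \<psi> \<and> (\<lambda>x. f' x c) = (\<lambda>x. integral (cbox a b) (\<lambda>y. z y * \<psi> (x - y))))"
    by (intro exI[of _ "\<lambda>x h. integral (cbox a b) (\<lambda>y. z y * (G (x - y) \<bullet> h))"]) blast
qed

section \<open>Approximation of continuous functions by test functions\<close>

lemma test_functionsI:
  assumes "\<And>k. Ck k \<phi>" "\<And>x. R < norm x \<Longrightarrow> \<phi> x = 0" "cball 0 R \<subseteq> D"
  shows "\<phi> \<in> test_functions D"
proof -
  have "{x. \<phi> x \<noteq> 0} \<subseteq> cball 0 R"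
    using assms(2) by (force simp: not_less[symmetric])
  then have "closure {x. \<phi> x \<noteq> 0} \<subseteq> cball 0 R"
    by (rule closure_minimal) simp
  moreover have "compact (closure {x. \<phi> x \<noteq> 0})"
    using calculation compact_cball bounded_subset compact_eq_bounded_closed by (metis closed_closure)
  ultimately show ?thesis
    using assms by (auto simp: test_functions_def)
qed

text \<open>The averaging kernels \<open>\<rho> i\<close> are exposed because later estimates use
  that \<open>m i x\<close> is a mean of translates of \<open>z\<close>: Lipschitz bounds and
  translation invariant energies do not grow under averaging.\<close>

lemma mollification:
  fixes z :: "'a::euclidean_space \<Rightarrow> real"
  assumes cont: "continuous_on UNIV z" and supp: "\<And>x. R < norm x \<Longrightarrow> z x = 0"
  obtains m \<rho> where
    "\<And>i k. Ck k (m i)"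
    "\<And>i x. R + 1 / real (Suc i) < norm x \<Longrightarrow> m i x = 0"
    "uniform_limit UNIV m z sequentially"
    "\<And>i. \<rho> i \<in> borel_measurable borel" "\<And>i v. 0 \<le> \<rho> i v" "\<And>i. has_bochner_integral lborel (\<rho> i) 1"
    "\<And>i x. has_bochner_integral lborel (\<lambda>v. \<rho> i v * z (x - v)) (m i x)"
proof -
  obtain a b where ab: "cball 0 (max R 0) \<subseteq> cbox a (b::'a)"
    using bounded_subset_cbox_symmetric[OF bounded_cball] by metis
  define \<epsilon> where "\<epsilon> i = 1 / real (Suc i)" for i
  have \<epsilon>: "0 < \<epsilon> i" for i by (simp add: \<epsilon>_def)
  \<comment> \<open>The argument of \<open>exp_inv\<close> is positive exactly when
    \<open>norm x < \<epsilon> i\<close>, so \<open>\<beta> i\<close> lives on that ball.\<close>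
  define \<beta> where "\<beta> i x = exp_inv 1 (1 - (1 / (\<epsilon> i)\<^sup>2) * (x \<bullet> x))" for i and x :: 'a
  have \<beta>_bump: "bump_fun (\<beta> i)" for i unfolding \<beta>_def by (rule bump_fun.base)
  have cont\<beta>: "continuous_on A (\<beta> i)" for i A using bump_fun_continuous[OF \<beta>_bump] .
  have pos_iff: "0 < 1 - (1 / (\<epsilon> i)\<^sup>2) * (x \<bullet> x) \<longleftrightarrow> norm x < \<epsilon> i" for i and x :: 'a
  proof -
    have "0 < 1 - (1 / (\<epsilon> i)\<^sup>2) * (x \<bullet> x) \<longleftrightarrow> (norm x)\<^sup>2 < (\<epsilon> i)\<^sup>2"
      using \<epsilon>[of i] by (simp add: power2_norm_eq_inner field_simps)
    also have "\<dots> \<longleftrightarrow> norm x < \<epsilon> i" using \<epsilon>[of i] power_mono_iff[of "\<epsilon> i" "norm x" 2] by (simp add: not_le[symmetric])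
    finally show ?thesis .
  qed
  have \<beta>0: "\<beta> i x = 0" if "\<epsilon> i \<le> norm x" for i x
    using pos_iff[of i x] that unfolding \<beta>_def exp_inv_def by (simp only: not_less[symmetric] if_False)
  have \<beta>nn: "0 \<le> \<beta> i x" for i x by (simp add: \<beta>_def exp_inv_def)
  have \<beta>pos: "0 < \<beta> i x" if "norm x < \<epsilon> i" for i x
    using pos_iff[of i x] that unfolding \<beta>_def exp_inv_def by simp
  have [measurable]: "\<beta> i \<in> borel_measurable borel" for i
    using cont\<beta> by (rule borel_measurable_continuous_onI)
  have \<beta>int: "integrable lborel (\<beta> i)" for i
  proof -
    have "integrable lborel (\<lambda>x. indicator (cball 0 (\<epsilon> i)) x *\<^sub>R \<beta> i x)"
      by (rule borel_integrable_compact) (auto intro: cont\<beta>)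
    moreover have "(\<lambda>x. indicator (cball 0 (\<epsilon> i)) x *\<^sub>R \<beta> i x) = \<beta> i"
      using \<beta>0 by (auto simp: indicator_def fun_eq_iff)
    ultimately show ?thesis by simp
  qed
  define c where "c i = (\<integral>x. \<beta> i x \<partial>lborel)" for i
  have c: "0 < c i" for i
  proof -
    have "c i \<noteq> 0"
    proof
      assume "c i = 0"
      then have "AE x in lborel. \<beta> i x = 0"
        unfolding c_def using integral_nonneg_eq_0_iff_AE[OF \<beta>int] \<beta>nn by auto
      then have "AE x in lborel. x \<notin> ball (0::'a) (\<epsilon> i)"
        by (rule eventually_mono) (metis \<beta>pos less_irrefl mem_ball_0)
      then have "emeasure lborel (ball (0::'a) (\<epsilon> i)) = 0"
        by (subst (asm) AE_iff_measurable[of "ball 0 (\<epsilon> i)"]) auto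
      then show False
        using \<epsilon>[of i] unit_ball_vol_pos[of "real DIM('a)"] by (simp add: emeasure_ball)
    qed
    moreover have "0 \<le> c i" unfolding c_def by (rule integral_nonneg_AE) (simp add: \<beta>nn)
    ultimately show ?thesis by simp
  qed
  define \<rho> where "\<rho> i x = (1 / c i) * \<beta> i x" for i x
  have \<rho>_bump: "bump_fun (\<rho> i)" for i unfolding \<rho>_def by (rule bump_fun.scale[OF \<beta>_bump])
  have cont\<rho>: "continuous_on A (\<rho> i)" for i A using bump_fun_continuous[OF \<rho>_bump] .
  have [measurable]: "\<rho> i \<in> borel_measurable borel" for i unfolding \<rho>_def by measurable
  have \<rho>nn: "0 \<le> \<rho> i x" for i x using \<beta>nn c[of i] by (simp add: \<rho>_def)
  have \<rho>0: "\<rho> i x = 0" if "\<epsilon> i \<le> norm x" for i x using \<beta>0[OF that] by (simp add: \<rho>_def)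
  have \<rho>1: "has_bochner_integral lborel (\<rho> i) 1" for i
    unfolding has_bochner_integral_iff \<rho>_def using \<beta>int c[of i] by (simp add: c_def[symmetric])
  define m where "m i x = (\<integral>v. \<rho> i v * z (x - v) \<partial>lborel)" for i x
  have [measurable]: "z \<in> borel_measurable borel"
    using cont by (rule borel_measurable_continuous_onI)
  have int: "integrable lborel (\<lambda>v. \<rho> i v * z (x - v))" for i x
  proof -
    have "integrable lborel (\<lambda>v. indicator (cball 0 (\<epsilon> i)) v *\<^sub>R (\<rho> i v * z (x - v)))"
      by (intro borel_integrable_compact compact_cball continuous_intros cont\<rho> continuous_on_compose2[OF cont]) auto
    moreover have "(\<lambda>v. indicator (cball 0 (\<epsilon> i)) v *\<^sub>R (\<rho> i v * z (x - v))) = (\<lambda>v. \<rho> i v * z (x - v))"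
      using \<rho>0 by (auto simp: indicator_def fun_eq_iff)
    ultimately show ?thesis by simp
  qed
  have m: "has_bochner_integral lborel (\<lambda>v. \<rho> i v * z (x - v)) (m i x)" for i x
    unfolding m_def using int by (simp add: has_bochner_integral_iff)
  \<comment> \<open>Translation and reflection move the variable from \<open>z\<close> to the
    kernel; the integral can then be cut to a box containing the support of \<open>z\<close>, the
    form whose smoothness is known.\<close>
  have m_eq: "m i = (\<lambda>x. integral (cbox a b) (\<lambda>y. z y * \<rho> i (x - y)))" for i
  proof
    fix x
    have "m i x = (\<integral>v. \<rho> i (v + x) * z (x - (v + x)) \<partial>lborel)"
      using has_bochner_integral_translate[OF m, of i x x] by (simp add: has_bochner_integral_iff)
    also have "\<dots> = (\<integral>y. \<rho> i (x - y) * z y \<partial>lborel)"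
    proof -
      have "(\<integral>v. \<rho> i (v + x) * z (- v) \<partial>lborel) = (\<integral>v. \<rho> i (v + x) * z (- v) \<partial>distr lborel borel uminus)"
        using lborel_affine[of "-1" "0::'a"] by (simp add: density_1)
      also have "\<dots> = (\<integral>y. \<rho> i (x - y) * z y \<partial>lborel)"
        by (subst integral_distr) auto
      finally show ?thesis by simp
    qed
    also have "\<dots> = (LINT y:cbox a b|lborel. z y * \<rho> i (x - y))"
      unfolding set_lebesgue_integral_def
    proof (rule Bochner_Integration.integral_cong[OF refl])
      fix y show "\<rho> i (x - y) * z y = indicator (cbox a b) y *\<^sub>R (z y * \<rho> i (x - y))"
        using ab supp[of y] by (cases "norm y \<le> max R 0") (auto simp: indicator_def subset_iff)
    qed
    also have "\<dots> = integral (cbox a b) (\<lambda>y. z y * \<rho> i (x - y))"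
    proof (rule set_borel_integral_eq_integral(2))
      show "set_integrable lborel (cbox a b) (\<lambda>y. z y * \<rho> i (x - y))"
        unfolding set_integrable_def
        by (intro borel_integrable_compact compact_cbox continuous_intros
            continuous_on_subset[OF cont] continuous_on_compose2[OF cont\<rho>[of UNIV]]) auto
    qed
    finally show "m i x = integral (cbox a b) (\<lambda>y. z y * \<rho> i (x - y))" .
  qed
  \<comment> \<open>Two points closer than 1 either both lie in the ball of radius R + 1, where
    compactness applies, or both lie beyond \<open>R\<close>, where \<open>z\<close>
    vanishes.\<close>
  have zu: "uniformly_continuous_on UNIV z"
  proof -
    have "uniformly_continuous_on (cball 0 (R + 1)) z"
      by (intro compact_uniformly_continuous continuous_on_subset[OF cont]) auto
    show ?thesis
      unfolding uniformly_continuous_on_def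
    proof (intro allI impI)
      fix e :: real assume e: "0 < e"
      obtain d where d: "d > 0" "\<And>x y. x \<in> cball 0 (R + 1) \<Longrightarrow> y \<in> cball 0 (R + 1) \<Longrightarrow> dist y x < d \<Longrightarrow> dist (z y) (z x) < e"
        using \<open>uniformly_continuous_on (cball 0 (R + 1)) z\<close> e unfolding uniformly_continuous_on_def by metis
      show "\<exists>d>0. \<forall>x\<in>UNIV. \<forall>x'\<in>UNIV. dist x' x < d \<longrightarrow> dist (z x') (z x) < e"
      proof (intro exI[of _ "min d 1"] conjI ballI impI)
        fix x y :: 'a assume xy: "dist y x < min d 1"
        show "dist (z y) (z x) < e"
        proof (cases "x \<in> cball 0 (R + 1) \<and> y \<in> cball 0 (R + 1)")
          case True
          then show ?thesis using d xy by auto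
        next
          case False
          have "\<bar>norm y - norm x\<bar> \<le> dist y x" by (simp add: dist_norm norm_triangle_ineq3)
          then have "R < norm x" "R < norm y" using False xy by auto
          then show ?thesis using supp e by simp
        qed
      qed (use d in auto)
    qed
  qed
  show ?thesis
  proof (rule that[of m \<rho>])
    show "Ck k (m i)" for i k
      unfolding m_eq by (rule Ck_convolution_bump[OF continuous_on_subset[OF cont] \<rho>_bump]) auto
    show "m i x = 0" if "R + 1 / real (Suc i) < norm x" for i x
    proof -
      have *: "\<rho> i v * z (x - v) = 0" for v
      proof (cases "\<epsilon> i \<le> norm v")
        case False
        have "norm x \<le> norm v + norm (x - v)" using norm_triangle_ineq[of v "x - v"] by simp
        then show ?thesis using supp[of "x - v"] False that by (simp add: \<epsilon>_def)
      qed (simp add: \<rho>0)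
      show ?thesis unfolding m_def * by simp
    qed
    show "uniform_limit UNIV m z sequentially"
    proof (rule uniform_limitI)
      fix e :: real assume e: "0 < e"
      obtain d where d: "d > 0" "\<And>x y. dist y x < d \<Longrightarrow> dist (z y) (z x) < e / 2"
        using zu e unfolding uniformly_continuous_on_def by (metis UNIV_I half_gt_zero)
      have "\<forall>\<^sub>F i in sequentially. \<epsilon> i < d"
        unfolding \<epsilon>_def using order_tendstoD(2)[OF LIMSEQ_Suc[OF lim_1_over_n] d(1)] by simp
      then show "\<forall>\<^sub>F i in sequentially. \<forall>x\<in>UNIV. dist (m i x) (z x) < e"
      proof eventually_elim
        case (elim i)
        have "\<bar>m i x - z x\<bar> \<le> e / 2" for x
        proof -
          have h: "has_bochner_integral lborel (\<lambda>v. \<rho> i v * z (x - v) - \<rho> i v * z x) (m i x - 1 * z x)"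
            by (intro has_bochner_integral_diff m has_bochner_integral_mult_left \<rho>1)
          have "\<bar>m i x - 1 * z x\<bar> = \<bar>\<integral>v. \<rho> i v * z (x - v) - \<rho> i v * z x \<partial>lborel\<bar>"
            using h by (simp add: has_bochner_integral_iff)
          also have "\<dots> \<le> (\<integral>v. \<bar>\<rho> i v * z (x - v) - \<rho> i v * z x\<bar> \<partial>lborel)"
            by (rule integral_abs_bound)
          also have "\<dots> \<le> (\<integral>v. \<rho> i v * (e / 2) \<partial>lborel)"
          proof (rule integral_mono)
            show "integrable lborel (\<lambda>v. \<bar>\<rho> i v * z (x - v) - \<rho> i v * z x\<bar>)"
              using h by (auto simp: has_bochner_integral_iff)
            show "integrable lborel (\<lambda>v. \<rho> i v * (e / 2))"
              using \<rho>1[of i] by (auto simp: has_bochner_integral_iff)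
            fix v
            show "\<bar>\<rho> i v * z (x - v) - \<rho> i v * z x\<bar> \<le> \<rho> i v * (e / 2)"
            proof (cases "\<epsilon> i \<le> norm v")
              case False
              then have "dist (z (x - v)) (z x) < e / 2" using elim by (intro d(2)) (simp add: dist_norm)
              then have "\<rho> i v * \<bar>z (x - v) - z x\<bar> \<le> \<rho> i v * (e / 2)"
                using \<rho>nn by (intro mult_left_mono) (auto simp: dist_real_def)
              then show ?thesis using \<rho>nn[of i v] by (simp add: abs_mult flip: right_diff_distrib)
            qed (simp add: \<rho>0)
          qed
          also have "\<dots> = e / 2" using \<rho>1[of i] by (simp add: has_bochner_integral_iff)
          finally show ?thesis by simp
        qed
        then show ?case using e by (auto simp: dist_real_def intro: le_less_trans[of _ "e/2"])
      qed
    qed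
  qed (use \<rho>nn \<rho>1 m in auto)
qed

text \<open>The first partial derivatives are continuous, hence bounded on the compact support; off
  the support the differential vanishes.\<close>

lemma test_function_lipschitz:
  fixes \<phi> :: "'a::euclidean_space \<Rightarrow> real"
  assumes "\<phi> \<in> test_functions D"
  obtains L where "L-lipschitz_on UNIV \<phi>"
proof -
  define S where "S = closure {x. \<phi> x \<noteq> 0}"
  have S: "compact S" using assms by (simp add: test_functions_def S_def)
  have "Ck 1 \<phi>" using assms by (simp add: test_functions_def)
  then have d: "\<And>x. \<phi> differentiable (at x)"
    and c: "\<And>b. b \<in> Basis \<Longrightarrow> continuous_on UNIV (\<lambda>x. frechet_derivative \<phi> (at x) b)" by auto
  let ?D = "\<lambda>x. frechet_derivative \<phi> (at x)"
  have der: "(\<phi> has_derivative ?D x) (at x)" for x using d frechet_derivative_works by blast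
  have "\<exists>M. 0 \<le> M \<and> (\<forall>x\<in>S. \<bar>?D x b\<bar> \<le> M)" if "b \<in> Basis" for b
  proof -
    have "bounded ((\<lambda>x. ?D x b) ` S)"
      using S c[OF that] by (intro compact_imp_bounded compact_continuous_image) (auto intro: continuous_on_subset)
    then obtain M where "0 < M" "\<forall>x\<in>S. \<bar>?D x b\<bar> \<le> M" unfolding bounded_pos by auto
    then show ?thesis by (intro exI[of _ M]) auto
  qed
  then obtain M where M: "\<And>b. b \<in> Basis \<Longrightarrow> 0 \<le> M b" "\<And>b x. b \<in> Basis \<Longrightarrow> x \<in> S \<Longrightarrow> \<bar>?D x b\<bar> \<le> M b"
    by metis
  have b: "onorm (?D x) \<le> (\<Sum>b\<in>Basis. M b)" for x
  proof (cases "x \<in> S")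
    case True
    interpret bounded_linear "?D x" using der has_derivative_bounded_linear by blast
    show ?thesis
    proof (rule onorm_le)
      fix h :: 'a
      have "?D x h = (\<Sum>b\<in>Basis. (h \<bullet> b) * ?D x b)"
        by (subst euclidean_representation[of h, symmetric], subst sum) (simp add: scaleR)
      also have "\<bar>\<dots>\<bar> \<le> (\<Sum>b\<in>Basis. \<bar>h \<bullet> b\<bar> * \<bar>?D x b\<bar>)"
        by (rule order_trans[OF sum_abs]) (simp add: abs_mult)
      also have "\<dots> \<le> (\<Sum>b\<in>Basis. norm h * M b)"
        using True by (intro sum_mono mult_mono M Basis_le_norm) auto
      finally show "norm (?D x h) \<le> (\<Sum>b\<in>Basis. M b) * norm h"
        by (simp add: sum_distrib_left sum_distrib_right mult.commute)
    qed
  next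
    case False
    have "(\<phi> has_derivative (\<lambda>_. 0)) (at x)"
    proof (rule has_derivative_transform_within_open[of "\<lambda>_. 0" _ _ _ "- S"])
      show "y \<in> - S \<Longrightarrow> 0 = \<phi> y" for y using closure_subset by (force simp: S_def)
    qed (use False in \<open>auto simp: S_def\<close>)
    then have "?D x = (\<lambda>_. 0)" using frechet_derivative_at by metis
    then show ?thesis using M(1) by (simp add: onorm_zero sum_nonneg)
  qed
  have "(\<Sum>b\<in>Basis. M b)-lipschitz_on UNIV \<phi>"
    by (rule bounded_derivative_imp_lipschitz[OF der _ b]) (use M(1) in \<open>auto intro: sum_nonneg\<close>)
  then show ?thesis by (rule that)
qed

section \<open>The linearised kernel\<close>

text \<open>The mass of |y|^(-b) at infinity as a real number; the type argument records the
  dimension of the space.\<close>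

definition tail_const :: "'a::euclidean_space itself \<Rightarrow> real \<Rightarrow> real \<Rightarrow> real" where
  "tail_const _ b R = enn2real (\<integral>\<^sup>+y\<in>- ball (0::'a) R. ennreal (norm y powr (- b)) \<partial>lborel)"

text \<open>What the argument takes from the solution: in the large ball the increase along
  \<open>e\<close>, in \<open>ball 0 r0\<close> the pointwise derivative and its continuity,
  elsewhere Lipschitz continuity and the derivative almost everywhere. The doubled radius in
  \<open>mono\<close> leaves room for the closed ball of radius \<open>r0\<close>. \<open>N\<close>
  is the exponent of the kernel, and \<open>n\<close> is the dimension as a real number.\<close>

locale directed_solution =
  fixes U w :: "'a::euclidean_space \<Rightarrow> real" and e :: 'a and s p L r0 lam n N :: real
  assumes dim: "real DIM('a) = n" "2 \<le> n" and N: "N = n + s * p" and p: "1 < p" "p < 2" and s: "0 < s" "s < 1" and sp: "p - 1 < s * p"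
    and lip: "L-lipschitz_on UNIV U" and e: "norm e = 1" and r0: "0 < r0" and lam: "0 < lam"
    and mono: "\<And>x t. 0 \<le> t \<Longrightarrow> x \<in> ball 0 (2 * r0) \<Longrightarrow> x + t *\<^sub>R e \<in> ball 0 (2 * r0) \<Longrightarrow>
      lam * t \<le> U (x + t *\<^sub>R e) - U x"
    and weak: "\<And>\<phi>. \<phi> \<in> test_functions UNIV \<Longrightarrow>
      has_bochner_integral (lborel \<Otimes>\<^sub>M lborel)
        (\<lambda>(x, y). Jp p (U x - U y) * (\<phi> x - \<phi> y) / norm (x - y) powr N) 0"
    and w_meas: "w \<in> borel_measurable borel"
    and w_AE: "AE x in lborel. ((\<lambda>t. U (x + t *\<^sub>R e)) has_real_derivative w x) (at 0)"
    and w_ball: "\<And>x. x \<in> ball 0 r0 \<Longrightarrow> ((\<lambda>t. U (x + t *\<^sub>R e)) has_real_derivative w x) (at 0)"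
    and w_cont: "continuous_on (ball 0 r0) w"
begin

abbreviation J :: "'a \<Rightarrow> 'a \<Rightarrow> real" where "J \<equiv> JU s p U"

declare w_meas [measurable] and dim(1) [simp]

lemma contU: "continuous_on A U"
  using lip lipschitz_on_continuous_on continuous_on_subset by blast

lemma U_meas [measurable]: "U \<in> borel_measurable borel"
  using contU by (rule borel_measurable_continuous_onI)

lemma L: "0 \<le> L" using lip by (rule lipschitz_on_nonneg)

text \<open>The case distinction disappears because \<open>0 powr (p - 2)\<close> is 0, which agrees
  with the convention that \<open>J\<close> vanishes where \<open>U x = U y\<close>.\<close>

lemma J_eq: "J x y = (p - 1) * (\<bar>U x - U y\<bar> powr (p - 2) * norm (x - y) powr (- N))"
  by (simp add: JU_def powr_minus_divide N[symmetric])

lemma J_nonneg: "0 \<le> J x y" using p by (simp add: J_eq)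

lemma J_sym: "J x y = J y x"
  by (simp add: J_eq norm_minus_commute abs_minus_commute)

lemma J_meas [measurable]: "(\<lambda>z. J (fst z) (snd z)) \<in> borel_measurable (lborel \<Otimes>\<^sub>M lborel)"
  unfolding J_eq by measurable

lemma J_meas_comp [measurable (raw)]:
  assumes [measurable]: "f \<in> borel_measurable M" "g \<in> borel_measurable M"
  shows "(\<lambda>z. J (f z) (g z)) \<in> borel_measurable M"
  unfolding J_eq by measurable

lemma sp_bounds: "0 < s * p" "s * p < p" "s * p < 2" "n < N" "N < n + p" "2 < N"
proof -
  show "0 < s * p" using s p by simp
  show "s * p < p" using s p by simp
  with \<open>0 < s * p\<close> dim(2) p N show "s * p < 2" "n < N" "N < n + p" "2 < N" by linarith+
qed

text \<open>The one-dimensional constant times the volume of a ball of radius 2 r, divided by the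
  length 2 r of the interval of translations, with the powers of \<open>r\<close> taken out.\<close>

definition slab_const :: real where
  "slab_const = (lam / 2) powr (p - 2) * (2 * (2 powr (2 - p) / (1 - 2 powr (1 - p)))) * 2 powr (p - 1)
     * unit_ball_vol n * 2 powr n / 2"

lemma two_powr_less_1: "(2::real) powr (1 - p) < 1"
  using p powr_less_mono[of "1 - p" 0 2] by simp

lemma slab_const_nonneg: "0 \<le> slab_const"
  using two_powr_less_1 dim(2)
  by (auto simp: slab_const_def intro!: mult_nonneg_nonneg divide_nonneg_nonneg unit_ball_vol_nonneg)

lemma power_dim: "0 < r \<Longrightarrow> r ^ DIM('a) = r powr n"
  by (simp flip: powr_realpow)

text \<open>Averaging over the translates by t e with |t| <= r creates the line integrals without
  straightening coordinates: a line through \<open>x\<close> meets the set for such \<open>t\<close>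
  only if \<open>x\<close> lies in the ball of radius 2 r about \<open>x0\<close>, and then
  contributes at most a multiple of r^(p - 1). The total r^(p - 1) r^n / r is the stated power.
  Later estimates rest on the uniformity in the level \<open>c\<close> and the centre
  \<open>x0\<close>.\<close>

lemma slab:
  assumes r: "0 < r"
  shows "(\<integral>\<^sup>+x\<in>cball 0 r0 \<inter> cball x0 r. ennreal (\<bar>U x - c\<bar> powr (p - 2)) \<partial>lborel)
    \<le> ennreal (slab_const * r powr (n + p - 2))"
proof -
  define S where "S = cball 0 r0 \<inter> cball x0 r"
  have [measurable]: "S \<in> sets borel" unfolding S_def by measurable
  define F where "F x = ennreal (\<bar>U x - c\<bar> powr (p - 2)) * indicator S x" for x
  have [measurable]: "F \<in> borel_measurable borel" unfolding F_def by measurable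
  define c1 where "c1 = (lam / 2) powr (p - 2) * (2 * (2 powr (2 - p) / (1 - 2 powr (1 - p)))) * 2 powr (p - 1)"
  have c1: "0 \<le> c1" using two_powr_less_1 by (auto simp: c1_def)
  have line: "(\<integral>\<^sup>+t. F (x + t *\<^sub>R e) * indicator {-r..r} t \<partial>lborel)
      \<le> ennreal (c1 * r powr (p - 1)) * indicator (cball x0 (2 * r)) x" for x
  proof -
    define T where "T = {-r..r} \<inter> (\<lambda>t. x + t *\<^sub>R e) -` S"
    have "closed S" by (simp add: S_def closed_Int)
    then have T: "compact T"
      unfolding T_def by (intro compact_Int_closed closed_vimage continuous_intros) auto
    have FT: "F (x + t *\<^sub>R e) * indicator {-r..r} t = ennreal (\<bar>U (x + t *\<^sub>R e) - c\<bar> powr (p - 2)) * indicator T t" for t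
      by (auto simp: F_def T_def indicator_def)
    show ?thesis
    proof (cases "x \<in> cball x0 (2 * r)")
      case True
      have S2: "y \<in> ball 0 (2 * r0)" if "y \<in> S" for y using that r0 by (auto simp: S_def)
      have half: "lam * \<bar>t - u\<bar> \<le> \<bar>U (x + t *\<^sub>R e) - c - (U (x + u *\<^sub>R e) - c)\<bar>"
        if "t \<in> T" "u \<in> T" "u \<le> t" for t u
      proof -
        have "lam * (t - u) \<le> U (x + u *\<^sub>R e + (t - u) *\<^sub>R e) - U (x + u *\<^sub>R e)"
          using that by (intro mono S2) (auto simp: T_def algebra_simps)
        then show ?thesis using that by (simp add: algebra_simps)
      qed
      have "(\<integral>\<^sup>+t\<in>T. ennreal (\<bar>U (x + t *\<^sub>R e) - c\<bar> powr (p - 2)) \<partial>lborel)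
        \<le> ennreal ((lam / 2) powr (p - 2) * (2 * (2 powr (2 - p) / (1 - 2 powr (1 - p)))) * (2 * r) powr (p - 1))"
      proof (rule nn_integral_powr_expanding[OF p r lam T])
        show "T \<subseteq> {-r..r}" by (auto simp: T_def)
        show "continuous_on T (\<lambda>t. U (x + t *\<^sub>R e) - c)"
          by (intro continuous_intros continuous_on_compose2[OF contU]) auto
        fix t u assume "t \<in> T" "u \<in> T"
        then show "lam * \<bar>t - u\<bar> \<le> \<bar>U (x + t *\<^sub>R e) - c - (U (x + u *\<^sub>R e) - c)\<bar>"
          using half[of t u] half[of u t] by (cases "u \<le> t") (auto simp: abs_minus_commute)
      qed
      then show ?thesis using True r by (simp add: FT c1_def powr_mult mult_ac)
    next
      case False
      have "T = {}"
      proof (rule equals0I)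
        fix t assume "t \<in> T"
        then have "dist x0 (x + t *\<^sub>R e) \<le> r" "\<bar>t\<bar> \<le> r" by (auto simp: T_def S_def)
        moreover have "dist x0 x \<le> dist x0 (x + t *\<^sub>R e) + dist (x + t *\<^sub>R e) x" by (rule dist_triangle)
        ultimately show False using False e by (simp add: dist_norm)
      qed
      then show ?thesis by (simp add: FT)
    qed
  qed
  have "ennreal (2 * r) * (\<integral>\<^sup>+x. F x \<partial>lborel) = (\<integral>\<^sup>+t. (\<integral>\<^sup>+x. F x \<partial>lborel) * indicator {-r..r} t \<partial>lborel)"
    using r by (simp add: nn_integral_cmult_indicator mult.commute)
  also have "\<dots> = (\<integral>\<^sup>+t. (\<integral>\<^sup>+x. F (x + t *\<^sub>R e) * indicator {-r..r} t \<partial>lborel) \<partial>lborel)"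
  proof (rule nn_integral_cong)
    fix t
    have "(\<integral>\<^sup>+x. F x \<partial>lborel) = (\<integral>\<^sup>+x. F (x + t *\<^sub>R e) \<partial>lborel)"
      by (rule nn_integral_translate[symmetric]) measurable
    then show "(\<integral>\<^sup>+x. F x \<partial>lborel) * indicator {-r..r} t = (\<integral>\<^sup>+x. F (x + t *\<^sub>R e) * indicator {-r..r} t \<partial>lborel)"
      by (simp add: nn_integral_multc)
  qed
  also have "\<dots> = (\<integral>\<^sup>+x. (\<integral>\<^sup>+t. F (x + t *\<^sub>R e) * indicator {-r..r} t \<partial>lborel) \<partial>lborel)"
    by (intro lborel_pair.Fubini') measurable
  also have "\<dots> \<le> (\<integral>\<^sup>+x. ennreal (c1 * r powr (p - 1)) * indicator (cball x0 (2 * r)) x \<partial>lborel)"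
    by (intro nn_integral_mono line)
  also have "\<dots> = ennreal (c1 * r powr (p - 1) * (unit_ball_vol n * (2 * r) powr n))"
    using r c1 dim(2) by (simp add: nn_integral_cmult_indicator emeasure_cball ennreal_mult power_dim powr_mult)
  finally have "ennreal (1 / (2 * r)) * (ennreal (2 * r) * (\<integral>\<^sup>+x. F x \<partial>lborel))
      \<le> ennreal (1 / (2 * r)) * ennreal (c1 * r powr (p - 1) * (unit_ball_vol n * (2 * r) powr n))"
    by (rule mult_left_mono) simp
  moreover have "ennreal (1 / (2 * r)) * (ennreal (2 * r) * (\<integral>\<^sup>+x. F x \<partial>lborel)) = (\<integral>\<^sup>+x. F x \<partial>lborel)"
    using r by (simp add: mult.assoc[symmetric] ennreal_mult[symmetric])
  moreover have "ennreal (1 / (2 * r)) * ennreal (c1 * r powr (p - 1) * (unit_ball_vol n * (2 * r) powr n))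
      = ennreal (slab_const * r powr (n + p - 2))"
  proof -
    have "r powr (n + p - 2) = r powr (p - 1) * r powr n / r"
    proof -
      have "n + p - 2 = (p - 1) + n - 1" by simp
      then show ?thesis using r by (simp only: powr_add powr_diff powr_one power_dim)
    qed
    then have "1 / (2 * r) * (c1 * r powr (p - 1) * (unit_ball_vol n * (2 * r) powr n))
      = slab_const * r powr (n + p - 2)"
    proof -
      have sc: "slab_const = c1 * unit_ball_vol n * 2 powr n / 2"
        by (simp add: slab_const_def c1_def)
      have "(2 * r) powr n = 2 powr n * r powr n" using r by (simp add: powr_mult)
      then show ?thesis unfolding sc \<open>r powr (n + p - 2) = _\<close> by simp
    qed
    then show ?thesis using r by (subst ennreal_mult'[symmetric]) auto
  qed
  ultimately show ?thesis unfolding F_def S_def by simp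
qed

text \<open>At the level \<open>c\<close> itself the integrand of the slab bound is 0 by convention,
  so the level is moved to c - \<delta>, where it equals \<delta>^(p - 2) on the set. Hence the
  measure is at most C \<delta>^(2 - p), which tends to 0.\<close>

lemma emeasure_level_set: "emeasure lborel {x \<in> cball 0 r0. U x = c} = 0"
proof -
  define E where "E = {x \<in> cball 0 r0. U x = c}"
  have [measurable]: "E \<in> sets borel" unfolding E_def by measurable
  define C where "C = slab_const * r0 powr (n + p - 2)"
  have le: "emeasure lborel E \<le> ennreal (C * \<delta> powr (2 - p))" if \<delta>: "0 < \<delta>" for \<delta>
  proof -
    have "ennreal (\<delta> powr (p - 2)) * emeasure lborel E = (\<integral>\<^sup>+x. ennreal (\<delta> powr (p - 2)) * indicator E x \<partial>lborel)"
      by (simp add: nn_integral_cmult_indicator)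
    also have "\<dots> \<le> (\<integral>\<^sup>+x\<in>cball 0 r0 \<inter> cball 0 r0. ennreal (\<bar>U x - (c - \<delta>)\<bar> powr (p - 2)) \<partial>lborel)"
      using \<delta> by (intro nn_integral_mono) (auto simp: E_def indicator_def)
    also have "\<dots> \<le> ennreal C" unfolding C_def by (rule slab[OF r0])
    finally have mul: "ennreal (\<delta> powr (2 - p)) * (ennreal (\<delta> powr (p - 2)) * emeasure lborel E) \<le> ennreal (\<delta> powr (2 - p)) * ennreal C"
      by (rule mult_left_mono) simp
    have "\<delta> powr (2 - p) * \<delta> powr (p - 2) = 1" using \<delta> by (simp flip: powr_add)
    then have "ennreal (\<delta> powr (2 - p)) * (ennreal (\<delta> powr (p - 2)) * emeasure lborel E) = emeasure lborel E"
      by (subst mult.assoc[symmetric], subst ennreal_mult[symmetric]) simp_all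
    moreover have "ennreal (\<delta> powr (2 - p)) * ennreal C = ennreal (C * \<delta> powr (2 - p))"
      by (subst ennreal_mult'[symmetric]) (simp_all add: mult.commute)
    ultimately show ?thesis using mul by (simp only:)
  qed
  have "((\<lambda>\<delta>. ennreal (C * \<delta> powr (2 - p))) \<longlongrightarrow> ennreal (C * 0 powr (2 - p))) (at_right 0)"
    using p by (intro tendsto_ennrealI tendsto_intros) (auto simp: eventually_at_right_field intro!: exI[of _ 1])
  moreover have "\<forall>\<^sub>F \<delta> in at_right 0. emeasure lborel E \<le> ennreal (C * \<delta> powr (2 - p))"
    unfolding eventually_at_right_field by (intro exI[of _ 1]) (use le in auto)
  ultimately have "emeasure lborel E \<le> ennreal (C * 0 powr (2 - p))"
    by (intro tendsto_lowerbound[of _ _ "at_right 0"]) auto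
  then show ?thesis using p by (simp add: E_def)
qed

text \<open>Hides the convention on level sets from every integral with one point in the closed
  ball: the bounds for \<open>J\<close> and for the kernels of the difference quotients, which
  require \<open>U x \<noteq> U y\<close>, hold there almost everywhere.\<close>

lemma AE_level: "AE z in lborel \<Otimes>\<^sub>M lborel. fst z \<in> cball 0 r0 \<or> snd z \<in> cball 0 r0 \<longrightarrow> U (fst z) \<noteq> U (snd z)"
proof -
  define Q where "Q = {z. fst z \<in> cball 0 r0 \<and> U (fst z) = U (snd z)}"
  have Qp: "Measurable.pred (lborel \<Otimes>\<^sub>M lborel) (\<lambda>z. fst z \<in> cball 0 r0 \<and> U (fst z) = U (snd z))" by measurable
  then have Q: "Q \<in> sets (lborel \<Otimes>\<^sub>M lborel)"
    unfolding Q_def pred_def by (simp add: space_pair_measure)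
  have "(\<lambda>x. (x, y)) -` Q = {x \<in> cball 0 r0. U x = U y}" for y by (auto simp: Q_def)
  then have "emeasure (lborel \<Otimes>\<^sub>M lborel) Q = 0"
    using Q emeasure_level_set by (subst lborel_pair.emeasure_pair_measure_alt2) (simp_all del: mem_cball)
  then have "Q \<in> null_sets (lborel \<Otimes>\<^sub>M lborel)" using Q by (simp add: null_sets_def)
  then have 1: "AE z in lborel \<Otimes>\<^sub>M lborel. fst z \<in> cball 0 r0 \<longrightarrow> U (fst z) \<noteq> U (snd z)"
    by (rule AE_I') (auto simp: Q_def)
  have "AE z in distr (lborel \<Otimes>\<^sub>M lborel) (lborel \<Otimes>\<^sub>M lborel) (\<lambda>(x, y). (y, x)). fst z \<in> cball 0 r0 \<longrightarrow> U (fst z) \<noteq> U (snd z)"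
    using 1 by (subst (asm) lborel_pair.distr_pair_swap)
  then have "AE z in lborel \<Otimes>\<^sub>M lborel. snd z \<in> cball 0 r0 \<longrightarrow> U (snd z) \<noteq> U (fst z)"
    by (rule AE_distrD[rotated, THEN AE_mp]) (auto simp: split_beta)
  with 1 show ?thesis by eventually_elim auto
qed

section \<open>Integrability of the kernel\<close>

definition mm :: "'a \<Rightarrow> 'a \<Rightarrow> real" where "mm x y = min 1 ((norm (x - y))\<^sup>2)"

lemma mm_nonneg: "0 \<le> mm x y" and mm_sym: "mm x y = mm y x"
  by (simp_all add: mm_def norm_minus_commute)

lemma mm_meas [measurable (raw)]:
  assumes [measurable]: "f \<in> borel_measurable M" "g \<in> borel_measurable M"
  shows "(\<lambda>z. mm (f z) (g z)) \<in> borel_measurable M"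
  unfolding mm_def by measurable

lemma slab_indicator:
  assumes "0 < r"
  shows "(\<integral>\<^sup>+x\<in>cball x0 r. (ennreal (\<bar>U x - c\<bar> powr (p - 2)) * indicator (cball 0 r0) x) \<partial>lborel)
    \<le> ennreal (slab_const * r powr (n + p - 2))"
proof -
  have "(\<integral>\<^sup>+x\<in>cball x0 r. (ennreal (\<bar>U x - c\<bar> powr (p - 2)) * indicator (cball 0 r0) x) \<partial>lborel)
     = (\<integral>\<^sup>+x\<in>cball 0 r0 \<inter> cball x0 r. ennreal (\<bar>U x - c\<bar> powr (p - 2)) \<partial>lborel)"
    by (intro nn_integral_cong) (auto simp: indicator_def)
  then show ?thesis using slab[OF assms] by simp
qed

text \<open>For fixed \<open>y\<close>, anywhere in space, |U - U y|^(p - 2) has growth exponent n +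
  p - 2 by the slab bound. Near \<open>y\<close> it meets |x - y|^(-(N - 2)), and N - 2 < n + p - 2
  is just sp < p; at distances beyond 1 the power of the distance is at most 1.\<close>

lemma J_mm_section:
  obtains C where "0 \<le> C"
    "\<And>y. (\<integral>\<^sup>+x\<in>cball 0 r0. ennreal (J x y * mm x y) \<partial>lborel) \<le> ennreal C"
proof -
  define C1 where "C1 = slab_const * (2 powr (N - 2) / (1 - 2 powr (N - 2 - (n + p - 2))))"
  define C2 where "C2 = slab_const * r0 powr (n + p - 2)"
  have C1: "0 \<le> C1"
  proof -
    have "(2::real) powr (N - 2 - (n + p - 2)) < 2 powr 0" using sp_bounds by (intro powr_less_mono) auto
    then show ?thesis using slab_const_nonneg by (auto simp: C1_def)
  qed
  have C2: "0 \<le> C2" using slab_const_nonneg by (simp add: C2_def)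
  show ?thesis
  proof (rule that[of "(p - 1) * (C1 + C2)"])
    show "0 \<le> (p - 1) * (C1 + C2)" using p C1 C2 by simp
    fix y
    define G where "G x = \<bar>U x - U y\<bar> powr (p - 2)" for x
    have [measurable]: "G \<in> borel_measurable borel" unfolding G_def by measurable
    have G0: "0 \<le> G x" for x by (simp add: G_def)
    have pt: "ennreal (J x y * mm x y) * indicator (cball 0 r0) x \<le>
      ennreal (p - 1) * ((ennreal (G x) * indicator (cball 0 r0) x) * ennreal (norm (x - y) powr (- (N - 2))) * indicator (cball y 1) x
         + ennreal (G x) * indicator (cball 0 r0 \<inter> cball 0 r0) x)" for x
    proof (cases "x \<in> cball 0 r0")
      case True
      show ?thesis
      proof (cases "norm (x - y) \<le> 1")
        case le1: True
        have "mm x y = (norm (x - y))\<^sup>2"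
          using le1 by (simp add: mm_def power_le_one)
        moreover have "norm (x - y) powr (- N) * (norm (x - y))\<^sup>2 = norm (x - y) powr (- (N - 2))"
          by (cases "x = y") (simp_all add: powr_diff powr_minus_divide powr_realpow)
        ultimately have "J x y * mm x y = (p - 1) * (G x * norm (x - y) powr (- (N - 2)))"
          by (simp add: J_eq G_def mult.assoc)
        moreover have "x \<in> cball y 1" using le1 by (simp add: dist_norm norm_minus_commute)
        ultimately show ?thesis using True G0 p
          by (simp add: ennreal_mult distrib_left)
      next
        case False
        have "norm (x - y) powr (- N) \<le> 1"
          using False sp_bounds powr_mono[of "- N" 0 "norm (x - y)"] by (simp split: if_splits)
        then have "J x y * mm x y \<le> (p - 1) * (G x * (1 * 1))"
          unfolding J_eq G_def mult.assoc using p by (intro mult_left_mono mult_mono) (auto simp: mm_def)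
        then have "ennreal (J x y * mm x y) \<le> ennreal (p - 1) * ennreal (G x)"
          using p G0 by (simp add: ennreal_mult[symmetric] ennreal_leI)
        then show ?thesis using True by (simp add: distrib_left add_increasing)
      qed
    qed simp
    have "(\<integral>\<^sup>+x\<in>cball 0 r0. ennreal (J x y * mm x y) \<partial>lborel) \<le>
      (\<integral>\<^sup>+x. ennreal (p - 1) * ((ennreal (G x) * indicator (cball 0 r0) x) * ennreal (norm (x - y) powr (- (N - 2))) * indicator (cball y 1) x
         + ennreal (G x) * indicator (cball 0 r0 \<inter> cball 0 r0) x) \<partial>lborel)"
      by (intro nn_integral_mono pt)
    also have "\<dots> = ennreal (p - 1) * ((\<integral>\<^sup>+x\<in>cball y 1. (ennreal (G x) * indicator (cball 0 r0) x) * ennreal (norm (x - y) powr (- (N - 2))) \<partial>lborel)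
         + (\<integral>\<^sup>+x\<in>cball 0 r0 \<inter> cball 0 r0. ennreal (G x) \<partial>lborel))"
      by (subst nn_integral_cmult, measurable, subst nn_integral_add) measurable
    also have "\<dots> \<le> ennreal (p - 1) * (ennreal (C1 * 1 powr (n + p - 2 - (N - 2))) + ennreal C2)"
    proof (intro mult_left_mono add_mono)
      show "(\<integral>\<^sup>+x\<in>cball y 1. (ennreal (G x) * indicator (cball 0 r0) x) * ennreal (norm (x - y) powr (- (N - 2))) \<partial>lborel)
          \<le> ennreal (C1 * 1 powr (n + p - 2 - (N - 2)))"
        unfolding C1_def
        by (rule nn_integral_powr_dyadic)
           (use dim sp_bounds slab_const_nonneg slab_indicator in \<open>auto simp: G_def\<close>)
      show "(\<integral>\<^sup>+x\<in>cball 0 r0 \<inter> cball 0 r0. ennreal (G x) \<partial>lborel) \<le> ennreal C2"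
        unfolding C2_def G_def by (rule slab[OF r0])
    qed simp
    also have "\<dots> = ennreal ((p - 1) * (C1 + C2))"
      using C1 C2 p by (simp add: ennreal_mult)
    finally show "(\<integral>\<^sup>+x\<in>cball 0 r0. ennreal (J x y * mm x y) \<partial>lborel) \<le> ennreal ((p - 1) * (C1 + C2))" .
  qed
qed

text \<open>For |x| <= R < r1 <= |y| the triangle inequality gives |x - y| >= (1 - R / r1) |y|, so
  the kernel splits into a decay in \<open>y\<close> and the slab bound in \<open>x\<close>. The
  second inclusion for \<open>A\<close> retains the Morrey power of \<open>r\<close>.\<close>

lemma J_far_section:
  assumes r1: "0 < r1" and R: "0 \<le> R" "R < r1" "R \<le> r0" and r: "0 < r" and A: "A \<subseteq> cball 0 R" "A \<subseteq> cball x0 r"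
    and y: "y \<notin> ball 0 r1" and [measurable]: "A \<in> sets borel"
  shows "(\<integral>\<^sup>+x\<in>A. ennreal (J x y) \<partial>lborel)
    \<le> ennreal ((p - 1) * slab_const * (1 - R / r1) powr (- N) * r powr (n + p - 2)) * ennreal (norm y powr (- N))"
proof -
  define \<theta> where "\<theta> = 1 - R / r1"
  have \<theta>: "0 < \<theta>" using R r1 by (simp add: \<theta>_def)
  have y': "r1 \<le> norm y" using y by simp
  have "ennreal (J x y) * indicator A x \<le> ennreal ((p - 1) * (\<theta> powr (- N) * norm y powr (- N))) *
     (ennreal (\<bar>U x - U y\<bar> powr (p - 2)) * indicator (cball 0 r0 \<inter> cball x0 r) x)" for x
  proof (cases "x \<in> A")
    case True
    have "norm x \<le> R" using True A(1) by auto
    also have "R \<le> R / r1 * norm y" using y' r1 R by (simp add: field_simps mult_left_mono)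
    finally have "\<theta> * norm y \<le> norm y - norm x" by (simp add: \<theta>_def algebra_simps)
    also have "\<dots> \<le> norm (x - y)" by (metis norm_minus_commute norm_triangle_ineq2)
    finally have "norm (x - y) powr (- N) \<le> (\<theta> * norm y) powr (- N)"
      using \<theta> y' r1 sp_bounds by (intro powr_mono2' mult_pos_pos) auto
    also have "\<dots> = \<theta> powr (- N) * norm y powr (- N)" using \<theta> by (simp add: powr_mult)
    finally have "J x y \<le> (p - 1) * (\<bar>U x - U y\<bar> powr (p - 2) * (\<theta> powr (- N) * norm y powr (- N)))"
      unfolding J_eq using p by (intro mult_left_mono) auto
    then have "ennreal (J x y) \<le> ennreal ((p - 1) * (\<theta> powr (- N) * norm y powr (- N))) * ennreal (\<bar>U x - U y\<bar> powr (p - 2))"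
      using p by (subst ennreal_mult[symmetric]) (auto simp: mult_ac intro!: ennreal_leI)
    moreover have "x \<in> cball 0 r0 \<inter> cball x0 r" using True A R by auto
    ultimately show ?thesis using True by simp
  qed simp
  then have "(\<integral>\<^sup>+x\<in>A. ennreal (J x y) \<partial>lborel) \<le> (\<integral>\<^sup>+x. ennreal ((p - 1) * (\<theta> powr (- N) * norm y powr (- N))) *
     (ennreal (\<bar>U x - U y\<bar> powr (p - 2)) * indicator (cball 0 r0 \<inter> cball x0 r) x) \<partial>lborel)"
    by (rule nn_integral_mono)
  also have "\<dots> = ennreal ((p - 1) * (\<theta> powr (- N) * norm y powr (- N))) *
     (\<integral>\<^sup>+x\<in>cball 0 r0 \<inter> cball x0 r. ennreal (\<bar>U x - U y\<bar> powr (p - 2)) \<partial>lborel)"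
    by (rule nn_integral_cmult) measurable
  also have "\<dots> \<le> ennreal ((p - 1) * (\<theta> powr (- N) * norm y powr (- N))) * ennreal (slab_const * r powr (n + p - 2))"
    by (intro mult_left_mono slab r) simp
  also have "\<dots> = ennreal ((p - 1) * slab_const * \<theta> powr (- N) * r powr (n + p - 2)) * ennreal (norm y powr (- N))"
    using p slab_const_nonneg by (subst (1 2) ennreal_mult[symmetric]) (auto simp: mult_ac)
  finally show ?thesis by (simp add: \<theta>_def)
qed

lemma tail: "0 < r1 \<Longrightarrow> (\<integral>\<^sup>+y\<in>- ball (0::'a) r1. ennreal (norm y powr (- N)) \<partial>lborel) = ennreal (tail_const TYPE('a) N r1)"
  using nn_integral_powr_outside_ball[where ?'a = 'a and R = r1 and b = N] sp_bounds
  by (simp add: tail_const_def)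

text \<open>The exchange of the integrals is the point: the slab bound acts on the integral over
  \<open>x\<close>, uniformly in \<open>y\<close>, and |y|^(-N) is integrable at infinity.\<close>

lemma J_far:
  assumes r1: "0 < r1" and R: "0 \<le> R" "R < r1" "R \<le> r0" and r: "0 < r" and A: "A \<subseteq> cball 0 R" "A \<subseteq> cball x0 r"
    and [measurable]: "A \<in> sets borel"
  shows "(\<integral>\<^sup>+x\<in>A. (\<integral>\<^sup>+y\<in>- ball 0 r1. ennreal (J x y) \<partial>lborel) \<partial>lborel)
    \<le> ennreal ((p - 1) * slab_const * (1 - R / r1) powr (- N) * tail_const TYPE('a) N r1 * r powr (n + p - 2))"
proof -
  let ?c = "(p - 1) * slab_const * (1 - R / r1) powr (- N) * r powr (n + p - 2)"
  have c: "0 \<le> ?c" using p slab_const_nonneg by simp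
  have "(\<integral>\<^sup>+x\<in>A. (\<integral>\<^sup>+y\<in>- ball 0 r1. ennreal (J x y) \<partial>lborel) \<partial>lborel)
     = (\<integral>\<^sup>+x. (\<integral>\<^sup>+y. ennreal (J x y) * indicator (- ball 0 r1) y * indicator A x \<partial>lborel) \<partial>lborel)"
    by (intro nn_integral_cong nn_integral_multc[symmetric]) measurable
  also have "\<dots> = (\<integral>\<^sup>+y. (\<integral>\<^sup>+x. ennreal (J x y) * indicator (- ball 0 r1) y * indicator A x \<partial>lborel) \<partial>lborel)"
    by (intro lborel_pair.Fubini'[symmetric]) measurable
  also have "\<dots> \<le> (\<integral>\<^sup>+y. ennreal ?c * (ennreal (norm y powr (- N)) * indicator (- ball (0::'a) r1) y) \<partial>lborel)"
  proof (rule nn_integral_mono)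
    fix y
    show "(\<integral>\<^sup>+x. ennreal (J x y) * indicator (- ball 0 r1) y * indicator A x \<partial>lborel)
       \<le> ennreal ?c * (ennreal (norm y powr (- N)) * indicator (- ball 0 r1) y)"
    proof (cases "y \<in> ball 0 r1")
      case False
      then show ?thesis using J_far_section[OF r1 R r A False] by simp
    qed simp
  qed
  also have "\<dots> = ennreal ?c * ennreal (tail_const TYPE('a) N r1)"
    by (subst nn_integral_cmult) (auto simp: tail[OF r1])
  also have "\<dots> = ennreal ((p - 1) * slab_const * (1 - R / r1) powr (- N) * tail_const TYPE('a) N r1 * r powr (n + p - 2))"
    using c by (subst ennreal_mult'[symmetric]) (auto simp: mult_ac)
  finally show ?thesis .
qed

text \<open>The integrable majorant behind the Caccioppoli estimate and the limit of the equation.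
  One point must lie in the closed ball, since only there does the slab bound apply.\<close>

definition dom :: "'a \<Rightarrow> 'a \<Rightarrow> real" where
  "dom x y = J x y * mm x y * of_bool (x \<in> cball 0 r0 \<or> y \<in> cball 0 r0)"

lemma dom_nonneg: "0 \<le> dom x y"
  by (simp add: dom_def J_nonneg mm_nonneg)

lemma dom_meas [measurable]: "(\<lambda>z. dom (fst z) (snd z)) \<in> borel_measurable (lborel \<Otimes>\<^sub>M lborel)"
  unfolding dom_def by measurable

text \<open>The integral over \<open>x\<close> in the ball is bounded for |y| < 2 r0 and decays like
  |y|^(-N) beyond, where \<open>y\<close> is well separated from the ball. Symmetry covers the pairs
  with \<open>y\<close> in the ball.\<close>

lemma integrable_dom: "integrable (lborel \<Otimes>\<^sub>M lborel) (\<lambda>z. dom (fst z) (snd z))"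
proof (rule integrableI_bounded)
  obtain C where C: "0 \<le> C" "\<And>y. (\<integral>\<^sup>+x\<in>cball 0 r0. ennreal (J x y * mm x y) \<partial>lborel) \<le> ennreal C"
    using J_mm_section by metis
  define h where "h y = (\<integral>\<^sup>+x\<in>cball 0 r0. ennreal (J x y * mm x y) \<partial>lborel)" for y
  have [measurable]: "h \<in> borel_measurable borel" unfolding h_def by measurable
  let ?c = "(p - 1) * slab_const * (1 - r0 / (2 * r0)) powr (- N) * r0 powr (n + p - 2)"
  have hb: "h y \<le> ennreal C * indicator (ball 0 (2 * r0)) y + ennreal ?c * (ennreal (norm y powr (- N)) * indicator (- ball 0 (2 * r0)) y)" for y
  proof (cases "y \<in> ball 0 (2 * r0)")
    case True
    then show ?thesis using C(2)[of y] by (simp add: h_def)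
  next
    case False
    have "h y \<le> (\<integral>\<^sup>+x\<in>cball 0 r0. ennreal (J x y) \<partial>lborel)"
      unfolding h_def using J_nonneg
      by (intro nn_integral_mono mult_right_mono ennreal_leI mult_left_le) (auto simp: mm_def)
    also have "\<dots> \<le> ennreal ?c * ennreal (norm y powr (- N))"
      by (rule J_far_section[of _ _ _ _ 0]) (use r0 False in auto)
    finally show ?thesis using False by simp
  qed
  have "(\<integral>\<^sup>+y. h y \<partial>lborel) \<le> (\<integral>\<^sup>+y. ennreal C * indicator (ball (0::'a) (2 * r0)) y + ennreal ?c * (ennreal (norm y powr (- N)) * indicator (- ball 0 (2 * r0)) y) \<partial>lborel)"
    by (intro nn_integral_mono hb)
  also have "\<dots> = ennreal C * emeasure lborel (ball (0::'a) (2 * r0)) + ennreal ?c * ennreal (tail_const TYPE('a) N (2 * r0))"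
    using r0 by (subst nn_integral_add) (auto simp: nn_integral_cmult nn_integral_cmult_indicator tail)
  also have "\<dots> < \<infinity>"
    using r0 by (simp add: emeasure_ball ennreal_mult_less_top)
  finally have hfin: "(\<integral>\<^sup>+y. h y \<partial>lborel) < \<infinity>" .
  have 1: "(\<integral>\<^sup>+z. ennreal (J (fst z) (snd z) * mm (fst z) (snd z)) * indicator (cball 0 r0) (fst z) \<partial>(lborel \<Otimes>\<^sub>M lborel)) = (\<integral>\<^sup>+y. h y \<partial>lborel)"
    unfolding h_def by (subst lborel_pair.nn_integral_snd[symmetric]) auto
  have 2: "(\<integral>\<^sup>+z. ennreal (J (fst z) (snd z) * mm (fst z) (snd z)) * indicator (cball 0 r0) (snd z) \<partial>(lborel \<Otimes>\<^sub>M lborel)) = (\<integral>\<^sup>+y. h y \<partial>lborel)"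
    unfolding h_def by (subst lborel.nn_integral_fst[symmetric]) (auto simp: J_sym mm_sym)
  have "(\<integral>\<^sup>+z. ennreal (norm (dom (fst z) (snd z))) \<partial>(lborel \<Otimes>\<^sub>M lborel)) \<le>
    (\<integral>\<^sup>+z. ennreal (J (fst z) (snd z) * mm (fst z) (snd z)) * indicator (cball 0 r0) (fst z) +
       ennreal (J (fst z) (snd z) * mm (fst z) (snd z)) * indicator (cball 0 r0) (snd z) \<partial>(lborel \<Otimes>\<^sub>M lborel))"
    by (intro nn_integral_mono) (auto simp: dom_def indicator_def J_nonneg mm_nonneg)
  also have "\<dots> < \<infinity>"
    using hfin by (subst nn_integral_add) (auto simp: 1 2)
  finally show "(\<integral>\<^sup>+z. ennreal (norm (dom (fst z) (snd z))) \<partial>(lborel \<Otimes>\<^sub>M lborel)) < \<infinity>" .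
qed measurable

end

section \<open>Limits of vanishing integrals\<close>

lemma liminf_le_bound: "(\<And>k. f k \<le> (B :: ennreal)) \<Longrightarrow> liminf f \<le> B"
  by (rule order_trans[OF Liminf_le_Limsup[OF sequentially_bot] Limsup_bounded[OF always_eventually]]) simp

lemma has_bochner_integral_dominated:
  fixes f :: "nat \<Rightarrow> 'm \<Rightarrow> real"
  assumes "\<And>k. has_bochner_integral M (f k) 0" "AE x in M. (\<lambda>k. f k x) \<longlonglongrightarrow> F x"
    "\<And>k. AE x in M. norm (f k x) \<le> g x" "integrable M g" "F \<in> borel_measurable M"
  shows "has_bochner_integral M F 0"
proof -
  have m: "f k \<in> borel_measurable M" "integral\<^sup>L M (f k) = 0" for k
    using assms(1) by (auto simp: has_bochner_integral_iff)
  have "integrable M F" by (rule integrable_dominated_convergence[OF assms(5) m(1) assms(4,2,3)])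
  moreover have "(\<lambda>k. integral\<^sup>L M (f k)) \<longlonglongrightarrow> integral\<^sup>L M F"
    by (rule integral_dominated_convergence[OF assms(5) m(1) assms(4,2,3)])
  then have "integral\<^sup>L M F = 0" by (simp add: m(2) LIMSEQ_const_iff)
  ultimately show ?thesis by (simp add: has_bochner_integral_iff)
qed

text \<open>A substitute for Vitali's convergence theorem: the second hypothesis on the \<open>f k\<close> says that their
  parts above \<open>T * D\<close> have integral of order \<open>1 / T\<close>.\<close>

lemma has_bochner_integral_almost_dominated:
  fixes f g :: "nat \<Rightarrow> 'm \<Rightarrow> real" and D :: "'m \<Rightarrow> real"
  assumes f: "\<And>k. has_bochner_integral M (f k) 0" and lim: "AE x in M. (\<lambda>k. f k x) \<longlonglongrightarrow> F x"
    and D: "integrable M D" "\<And>x. 0 \<le> D x" and g [measurable]: "\<And>k. g k \<in> borel_measurable M"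
    and g0: "\<And>k x. 0 \<le> g k x" and gC: "\<And>k. (\<integral>\<^sup>+x. ennreal (g k x) \<partial>M) \<le> ennreal C"
    and bound: "\<And>k. AE x in M. \<forall>T\<ge>1. \<bar>f k x\<bar> \<le> T * D x + g k x / T"
    and F [measurable]: "F \<in> borel_measurable M"
  shows "has_bochner_integral M F 0"
proof -
  have m [measurable]: "f k \<in> borel_measurable M" and fi: "integrable M (f k)" "integral\<^sup>L M (f k) = 0" for k
    using f by (auto simp: has_bochner_integral_iff)
  have [measurable]: "D \<in> borel_measurable M" using D by auto
  define C' where "C' = max C 0"
  have gint: "integrable M (g k)" and gle: "integral\<^sup>L M (g k) \<le> C'" for k
  proof -
    show "integrable M (g k)"
      using gC[of k] g0 by (intro integrableI_nonneg) (auto simp: le_less_trans)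
    then have "ennreal (integral\<^sup>L M (g k)) \<le> ennreal C"
      using gC[of k] g0 by (subst nn_integral_eq_integral[symmetric]) auto
    then show "integral\<^sup>L M (g k) \<le> C'" unfolding C'_def
      by (cases "0 \<le> C") (auto simp: ennreal_le_iff ennreal_neg)
  qed
  \<comment> \<open>The case T = 1 of \<open>bound\<close> together with Fatou's lemma.\<close>
  have Fint: "integrable M F"
  proof (rule integrableI_bounded)
    have "(\<integral>\<^sup>+x. ennreal (norm (F x)) \<partial>M) = (\<integral>\<^sup>+x. liminf (\<lambda>k. ennreal (norm (f k x))) \<partial>M)"
    proof (rule nn_integral_cong_AE)
      show "AE x in M. ennreal (norm (F x)) = liminf (\<lambda>k. ennreal (norm (f k x)))"
        using lim
      proof eventually_elim
        case (elim x)
        then have "(\<lambda>k. ennreal (norm (f k x))) \<longlonglongrightarrow> ennreal (norm (F x))"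
          by (intro tendsto_ennrealI tendsto_norm)
        then show ?case using lim_imp_Liminf[OF sequentially_bot] by metis
      qed
    qed
    also have "\<dots> \<le> liminf (\<lambda>k. \<integral>\<^sup>+x. ennreal (norm (f k x)) \<partial>M)"
      by (rule nn_integral_liminf) measurable
    also have "\<dots> \<le> (\<integral>\<^sup>+x. ennreal (D x) \<partial>M) + ennreal C"
    proof (rule liminf_le_bound)
      fix k
      have "(\<integral>\<^sup>+x. ennreal (norm (f k x)) \<partial>M) \<le> (\<integral>\<^sup>+x. ennreal (D x) + ennreal (g k x) \<partial>M)"
      proof (rule nn_integral_mono_AE)
        show "AE x in M. ennreal (norm (f k x)) \<le> ennreal (D x) + ennreal (g k x)"
          using bound[of k]
        proof eventually_elim
          case (elim x)
          then have "\<bar>f k x\<bar> \<le> 1 * D x + g k x / 1" by blast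
          then show ?case using D(2) g0 by (simp flip: ennreal_plus)
        qed
      qed
      also have "\<dots> \<le> (\<integral>\<^sup>+x. ennreal (D x) \<partial>M) + ennreal C"
        using gC[of k] by (subst nn_integral_add) (auto intro: add_left_mono)
      finally show "(\<integral>\<^sup>+x. ennreal (norm (f k x)) \<partial>M) \<le> (\<integral>\<^sup>+x. ennreal (D x) \<partial>M) + ennreal C" .
    qed
    also have "\<dots> < \<infinity>" using D by (simp add: integrable_iff_bounded)
    finally show "(\<integral>\<^sup>+x. ennreal (norm (F x)) \<partial>M) < \<infinity>" .
  qed measurable
  \<comment> \<open>Truncation at the level T D. The truncated integrals converge by domination, and
    \<open>bound\<close> says that truncating \<open>f k\<close> costs at most C' / T.\<close>
  define cl where "cl T u x = max (- (T * D x)) (min (T * D x) u)" for T u x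
  have cl_meas [measurable]: "(\<lambda>x. cl T (f k x) x) \<in> borel_measurable M" "(\<lambda>x. cl T (F x) x) \<in> borel_measurable M" for T k
    unfolding cl_def by measurable
  have cl_b: "\<bar>cl T u x\<bar> \<le> T * D x" if "0 \<le> T" for T u x
    using mult_nonneg_nonneg[OF that D(2)[of x]] by (auto simp: cl_def)
  have cl_d: "\<bar>cl T u x\<bar> \<le> \<bar>u\<bar>" if "0 \<le> T" for T u x
    using mult_nonneg_nonneg[OF that D(2)[of x]] by (auto simp: cl_def)
  have TD: "integrable M (\<lambda>x. T * D x)" for T using D by simp
  have small: "\<bar>\<integral>x. cl T (F x) x \<partial>M\<bar> \<le> C' / T" if T: "1 \<le> T" for T
  proof -
    have "(\<lambda>k. \<integral>x. cl T (f k x) x \<partial>M) \<longlonglongrightarrow> (\<integral>x. cl T (F x) x \<partial>M)"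
    proof (rule integral_dominated_convergence[OF cl_meas(2) cl_meas(1) TD])
      show "AE x in M. (\<lambda>k. cl T (f k x) x) \<longlonglongrightarrow> cl T (F x) x"
        using lim by eventually_elim (auto simp: cl_def intro!: tendsto_intros)
      show "AE x in M. norm (cl T (f k x) x) \<le> T * D x" for k using cl_b T by simp
    qed
    moreover have "\<bar>\<integral>x. cl T (f k x) x \<partial>M\<bar> \<le> C' / T" for k
    proof -
      have ci: "integrable M (\<lambda>x. cl T (f k x) x)"
        by (rule Bochner_Integration.integrable_bound[OF TD[of T]])
           (use order_trans[OF cl_b[of T] abs_ge_self] T in \<open>auto intro!: AE_I2\<close>)
      have "\<bar>\<integral>x. cl T (f k x) x \<partial>M\<bar> = \<bar>\<integral>x. cl T (f k x) x - f k x \<partial>M\<bar>"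
        using ci fi by simp
      also have "\<dots> \<le> (\<integral>x. \<bar>cl T (f k x) x - f k x\<bar> \<partial>M)" by (rule integral_abs_bound)
      also have "\<dots> \<le> (\<integral>x. g k x / T \<partial>M)"
      proof (rule integral_mono_AE)
        show "integrable M (\<lambda>x. \<bar>cl T (f k x) x - f k x\<bar>)" using ci fi by simp
        show "integrable M (\<lambda>x. g k x / T)" using gint by simp
        show "AE x in M. \<bar>cl T (f k x) x - f k x\<bar> \<le> g k x / T"
          using bound[of k]
        proof eventually_elim
          case (elim x)
          then have "\<bar>f k x\<bar> \<le> T * D x + g k x / T" using T by blast
          moreover have "0 \<le> T * D x" "0 \<le> g k x / T" using D(2) T g0 by auto
          ultimately show ?case unfolding cl_def by linarith
        qed
      qed
      also have "\<dots> \<le> C' / T" using gle T by (simp add: divide_right_mono)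
      finally show ?thesis .
    qed
    ultimately show ?thesis
      by (intro tendsto_upperbound[OF tendsto_rabs]) auto
  qed
  \<comment> \<open>Where D = 0 the truncation is 0 at every level; letting \<open>T\<close> grow in
    \<open>bound\<close> shows that there all \<open>f k\<close> vanish, hence also the
    limit.\<close>
  have D0: "AE x in M. D x = 0 \<longrightarrow> F x = 0"
  proof -
    have "AE x in M. \<forall>k. \<forall>T\<ge>1. \<bar>f k x\<bar> \<le> T * D x + g k x / T" using bound by (simp add: AE_all_countable)
    with lim show ?thesis
    proof eventually_elim
      case (elim x)
      show ?case
      proof
        assume Dx: "D x = 0"
        have "f k x = 0" for k
        proof -
          have "\<bar>f k x\<bar> \<le> g k x / real (Suc i)" for i using elim(2) Dx by (auto dest!: spec[of _ k] spec[of _ "real (Suc i)"])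
          moreover have "(\<lambda>i. g k x / real (Suc i)) \<longlonglongrightarrow> 0"
            using tendsto_mult_right_zero[OF LIMSEQ_Suc[OF lim_1_over_n], of "g k x"] by simp
          ultimately have "\<bar>f k x\<bar> \<le> 0" by (intro tendsto_lowerbound[of _ _ sequentially]) auto
          then show ?thesis by simp
        qed
        then show "F x = 0" using elim(1) by (simp add: LIMSEQ_const_iff)
      qed
    qed
  qed
  have "(\<lambda>i. \<integral>x. cl (real (Suc i)) (F x) x \<partial>M) \<longlonglongrightarrow> (\<integral>x. F x \<partial>M)"
  proof (rule integral_dominated_convergence[OF F cl_meas(2)])
    show "integrable M (\<lambda>x. \<bar>F x\<bar>)" using Fint by simp
    show "AE x in M. norm (cl (real (Suc i)) (F x) x) \<le> \<bar>F x\<bar>" for i using cl_d by simp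
    show "AE x in M. (\<lambda>i. cl (real (Suc i)) (F x) x) \<longlonglongrightarrow> F x"
      using D0
    proof eventually_elim
      case (elim x)
      show ?case
      proof (cases "D x = 0")
        case True
        then show ?thesis using elim by (simp add: cl_def)
      next
        case False
        then have Dx: "0 < D x" using D(2)[of x] by simp
        obtain i0 :: nat where i0: "\<bar>F x\<bar> / D x \<le> real i0" using real_arch_simple by blast
        have "\<forall>\<^sub>F i in sequentially. F x = cl (real (Suc i)) (F x) x"
          using eventually_ge_at_top[of i0]
        proof eventually_elim
          case (elim i)
          then have "\<bar>F x\<bar> / D x \<le> real (Suc i)" using i0 by linarith
          then have "\<bar>F x\<bar> \<le> real (Suc i) * D x" using Dx by (simp add: field_simps)
          then show ?case by (auto simp: cl_def)
        qed
        then show ?thesis by (rule Lim_transform_eventually[OF tendsto_const])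
      qed
    qed
  qed
  then have "(\<lambda>i. \<bar>\<integral>x. cl (real (Suc i)) (F x) x \<partial>M\<bar>) \<longlonglongrightarrow> \<bar>\<integral>x. F x \<partial>M\<bar>" by (rule tendsto_rabs)
  moreover have "(\<lambda>i. C' / real (Suc i)) \<longlonglongrightarrow> 0"
    using tendsto_mult_right_zero[OF LIMSEQ_Suc[OF lim_1_over_n], of C'] by simp
  ultimately have "\<bar>\<integral>x. F x \<partial>M\<bar> \<le> 0"
    by (rule LIMSEQ_le) (auto intro!: small)
  then show ?thesis using Fint by (simp add: has_bochner_integral_iff)
qed

lemma AE_lborel_pair:
  assumes "AE x in lborel. P (x::'a::euclidean_space)"
  shows "AE z in (lborel :: 'a measure) \<Otimes>\<^sub>M (lborel :: 'a measure). P (fst z) \<and> P (snd z)"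
proof -
  obtain A where A: "A \<in> null_sets lborel" "{x. \<not> P x} \<subseteq> A" using assms by (auto elim: AE_E3 simp: eventually_ae_filter)
  have "A \<times> UNIV \<in> null_sets (lborel \<Otimes>\<^sub>M (lborel :: 'a measure))" "UNIV \<times> A \<in> null_sets ((lborel :: 'a measure) \<Otimes>\<^sub>M lborel)"
    using A(1) lborel.emeasure_pair_measure_Times[of A "lborel :: 'a measure" UNIV]
      lborel.emeasure_pair_measure_Times[of UNIV "lborel :: 'a measure" A]
    by (auto simp: null_sets_def)
  then have "AE z in lborel \<Otimes>\<^sub>M lborel. z \<notin> A \<times> (UNIV :: 'a set)" "AE z in lborel \<Otimes>\<^sub>M lborel. z \<notin> (UNIV :: 'a set) \<times> A"
    by (auto intro: AE_not_in)
  then show ?thesis by eventually_elim (use A(2) in auto)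
qed

section \<open>The linearised equation\<close>

text \<open>Bounded Lipschitz functions with explicit constants. The test functions \<eta>^2
  \<open>W h\<close> below are of this kind, and the class is closed under products.\<close>

definition bl_fun :: "real \<Rightarrow> real \<Rightarrow> ('a::real_normed_vector \<Rightarrow> real) \<Rightarrow> bool" where
  "bl_fun B K f \<longleftrightarrow> (\<forall>x. \<bar>f x\<bar> \<le> B) \<and> K-lipschitz_on UNIV f"

lemma bl_funD:
  assumes "bl_fun B K f"
  shows "\<bar>f x\<bar> \<le> B" "\<bar>f x - f y\<bar> \<le> K * norm (x - y)" "0 \<le> B" "0 \<le> K" "continuous_on A f"
proof -
  show 1: "\<bar>f x\<bar> \<le> B" for x using assms by (simp add: bl_fun_def)
  show "\<bar>f x - f y\<bar> \<le> K * norm (x - y)" using assms lipschitz_UNIV_D by (auto simp: bl_fun_def)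
  show "0 \<le> B" using 1[of undefined] by linarith
  show "0 \<le> K" "continuous_on A f" using assms
    by (auto simp: bl_fun_def intro: lipschitz_on_nonneg continuous_on_subset[OF lipschitz_on_continuous_on])
qed

lemma bl_fun_mult:
  assumes f: "bl_fun B K f" and g: "bl_fun C M g"
  shows "bl_fun (B * C) (B * M + C * K) (\<lambda>x. f x * g x)"
  unfolding bl_fun_def
proof (intro conjI allI lipschitz_onI)
  fix x y
  show "\<bar>f x * g x\<bar> \<le> B * C"
    using bl_funD(1,3)[OF f] bl_funD(1)[OF g] by (auto simp: abs_mult intro!: mult_mono)
  have "f x * g x - f y * g y = f x * (g x - g y) + g y * (f x - f y)" by algebra
  then have "\<bar>f x * g x - f y * g y\<bar> \<le> \<bar>f x\<bar> * \<bar>g x - g y\<bar> + \<bar>g y\<bar> * \<bar>f x - f y\<bar>"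
    by (metis abs_mult abs_triangle_ineq)
  also have "\<dots> \<le> B * (M * norm (x - y)) + C * (K * norm (x - y))"
    using bl_funD[OF f] bl_funD[OF g] by (intro add_mono mult_mono) auto
  finally show "dist (f x * g x) (f y * g y) \<le> (B * M + C * K) * dist x y"
    by (simp add: dist_real_def dist_norm algebra_simps)
qed (use bl_funD(3,4)[OF f] bl_funD(3,4)[OF g] in auto)

lemma bl_fun_if_lipschitz:
  fixes f :: "'a::euclidean_space \<Rightarrow> real"
  assumes lip: "K-lipschitz_on UNIV f" and supp: "\<And>x. R < norm x \<Longrightarrow> f x = 0"
  obtains B where "bl_fun B K f"
proof -
  have "bounded (f ` cball 0 R)"
    by (intro compact_imp_bounded compact_continuous_image compact_cball
        continuous_on_subset[OF lipschitz_on_continuous_on[OF lip]]) auto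
  then obtain B where B: "0 < B" "\<And>x. norm x \<le> R \<Longrightarrow> \<bar>f x\<bar> \<le> B" unfolding bounded_pos by auto
  have "\<bar>f x\<bar> \<le> B" for x using B supp[of x] by (cases "norm x \<le> R") auto
  then show ?thesis using lip by (intro that[of B]) (simp add: bl_fun_def)
qed

lemma bl_fun_cutoff:
  assumes "0 \<le> R1" "R1 < R2"
  shows "bl_fun 1 (1 / (R2 - R1)) (\<lambda>x :: 'a::real_normed_vector. max 0 (min 1 ((R2 - norm x) / (R2 - R1))))"
  unfolding bl_fun_def
proof (intro conjI allI lipschitz_onI)
  fix x y :: 'a
  have c: "\<bar>max 0 (min 1 a) - max 0 (min 1 b)\<bar> \<le> \<bar>a - b\<bar>" for a b :: real by auto
  have "\<bar>max 0 (min 1 ((R2 - norm x) / (R2 - R1))) - max 0 (min 1 ((R2 - norm y) / (R2 - R1)))\<bar>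
     \<le> \<bar>(R2 - norm x) / (R2 - R1) - (R2 - norm y) / (R2 - R1)\<bar>" by (rule c)
  also have "\<dots> = \<bar>norm y - norm x\<bar> / (R2 - R1)"
    using assms by (simp add: diff_divide_distrib[symmetric] abs_divide)
  also have "\<dots> \<le> norm (x - y) / (R2 - R1)"
    using assms norm_triangle_ineq3[of y x] by (intro divide_right_mono) (auto simp: norm_minus_commute)
  finally show "dist (max 0 (min 1 ((R2 - norm x) / (R2 - R1)))) (max 0 (min 1 ((R2 - norm y) / (R2 - R1))))
      \<le> 1 / (R2 - R1) * dist x y" by (simp add: dist_norm dist_real_def)
qed (use assms in auto)

section \<open>The odd power and its secant slopes\<close>

lemma Jp_abs: "\<bar>Jp p t\<bar> = \<bar>t\<bar> powr (p - 1)"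
  using powr_mult_base[of "\<bar>t\<bar>" "p - 2"] by (simp add: Jp_def abs_mult mult.commute)

lemma Jp_pos: "0 \<le> t \<Longrightarrow> Jp p t = t powr (p - 2) * t"
  by (simp add: Jp_def)

lemma Jp_minus: "Jp p (- t) = - Jp p t"
  by (simp add: Jp_def)

text \<open>The factor of |b - a| depends on \<open>a\<close> alone. For equal signs it comes from
  t^(p - 2) decreasing and t^(p - 1) increasing. For a > 0 and b = - c with c >= 0, each of a^(p -
  1) and c^(p - 1) is at most a^(p - 2) (a + c), whence the factor 2.\<close>

lemma Jp_slope_bound:
  assumes p: "1 < p" "p < 2" and a: "a \<noteq> 0"
  shows "\<bar>Jp p b - Jp p a\<bar> \<le> 2 * \<bar>a\<bar> powr (p - 2) * \<bar>b - a\<bar>"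
proof -
  have pos: "\<bar>Jp p b - Jp p a\<bar> \<le> 2 * a powr (p - 2) * \<bar>b - a\<bar>" if a: "0 < a" for a b
  proof -
    have pa: "Jp p a = a powr (p - 2) * a" using a by (simp add: Jp_pos)
    consider "b \<ge> a" | "0 < b" "b < a" | "b \<le> 0" by linarith
    then show ?thesis
    proof cases
      case 1
      have "b powr (p - 2) \<le> a powr (p - 2)" using 1 a p by (intro powr_mono2') auto
      then have "b powr (p - 2) * b \<le> a powr (p - 2) * b" using 1 a by (intro mult_right_mono) auto
      moreover have "a powr (p - 1) \<le> b powr (p - 1)" using 1 a p by (intro powr_mono2) auto
      then have "a powr (p - 2) * a \<le> b powr (p - 2) * b" using a 1 by (simp add: powr_diff power2_eq_square)
      moreover have "0 \<le> a powr (p - 2) * (b - a)" using 1 by simp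
      moreover have "Jp p b = b powr (p - 2) * b" using 1 a by (simp add: Jp_pos)
      ultimately show ?thesis
        unfolding pa abs_of_nonneg[OF diff_ge_0_iff_ge[THEN iffD2, OF 1]] mult.assoc right_diff_distrib by linarith
    next
      case 2
      have "a powr (p - 2) \<le> b powr (p - 2)" using 2 a p by (intro powr_mono2') auto
      then have "a powr (p - 2) * b \<le> b powr (p - 2) * b" using 2 a by (intro mult_right_mono) auto
      moreover have "b powr (p - 1) \<le> a powr (p - 1)" using 2 a p by (intro powr_mono2) auto
      then have "b powr (p - 2) * b \<le> a powr (p - 2) * a" using a 2 by (simp add: powr_diff power2_eq_square)
      moreover have "0 \<le> a powr (p - 2) * (a - b)" using 2 by simp
      moreover have "Jp p b = b powr (p - 2) * b" using 2 by (simp add: Jp_pos)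
      moreover have "\<bar>b - a\<bar> = a - b" using 2 by simp
      ultimately show ?thesis unfolding pa mult.assoc by (simp only: right_diff_distrib)
    next
      case 3
      define c where "c = - b"
      have c: "0 \<le> c" using 3 by (simp add: c_def)
      have Jb: "Jp p b = - (c powr (p - 2) * c)" using Jp_minus[of p c] c by (simp add: c_def Jp_pos)
      have "c powr (p - 2) * c \<le> a powr (p - 2) * (a + c)"
      proof (cases "a \<le> c")
        case True
        have "c powr (p - 2) \<le> a powr (p - 2)" using True a p by (intro powr_mono2') auto
        then have "c powr (p - 2) * c \<le> a powr (p - 2) * c" using c by (intro mult_right_mono) auto
        then show ?thesis using a by (simp add: distrib_left add_increasing)
      next
        case False
        have "c powr (p - 1) \<le> a powr (p - 1)" using False c p by (intro powr_mono2) auto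
        then have "c powr (p - 2) * c \<le> a powr (p - 2) * a" using a c by (cases "c = 0") (simp_all add: powr_diff power2_eq_square)
        then show ?thesis using c by (simp add: distrib_left add_increasing2)
      qed
      moreover have "a powr (p - 2) * a \<le> a powr (p - 2) * (a + c)" using c by (intro mult_left_mono) auto
      moreover have ba: "\<bar>b - a\<bar> = a + c" using a 3 by (simp add: c_def)
      moreover have "Jp p b - Jp p a = - (c powr (p - 2) * c) - a powr (p - 2) * a" by (simp add: pa Jb)
      moreover have "0 \<le> c powr (p - 2) * c" "0 \<le> a powr (p - 2) * a" using a c by auto
      ultimately show ?thesis unfolding mult.assoc ba by linarith
    qed
  qed
  show ?thesis
  proof (cases "0 < a")
    case True
    then show ?thesis using pos[of a b] by simp
  next
    case False
    then show ?thesis using pos[of "- a" "- b"] a by (simp add: Jp_minus abs_minus_commute)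
  qed
qed

lemma Jp_mono:
  assumes p: "1 < p" and ab: "a \<le> b"
  shows "Jp p a \<le> Jp p b"
proof -
  have pos: "Jp p a \<le> Jp p b" if "0 \<le> a" "a \<le> b" for a b
  proof -
    have "a powr (p - 1) \<le> b powr (p - 1)" using that p by (intro powr_mono2) auto
    then have "\<bar>Jp p a\<bar> \<le> \<bar>Jp p b\<bar>" using that by (simp add: Jp_abs)
    moreover have "0 \<le> Jp p a" "0 \<le> Jp p b" using that by (auto simp: Jp_def)
    ultimately show ?thesis by simp
  qed
  consider "0 \<le> a" | "a < 0" "0 < b" | "b \<le> 0" by linarith
  then show ?thesis
  proof cases
    case 2
    have "Jp p a \<le> 0" "0 \<le> Jp p b" using 2 by (auto simp: Jp_def mult_nonneg_nonpos)
    then show ?thesis by simp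
  qed (use pos[of a b] pos[of "- b" "- a"] ab in \<open>auto simp: Jp_minus\<close>)
qed

lemma Jp_has_derivative:
  assumes "a \<noteq> 0"
  shows "(Jp p has_real_derivative (p - 1) * \<bar>a\<bar> powr (p - 2)) (at a)"
proof -
  have pos: "(Jp p has_real_derivative (p - 1) * a powr (p - 2)) (at a)" if "0 < a" for a
  proof -
    have "((\<lambda>t. t powr (p - 1)) has_real_derivative (p - 1) * a powr (p - 1 - 1)) (at a)"
      using that by (rule has_real_derivative_powr)
    then have "((\<lambda>t. t powr (p - 1)) has_real_derivative (p - 1) * a powr (p - 2)) (at a)" by simp
    then show ?thesis
      by (rule has_field_derivative_transform_within[where d = a])
         (use that in \<open>auto simp: dist_real_def Jp_pos powr_diff power2_eq_square\<close>)
  qed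
  show ?thesis
  proof (cases "0 < a")
    case False
    then have "((\<lambda>t. - Jp p (- t)) has_real_derivative - ((p - 1) * (- a) powr (p - 2) * - 1)) (at a)"
      using assms by (intro DERIV_minus DERIV_chain2[OF pos]) (auto intro!: derivative_eq_intros)
    then show ?thesis using False assms by (simp add: Jp_minus[of p])
  qed (use pos in simp)
qed

text \<open>For a = b the value is the derivative, so that the slope is continuous in
  \<open>b\<close> there if \<open>a\<close> is nonzero; for a = b = 0 it is 0 by the convention for
  \<open>powr\<close>.\<close>

definition slope :: "real \<Rightarrow> real \<Rightarrow> real \<Rightarrow> real" where
  "slope p a b = (if a = b then (p - 1) * \<bar>a\<bar> powr (p - 2) else (Jp p b - Jp p a) / (b - a))"

lemma slope_mult: "slope p a b * (b - a) = Jp p b - Jp p a"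
  by (simp add: slope_def)

lemma slope_nonneg: "1 < p \<Longrightarrow> 0 \<le> slope p a b"
  using Jp_mono[of p a b] Jp_mono[of p b a]
  by (cases a b rule: linorder_cases) (auto simp: slope_def zero_le_divide_iff)

lemma slope_bound:
  assumes p: "1 < p" "p < 2" and a: "a \<noteq> 0"
  shows "slope p a b \<le> 2 * \<bar>a\<bar> powr (p - 2)"
proof (cases "a = b")
  case False
  have "\<bar>slope p a b\<bar> = \<bar>Jp p b - Jp p a\<bar> / \<bar>b - a\<bar>" using False by (simp add: slope_def abs_divide)
  also have "\<dots> \<le> 2 * \<bar>a\<bar> powr (p - 2)"
    using Jp_slope_bound[OF p a, of b] False by (simp add: divide_le_eq)
  finally show ?thesis by simp
qed (use p in \<open>auto simp: slope_def intro!: mult_right_mono\<close>)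

text \<open>Caratheodory's form of differentiability: \<open>slope p a\<close> is the continuous
  factor.\<close>

lemma slope_tendsto:
  assumes a: "a \<noteq> 0" and b: "b \<longlonglongrightarrow> a"
  shows "(\<lambda>k. slope p a (b k)) \<longlonglongrightarrow> (p - 1) * \<bar>a\<bar> powr (p - 2)"
proof -
  obtain g where g: "\<And>z. Jp p z - Jp p a = g z * (z - a)" "isCont g a" "g a = (p - 1) * \<bar>a\<bar> powr (p - 2)"
    using Jp_has_derivative[OF a, of p] unfolding CARAT_DERIV by blast
  have "slope p a z = g z" for z
    using g(1)[of z] g(3) by (auto simp: slope_def field_simps)
  then show ?thesis using isCont_tendsto_compose[OF g(2) b] g(3) by simp
qed

lemma slope_meas [measurable (raw)]:
  assumes [measurable]: "f \<in> borel_measurable M" "g \<in> borel_measurable M"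
  shows "(\<lambda>x. slope p (f x) (g x)) \<in> borel_measurable M"
  unfolding slope_def Jp_def by measurable

context directed_solution
begin

text \<open>A majorant for the weak equation: |v|^(p - 1) comes from \<open>Jp\<close> of a
  Lipschitz increment and min(1, |v|) from a bounded Lipschitz test function. Near 0 the exponent is
  p - N > -n because sp < p; at infinity it is p - 1 - N < -n because sp > p - 1.\<close>

lemma lipschitz_test_dominated:
  assumes R: "0 < R"
  shows "integrable (lborel \<Otimes>\<^sub>M lborel) (\<lambda>z. norm (fst z - snd z :: 'a) powr (p - 1) * min 1 (norm (fst z - snd z))
     * norm (fst z - snd z) powr (- N) * of_bool (fst z \<in> cball 0 R \<or> snd z \<in> cball 0 R))"
proof (rule integrableI_bounded)
  define h where "h v = norm v powr (p - 1) * min 1 (norm v) * norm v powr (- N)" for v :: 'a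
  have h0: "0 \<le> h v" for v by (simp add: h_def)
  have hm: "h (- v) = h v" for v by (simp add: h_def)
  have [measurable]: "h \<in> borel_measurable borel" unfolding h_def by measurable
  have hb: "ennreal (h v) \<le> ennreal (norm (v - 0) powr (- (N - p))) * indicator (cball 0 1) v
      + ennreal (norm v powr (- (N - p + 1))) * indicator (- ball 0 1) v" for v
  proof (cases "v = 0")
    case False
    have 1: "norm v powr (p - 1) * norm v * norm v powr (- N) = norm v powr (- (N - p))"
      using False by (simp add: powr_diff powr_minus_divide)
    have 2: "norm v powr (p - 1) * norm v powr (- N) = norm v powr (- (N - p + 1))"
    proof -
      have "p - 1 + - N = - (N - p + 1)" by simp
      then show ?thesis by (simp only: powr_add[symmetric])
    qed
    show ?thesis
    proof (cases "norm v < 1")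
      case True
      then show ?thesis using 1 by (simp add: h_def)
    next
      case False
      then show ?thesis using 2 by (simp add: h_def add_increasing)
    qed
  qed (simp add: h_def)
  have "(\<integral>\<^sup>+v. ennreal (h v) \<partial>lborel) \<le> (\<integral>\<^sup>+v. ennreal (norm (v - 0) powr (- (N - p))) * indicator (cball 0 1) v
      + ennreal (norm v powr (- (N - p + 1))) * indicator (- ball (0::'a) 1) v \<partial>lborel)"
    by (intro nn_integral_mono hb)
  also have "\<dots> = (\<integral>\<^sup>+v\<in>cball (0::'a) 1. ennreal (norm (v - 0) powr (- (N - p))) \<partial>lborel)
      + (\<integral>\<^sup>+v\<in>- ball (0::'a) 1. ennreal (norm v powr (- (N - p + 1))) \<partial>lborel)"
    by (rule nn_integral_add) measurable
  also have "\<dots> < \<infinity>"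
  proof -
    have "(\<integral>\<^sup>+v\<in>cball (0::'a) 1. ennreal (norm (v - 0) powr (- (N - p))) \<partial>lborel) < \<infinity>"
      using sp_bounds dim(2) p
      by (intro le_less_trans[OF nn_integral_powr_cball]) auto
    moreover have "(\<integral>\<^sup>+v\<in>- ball (0::'a) 1. ennreal (norm v powr (- (N - p + 1))) \<partial>lborel) < \<infinity>"
      using N sp by (intro nn_integral_powr_outside_ball) auto
    ultimately show ?thesis by simp
  qed
  finally have hfin: "(\<integral>\<^sup>+v. ennreal (h v) \<partial>lborel) < \<infinity>" .
  have tr: "(\<integral>\<^sup>+y. ennreal (h (x - y)) \<partial>lborel) = (\<integral>\<^sup>+v. ennreal (h v) \<partial>lborel)" for x
    using nn_integral_translate[of "\<lambda>y. ennreal (h y)" "- x"] hm[of "x - _"] by simp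
  have fin: "(\<integral>\<^sup>+x. (\<integral>\<^sup>+y. ennreal (h (x - y)) * indicator (cball 0 R) x \<partial>lborel) \<partial>lborel) < \<infinity>"
    using hfin R by (simp add: nn_integral_multc tr nn_integral_cmult_indicator emeasure_cball ennreal_mult_less_top)
  have 1: "(\<integral>\<^sup>+z. ennreal (h (fst z - snd z)) * indicator (cball 0 R) (fst z) \<partial>(lborel \<Otimes>\<^sub>M lborel)) < \<infinity>"
    using fin by (subst lborel.nn_integral_fst[symmetric]) auto
  have 2: "(\<integral>\<^sup>+z. ennreal (h (fst z - snd z)) * indicator (cball 0 R) (snd z) \<partial>(lborel \<Otimes>\<^sub>M lborel)) < \<infinity>"
  proof -
    have "h (x - y) = h (y - x)" for x y using hm[of "x - y"] by simp
    then show ?thesis using fin by (subst lborel_pair.nn_integral_snd[symmetric]) auto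
  qed
  have "(\<integral>\<^sup>+z. ennreal (norm (norm (fst z - snd z :: 'a) powr (p - 1) * min 1 (norm (fst z - snd z))
     * norm (fst z - snd z) powr (- N) * of_bool (fst z \<in> cball 0 R \<or> snd z \<in> cball 0 R))) \<partial>(lborel \<Otimes>\<^sub>M lborel))
   \<le> (\<integral>\<^sup>+z. ennreal (h (fst z - snd z)) * indicator (cball 0 R) (fst z) + ennreal (h (fst z - snd z)) * indicator (cball 0 R) (snd z) \<partial>(lborel \<Otimes>\<^sub>M lborel))"
    by (intro nn_integral_mono) (auto simp: h_def[symmetric] h0 indicator_def)
  also have "\<dots> < \<infinity>" using 1 2 by (subst nn_integral_add) auto
  finally show "(\<integral>\<^sup>+z. ennreal (norm (norm (fst z - snd z :: 'a) powr (p - 1) * min 1 (norm (fst z - snd z))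
     * norm (fst z - snd z) powr (- N) * of_bool (fst z \<in> cball 0 R \<or> snd z \<in> cball 0 R))) \<partial>(lborel \<Otimes>\<^sub>M lborel)) < \<infinity>" .
qed measurable

section \<open>The weak equation for Lipschitz test functions and for difference quotients\<close>

lemma Jp_meas [measurable (raw)]:
  assumes [measurable]: "f \<in> borel_measurable M"
  shows "(\<lambda>x. Jp p (f x)) \<in> borel_measurable M"
  unfolding Jp_def by measurable

text \<open>Admits test functions that involve \<open>U\<close> itself, which are only Lipschitz.
  Mollifications are admissible and, being means of translates, share the bounds of \<phi>, so one
  majorant serves them all.\<close>

lemma weak_lipschitz:
  assumes bl: "bl_fun B K \<phi>" and supp: "\<And>x. R < norm x \<Longrightarrow> \<phi> x = 0"
  shows "has_bochner_integral (lborel \<Otimes>\<^sub>M lborel)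
    (\<lambda>z. Jp p (U (fst z) - U (snd z)) * (\<phi> (fst z) - \<phi> (snd z)) * norm (fst z - snd z) powr (- N)) 0"
proof -
  obtain m \<rho> where m: "\<And>i k. Ck k (m i)"
    "\<And>i x. R + 1 / real (Suc i) < norm x \<Longrightarrow> m i x = 0"
    "uniform_limit UNIV m \<phi> sequentially"
    "\<And>i. \<rho> i \<in> borel_measurable borel" "\<And>i v. 0 \<le> \<rho> i v" "\<And>i. has_bochner_integral lborel (\<rho> i) 1"
    "\<And>i x. has_bochner_integral lborel (\<lambda>v. \<rho> i v * \<phi> (x - v)) (m i x)"
    by (rule mollification[where z = \<phi> and R = R], rule bl_funD(5)[OF bl], erule supp, rule that)
  have m_bound: "\<bar>m i x - m i y\<bar> \<le> c" if c: "\<And>v. \<bar>\<phi> (x - v) - \<phi> (y - v)\<bar> \<le> c" for i x y c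
  proof -
    have h: "has_bochner_integral lborel (\<lambda>v. \<rho> i v * \<phi> (x - v) - \<rho> i v * \<phi> (y - v)) (m i x - m i y)"
      by (intro has_bochner_integral_diff m)
    have "\<bar>m i x - m i y\<bar> = \<bar>\<integral>v. \<rho> i v * \<phi> (x - v) - \<rho> i v * \<phi> (y - v) \<partial>lborel\<bar>"
      using h by (simp add: has_bochner_integral_iff)
    also have "\<dots> \<le> (\<integral>v. \<bar>\<rho> i v * \<phi> (x - v) - \<rho> i v * \<phi> (y - v)\<bar> \<partial>lborel)" by (rule integral_abs_bound)
    also have "\<dots> \<le> (\<integral>v. \<rho> i v * c \<partial>lborel)"
    proof (rule integral_mono)
      show "integrable lborel (\<lambda>v. \<bar>\<rho> i v * \<phi> (x - v) - \<rho> i v * \<phi> (y - v)\<bar>)" using h by (auto simp: has_bochner_integral_iff)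
      show "integrable lborel (\<lambda>v. \<rho> i v * c)" using m(6)[of i] by (auto simp: has_bochner_integral_iff)
      show "\<bar>\<rho> i v * \<phi> (x - v) - \<rho> i v * \<phi> (y - v)\<bar> \<le> \<rho> i v * c" for v
        using mult_left_mono[OF c[of v] m(5)[of i v]] m(5)[of i v] by (simp add: abs_mult flip: right_diff_distrib)
    qed
    also have "\<dots> = c" using m(6)[of i] by (simp add: has_bochner_integral_iff)
    finally show ?thesis .
  qed
  have mK: "\<bar>m i x - m i y\<bar> \<le> (K + 2 * B) * min 1 (norm (x - y))" for i x y
  proof -
    have "\<bar>m i x - m i y\<bar> \<le> K * norm (x - y)"
    proof (rule m_bound)
      show "\<bar>\<phi> (x - v) - \<phi> (y - v)\<bar> \<le> K * norm (x - y)" for v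
        using bl_funD(2)[OF bl, of "x - v" "y - v"] by simp
    qed
    moreover have "\<bar>m i x - m i y\<bar> \<le> 2 * B"
    proof (rule m_bound)
      show "\<bar>\<phi> (x - v) - \<phi> (y - v)\<bar> \<le> 2 * B" for v
        using bl_funD(1)[OF bl, of "x - v"] bl_funD(1)[OF bl, of "y - v"] by linarith
    qed
    moreover have "0 \<le> K" "0 \<le> 2 * B * norm (x - y)" using bl_funD(3,4)[OF bl] by auto
    moreover have "min 1 (norm (x - y)) = 1 \<or> min 1 (norm (x - y)) = norm (x - y)" by linarith
    ultimately show ?thesis by (elim disjE; simp only: distrib_right mult_1_right; linarith)
  qed
  have [measurable]: "\<phi> \<in> borel_measurable borel" using bl_funD(5)[OF bl] by (rule borel_measurable_continuous_onI)
  \<comment> \<open>One ball for all supports: mollification enlarges them by at most 1.\<close>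
  define R' where "R' = max R 0 + 1"
  have R': "0 < R'" by (simp add: R'_def)
  define g where "g z = L powr (p - 1) * (K + 2 * B) * (norm (fst z - snd z :: 'a) powr (p - 1) * min 1 (norm (fst z - snd z))
     * norm (fst z - snd z) powr (- N) * of_bool (fst z \<in> cball 0 R' \<or> snd z \<in> cball 0 R'))" for z
  show ?thesis
  proof (rule has_bochner_integral_dominated)
    show "has_bochner_integral (lborel \<Otimes>\<^sub>M lborel)
      (\<lambda>z. Jp p (U (fst z) - U (snd z)) * (m k (fst z) - m k (snd z)) * norm (fst z - snd z) powr (- N)) 0" for k
    proof -
      have "m k \<in> test_functions UNIV" by (rule test_functionsI[OF m(1,2)]) auto
      from weak[OF this] show ?thesis
        unfolding powr_minus_divide split_beta by (simp only: times_divide_eq_right mult_1_right)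
    qed
    show "AE z in lborel \<Otimes>\<^sub>M lborel. (\<lambda>k. Jp p (U (fst z) - U (snd z)) * (m k (fst z) - m k (snd z)) * norm (fst z - snd z) powr (- N))
       \<longlonglongrightarrow> Jp p (U (fst z) - U (snd z)) * (\<phi> (fst z) - \<phi> (snd z)) * norm (fst z - snd z) powr (- N)"
      by (intro AE_I2 tendsto_intros tendsto_uniform_limitI[OF m(3)]) auto
    show "integrable (lborel \<Otimes>\<^sub>M lborel) g"
      unfolding g_def by (intro integrable_mult_right lipschitz_test_dominated R')
    show "AE z in lborel \<Otimes>\<^sub>M lborel. norm (Jp p (U (fst z) - U (snd z)) * (m k (fst z) - m k (snd z)) * norm (fst z - snd z) powr (- N)) \<le> g z" for k
    proof (rule AE_I2)
      fix z :: "'a \<times> 'a"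
      let ?x = "fst z" and ?y = "snd z"
      show "norm (Jp p (U ?x - U ?y) * (m k ?x - m k ?y) * norm (?x - ?y) powr (- N)) \<le> g z"
      proof (cases "?x \<in> cball 0 R' \<or> ?y \<in> cball 0 R'")
        case True
        have "\<bar>U ?x - U ?y\<bar> powr (p - 1) \<le> (L * norm (?x - ?y)) powr (p - 1)"
          using lipschitz_UNIV_D[OF lip] p by (intro powr_mono2) auto
        also have "\<dots> = L powr (p - 1) * norm (?x - ?y) powr (p - 1)" using L by (simp add: powr_mult)
        finally have "\<bar>Jp p (U ?x - U ?y)\<bar> * \<bar>m k ?x - m k ?y\<bar> * norm (?x - ?y) powr (- N)
           \<le> L powr (p - 1) * norm (?x - ?y) powr (p - 1) * ((K + 2 * B) * min 1 (norm (?x - ?y))) * norm (?x - ?y) powr (- N)"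
          using mK bl_funD(3,4)[OF bl] by (intro mult_mono mult_nonneg_nonneg) (auto simp: Jp_abs)
        then show ?thesis using True by (simp add: g_def abs_mult mult_ac)
      next
        case False
        have "R + 1 / real (Suc k) \<le> R'" unfolding R'_def by (intro add_mono) auto
        then have "m k ?x = 0" "m k ?y = 0" using False by (auto intro!: m(2))
        then show ?thesis using False by (simp add: g_def)
      qed
    qed
  qed measurable
qed

definition W :: "real \<Rightarrow> 'a \<Rightarrow> real" where "W h x = (U (x + h *\<^sub>R e) - U x) / h"

definition Kh :: "real \<Rightarrow> 'a \<Rightarrow> 'a \<Rightarrow> real" where
  "Kh h x y = slope p (U x - U y) (U (x + h *\<^sub>R e) - U (y + h *\<^sub>R e)) * norm (x - y) powr (- N)"

lemma W_meas [measurable (raw)]: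
  assumes [measurable]: "f \<in> borel_measurable M"
  shows "(\<lambda>x. W h (f x)) \<in> borel_measurable M"
  unfolding W_def by measurable

lemma Kh_meas [measurable (raw)]:
  assumes [measurable]: "f \<in> borel_measurable M" "g \<in> borel_measurable M"
  shows "(\<lambda>x. Kh h (f x) (g x)) \<in> borel_measurable M"
  unfolding Kh_def by measurable

lemma Kh_nonneg: "0 \<le> Kh h x y"
  using p by (auto simp: Kh_def intro!: mult_nonneg_nonneg slope_nonneg)

lemma Kh_le:
  assumes "U x \<noteq> U y"
  shows "Kh h x y \<le> 2 / (p - 1) * J x y"
proof -
  have "Kh h x y \<le> 2 * \<bar>U x - U y\<bar> powr (p - 2) * norm (x - y) powr (- N)"
    unfolding Kh_def using assms by (intro mult_right_mono slope_bound p) auto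
  also have "\<dots> = 2 / (p - 1) * J x y" using p by (simp add: J_eq)
  finally show ?thesis .
qed

text \<open>Only the bound \<open>L\<close> is uniform in \<open>h\<close>. The Lipschitz constant 2
  L / h merely admits \<open>W h\<close> into test functions for fixed \<open>h\<close>.\<close>

lemma W_bl:
  assumes h: "0 < h"
  shows "bl_fun L (2 * L / h) (W h)"
  unfolding bl_fun_def
proof (intro conjI allI lipschitz_onI)
  fix x y
  show "\<bar>W h x\<bar> \<le> L"
    using lipschitz_UNIV_D[OF lip, of "x + h *\<^sub>R e" x] h e by (simp add: W_def abs_divide divide_le_eq)
  have "\<bar>(U (x + h *\<^sub>R e) - U x) - (U (y + h *\<^sub>R e) - U y)\<bar> \<le> 2 * L * norm (x - y)"
    using lipschitz_UNIV_D[OF lip, of "x + h *\<^sub>R e" "y + h *\<^sub>R e"] lipschitz_UNIV_D[OF lip, of x y] by simp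
  then show "dist (W h x) (W h y) \<le> 2 * L / h * dist x y"
    using h by (simp add: W_def dist_real_def dist_norm abs_divide divide_right_mono flip: diff_divide_distrib)
qed (use L h in auto)

text \<open>Testing with \<phi> shifted by h e and translating both variables back gives the
  equation of the shifted \<open>U\<close> with \<phi> itself. Subtract the equation of
  \<open>U\<close> and divide by \<open>h\<close>: the difference of the values of \<open>Jp\<close>
  is the secant slope times \<open>h\<close> times the increment of \<open>W h\<close>.\<close>

lemma Kh_weak:
  assumes h: "0 < h" and bl: "bl_fun B K \<phi>" and supp: "\<And>x. R < norm x \<Longrightarrow> \<phi> x = 0"
  shows "has_bochner_integral (lborel \<Otimes>\<^sub>M lborel)
    (\<lambda>z. Kh h (fst z) (snd z) * (W h (fst z) - W h (snd z)) * (\<phi> (fst z) - \<phi> (snd z))) 0"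
proof -
  define \<psi> where "\<psi> x = \<phi> (x - h *\<^sub>R e)" for x
  have "has_bochner_integral (lborel \<Otimes>\<^sub>M lborel)
    (\<lambda>z. Jp p (U (fst z) - U (snd z)) * (\<psi> (fst z) - \<psi> (snd z)) * norm (fst z - snd z) powr (- N)) 0"
  proof (rule weak_lipschitz)
    show "bl_fun B K \<psi>"
      using bl_funD[OF bl] unfolding \<psi>_def bl_fun_def
      by (auto intro!: lipschitz_onI simp: dist_real_def dist_norm) (metis add_diff_cancel_right' diff_add_cancel diff_diff_eq2)
    show "\<psi> x = 0" if "R + h < norm x" for x
    proof -
      have "norm x \<le> norm (x - h *\<^sub>R e) + norm (h *\<^sub>R e)" using norm_triangle_ineq[of "x - h *\<^sub>R e" "h *\<^sub>R e"] by simp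
      then show ?thesis using that e h unfolding \<psi>_def by (intro supp) simp
    qed
  qed
  then have "has_bochner_integral lborel
    (\<lambda>z. Jp p (U (fst z) - U (snd z)) * (\<psi> (fst z) - \<psi> (snd z)) * norm (fst z - snd z) powr (- N)) 0"
    by (simp add: lborel_prod)
  from has_bochner_integral_translate[OF this, of "(h *\<^sub>R e, h *\<^sub>R e)"]
  have 1: "has_bochner_integral (lborel \<Otimes>\<^sub>M lborel)
    (\<lambda>z. Jp p (U (fst z + h *\<^sub>R e) - U (snd z + h *\<^sub>R e)) * (\<phi> (fst z) - \<phi> (snd z)) * norm (fst z - snd z) powr (- N)) 0"
    by (simp add: lborel_prod \<psi>_def)
  have 2: "has_bochner_integral (lborel \<Otimes>\<^sub>M lborel)
    (\<lambda>z. Jp p (U (fst z) - U (snd z)) * (\<phi> (fst z) - \<phi> (snd z)) * norm (fst z - snd z) powr (- N)) 0"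
    by (rule weak_lipschitz[OF bl supp])
  have "has_bochner_integral (lborel \<Otimes>\<^sub>M lborel)
    (\<lambda>z. (1 / h) * (Jp p (U (fst z + h *\<^sub>R e) - U (snd z + h *\<^sub>R e)) * (\<phi> (fst z) - \<phi> (snd z)) * norm (fst z - snd z) powr (- N)
       - Jp p (U (fst z) - U (snd z)) * (\<phi> (fst z) - \<phi> (snd z)) * norm (fst z - snd z) powr (- N))) ((1 / h) * (0 - 0))"
    by (intro has_bochner_integral_mult_right has_bochner_integral_diff 1 2)
  moreover have "(1 / h) * (Jp p (U (x + h *\<^sub>R e) - U (y + h *\<^sub>R e)) * (\<phi> x - \<phi> y) * norm (x - y) powr (- N)
       - Jp p (U x - U y) * (\<phi> x - \<phi> y) * norm (x - y) powr (- N))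
     = Kh h x y * (W h x - W h y) * (\<phi> x - \<phi> y)" for x y
  proof -
    have "Kh h x y * (W h x - W h y) = slope p (U x - U y) (U (x + h *\<^sub>R e) - U (y + h *\<^sub>R e))
        * ((U (x + h *\<^sub>R e) - U (y + h *\<^sub>R e)) - (U x - U y)) * norm (x - y) powr (- N) / h"
    proof -
      have "W h x - W h y = ((U (x + h *\<^sub>R e) - U (y + h *\<^sub>R e)) - (U x - U y)) / h"
        by (simp add: W_def diff_divide_distrib)
      then show ?thesis by (simp add: Kh_def mult_ac)
    qed
    also have "\<dots> = (Jp p (U (x + h *\<^sub>R e) - U (y + h *\<^sub>R e)) - Jp p (U x - U y)) * norm (x - y) powr (- N) / h"
      by (simp only: slope_mult)
    finally have X: "Kh h x y * (W h x - W h y)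
        = (Jp p (U (x + h *\<^sub>R e) - U (y + h *\<^sub>R e)) - Jp p (U x - U y)) * norm (x - y) powr (- N) / h" .
    have "(1 / h) * (a * d * c - b * d * c) = (a - b) * c / h * d" for a b c d :: real
      by (simp add: right_diff_distrib left_diff_distrib diff_divide_distrib mult_ac)
    then show ?thesis unfolding X .
  qed
  ultimately show ?thesis by simp
qed

lemma square_diff_le_mm:
  assumes bl: "bl_fun B K \<phi>" and supp: "\<And>x. r0 < norm x \<Longrightarrow> \<phi> x = 0"
  shows "(\<phi> x - \<phi> y)\<^sup>2 \<le> (4 * B\<^sup>2 + K\<^sup>2) * mm x y * of_bool (x \<in> cball 0 r0 \<or> y \<in> cball 0 r0)"
proof (cases "x \<in> cball 0 r0 \<or> y \<in> cball 0 r0")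
  case True
  have 1: "(\<phi> x - \<phi> y)\<^sup>2 \<le> 4 * B\<^sup>2"
  proof -
    have "\<bar>\<phi> x - \<phi> y\<bar> \<le> 2 * B" using bl_funD(1)[OF bl, of x] bl_funD(1)[OF bl, of y] by linarith
    from power_mono[OF this abs_ge_zero, of 2] show ?thesis by (simp add: power_mult_distrib)
  qed
  have 2: "(\<phi> x - \<phi> y)\<^sup>2 \<le> K\<^sup>2 * (norm (x - y))\<^sup>2"
    using bl_funD(2)[OF bl, of x y] bl_funD(4)[OF bl]
    by (simp add: power_mult_distrib[symmetric] abs_le_square_iff[symmetric])
  have "(\<phi> x - \<phi> y)\<^sup>2 \<le> (4 * B\<^sup>2 + K\<^sup>2) * mm x y"
  proof (cases "(norm (x - y))\<^sup>2 \<le> 1")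
    case True
    then show ?thesis using 2 by (simp add: mm_def distrib_right add_increasing)
  next
    case False
    then show ?thesis using 1 by (simp add: mm_def add_increasing2)
  qed
  then show ?thesis using True by simp
qed (use supp in auto)

text \<open>Testing with \<open>\<eta>\<^sup>2 W\<close> and the identity
  \<open>(a - b) (\<eta>\<^sub>1\<^sup>2 a - \<eta>\<^sub>2\<^sup>2 b) = (\<eta>\<^sub>1 a - \<eta>\<^sub>2 b)\<^sup>2 - a b (\<eta>\<^sub>1 - \<eta>\<^sub>2)\<^sup>2\<close> bounds the energy of \<open>\<eta> W\<close>.\<close>

lemma Kh_caccioppoli:
  assumes bl: "bl_fun B K \<eta>" and supp: "\<And>x. r0 < norm x \<Longrightarrow> \<eta> x = 0"
  obtains C where "\<And>h. 0 < h \<Longrightarrow>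
    (\<integral>\<^sup>+z. ennreal (Kh h (fst z) (snd z) * (\<eta> (fst z) * W h (fst z) - \<eta> (snd z) * W h (snd z))\<^sup>2) \<partial>(lborel \<Otimes>\<^sub>M lborel))
      \<le> ennreal C"
proof -
  define d where "d = 4 * B\<^sup>2 + K\<^sup>2"
  define c where "c = L * L * (2 / (p - 1)) * d"
  have c: "0 \<le> c" using L p by (simp add: c_def d_def)
  have [measurable]: "\<eta> \<in> borel_measurable borel" using bl_funD(5)[OF bl] by (rule borel_measurable_continuous_onI)
  show ?thesis
  proof (rule that)
    fix h :: real assume h: "0 < h"
    \<comment> \<open>The correction term of the identity. Only the sup bound of \<open>W h\<close>
      enters it, so it is dominated uniformly in \<open>h\<close>; its integral equals the energy
      because the tested equation contributes 0.\<close>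
    define P where "P z = Kh h (fst z) (snd z) * (W h (fst z) * W h (snd z)) * (\<eta> (fst z) - \<eta> (snd z))\<^sup>2" for z
    have [measurable]: "P \<in> borel_measurable (lborel \<Otimes>\<^sub>M lborel)" unfolding P_def by measurable
    have Pb: "AE z in lborel \<Otimes>\<^sub>M lborel. norm (P z) \<le> c * dom (fst z) (snd z)"
      using AE_level
    proof eventually_elim
      case (elim z)
      let ?x = "fst z" and ?y = "snd z"
      show ?case
      proof (cases "?x \<in> cball 0 r0 \<or> ?y \<in> cball 0 r0")
        case True
        then have "Kh h ?x ?y \<le> 2 / (p - 1) * J ?x ?y" using elim Kh_le by blast
        moreover have "\<bar>W h ?x * W h ?y\<bar> \<le> L * L"
          using bl_funD(1)[OF W_bl[OF h]] L by (auto simp: abs_mult intro!: mult_mono)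
        moreover have "(\<eta> ?x - \<eta> ?y)\<^sup>2 \<le> d * mm ?x ?y"
          using square_diff_le_mm[OF bl supp, of ?x ?y, folded d_def] by (simp only: True of_bool_eq(2) mult_1_right)
        ultimately have "Kh h ?x ?y * \<bar>W h ?x * W h ?y\<bar> * (\<eta> ?x - \<eta> ?y)\<^sup>2
           \<le> 2 / (p - 1) * J ?x ?y * (L * L) * (d * mm ?x ?y)"
          using p L by (intro mult_mono) (auto simp: J_nonneg Kh_nonneg)
        then show ?thesis using True by (simp add: P_def abs_mult Kh_nonneg dom_def c_def mult_ac)
      next
        case False
        then show ?thesis using supp by (simp add: P_def dom_def)
      qed
    qed
    have ci: "integrable (lborel \<Otimes>\<^sub>M lborel) (\<lambda>z. c * dom (fst z) (snd z))"
      by (intro integrable_mult_right integrable_dom)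
    have Pint: "integrable (lborel \<Otimes>\<^sub>M lborel) P"
      by (rule Bochner_Integration.integrable_bound[OF ci]) (use Pb dom_nonneg c in \<open>auto elim!: eventually_mono\<close>)
    have "has_bochner_integral (lborel \<Otimes>\<^sub>M lborel)
      (\<lambda>z. Kh h (fst z) (snd z) * (W h (fst z) - W h (snd z)) * (\<eta> (fst z) * \<eta> (fst z) * W h (fst z) - \<eta> (snd z) * \<eta> (snd z) * W h (snd z))) 0"
      by (rule Kh_weak[OF h bl_fun_mult[OF bl_fun_mult[OF bl bl] W_bl[OF h]], of r0]) (use supp in simp)
    moreover have "has_bochner_integral (lborel \<Otimes>\<^sub>M lborel) P (integral\<^sup>L (lborel \<Otimes>\<^sub>M lborel) P)"
      using Pint by (simp add: has_bochner_integral_iff)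
    ultimately have "has_bochner_integral (lborel \<Otimes>\<^sub>M lborel) (\<lambda>z. Kh h (fst z) (snd z) * (W h (fst z) - W h (snd z)) *
        (\<eta> (fst z) * \<eta> (fst z) * W h (fst z) - \<eta> (snd z) * \<eta> (snd z) * W h (snd z)) + P z) (0 + integral\<^sup>L (lborel \<Otimes>\<^sub>M lborel) P)"
      by (rule has_bochner_integral_add)
    moreover have "(\<lambda>z. Kh h (fst z) (snd z) * (W h (fst z) - W h (snd z)) *
        (\<eta> (fst z) * \<eta> (fst z) * W h (fst z) - \<eta> (snd z) * \<eta> (snd z) * W h (snd z)) + P z)
      = (\<lambda>z. Kh h (fst z) (snd z) * (\<eta> (fst z) * W h (fst z) - \<eta> (snd z) * W h (snd z))\<^sup>2)"
      by (rule ext) (simp add: P_def power2_eq_square algebra_simps)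
    ultimately have E: "has_bochner_integral (lborel \<Otimes>\<^sub>M lborel)
       (\<lambda>z. Kh h (fst z) (snd z) * (\<eta> (fst z) * W h (fst z) - \<eta> (snd z) * W h (snd z))\<^sup>2) (integral\<^sup>L (lborel \<Otimes>\<^sub>M lborel) P)"
      by simp
    have "integral\<^sup>L (lborel \<Otimes>\<^sub>M lborel) P \<le> (\<integral>z. c * dom (fst z) (snd z) \<partial>(lborel \<Otimes>\<^sub>M lborel))"
      by (rule integral_mono_AE[OF Pint ci]) (use Pb in \<open>auto elim!: eventually_mono\<close>)
    then show "(\<integral>\<^sup>+z. ennreal (Kh h (fst z) (snd z) * (\<eta> (fst z) * W h (fst z) - \<eta> (snd z) * W h (snd z))\<^sup>2) \<partial>(lborel \<Otimes>\<^sub>M lborel))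
      \<le> ennreal (\<integral>z. c * dom (fst z) (snd z) \<partial>(lborel \<Otimes>\<^sub>M lborel))"
      using E by (subst nn_integral_eq_integral) (auto simp: has_bochner_integral_iff Kh_nonneg intro!: ennreal_leI)
  qed
qed

section \<open>Passage to the limit in the difference quotients\<close>

definition hseq :: "nat \<Rightarrow> real" where "hseq k = 1 / real (Suc k)"

lemma hseq: "0 < hseq k" "hseq \<longlonglongrightarrow> 0"
  using LIMSEQ_Suc[OF lim_1_over_n] by (auto simp: hseq_def[abs_def])

lemma W_tendsto:
  assumes "((\<lambda>t. U (x + t *\<^sub>R e)) has_real_derivative w x) (at 0)"
  shows "(\<lambda>k. W (hseq k) x) \<longlonglongrightarrow> w x"
proof -
  have "(\<lambda>t. (U (x + t *\<^sub>R e) - U x) / t) \<midarrow>0\<rightarrow> w x"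
    using assms by (simp add: DERIV_def)
  then show ?thesis
    unfolding W_def
    by (rule tendsto_compose_eventually[unfolded o_def, OF _ hseq(2)]) (simp add: hseq(1) less_imp_neq[symmetric])
qed

lemma Kh_tendsto:
  assumes "U x \<noteq> U y"
  shows "(\<lambda>k. Kh (hseq k) x y) \<longlonglongrightarrow> J x y"
proof -
  have "(\<lambda>k. U (x + hseq k *\<^sub>R e)) \<longlonglongrightarrow> U x" for x
  proof -
    have "(\<lambda>k. x + hseq k *\<^sub>R e) \<longlonglongrightarrow> x + 0 *\<^sub>R e" by (intro tendsto_intros hseq)
    then have "(\<lambda>k. x + hseq k *\<^sub>R e) \<longlonglongrightarrow> x" by simp
    then show ?thesis using contU[of UNIV] continuous_on_tendsto_compose by fastforce
  qed
  then have "(\<lambda>k. U (x + hseq k *\<^sub>R e) - U (y + hseq k *\<^sub>R e)) \<longlonglongrightarrow> U x - U y" by (intro tendsto_diff)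
  then have "(\<lambda>k. slope p (U x - U y) (U (x + hseq k *\<^sub>R e) - U (y + hseq k *\<^sub>R e)) * norm (x - y) powr (- N))
     \<longlonglongrightarrow> (p - 1) * \<bar>U x - U y\<bar> powr (p - 2) * norm (x - y) powr (- N)"
    using assms by (intro tendsto_mult slope_tendsto tendsto_const) auto
  then show ?thesis by (simp add: Kh_def J_eq mult.assoc)
qed

lemma AE_limits: "AE z in lborel \<Otimes>\<^sub>M lborel.
   (\<lambda>k. W (hseq k) (fst z)) \<longlonglongrightarrow> w (fst z) \<and> (\<lambda>k. W (hseq k) (snd z)) \<longlonglongrightarrow> w (snd z) \<and>
   (fst z \<in> cball 0 r0 \<or> snd z \<in> cball 0 r0 \<longrightarrow> (\<lambda>k. Kh (hseq k) (fst z) (snd z)) \<longlonglongrightarrow> J (fst z) (snd z))"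
  using AE_lborel_pair[OF w_AE] AE_level
  by eventually_elim (auto simp del: mem_cball intro!: W_tendsto Kh_tendsto)

text \<open>Fatou along \<open>hseq\<close>. Pairs with both points off the closed ball contribute
  0, so convergence of the kernels is called for only where coincidences \<open>U x = U y\<close>
  are negligible.\<close>

lemma energy_finite:
  assumes bl: "bl_fun B K \<eta>" and supp: "\<And>x. r0 < norm x \<Longrightarrow> \<eta> x = 0"
  shows "(\<integral>\<^sup>+z. ennreal (J (fst z) (snd z) * (\<eta> (fst z) * w (fst z) - \<eta> (snd z) * w (snd z))\<^sup>2) \<partial>(lborel \<Otimes>\<^sub>M lborel)) < \<infinity>"
proof -
  obtain C where C: "\<And>h. 0 < h \<Longrightarrow>
    (\<integral>\<^sup>+z. ennreal (Kh h (fst z) (snd z) * (\<eta> (fst z) * W h (fst z) - \<eta> (snd z) * W h (snd z))\<^sup>2) \<partial>(lborel \<Otimes>\<^sub>M lborel))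
      \<le> ennreal C" by (rule Kh_caccioppoli[where \<eta> = \<eta> and B = B and K = K], rule bl, erule supp, rule that)
  have [measurable]: "\<eta> \<in> borel_measurable borel" using bl_funD(5)[OF bl] by (rule borel_measurable_continuous_onI)
  define E where "E k z = ennreal (Kh (hseq k) (fst z) (snd z) * (\<eta> (fst z) * W (hseq k) (fst z) - \<eta> (snd z) * W (hseq k) (snd z))\<^sup>2)" for k z
  have [measurable]: "E k \<in> borel_measurable (lborel \<Otimes>\<^sub>M lborel)" for k unfolding E_def by measurable
  have "AE z in lborel \<Otimes>\<^sub>M lborel. ennreal (J (fst z) (snd z) * (\<eta> (fst z) * w (fst z) - \<eta> (snd z) * w (snd z))\<^sup>2) = liminf (\<lambda>k. E k z)"
    using AE_limits
  proof eventually_elim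
    case (elim z)
    have "(\<lambda>k. E k z) \<longlonglongrightarrow> ennreal (J (fst z) (snd z) * (\<eta> (fst z) * w (fst z) - \<eta> (snd z) * w (snd z))\<^sup>2)"
    proof (cases "fst z \<in> cball 0 r0 \<or> snd z \<in> cball 0 r0")
      case True
      then show ?thesis unfolding E_def using elim by (intro tendsto_ennrealI tendsto_intros) auto
    next
      case False
      then show ?thesis using supp by (simp add: E_def)
    qed
    then show ?case using lim_imp_Liminf[OF sequentially_bot] by metis
  qed
  then have "(\<integral>\<^sup>+z. ennreal (J (fst z) (snd z) * (\<eta> (fst z) * w (fst z) - \<eta> (snd z) * w (snd z))\<^sup>2) \<partial>(lborel \<Otimes>\<^sub>M lborel))
      = (\<integral>\<^sup>+z. liminf (\<lambda>k. E k z) \<partial>(lborel \<Otimes>\<^sub>M lborel))"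
    by (rule nn_integral_cong_AE)
  also have "\<dots> \<le> liminf (\<lambda>k. \<integral>\<^sup>+z. E k z \<partial>(lborel \<Otimes>\<^sub>M lborel))" by (rule nn_integral_liminf) measurable
  also have "\<dots> \<le> ennreal C" unfolding E_def by (intro liminf_le_bound C hseq)
  also have "\<dots> < \<infinity>" by simp
  finally show ?thesis .
qed

text \<open>Near the diagonal \<open>J\<close> dominates a multiple of |x - y|^(-n-\<tau>) with
  \<tau> > 1, so sup bounds for \<open>W h\<close> give no integrable majorant. Young's inequality
  trades the product of increments for \<open>T\<close> times the energy of \<phi>, which
  \<open>dom\<close> controls, plus 1 / T times the energy of \<eta> \<open>W h\<close>, which is
  bounded in \<open>h\<close>. This is the form that
  \<open>has_bochner_integral_almost_dominated\<close> accepts.\<close>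

lemma linearised_identity:
  assumes bl: "bl_fun B K \<phi>" and supp: "\<And>x. R1 < norm x \<Longrightarrow> \<phi> x = 0" and R1: "0 \<le> R1" "R1 < r0"
  shows "has_bochner_integral (lborel \<Otimes>\<^sub>M lborel)
    (\<lambda>z. J (fst z) (snd z) * (w (fst z) - w (snd z)) * (\<phi> (fst z) - \<phi> (snd z))) 0"
proof -
  \<comment> \<open>Three cases result: both points within \<open>R2\<close>, where \<eta> is 1; one
    within \<open>R1\<close> and the other beyond \<open>R2\<close>, hence at distance at least R2 -
    R1; both beyond \<open>R1\<close>, where the increment of \<phi> vanishes.\<close>
  define R2 where "R2 = (R1 + r0) / 2"
  have R2: "R1 < R2" "R2 < r0" "0 \<le> R2" using R1 by (auto simp: R2_def)
  define \<eta> where "\<eta> x = max 0 (min 1 ((r0 - norm x) / (r0 - R2)))" for x :: 'a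
  have \<eta>: "bl_fun 1 (1 / (r0 - R2)) \<eta>" unfolding \<eta>_def using R2 by (intro bl_fun_cutoff) auto
  have \<eta>0: "\<eta> x = 0" if "r0 < norm x" for x using that R2 by (simp add: \<eta>_def divide_nonpos_pos)
  have \<eta>1: "\<eta> x = 1" if "norm x \<le> R2" for x using that R2 by (simp add: \<eta>_def)
  have supp0: "\<phi> x = 0" if "r0 < norm x" for x using that R1 supp by simp
  obtain C where C: "\<And>h. 0 < h \<Longrightarrow>
    (\<integral>\<^sup>+z. ennreal (Kh h (fst z) (snd z) * (\<eta> (fst z) * W h (fst z) - \<eta> (snd z) * W h (snd z))\<^sup>2) \<partial>(lborel \<Otimes>\<^sub>M lborel))
      \<le> ennreal C" by (rule Kh_caccioppoli[where \<eta> = \<eta>], rule \<eta>, erule \<eta>0, rule that)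
  have [measurable]: "\<eta> \<in> borel_measurable borel" "\<phi> \<in> borel_measurable borel"
    using bl_funD(5)[OF \<eta>] bl_funD(5)[OF bl] by (auto intro: borel_measurable_continuous_onI)
  define \<mu> where "\<mu> = min 1 ((R2 - R1)\<^sup>2)"
  have \<mu>: "0 < \<mu>" using R2 by (simp add: \<mu>_def)
  \<comment> \<open>The first two summands serve the near case through
    \<open>square_diff_le_mm\<close>; the last one serves the far case, where \<open>mm\<close> is
    at least \<mu>.\<close>
  define c where "c = 2 / (p - 1) * (4 * B\<^sup>2 + K\<^sup>2 + 4 * L * B / \<mu>)"
  have c: "0 \<le> c" using L p \<mu> bl_funD(3)[OF bl] by (simp add: c_def)
  let ?F = "\<lambda>k z. Kh (hseq k) (fst z) (snd z) * (W (hseq k) (fst z) - W (hseq k) (snd z)) * (\<phi> (fst z) - \<phi> (snd z))"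
  let ?G = "\<lambda>k z. Kh (hseq k) (fst z) (snd z) * (\<eta> (fst z) * W (hseq k) (fst z) - \<eta> (snd z) * W (hseq k) (snd z))\<^sup>2"
  show ?thesis
  proof (rule has_bochner_integral_almost_dominated[where f = ?F and g = ?G and D = "\<lambda>z. c * dom (fst z) (snd z)"])
    show "has_bochner_integral (lborel \<Otimes>\<^sub>M lborel) (?F k) 0" for k
      by (rule Kh_weak[OF hseq(1) bl supp])
    show "AE z in lborel \<Otimes>\<^sub>M lborel. (\<lambda>k. ?F k z) \<longlonglongrightarrow> J (fst z) (snd z) * (w (fst z) - w (snd z)) * (\<phi> (fst z) - \<phi> (snd z))"
      using AE_limits
    proof eventually_elim
      case (elim z)
      show ?case
      proof (cases "fst z \<in> cball 0 r0 \<or> snd z \<in> cball 0 r0")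
        case True
        then show ?thesis using elim by (intro tendsto_intros) auto
      next
        case False
        then show ?thesis using supp0 by simp
      qed
    qed
    show "integrable (lborel \<Otimes>\<^sub>M lborel) (\<lambda>z. c * dom (fst z) (snd z))"
      by (intro integrable_mult_right integrable_dom)
    show "0 \<le> c * dom (fst z) (snd z)" for z using c dom_nonneg by simp
    show "0 \<le> ?G k z" for k z by (simp add: Kh_nonneg)
    show "(\<integral>\<^sup>+z. ennreal (?G k z) \<partial>(lborel \<Otimes>\<^sub>M lborel)) \<le> ennreal C" for k by (rule C[OF hseq(1)])
    show "AE z in lborel \<Otimes>\<^sub>M lborel. \<forall>T\<ge>1. \<bar>?F k z\<bar> \<le> T * (c * dom (fst z) (snd z)) + ?G k z / T" for k
      using AE_level
    proof eventually_elim
      case (elim z)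
      obtain x y where z: "z = (x, y)" by (cases z)
      let ?K = "Kh (hseq k) x y" and ?W = "W (hseq k)"
      have cd: "0 \<le> c * dom x y" using c dom_nonneg by simp
      have near: "\<bar>?F k z\<bar> \<le> T * (c * dom x y) + ?G k z / T"
        if T: "1 \<le> T" and x: "norm x \<le> R2" and y: "norm y \<le> R2" for T
      proof -
        have xy: "x \<in> cball 0 r0" "y \<in> cball 0 r0" using x y R2 by auto
        have "\<bar>a * b\<bar> \<le> T * b\<^sup>2 + a\<^sup>2 / T" for a b :: real
        proof -
          have "0 \<le> (\<bar>a\<bar> / T - \<bar>b\<bar>)\<^sup>2 * T" using T by simp
          also have "\<dots> = a\<^sup>2 / T - 2 * \<bar>a * b\<bar> + T * b\<^sup>2"
            using T by (simp add: power2_eq_square field_simps abs_mult)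
          finally show ?thesis by simp
        qed
        then have "?K * \<bar>(?W x - ?W y) * (\<phi> x - \<phi> y)\<bar> \<le> ?K * (T * (\<phi> x - \<phi> y)\<^sup>2 + (?W x - ?W y)\<^sup>2 / T)"
          by (intro mult_left_mono Kh_nonneg)
        moreover have "\<bar>?F k z\<bar> = ?K * \<bar>(?W x - ?W y) * (\<phi> x - \<phi> y)\<bar>"
          by (simp add: z abs_mult Kh_nonneg mult.assoc)
        moreover have "?G k z = ?K * (?W x - ?W y)\<^sup>2"
          using \<eta>1[OF x] \<eta>1[OF y] by (simp add: z)
        moreover have "?K * (T * b + a / T) = T * (?K * b) + ?K * a / T" for a b
          by (simp add: algebra_simps)
        ultimately have 1: "\<bar>?F k z\<bar> \<le> T * (?K * (\<phi> x - \<phi> y)\<^sup>2) + ?G k z / T"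
          by (simp only:)
        have "?K * (\<phi> x - \<phi> y)\<^sup>2 \<le> (2 / (p - 1) * J x y) * ((4 * B\<^sup>2 + K\<^sup>2) * mm x y)"
          using Kh_le[of x y] elim xy square_diff_le_mm[OF bl supp0, of x y] p
          by (intro mult_mono) (auto simp: z J_nonneg)
        also have "\<dots> = 2 / (p - 1) * (4 * B\<^sup>2 + K\<^sup>2) * dom x y" using xy by (simp add: dom_def)
        also have "\<dots> \<le> c * dom x y"
          unfolding c_def using p L \<mu> bl_funD(3)[OF bl] by (intro mult_right_mono mult_left_mono dom_nonneg) auto
        finally have "T * (?K * (\<phi> x - \<phi> y)\<^sup>2) \<le> T * (c * dom x y)" using T by (intro mult_left_mono) auto
        then show ?thesis using 1 by linarith
      qed
      have far: "\<bar>?F k z\<bar> \<le> c * dom x y" if xy: "norm x \<le> R1 \<and> R2 < norm y \<or> norm y \<le> R1 \<and> R2 < norm x"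
      proof -
        have in0: "x \<in> cball 0 r0 \<or> y \<in> cball 0 r0" using xy R1 by auto
        have "R2 - R1 \<le> norm (x - y)"
          using xy norm_triangle_ineq3[of x y] by linarith
        then have "(R2 - R1)\<^sup>2 \<le> (norm (x - y))\<^sup>2" using R2 by (intro power_mono) auto
        then have "\<mu> \<le> mm x y" by (auto simp: \<mu>_def mm_def)
        then have "1 \<le> mm x y / \<mu>" using \<mu> by simp
        then have "2 * B * 1 \<le> 2 * B * (mm x y / \<mu>)" using bl_funD(3)[OF bl] by (intro mult_left_mono) auto
        moreover have "\<bar>\<phi> x - \<phi> y\<bar> \<le> 2 * B" using bl_funD(1)[OF bl, of x] bl_funD(1)[OF bl, of y] by linarith
        ultimately have p1: "\<bar>\<phi> x - \<phi> y\<bar> \<le> 2 * B * (mm x y / \<mu>)" by linarith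
        have "\<bar>?W x - ?W y\<bar> \<le> 2 * L"
          using bl_funD(1)[OF W_bl[OF hseq(1)], of k x] bl_funD(1)[OF W_bl[OF hseq(1)], of k y] by linarith
        then have "?K * \<bar>?W x - ?W y\<bar> * \<bar>\<phi> x - \<phi> y\<bar> \<le> (2 / (p - 1) * J x y) * (2 * L) * (2 * B * (mm x y / \<mu>))"
          using Kh_le[of x y] elim in0 p p1 L by (intro mult_mono) (auto simp: z J_nonneg Kh_nonneg)
        also have "\<dots> = 2 / (p - 1) * (4 * L * B / \<mu>) * dom x y" using in0 by (simp add: dom_def)
        also have "\<dots> \<le> c * dom x y"
          unfolding c_def using p by (intro mult_right_mono mult_left_mono dom_nonneg) auto
        finally show ?thesis by (simp add: z abs_mult Kh_nonneg)
      qed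
      show ?case
      proof (intro allI impI)
        fix T :: real assume T: "1 \<le> T"
        have cT: "c * dom x y \<le> T * (c * dom x y)" using T cd mult_right_mono[of 1 T "c * dom x y"] by simp
        have G0: "0 \<le> ?G k z / T" using T by (simp add: Kh_nonneg)
        consider "norm x \<le> R2 \<and> norm y \<le> R2" | "norm x \<le> R1 \<and> R2 < norm y \<or> norm y \<le> R1 \<and> R2 < norm x"
          | "R1 < norm x \<and> R1 < norm y" by linarith
        then have "\<bar>?F k z\<bar> \<le> T * (c * dom x y) + ?G k z / T"
        proof cases
          case 1
          then show ?thesis using near[OF T] by blast
        next
          case 2
          from far[OF this] cT G0 show ?thesis by linarith
        next
          case 3
          then have "?F k z = 0" using supp by (simp add: z)
          then show ?thesis using cT cd G0 by linarith
        qed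
        then show "\<bar>?F k z\<bar> \<le> T * (c * dom (fst z) (snd z)) + ?G k z / T" by (simp add: z)
      qed
    qed
  qed measurable
qed

end

section \<open>The directional derivative in the energy space\<close>

text \<open>A Hilbert space argument: pointwise convergence and norms not above that of the limit
  imply strong convergence. Fatou for f k + g makes the lower limit of \<open>A\<close> at least 4
  I, while the parallelogram identity bounds A + B by 4 I.\<close>

lemma nn_integral_square_diff_tendsto_0:
  fixes f :: "nat \<Rightarrow> 'm \<Rightarrow> real"
  assumes [measurable]: "\<And>k. f k \<in> borel_measurable M" "g \<in> borel_measurable M"
    and lim: "AE x in M. (\<lambda>k. f k x) \<longlonglongrightarrow> g x"
    and le: "\<And>k. (\<integral>\<^sup>+x. ennreal ((f k x)\<^sup>2) \<partial>M) \<le> (\<integral>\<^sup>+x. ennreal ((g x)\<^sup>2) \<partial>M)"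
    and fin: "(\<integral>\<^sup>+x. ennreal ((g x)\<^sup>2) \<partial>M) < \<infinity>" and \<epsilon>: "0 < \<epsilon>"
  shows "\<forall>\<^sub>F k in sequentially. (\<integral>\<^sup>+x. ennreal ((g x - f k x)\<^sup>2) \<partial>M) \<le> ennreal \<epsilon>"
proof -
  obtain I where I: "(\<integral>\<^sup>+x. ennreal ((g x)\<^sup>2) \<partial>M) = ennreal I" "0 \<le> I"
    using fin by (cases "\<integral>\<^sup>+x. ennreal ((g x)\<^sup>2) \<partial>M") auto
  define A where "A k = (\<integral>\<^sup>+x. ennreal ((f k x + g x)\<^sup>2) \<partial>M)" for k
  define B where "B k = (\<integral>\<^sup>+x. ennreal ((g x - f k x)\<^sup>2) \<partial>M)" for k
  have AB: "A k + B k \<le> ennreal (4 * I)" for k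
  proof -
    have "A k + B k = (\<integral>\<^sup>+x. ennreal ((f k x + g x)\<^sup>2) + ennreal ((g x - f k x)\<^sup>2) \<partial>M)"
      unfolding A_def B_def by (rule nn_integral_add[symmetric]) measurable
    also have "\<dots> = (\<integral>\<^sup>+x. 2 * ennreal ((f k x)\<^sup>2) + 2 * ennreal ((g x)\<^sup>2) \<partial>M)"
    proof (rule nn_integral_cong)
      fix x
      have "ennreal ((f k x + g x)\<^sup>2) + ennreal ((g x - f k x)\<^sup>2) = ennreal ((f k x + g x)\<^sup>2 + (g x - f k x)\<^sup>2)"
        by (simp add: ennreal_plus)
      also have "(f k x + g x)\<^sup>2 + (g x - f k x)\<^sup>2 = 2 * (f k x)\<^sup>2 + 2 * (g x)\<^sup>2"
        by (simp add: power2_eq_square algebra_simps)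
      also have "ennreal \<dots> = 2 * ennreal ((f k x)\<^sup>2) + 2 * ennreal ((g x)\<^sup>2)"
        by (simp add: ennreal_plus ennreal_mult)
      finally show "ennreal ((f k x + g x)\<^sup>2) + ennreal ((g x - f k x)\<^sup>2) = 2 * ennreal ((f k x)\<^sup>2) + 2 * ennreal ((g x)\<^sup>2)" .
    qed
    also have "\<dots> = 2 * (\<integral>\<^sup>+x. ennreal ((f k x)\<^sup>2) \<partial>M) + 2 * (\<integral>\<^sup>+x. ennreal ((g x)\<^sup>2) \<partial>M)"
      by (subst nn_integral_add) (auto simp: nn_integral_cmult)
    also have "\<dots> \<le> 2 * ennreal I + 2 * ennreal I"
      using le[of k] by (intro add_mono mult_left_mono) (auto simp: I)
    also have "\<dots> = ennreal (4 * I)"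
    proof -
      have "2 * ennreal I = ennreal (2 * I)" using I by (simp add: ennreal_mult)
      then show ?thesis using I by (simp flip: ennreal_plus)
    qed
    finally show ?thesis .
  qed
  have "ennreal (4 * I) = (\<integral>\<^sup>+x. ennreal 4 * ennreal ((g x)\<^sup>2) \<partial>M)"
    using I by (subst nn_integral_cmult) (auto simp: ennreal_mult)
  also have "\<dots> = (\<integral>\<^sup>+x. ennreal ((g x + g x)\<^sup>2) \<partial>M)"
    by (intro nn_integral_cong, subst ennreal_mult[symmetric]) (auto simp: power2_eq_square)
  also have "\<dots> = (\<integral>\<^sup>+x. liminf (\<lambda>k. ennreal ((f k x + g x)\<^sup>2)) \<partial>M)"
  proof (rule nn_integral_cong_AE)
    show "AE x in M. ennreal ((g x + g x)\<^sup>2) = liminf (\<lambda>k. ennreal ((f k x + g x)\<^sup>2))"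
      using lim
    proof eventually_elim
      case (elim x)
      then have "(\<lambda>k. ennreal ((f k x + g x)\<^sup>2)) \<longlonglongrightarrow> ennreal ((g x + g x)\<^sup>2)"
        by (intro tendsto_ennrealI tendsto_intros)
      then show ?case using lim_imp_Liminf[OF sequentially_bot] by metis
    qed
  qed
  also have "\<dots> \<le> liminf A" unfolding A_def by (rule nn_integral_liminf) measurable
  finally have I4: "ennreal (4 * I) \<le> liminf A" .
  show ?thesis
  proof (cases "4 * I < \<epsilon>")
    case True
    have "B k \<le> ennreal \<epsilon>" for k
    proof -
      have "B k \<le> A k + B k" by simp
      also have "\<dots> \<le> ennreal \<epsilon>" using AB[of k] True by (meson ennreal_leI less_imp_le order_trans)
      finally show ?thesis .
    qed
    then show ?thesis by (simp add: B_def)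
  next
    case False
    then have "ennreal (4 * I - \<epsilon>) < liminf A"
      using \<epsilon> I4 by (intro less_le_trans[OF _ I4]) (auto simp: ennreal_less_iff)
    then have "\<forall>\<^sub>F k in sequentially. ennreal (4 * I - \<epsilon>) < A k" by (rule less_LiminfD)
    then have "\<forall>\<^sub>F k in sequentially. B k \<le> ennreal \<epsilon>"
    proof eventually_elim
      case (elim k)
      have "A k + B k < top" by (rule le_less_trans[OF AB]) simp
      then obtain a b where ab: "A k = ennreal a" "0 \<le> a" "B k = ennreal b" "0 \<le> b"
        by (cases "A k"; cases "B k") auto
      have "4 * I - \<epsilon> < a" using elim ab False by (simp add: ennreal_less_iff)
      moreover have "a + b \<le> 4 * I" using AB[of k] ab I by (simp flip: ennreal_plus)
      ultimately show ?case using ab \<epsilon> by (simp add: ennreal_leI)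
    qed
    then show ?thesis by (simp add: B_def)
  qed
qed

text \<open>Jensen's inequality as nonnegativity of the variance of \<open>g\<close> under the
  density \<rho>. If \<rho> g^2 is not integrable, the right side is infinite.\<close>

lemma square_mean_le:
  fixes g \<rho> :: "'m \<Rightarrow> real"
  assumes \<rho>: "has_bochner_integral M \<rho> 1" "\<And>v. 0 \<le> \<rho> v" and g: "has_bochner_integral M (\<lambda>v. \<rho> v * g v) m"
    and [measurable]: "g \<in> borel_measurable M"
  shows "ennreal (m\<^sup>2) \<le> (\<integral>\<^sup>+v. ennreal (\<rho> v * (g v)\<^sup>2) \<partial>M)"
proof (cases "integrable M (\<lambda>v. \<rho> v * (g v)\<^sup>2)")
  case True
  have "has_bochner_integral M (\<lambda>v. \<rho> v * (g v)\<^sup>2 - 2 * m * (\<rho> v * g v) + m\<^sup>2 * \<rho> v) ((\<integral>v. \<rho> v * (g v)\<^sup>2 \<partial>M) - 2 * m * m + m\<^sup>2 * 1)"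
    using True by (intro has_bochner_integral_add has_bochner_integral_diff has_bochner_integral_mult_right g \<rho>(1))
      (simp add: has_bochner_integral_iff)
  moreover have "(\<lambda>v. \<rho> v * (g v)\<^sup>2 - 2 * m * (\<rho> v * g v) + m\<^sup>2 * \<rho> v) = (\<lambda>v. \<rho> v * (g v - m)\<^sup>2)"
    by (rule ext) (simp add: power2_eq_square algebra_simps)
  ultimately have "has_bochner_integral M (\<lambda>v. \<rho> v * (g v - m)\<^sup>2) ((\<integral>v. \<rho> v * (g v)\<^sup>2 \<partial>M) - m\<^sup>2)"
    by (simp add: power2_eq_square)
  then have "(\<integral>v. \<rho> v * (g v - m)\<^sup>2 \<partial>M) = (\<integral>v. \<rho> v * (g v)\<^sup>2 \<partial>M) - m\<^sup>2"
    by (simp add: has_bochner_integral_iff)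
  moreover have "0 \<le> (\<integral>v. \<rho> v * (g v - m)\<^sup>2 \<partial>M)"
    by (rule integral_nonneg_AE) (simp add: \<rho>(2))
  ultimately have "0 \<le> (\<integral>v. \<rho> v * (g v)\<^sup>2 \<partial>M) - m\<^sup>2" by simp
  then show ?thesis
    using True \<rho>(2) by (subst nn_integral_eq_integral) (auto intro!: ennreal_leI)
next
  case False
  have [measurable]: "\<rho> \<in> borel_measurable M" using \<rho>(1) by (auto simp: has_bochner_integral_iff)
  have "(\<integral>\<^sup>+v. ennreal (\<rho> v * (g v)\<^sup>2) \<partial>M) = \<infinity>"
  proof (rule ccontr)
    assume "(\<integral>\<^sup>+v. ennreal (\<rho> v * (g v)\<^sup>2) \<partial>M) \<noteq> \<infinity>"
    then have "integrable M (\<lambda>v. \<rho> v * (g v)\<^sup>2)"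
      using \<rho>(2) by (intro integrableI_nonneg) (auto simp: less_top)
    then show False using False by simp
  qed
  then show ?thesis by simp
qed

lemma compact_subset_ball_radius:
  fixes S :: "'a::real_normed_vector set"
  assumes "compact S" "S \<subseteq> ball 0 r" "0 < r"
  obtains R where "0 \<le> R" "R < r" "S \<subseteq> cball 0 R"
proof (cases "S = {}")
  case True
  then show ?thesis using that[of 0] assms by simp
next
  case False
  obtain x where x: "x \<in> S" "\<And>y. y \<in> S \<Longrightarrow> norm y \<le> norm x"
    using continuous_attains_sup[OF assms(1) False, of norm] by (auto intro: continuous_intros)
  show ?thesis by (rule that[of "norm x"]) (use x assms in auto)
qed

lemma test_function_support:
  fixes \<phi> :: "'a::euclidean_space \<Rightarrow> real"
  assumes \<phi>: "\<phi> \<in> test_functions (ball 0 r)" and r: "0 < r"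
  obtains R B K where "0 \<le> R" "R < r" "\<And>x. R < norm x \<Longrightarrow> \<phi> x = 0" "bl_fun B K \<phi>"
proof -
  obtain R where R: "0 \<le> R" "R < r" "closure {x. \<phi> x \<noteq> 0} \<subseteq> cball 0 R"
    using compact_subset_ball_radius[of "closure {x. \<phi> x \<noteq> 0}" r] \<phi> r by (auto simp: test_functions_def)
  have 0: "\<phi> x = 0" if "R < norm x" for x
    using R(3) closure_subset[of "{x. \<phi> x \<noteq> 0}"] that by force
  obtain K where K: "K-lipschitz_on UNIV \<phi>" using test_function_lipschitz[OF \<phi>] .
  obtain B where "bl_fun B K \<phi>" by (rule bl_fun_if_lipschitz[OF K, of R], erule 0, rule that)
  with R 0 show ?thesis using that by blast
qed

context directed_solution
begin

text \<open>The Gagliardo energy of order \<open>\<tau> / 2\<close>. It is comparable to the energy of \<open>J\<close>, but translation invariant.\<close>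

definition reg :: "('a \<Rightarrow> real) \<Rightarrow> ennreal" where
  "reg f = (\<integral>\<^sup>+z. ennreal ((f (fst z) - f (snd z))\<^sup>2 * norm (fst z - snd z) powr (- (N - p + 2))) \<partial>(lborel \<Otimes>\<^sub>M lborel))"

section \<open>Comparison of the energy of \<open>J\<close> with the Gagliardo energy\<close>

lemma L_pos: "0 < L"
proof -
  have "lam * r0 \<le> U (0 + r0 *\<^sub>R e) - U 0" using r0 e by (intro mono) auto
  also have "\<dots> \<le> L * r0" using lipschitz_UNIV_D[OF lip, of "0 + r0 *\<^sub>R e" 0] e r0 by simp
  finally have "lam \<le> L" using r0 by simp
  then show ?thesis using lam by simp
qed

text \<open>The exponent p - 2 is negative, so the Lipschitz upper bound for the increment of
  \<open>U\<close> becomes a lower bound for \<open>J\<close>.\<close>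

lemma J_lower:
  assumes "U x \<noteq> U y"
  shows "norm (x - y) powr (- (N - p + 2)) \<le> 1 / ((p - 1) * L powr (p - 2)) * J x y"
proof -
  have xy: "x \<noteq> y" using assms by auto
  have "(L * norm (x - y)) powr (p - 2) \<le> \<bar>U x - U y\<bar> powr (p - 2)"
    using assms p lipschitz_UNIV_D[OF lip] by (intro powr_mono2') auto
  then have "L powr (p - 2) * norm (x - y) powr (p - 2) * norm (x - y) powr (- N) \<le> \<bar>U x - U y\<bar> powr (p - 2) * norm (x - y) powr (- N)"
    using L_pos by (intro mult_right_mono) (simp_all add: powr_mult)
  moreover have "norm (x - y) powr (p - 2) * norm (x - y) powr (- N) = norm (x - y) powr (- (N - p + 2))"
  proof -
    have "p - 2 + - N = - (N - p + 2)" by simp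
    then show ?thesis by (simp only: powr_add[symmetric])
  qed
  ultimately have "L powr (p - 2) * norm (x - y) powr (- (N - p + 2)) \<le> \<bar>U x - U y\<bar> powr (p - 2) * norm (x - y) powr (- N)"
    by (simp only: mult.assoc)
  then have "norm (x - y) powr (- (N - p + 2)) \<le> \<bar>U x - U y\<bar> powr (p - 2) * norm (x - y) powr (- N) / L powr (p - 2)"
    using L_pos by (simp only: pos_le_divide_eq powr_gt_zero mult.commute)
  then show ?thesis using p by (simp add: J_eq)
qed

lemma reg_finite:
  assumes bl: "bl_fun B K \<eta>" and supp: "\<And>x. r0 < norm x \<Longrightarrow> \<eta> x = 0"
  shows "reg (\<lambda>x. \<eta> x * w x) < \<infinity>"
proof -
  let ?z = "\<lambda>x. \<eta> x * w x"
  let ?c = "1 / ((p - 1) * L powr (p - 2))"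
  have [measurable]: "\<eta> \<in> borel_measurable borel" using bl_funD(5)[OF bl] by (rule borel_measurable_continuous_onI)
  have "reg ?z \<le> (\<integral>\<^sup>+z. ennreal ?c * ennreal (J (fst z) (snd z) * (?z (fst z) - ?z (snd z))\<^sup>2) \<partial>(lborel \<Otimes>\<^sub>M lborel))"
    unfolding reg_def
  proof (rule nn_integral_mono_AE)
    show "AE z in lborel \<Otimes>\<^sub>M lborel. ennreal ((?z (fst z) - ?z (snd z))\<^sup>2 * norm (fst z - snd z) powr (- (N - p + 2)))
      \<le> ennreal ?c * ennreal (J (fst z) (snd z) * (?z (fst z) - ?z (snd z))\<^sup>2)"
      using AE_level
    proof eventually_elim
      case (elim z)
      show ?case
      proof (cases "fst z \<in> cball 0 r0 \<or> snd z \<in> cball 0 r0")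
        case True
        then have "norm (fst z - snd z) powr (- (N - p + 2)) \<le> ?c * J (fst z) (snd z)"
          using elim by (intro J_lower) blast
        then have "(?z (fst z) - ?z (snd z))\<^sup>2 * norm (fst z - snd z) powr (- (N - p + 2)) \<le> (?z (fst z) - ?z (snd z))\<^sup>2 * (?c * J (fst z) (snd z))"
          by (rule mult_left_mono) simp
        then show ?thesis using p by (subst ennreal_mult[symmetric]) (auto simp: J_nonneg mult_ac intro!: ennreal_leI)
      next
        case False
        then show ?thesis using supp by simp
      qed
    qed
  qed
  also have "\<dots> = ennreal ?c * (\<integral>\<^sup>+z. ennreal (J (fst z) (snd z) * (?z (fst z) - ?z (snd z))\<^sup>2) \<partial>(lborel \<Otimes>\<^sub>M lborel))"
    by (rule nn_integral_cmult) measurable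
  also have "\<dots> < \<infinity>" using energy_finite[OF bl supp] by (simp add: ennreal_mult_less_top)
  finally show ?thesis .
qed

text \<open>A pointwise comparison of the kernels fails, since |U x - U y| may be far smaller than
  |x - y|. The increment of \<open>f\<close> is therefore replaced by increments to points
  \<open>m\<close> near the midpoint and averaged over \<open>m\<close>: for fixed \<open>x\<close>
  and \<open>m\<close> the singular factor is integrated over \<open>y\<close> by the slab bound,
  and a pure power of |x - m| remains.\<close>

lemma J_energy_le_reg:
  obtains C where "0 \<le> C" "\<And>f. f \<in> borel_measurable borel \<Longrightarrow>
    (\<integral>\<^sup>+z\<in>ball 0 r0 \<times> ball 0 r0. ennreal (J (fst z) (snd z) * (f (fst z) - f (snd z))\<^sup>2) \<partial>(lborel \<Otimes>\<^sub>M lborel))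
      \<le> ennreal C * reg f"
proof -
  \<comment> \<open>A ball of radius |x - y| / 4 has volume |x - y|^n / c.\<close>
  define c where "c = 4 powr n / unit_ball_vol n"
  have V: "0 < unit_ball_vol n" using dim by simp
  have c: "0 < c" using V by (simp add: c_def)
  define p1 where "p1 = p - 1"
  have p1: "0 < p1" using p by (simp add: p1_def)
  define C where "C = 2 * c * p1 * slab_const * 4 powr (n + p - 2)"
  have C: "0 \<le> C" using c p1 slab_const_nonneg by (simp add: C_def)
  show ?thesis
  proof (rule that[of "2 * C"])
    show "0 \<le> 2 * C" using C by simp
    fix f :: "'a \<Rightarrow> real" assume [measurable]: "f \<in> borel_measurable borel"
    let ?B = "ball (0::'a) r0"
    \<comment> \<open>The indicator of the ball about the midpoint with radius |x - y| / 4. It is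
      symmetric in \<open>x\<close> and \<open>y\<close>, and its points satisfy |x - m| <= |x - y|
      <= 4 |x - m|.\<close>
    define A where "A x y m = (indicator {m. norm (m - (1/2) *\<^sub>R (x + y)) \<le> norm (x - y) / 4} m :: ennreal)" for x y m :: 'a
    have A_meas [measurable (raw)]: "(\<lambda>z. A (g1 z) (g2 z) (g3 z)) \<in> borel_measurable M'"
      if [measurable]: "g1 \<in> borel_measurable M'" "g2 \<in> borel_measurable M'" "g3 \<in> borel_measurable M'" for M' :: "'z measure" and g1 g2 g3
      unfolding A_def indicator_def mem_Collect_eq by measurable
    have A_sym: "A x y m = A y x m" for x y m
      by (simp add: A_def add.commute norm_minus_commute)
    \<comment> \<open>One half of (f x - f y)^2 <= 2 (f x - f m)^2 + 2 (f y - f m)^2, normalised by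
      the volume of the ball; the other half is \<Psi> with \<open>x\<close> and \<open>y\<close>
      exchanged.\<close>
    define \<Psi> where "\<Psi> x y m = ennreal (2 * c * (J x y * norm (x - y) powr (- n)) * (f x - f m)\<^sup>2) * A x y m * indicator ?B x * indicator ?B y" for x y m
    have \<Psi>_meas [measurable (raw)]: "(\<lambda>z. \<Psi> (g1 z) (g2 z) (g3 z)) \<in> borel_measurable M'"
      if [measurable]: "g1 \<in> borel_measurable M'" "g2 \<in> borel_measurable M'" "g3 \<in> borel_measurable M'" for M' :: "'z measure" and g1 g2 g3
      unfolding \<Psi>_def by measurable
    have A_int: "(\<integral>\<^sup>+m. A x y m \<partial>lborel) = ennreal (norm (x - y) powr n / c)" for x y
    proof (cases "x = y")
      case True
      have "(\<integral>\<^sup>+m. A x y m \<partial>lborel) = emeasure lborel (cball x 0)"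
        unfolding A_def using True
        by (subst nn_integral_indicator[symmetric]) (auto intro!: nn_integral_cong simp: indicator_def scaleR_2[symmetric])
      then show ?thesis using True by simp
    next
      case False
      have "(\<integral>\<^sup>+m. A x y m \<partial>lborel) = (\<integral>\<^sup>+m. indicator (cball ((1/2) *\<^sub>R (x + y)) (norm (x - y) / 4)) m \<partial>lborel)"
        by (intro nn_integral_cong) (auto simp: A_def indicator_def dist_norm norm_minus_commute)
      also have "\<dots> = ennreal (unit_ball_vol n * (norm (x - y) / 4) powr n)"
        using False by (simp add: emeasure_cball power_dim)
      finally show ?thesis using False V by (simp add: c_def powr_divide field_simps)
    qed
    have pt: "ennreal (J x y * (f x - f y)\<^sup>2) * indicator ?B y * indicator ?B x \<le> (\<integral>\<^sup>+m. \<Psi> x y m + \<Psi> y x m \<partial>lborel)" for x y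
    proof (cases "x = y \<or> x \<notin> ?B \<or> y \<notin> ?B")
      case True
      then show ?thesis by (auto simp: J_eq)
    next
      case False
      let ?k = "c * (J x y * norm (x - y) powr (- n))"
      have k: "0 \<le> ?k" using c by (simp add: J_nonneg)
      have "ennreal (J x y * (f x - f y)\<^sup>2) = ennreal (?k * (f x - f y)\<^sup>2) * (\<integral>\<^sup>+m. A x y m \<partial>lborel)"
      proof -
        have "?k * (f x - f y)\<^sup>2 * (norm (x - y) powr n / c) = J x y * (f x - f y)\<^sup>2"
          using False c by (simp add: powr_minus field_simps)
        moreover have "ennreal (?k * (f x - f y)\<^sup>2) * ennreal (norm (x - y) powr n / c) = ennreal (?k * (f x - f y)\<^sup>2 * (norm (x - y) powr n / c))"
          using k c by (intro ennreal_mult[symmetric]) auto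
        ultimately show ?thesis unfolding A_int by (simp only:)
      qed
      also have "\<dots> = (\<integral>\<^sup>+m. ennreal (?k * (f x - f y)\<^sup>2) * A x y m \<partial>lborel)"
        by (rule nn_integral_cmult[symmetric]) measurable
      also have "\<dots> \<le> (\<integral>\<^sup>+m. \<Psi> x y m + \<Psi> y x m \<partial>lborel)"
      proof (rule nn_integral_mono)
        fix m
        have "(f x - f y)\<^sup>2 \<le> 2 * (f x - f m)\<^sup>2 + 2 * (f y - f m)\<^sup>2"
        proof -
          have "2 * (f x - f m)\<^sup>2 + 2 * (f y - f m)\<^sup>2 - (f x - f y)\<^sup>2 = (f x + f y - 2 * f m)\<^sup>2"
            by (simp add: power2_eq_square algebra_simps)
          then show ?thesis by (smt (verit) zero_le_power2)
        qed
        from mult_left_mono[OF this k]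
        have "?k * (f x - f y)\<^sup>2 \<le> 2 * ?k * (f x - f m)\<^sup>2 + 2 * ?k * (f y - f m)\<^sup>2"
          by (simp add: algebra_simps)
        then have "ennreal (?k * (f x - f y)\<^sup>2) \<le> ennreal (2 * ?k * (f x - f m)\<^sup>2) + ennreal (2 * ?k * (f y - f m)\<^sup>2)"
        proof -
          have "0 \<le> 2 * ?k * (f x - f m)\<^sup>2" "0 \<le> 2 * ?k * (f y - f m)\<^sup>2"
            using k by (auto intro!: mult_nonneg_nonneg)
          then show ?thesis
            using ennreal_leI[OF \<open>?k * (f x - f y)\<^sup>2 \<le> 2 * ?k * (f x - f m)\<^sup>2 + 2 * ?k * (f y - f m)\<^sup>2\<close>]
            by (simp only: ennreal_plus)
        qed
        then have "ennreal (?k * (f x - f y)\<^sup>2) * A x y m \<le> (ennreal (2 * ?k * (f x - f m)\<^sup>2) + ennreal (2 * ?k * (f y - f m)\<^sup>2)) * A x y m"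
          by (rule mult_right_mono) simp
        then show "ennreal (?k * (f x - f y)\<^sup>2) * A x y m \<le> \<Psi> x y m + \<Psi> y x m"
          using False by (simp add: \<Psi>_def A_sym[of y x] J_sym[of y x] norm_minus_commute[of y x] distrib_right mult.assoc)
      qed
      finally show ?thesis using False by simp
    qed
    \<comment> \<open>With d = |x - m| the powers combine to d^(-N) d^(-n) d^(n + p - 2) = d^(-(N -
      p + 2)).\<close>
    have inner: "(\<integral>\<^sup>+y. \<Psi> x y m \<partial>lborel) \<le> ennreal C * ennreal ((f x - f m)\<^sup>2 * norm (x - m) powr (- (N - p + 2)))" for x m
    proof (cases "x = m")
      case True
      then show ?thesis by (simp add: \<Psi>_def)
    next
      case False
      define d where "d = norm (x - m)"
      have d: "0 < d" using False by (simp add: d_def)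
      let ?k = "2 * c * p1 * d powr (- N) * d powr (- n) * (f x - f m)\<^sup>2"
      have k: "0 \<le> ?k" using c p1 by simp
      have "\<Psi> x y m \<le> ennreal ?k * (ennreal (\<bar>U y - U x\<bar> powr (p - 2)) * indicator (cball 0 r0 \<inter> cball x (4 * d)) y)" for y
      proof (cases "norm (m - (1/2) *\<^sub>R (x + y)) \<le> norm (x - y) / 4 \<and> x \<in> ?B \<and> y \<in> ?B")
        case True
        have half: "norm (x - (1/2) *\<^sub>R (x + y)) = norm (x - y) / 2"
        proof -
          have "x - (1/2) *\<^sub>R (x + y) = (1/2) *\<^sub>R (x - y)"
            by (simp add: scaleR_right_distrib scaleR_right_diff_distrib) (metis add_diff_cancel_left' diff_diff_eq2 scaleR_half_double scaleR_right_distrib)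
          then show ?thesis by simp
        qed
        have t1: "d \<le> norm (x - (1/2) *\<^sub>R (x + y)) + norm (m - (1/2) *\<^sub>R (x + y))"
          unfolding d_def by (metis norm_minus_commute norm_triangle_ineq4 diff_diff_eq2 diff_add_cancel add_diff_eq norm_diff_triangle_le order_refl)
        have t2: "norm (x - (1/2) *\<^sub>R (x + y)) \<le> d + norm (m - (1/2) *\<^sub>R (x + y))"
          unfolding d_def by (rule norm_diff_triangle_le) auto
        have dl: "d \<le> norm (x - y)" and du: "norm (x - y) \<le> 4 * d"
          using t1 t2 True half by linarith+
        have "J x y * norm (x - y) powr (- n) \<le> p1 * (\<bar>U x - U y\<bar> powr (p - 2) * d powr (- N)) * d powr (- n)"
          unfolding J_eq p1_def[symmetric] using d dl sp_bounds dim p1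
          by (intro mult_mono mult_left_mono powr_mono2') auto
        then have "2 * c * (J x y * norm (x - y) powr (- n)) * (f x - f m)\<^sup>2 \<le> 2 * c * (p1 * (\<bar>U x - U y\<bar> powr (p - 2) * d powr (- N)) * d powr (- n)) * (f x - f m)\<^sup>2"
          using c by (intro mult_right_mono mult_left_mono) auto
        then have "ennreal (2 * c * (J x y * norm (x - y) powr (- n)) * (f x - f m)\<^sup>2) \<le> ennreal ?k * ennreal (\<bar>U y - U x\<bar> powr (p - 2))"
          using k by (subst ennreal_mult[symmetric]) (auto simp: abs_minus_commute mult_ac intro!: ennreal_leI)
        moreover have "y \<in> cball 0 r0 \<inter> cball x (4 * d)" using True du by (simp add: dist_norm)
        ultimately show ?thesis using True by (simp add: \<Psi>_def A_def)
      next
        case False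
        then show ?thesis by (auto simp: \<Psi>_def A_def indicator_def)
      qed
      then have "(\<integral>\<^sup>+y. \<Psi> x y m \<partial>lborel) \<le> (\<integral>\<^sup>+y. ennreal ?k * (ennreal (\<bar>U y - U x\<bar> powr (p - 2)) * indicator (cball 0 r0 \<inter> cball x (4 * d)) y) \<partial>lborel)"
        by (rule nn_integral_mono)
      also have "\<dots> = ennreal ?k * (\<integral>\<^sup>+y\<in>cball 0 r0 \<inter> cball x (4 * d). ennreal (\<bar>U y - U x\<bar> powr (p - 2)) \<partial>lborel)"
        by (rule nn_integral_cmult) measurable
      also have "\<dots> \<le> ennreal ?k * ennreal (slab_const * (4 * d) powr (n + p - 2))"
        by (intro mult_left_mono slab) (use d in auto)
      also have "\<dots> = ennreal C * ennreal ((f x - f m)\<^sup>2 * norm (x - m) powr (- (N - p + 2)))"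
      proof -
        have "d powr (- N) * d powr (- n) * (d powr (n + p - 2)) = d powr (- (N - p + 2))"
        proof -
          have "- N + - n + (n + p - 2) = - (N - p + 2)" by simp
          then show ?thesis by (simp only: powr_add[symmetric])
        qed
        then have "?k * (slab_const * (4 * d) powr (n + p - 2)) = C * ((f x - f m)\<^sup>2 * norm (x - m) powr (- (N - p + 2)))"
          using d by (simp add: C_def d_def[symmetric] powr_mult mult_ac)
        then show ?thesis using k C by (subst (1 2) ennreal_mult[symmetric]) (auto simp: slab_const_nonneg)
      qed
      finally show ?thesis .
    qed
    have I1: "(\<integral>\<^sup>+x. (\<integral>\<^sup>+y. (\<integral>\<^sup>+m. \<Psi> x y m \<partial>lborel) \<partial>lborel) \<partial>lborel) \<le> ennreal C * reg f"
    proof -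
      have "(\<integral>\<^sup>+x. (\<integral>\<^sup>+y. (\<integral>\<^sup>+m. \<Psi> x y m \<partial>lborel) \<partial>lborel) \<partial>lborel) = (\<integral>\<^sup>+x. (\<integral>\<^sup>+m. (\<integral>\<^sup>+y. \<Psi> x y m \<partial>lborel) \<partial>lborel) \<partial>lborel)"
        by (intro nn_integral_cong lborel_pair.Fubini') measurable
      also have "\<dots> \<le> (\<integral>\<^sup>+x. (\<integral>\<^sup>+m. ennreal C * ennreal ((f x - f m)\<^sup>2 * norm (x - m) powr (- (N - p + 2))) \<partial>lborel) \<partial>lborel)"
        by (intro nn_integral_mono inner)
      also have "\<dots> = ennreal C * reg f"
        unfolding reg_def by (subst lborel.nn_integral_fst[symmetric]) (auto simp: nn_integral_cmult)
      finally show ?thesis .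
    qed
    have "(\<integral>\<^sup>+z\<in>?B \<times> ?B. ennreal (J (fst z) (snd z) * (f (fst z) - f (snd z))\<^sup>2) \<partial>(lborel \<Otimes>\<^sub>M lborel))
       = (\<integral>\<^sup>+z. ennreal (J (fst z) (snd z) * (f (fst z) - f (snd z))\<^sup>2) * indicator ?B (snd z) * indicator ?B (fst z) \<partial>(lborel \<Otimes>\<^sub>M lborel))"
      by (intro nn_integral_cong) (auto simp: indicator_def)
    also have "\<dots> = (\<integral>\<^sup>+x. (\<integral>\<^sup>+y. ennreal (J x y * (f x - f y)\<^sup>2) * indicator ?B y * indicator ?B x \<partial>lborel) \<partial>lborel)"
      by (subst lborel.nn_integral_fst[symmetric]) auto
    also have "\<dots> \<le> (\<integral>\<^sup>+x. (\<integral>\<^sup>+y. (\<integral>\<^sup>+m. \<Psi> x y m + \<Psi> y x m \<partial>lborel) \<partial>lborel) \<partial>lborel)"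
      by (intro nn_integral_mono pt)
    also have "\<dots> = (\<integral>\<^sup>+x. (\<integral>\<^sup>+y. (\<integral>\<^sup>+m. \<Psi> x y m \<partial>lborel) \<partial>lborel) \<partial>lborel) + (\<integral>\<^sup>+x. (\<integral>\<^sup>+y. (\<integral>\<^sup>+m. \<Psi> y x m \<partial>lborel) \<partial>lborel) \<partial>lborel)"
      by (simp add: nn_integral_add)
    also have "(\<integral>\<^sup>+x. (\<integral>\<^sup>+y. (\<integral>\<^sup>+m. \<Psi> y x m \<partial>lborel) \<partial>lborel) \<partial>lborel) = (\<integral>\<^sup>+y. (\<integral>\<^sup>+x. (\<integral>\<^sup>+m. \<Psi> y x m \<partial>lborel) \<partial>lborel) \<partial>lborel)"
      by (intro lborel_pair.Fubini') measurable
    also have "(\<integral>\<^sup>+x. (\<integral>\<^sup>+y. (\<integral>\<^sup>+m. \<Psi> x y m \<partial>lborel) \<partial>lborel) \<partial>lborel) + \<dots> \<le> ennreal C * reg f + ennreal C * reg f"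
      by (intro add_mono I1)
    also have "\<dots> = ennreal (2 * C) * reg f"
      using C by (simp add: distrib_right[symmetric] ennreal_plus[symmetric] del: ennreal_plus)
    finally show "(\<integral>\<^sup>+z\<in>?B \<times> ?B. ennreal (J (fst z) (snd z) * (f (fst z) - f (snd z))\<^sup>2) \<partial>(lborel \<Otimes>\<^sub>M lborel)) \<le> ennreal (2 * C) * reg f" .
  qed
qed

text \<open>Jensen for each pair of points, then exchange of the integrals and a shift of both
  points by the same \<open>v\<close>. This shift is the step that the kernel \<open>J\<close> would
  not allow.\<close>

lemma reg_mollified_le:
  assumes [measurable]: "f \<in> borel_measurable borel" "\<rho> \<in> borel_measurable borel"
    and \<rho>: "has_bochner_integral lborel \<rho> 1" "\<And>v. 0 \<le> \<rho> v"
    and m: "\<And>x. has_bochner_integral lborel (\<lambda>v. \<rho> v * f (x - v)) (m x)"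
  shows "reg m \<le> reg f"
proof -
  let ?a = "- (N - p + 2)"
  have "sigma_finite_measure ((lborel :: 'a measure) \<Otimes>\<^sub>M (lborel :: 'a measure))"
    unfolding lborel_prod by (rule sigma_finite_lborel)
  then interpret P: pair_sigma_finite "(lborel :: 'a measure) \<Otimes>\<^sub>M (lborel :: 'a measure)" "lborel :: 'a measure"
    by (simp add: pair_sigma_finite_def sigma_finite_lborel)
  have "reg m \<le> (\<integral>\<^sup>+z. (\<integral>\<^sup>+v. ennreal (\<rho> v * ((f (fst z - v) - f (snd z - v))\<^sup>2 * norm (fst z - snd z) powr ?a)) \<partial>lborel) \<partial>(lborel \<Otimes>\<^sub>M lborel))"
    unfolding reg_def
  proof (rule nn_integral_mono)
    fix z :: "'a \<times> 'a"
    have "has_bochner_integral lborel (\<lambda>v. \<rho> v * (f (fst z - v) - f (snd z - v))) (m (fst z) - m (snd z))"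
      using has_bochner_integral_diff[OF m[of "fst z"] m[of "snd z"]] by (simp add: right_diff_distrib)
    then have "ennreal ((m (fst z) - m (snd z))\<^sup>2) \<le> (\<integral>\<^sup>+v. ennreal (\<rho> v * (f (fst z - v) - f (snd z - v))\<^sup>2) \<partial>lborel)"
      by (rule square_mean_le[OF \<rho>]) measurable
    then have "ennreal ((m (fst z) - m (snd z))\<^sup>2) * ennreal (norm (fst z - snd z) powr ?a)
      \<le> (\<integral>\<^sup>+v. ennreal (\<rho> v * (f (fst z - v) - f (snd z - v))\<^sup>2) \<partial>lborel) * ennreal (norm (fst z - snd z) powr ?a)"
      by (rule mult_right_mono) simp
    also have "\<dots> = (\<integral>\<^sup>+v. ennreal (\<rho> v * (f (fst z - v) - f (snd z - v))\<^sup>2) * ennreal (norm (fst z - snd z) powr ?a) \<partial>lborel)"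
      by (rule nn_integral_multc[symmetric]) measurable
    finally show "ennreal ((m (fst z) - m (snd z))\<^sup>2 * norm (fst z - snd z) powr ?a)
      \<le> (\<integral>\<^sup>+v. ennreal (\<rho> v * ((f (fst z - v) - f (snd z - v))\<^sup>2 * norm (fst z - snd z) powr ?a)) \<partial>lborel)"
      using \<rho>(2) by (simp add: ennreal_mult mult.assoc)
  qed
  also have "\<dots> = (\<integral>\<^sup>+v. (\<integral>\<^sup>+z. ennreal (\<rho> v * ((f (fst z - v) - f (snd z - v))\<^sup>2 * norm (fst z - snd z) powr ?a)) \<partial>(lborel \<Otimes>\<^sub>M lborel)) \<partial>lborel)"
    by (intro P.Fubini'[symmetric]) measurable
  also have "\<dots> = (\<integral>\<^sup>+v. ennreal (\<rho> v) * reg f \<partial>lborel)"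
  proof (rule nn_integral_cong)
    fix v
    define h where "h z = ennreal ((f (fst z) - f (snd z))\<^sup>2 * norm (fst z - snd z) powr ?a)" for z :: "'a \<times> 'a"
    have [measurable]: "h \<in> borel_measurable borel" unfolding h_def borel_prod[symmetric] by measurable
    have "(\<integral>\<^sup>+z. ennreal (\<rho> v * ((f (fst z - v) - f (snd z - v))\<^sup>2 * norm (fst z - snd z) powr ?a)) \<partial>(lborel \<Otimes>\<^sub>M lborel))
      = (\<integral>\<^sup>+z. ennreal (\<rho> v) * h (z + (- v, - v)) \<partial>lborel)"
      unfolding lborel_prod using \<rho>(2) by (intro nn_integral_cong) (simp add: h_def ennreal_mult)
    also have "\<dots> = ennreal (\<rho> v) * (\<integral>\<^sup>+z. h (z + (- v, - v)) \<partial>lborel)"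
      by (rule nn_integral_cmult) measurable
    also have "(\<integral>\<^sup>+z. h (z + (- v, - v)) \<partial>lborel) = (\<integral>\<^sup>+z. h z \<partial>lborel)"
      by (rule nn_integral_translate) measurable
    also have "\<dots> = reg f"
      by (simp only: reg_def h_def[abs_def] lborel_prod)
    finally show "(\<integral>\<^sup>+z. ennreal (\<rho> v * ((f (fst z - v) - f (snd z - v))\<^sup>2 * norm (fst z - snd z) powr ?a)) \<partial>(lborel \<Otimes>\<^sub>M lborel)) = ennreal (\<rho> v) * reg f" .
  qed
  also have "\<dots> = (\<integral>\<^sup>+v. ennreal (\<rho> v) \<partial>lborel) * reg f" by (rule nn_integral_multc) measurable
  also have "(\<integral>\<^sup>+v. ennreal (\<rho> v) \<partial>lborel) = 1"
    using \<rho> by (subst nn_integral_eq_integral) (auto simp: has_bochner_integral_iff)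
  finally show ?thesis by simp
qed

text \<open>Mollifications converge pointwise and do not increase \<open>reg\<close>, so by the
  Hilbert space argument \<open>reg\<close> of the errors tends to 0, and
  \<open>J_energy_le_reg\<close> carries this over to \<open>J\<close>. The margin R < r0 keeps the
  supports of late mollifications inside the ball.\<close>

lemma energy_space_if_reg_finite:
  assumes cont: "continuous_on UNIV f" and supp: "\<And>x. R < norm x \<Longrightarrow> f x = 0" and R: "R < r0"
    and reg: "reg f < \<infinity>"
  shows "f \<in> energy_space J (ball 0 r0)"
proof -
  let ?B = "ball (0::'a) r0"
  have [measurable]: "f \<in> borel_measurable borel" using cont by (rule borel_measurable_continuous_onI)
  obtain C where C: "0 \<le> C" "\<And>g. g \<in> borel_measurable borel \<Longrightarrow>
    (\<integral>\<^sup>+z\<in>?B \<times> ?B. ennreal (J (fst z) (snd z) * (g (fst z) - g (snd z))\<^sup>2) \<partial>(lborel \<Otimes>\<^sub>M lborel)) \<le> ennreal C * reg g"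
    by (rule J_energy_le_reg, rule that)
  obtain m \<rho> where m: "\<And>i k. Ck k (m i)"
    "\<And>i x. R + 1 / real (Suc i) < norm x \<Longrightarrow> m i x = 0"
    "uniform_limit UNIV m f sequentially"
    "\<And>i. \<rho> i \<in> borel_measurable borel" "\<And>i v. 0 \<le> \<rho> i v" "\<And>i. has_bochner_integral lborel (\<rho> i) 1"
    "\<And>i x. has_bochner_integral lborel (\<lambda>v. \<rho> i v * f (x - v)) (m i x)"
    by (rule mollification[where z = f and R = R], rule cont, erule supp, rule that)
  have "continuous_on UNIV (m i)" for i
    using m(1)[of 0 i] by simp
  then have [measurable]: "m i \<in> borel_measurable borel" for i by (rule borel_measurable_continuous_onI)
  let ?a = "- (N - p + 2)"
  \<comment> \<open>Half of the exponent goes inside the square, so that \<open>reg\<close> becomes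
    a squared L^2 norm on pairs.\<close>
  have a2: "(t powr (?a / 2))\<^sup>2 = t powr ?a" for t :: real
    by (simp add: power2_eq_square flip: powr_add)
  have reg2: "reg g = (\<integral>\<^sup>+z. ennreal (((g (fst z) - g (snd z)) * norm (fst z - snd z) powr (?a / 2))\<^sup>2) \<partial>(lborel \<Otimes>\<^sub>M lborel))" for g
    unfolding reg_def power_mult_distrib a2 ..
  have regsmall: "\<forall>\<^sub>F k in sequentially. reg (\<lambda>x. f x - m k x) \<le> ennreal \<delta>" if "0 < \<delta>" for \<delta>
  proof -
    have "\<forall>\<^sub>F k in sequentially. (\<integral>\<^sup>+z. ennreal (((f (fst z) - f (snd z)) * norm (fst z - snd z) powr (?a / 2)
        - (m k (fst z) - m k (snd z)) * norm (fst z - snd z) powr (?a / 2))\<^sup>2) \<partial>(lborel \<Otimes>\<^sub>M lborel)) \<le> ennreal \<delta>"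
    proof (rule nn_integral_square_diff_tendsto_0)
      show "AE z in lborel \<Otimes>\<^sub>M lborel. (\<lambda>k. (m k (fst z) - m k (snd z)) * norm (fst z - snd z) powr (?a / 2))
         \<longlonglongrightarrow> (f (fst z) - f (snd z)) * norm (fst z - snd z) powr (?a / 2)"
        by (intro AE_I2 tendsto_mult tendsto_diff tendsto_const tendsto_uniform_limitI[OF m(3)]) auto
      show "(\<integral>\<^sup>+z. ennreal (((m k (fst z) - m k (snd z)) * norm (fst z - snd z) powr (?a / 2))\<^sup>2) \<partial>(lborel \<Otimes>\<^sub>M lborel))
         \<le> (\<integral>\<^sup>+z. ennreal (((f (fst z) - f (snd z)) * norm (fst z - snd z) powr (?a / 2))\<^sup>2) \<partial>(lborel \<Otimes>\<^sub>M lborel))" for k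
        unfolding reg2[symmetric] by (rule reg_mollified_le[OF _ m(4) m(6) m(5) m(7)]) measurable
    qed (use reg[unfolded reg2] that in auto)
    moreover have "reg (\<lambda>x. f x - m k x) = (\<integral>\<^sup>+z. ennreal (((f (fst z) - f (snd z)) * norm (fst z - snd z) powr (?a / 2)
        - (m k (fst z) - m k (snd z)) * norm (fst z - snd z) powr (?a / 2))\<^sup>2) \<partial>(lborel \<Otimes>\<^sub>M lborel))" for k
      unfolding reg2 by (intro nn_integral_cong arg_cong[where f = ennreal] arg_cong[where f = "\<lambda>t. t\<^sup>2"]) (simp add: algebra_simps)
    ultimately show ?thesis by simp
  qed
  define V where "V = unit_ball_vol n * r0 powr n"
  have V: "emeasure lborel ?B = ennreal V" "0 \<le> V"
    using r0 dim by (auto simp: V_def emeasure_ball power_dim)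
  have L2: "(\<integral>\<^sup>+x\<in>?B. ennreal ((g x)\<^sup>2) \<partial>lborel) \<le> ennreal (b\<^sup>2 * V)" if "\<And>x. \<bar>g x\<bar> \<le> b" for g b
  proof -
    have "(\<integral>\<^sup>+x\<in>?B. ennreal ((g x)\<^sup>2) \<partial>lborel) \<le> (\<integral>\<^sup>+x. ennreal (b\<^sup>2) * indicator ?B x \<partial>lborel)"
      using that by (intro nn_integral_mono mult_right_mono ennreal_leI) (auto simp: abs_le_square_iff[symmetric] intro: order_trans[OF that abs_ge_self])
    then show ?thesis using V by (simp add: nn_integral_cmult_indicator ennreal_mult)
  qed
  show ?thesis
    unfolding energy_space_def mem_Collect_eq
  proof (intro conjI allI impI)
    show "set_borel_measurable lborel ?B f" unfolding set_borel_measurable_def by measurable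
    have "bounded (f ` cball 0 R)"
      by (intro compact_imp_bounded compact_continuous_image compact_cball continuous_on_subset[OF cont]) auto
    then obtain b where b: "0 < b" "\<And>x. norm x \<le> R \<Longrightarrow> \<bar>f x\<bar> \<le> b" unfolding bounded_pos by auto
    have "\<bar>f x\<bar> \<le> b" for x using b supp[of x] by (cases "norm x \<le> R") auto
    from L2[OF this] have "(\<integral>\<^sup>+x\<in>?B. ennreal ((f x)\<^sup>2) \<partial>lborel) < \<infinity>" by (rule le_less_trans) simp
    moreover have "(\<integral>\<^sup>+z\<in>?B \<times> ?B. ennreal (J (fst z) (snd z) * (f (fst z) - f (snd z))\<^sup>2) \<partial>(lborel \<Otimes>\<^sub>M lborel)) < \<infinity>"
      by (rule le_less_trans[OF C(2)]) (use reg in \<open>auto simp: ennreal_mult_less_top\<close>)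
    ultimately show "energy_norm2 J ?B f < \<infinity>" by (simp add: energy_norm2_def)
    fix \<epsilon> :: ennreal assume "0 < \<epsilon>"
    then obtain \<epsilon>' where \<epsilon>': "0 < \<epsilon>'" "ennreal \<epsilon>' < \<epsilon>"
    proof -
      obtain x where x: "0 < x" "x < \<epsilon>" using dense[OF \<open>0 < \<epsilon>\<close>] by blast
      then obtain t where "x = ennreal t" by (cases x) auto
      with x show ?thesis using that[of t] by simp
    qed
    \<comment> \<open>Uniform distance \<open>b\<close> costs b^2 V in the L^2 part; V + 1 in the
      denominator avoids a division by 0.\<close>
    define b where "b = sqrt (\<epsilon>' / 2 / (V + 1))"
    have b: "0 < b" "b\<^sup>2 * V \<le> \<epsilon>' / 2" using \<epsilon>' V by (auto simp: b_def field_simps)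
    have "\<forall>\<^sub>F k in sequentially. \<forall>x\<in>UNIV. dist (m k x) (f x) < b" by (rule uniform_limitD[OF m(3) b(1)])
    moreover have "\<forall>\<^sub>F k in sequentially. reg (\<lambda>x. f x - m k x) \<le> ennreal (\<epsilon>' / 2 / (C + 1))"
      using \<epsilon>' C by (intro regsmall) auto
    moreover have "\<forall>\<^sub>F k in sequentially. 1 / real (Suc k) < r0 - R"
      using order_tendstoD(2)[OF LIMSEQ_Suc[OF lim_1_over_n], of "r0 - R"] R by simp
    ultimately have "\<forall>\<^sub>F k in sequentially. m k \<in> test_functions ?B \<and> energy_norm2 J ?B (\<lambda>x. f x - m k x) < \<epsilon>"
    proof eventually_elim
      case (elim k)
      have "m k \<in> test_functions ?B"
        by (rule test_functionsI[OF m(1,2)]) (use elim(3) in \<open>auto simp: subset_iff\<close>)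
      moreover have "energy_norm2 J ?B (\<lambda>x. f x - m k x) \<le> ennreal (\<epsilon>' / 2) + ennreal (\<epsilon>' / 2)"
        unfolding energy_norm2_def
      proof (rule add_mono)
        have "\<bar>f x - m k x\<bar> \<le> b" for x using elim(1) by (simp add: dist_real_def abs_minus_commute less_imp_le)
        from L2[OF this] show "(\<integral>\<^sup>+x\<in>?B. ennreal ((f x - m k x)\<^sup>2) \<partial>lborel) \<le> ennreal (\<epsilon>' / 2)"
          by (rule order_trans) (use b in \<open>simp add: ennreal_leI\<close>)
        have "(\<integral>\<^sup>+z\<in>?B \<times> ?B. ennreal (J (fst z) (snd z) * ((f (fst z) - m k (fst z)) - (f (snd z) - m k (snd z)))\<^sup>2) \<partial>(lborel \<Otimes>\<^sub>M lborel))
           \<le> ennreal C * reg (\<lambda>x. f x - m k x)" by (rule C(2)) measurable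
        also have "\<dots> \<le> ennreal C * ennreal (\<epsilon>' / 2 / (C + 1))" by (intro mult_left_mono elim) simp
        also have "\<dots> \<le> ennreal (\<epsilon>' / 2)"
          using C \<epsilon>' by (subst ennreal_mult[symmetric]) (auto intro!: ennreal_leI simp: field_simps)
        finally show "(\<integral>\<^sup>+z\<in>?B \<times> ?B. ennreal (J (fst z) (snd z) * ((f (fst z) - m k (fst z)) - (f (snd z) - m k (snd z)))\<^sup>2) \<partial>(lborel \<Otimes>\<^sub>M lborel))
           \<le> ennreal (\<epsilon>' / 2)" .
      qed
      ultimately show ?case using \<epsilon>' by (simp flip: ennreal_plus)
    qed
    then show "\<exists>\<phi>\<in>test_functions ?B. energy_norm2 J ?B (\<lambda>x. f x - \<phi> x) < \<epsilon>"
      using eventually_happens'[OF sequentially_bot] by blast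
  qed
qed

text \<open>Continuity of \<open>w\<close> is known only inside the ball; the product with \<eta> is
  continuous everywhere by gluing with 0 off the smaller ball that carries \<eta>.\<close>

lemma w_energy_space_loc: "w \<in> energy_space_loc J (ball 0 r0)"
  unfolding energy_space_loc_def mem_Collect_eq
proof
  fix \<eta> assume "\<eta> \<in> test_functions (ball (0::'a) r0)"
  then obtain R B K where R: "0 \<le> R" "R < r0" and supp: "\<And>x. R < norm x \<Longrightarrow> \<eta> x = 0" and bl: "bl_fun B K \<eta>"
    using test_function_support r0 by blast
  have "continuous_on (ball 0 r0 \<union> - cball 0 R) (\<lambda>x. \<eta> x * w x)"
  proof (rule continuous_on_open_Un)
    show "continuous_on (ball 0 r0) (\<lambda>x. \<eta> x * w x)"
      by (intro continuous_intros w_cont bl_funD(5)[OF bl])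
    show "continuous_on (- cball 0 R) (\<lambda>x. \<eta> x * w x)"
      using continuous_on_const[of "- cball 0 R" "0::real"]
      by (rule continuous_on_eq) (use supp in auto)
  qed auto
  moreover have "ball (0::'a) r0 \<union> - cball 0 R = UNIV" using R by auto
  ultimately have cont: "continuous_on UNIV (\<lambda>x. \<eta> x * w x)" by simp
  show "(\<lambda>x. \<eta> x * w x) \<in> energy_space J (ball 0 r0)"
  proof (rule energy_space_if_reg_finite[OF cont _ R(2)])
    show "\<eta> x * w x = 0" if "R < norm x" for x using supp[OF that] by simp
    show "reg (\<lambda>x. \<eta> x * w x) < \<infinity>" by (rule reg_finite[OF bl]) (use supp R in auto)
  qed
qed

end

section \<open>The far interaction\<close>

text \<open>Telescoping over the averages of \<open>f\<close> on the balls of radius \<open>rad * 2\<^sup>-\<^sup>k\<close>: by Young's inequality the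
  \<open>k\<close>-th term is of order \<open>2\<^sup>-\<^sup>k\<^sup>\<gamma>\<close> with \<open>\<gamma> = (b + \<beta>) / 2 - n\<close>.\<close>

lemma morrey_kato_inequality:
  fixes a :: "'a::euclidean_space \<Rightarrow> ennreal" and b \<beta> rad M :: real
  assumes [measurable]: "a \<in> borel_measurable borel" "D \<in> sets borel" and D: "emeasure lborel D < \<infinity>"
    and rad: "0 < rad" and supp: "\<And>x. a x \<noteq> 0 \<Longrightarrow> cball x rad \<subseteq> D"
    and M: "0 \<le> M" "\<And>u r. 0 < r \<Longrightarrow> r \<le> rad \<Longrightarrow> (\<integral>\<^sup>+x\<in>cball u r. a x \<partial>lborel) \<le> ennreal (M * r powr \<beta>)"
    and mass: "(\<integral>\<^sup>+x. a x \<partial>lborel) < \<infinity>" and b: "0 \<le> b" "2 * real DIM('a) < b + \<beta>"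
  obtains C where "0 \<le> C" "\<And>f T. continuous_on UNIV f \<Longrightarrow> 0 < T \<Longrightarrow>
    (\<integral>\<^sup>+x. ennreal \<bar>f x\<bar> * a x \<partial>lborel) \<le> ennreal C * (ennreal T * ((\<integral>\<^sup>+x\<in>D. ennreal ((f x)\<^sup>2) \<partial>lborel)
      + (\<integral>\<^sup>+z\<in>D \<times> D. ennreal ((f (fst z) - f (snd z))\<^sup>2 * norm (fst z - snd z) powr (- b)) \<partial>(lborel \<Otimes>\<^sub>M lborel))) + ennreal (1 / T))"
proof -
  define n where "n = real DIM('a)"
  have n: "0 < n" by (simp add: n_def)
  define V where "V = unit_ball_vol n"
  have V: "0 < V" using n by (simp add: V_def)
  define \<rho> where "\<rho> k = rad * (1/2) ^ k" for k :: nat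
  have \<rho>: "0 < \<rho> k" "\<rho> k \<le> rad" "\<rho> (Suc k) \<le> \<rho> k" for k
    using rad by (auto simp: \<rho>_def power_le_one)
  have vol: "emeasure lborel (cball (x::'a) r) = ennreal (V * r powr n)" if "0 < r" for x r
    using that by (simp add: emeasure_cball V_def n_def powr_realpow)
  obtain m where m: "(\<integral>\<^sup>+x. a x \<partial>lborel) = ennreal m" "0 \<le> m"
    using mass by (cases "\<integral>\<^sup>+x. a x \<partial>lborel") auto
  obtain dD where dD: "emeasure lborel D = ennreal dD" "0 \<le> dD"
    using D by (cases "emeasure lborel D") auto
  \<comment> \<open>Young's weight at scale r = \<rho> k is T r^\<sigma>. The two resulting terms
    scale like r^(\<sigma> + b - 2 n) and r^(\<beta> - \<sigma>); the choice of \<sigma> makes both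
    exponents equal to \<gamma>, and 2 n < b + \<beta> makes \<gamma> positive.\<close>
  define \<gamma> where "\<gamma> = (b + \<beta>) / 2 - n"
  define \<sigma> where "\<sigma> = n + (\<beta> - b) / 2"
  have \<gamma>: "0 < \<gamma>" using b by (simp add: \<gamma>_def n_def)
  define S where "S = rad powr \<gamma> / (1 - 2 powr (- \<gamma>))"
  have two\<gamma>: "2 powr (- \<gamma>) < (1::real)" using \<gamma> powr_less_mono[of "- \<gamma>" 0 2] by simp
  have S: "0 \<le> S" using two\<gamma> by (simp add: S_def)
  define v where "v k = V * \<rho> k powr n" for k
  have v: "0 < v k" for k using V \<rho>(1)[of k] by (simp add: v_def)
  define c1 where "c1 = 2 powr n * 2 powr b / V\<^sup>2"
  define c2 where "c2 = M * m * 2 powr n * 2 powr n"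
  have c12: "0 \<le> c1" "0 \<le> c2" using M m by (auto simp: c1_def c2_def)
  define C where "C = m / v 0 + m * dD / v 0 + S * c1 + S * c2"
  have C: "0 \<le> C" "m / v 0 \<le> C" "m * dD / v 0 + S * c2 \<le> C" "m / v 0 + S * c1 \<le> C" 
    using m dD v[of 0] S c12 by (auto simp: C_def)
  show ?thesis
  proof (rule that[OF C(1)])
    fix f :: "'a \<Rightarrow> real" and T :: real
    assume cont: "continuous_on UNIV f" and T: "0 < T"
    have [measurable]: "f \<in> borel_measurable borel" using cont by (rule borel_measurable_continuous_onI)
    define avg where "avg k x = (\<integral>u. indicator (cball x (\<rho> k)) u * f u \<partial>lborel) / v k" for k x
    have avg_dev: "ennreal \<bar>avg k x - c\<bar> \<le> ennreal (1 / v k) * (\<integral>\<^sup>+u\<in>cball x (\<rho> k). ennreal \<bar>f u - c\<bar> \<partial>lborel)" for k x c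
    proof -
      have i1: "integrable lborel (\<lambda>u. indicator (cball x (\<rho> k)) u * f u)"
        using borel_integrable_compact[of "cball x (\<rho> k)" f] cont by (simp add: continuous_on_subset)
      have i2: "integrable lborel (\<lambda>u. indicator (cball x (\<rho> k)) u * c)"
        using borel_integrable_compact[of "cball x (\<rho> k)" "\<lambda>_. c"] by simp
      have "(\<integral>u. indicator (cball x (\<rho> k)) u * c \<partial>lborel) = v k * c"
        using vol[OF \<rho>(1), of x k] v[of k] by (simp add: measure_def v_def)
      then have "avg k x - c = (\<integral>u. indicator (cball x (\<rho> k)) u * (f u - c) \<partial>lborel) / v k"
        using i1 i2 v[of k] by (simp add: avg_def right_diff_distrib field_simps)
      then have "\<bar>avg k x - c\<bar> \<le> (\<integral>u. indicator (cball x (\<rho> k)) u * \<bar>f u - c\<bar> \<partial>lborel) / v k"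
        using v[of k] integral_abs_bound[of lborel "\<lambda>u. indicator (cball x (\<rho> k)) u * (f u - c)"]
        by (simp add: abs_divide abs_mult divide_right_mono)
      moreover have "ennreal (\<integral>u. indicator (cball x (\<rho> k)) u * \<bar>f u - c\<bar> \<partial>lborel) = (\<integral>\<^sup>+u\<in>cball x (\<rho> k). ennreal \<bar>f u - c\<bar> \<partial>lborel)"
      proof (subst nn_integral_eq_integral[symmetric])
        show "integrable lborel (\<lambda>u. indicator (cball x (\<rho> k)) u * \<bar>f u - c\<bar>)"
          using borel_integrable_compact[of "cball x (\<rho> k)" "\<lambda>u. \<bar>f u - c\<bar>"] cont
          by (simp add: continuous_on_subset continuous_intros)
      qed (auto simp: indicator_def intro!: nn_integral_cong)
      moreover have "ennreal (1 / v k) * ennreal I = ennreal (I / v k)" for I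
        using v[of k] by (subst ennreal_mult'[symmetric]) auto
      ultimately show ?thesis by (metis ennreal_leI)
    qed
    define P where "P x = ennreal (1 / v 0) * (\<integral>\<^sup>+u\<in>cball x (\<rho> 0). ennreal \<bar>f u\<bar> \<partial>lborel)" for x
    \<comment> \<open>The double mean that bounds the step from average \<open>k\<close> to average
      \<open>k + 1\<close>. The normalisation mixes two volumes because \<open>u\<close> comes from
      the smaller ball, which is then enlarged to the larger one.\<close>
    define Q where "Q k x = ennreal (1 / v (Suc k) * (1 / v k)) *
       (\<integral>\<^sup>+u. (\<integral>\<^sup>+y. ennreal \<bar>f u - f y\<bar> * indicator (cball x (\<rho> k)) u * indicator (cball x (\<rho> k)) y \<partial>lborel) \<partial>lborel)" for k x
    have [measurable]: "P \<in> borel_measurable borel" "Q k \<in> borel_measurable borel" for k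
      unfolding P_def Q_def by measurable
    have Qd: "ennreal \<bar>avg (Suc k) x - avg k x\<bar> \<le> Q k x" for k x
    proof -
      have "ennreal \<bar>avg (Suc k) x - avg k x\<bar> \<le> ennreal (1 / v (Suc k)) * (\<integral>\<^sup>+u\<in>cball x (\<rho> (Suc k)). ennreal \<bar>f u - avg k x\<bar> \<partial>lborel)"
        by (rule avg_dev)
      also have "\<dots> \<le> ennreal (1 / v (Suc k)) * (\<integral>\<^sup>+u. ennreal (1 / v k) *
          (\<integral>\<^sup>+y. ennreal \<bar>f u - f y\<bar> * indicator (cball x (\<rho> k)) u * indicator (cball x (\<rho> k)) y \<partial>lborel) \<partial>lborel)"
      proof (intro mult_left_mono nn_integral_mono)
        fix u
        show "ennreal \<bar>f u - avg k x\<bar> * indicator (cball x (\<rho> (Suc k))) u \<le> ennreal (1 / v k) *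
          (\<integral>\<^sup>+y. ennreal \<bar>f u - f y\<bar> * indicator (cball x (\<rho> k)) u * indicator (cball x (\<rho> k)) y \<partial>lborel)"
        proof (cases "u \<in> cball x (\<rho> (Suc k))")
          case True
          then have "u \<in> cball x (\<rho> k)" using \<rho>(3)[of k] by auto
          then show ?thesis using True avg_dev[of k x "f u"] by (simp add: abs_minus_commute)
        qed simp
      qed simp
      also have "\<dots> = Q k x"
        using v[of k] v[of "Suc k"] by (simp add: Q_def nn_integral_cmult ennreal_mult'[symmetric] mult.assoc[symmetric])
      finally show ?thesis .
    qed
    \<comment> \<open>Continuity makes the averages converge to \<open>f x\<close> at every point,
      so the telescoped bound holds pointwise, as an integral against the weight \<open>a\<close>
      demands.\<close>
    have fx: "ennreal \<bar>f x\<bar> \<le> P x + (\<Sum>k. Q k x)" for x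
    proof -
      have step: "ennreal \<bar>avg K x\<bar> \<le> ennreal \<bar>avg 0 x\<bar> + (\<Sum>k<K. Q k x)" for K
      proof (induction K)
        case (Suc K)
        have "ennreal \<bar>avg (Suc K) x\<bar> \<le> ennreal (\<bar>avg K x\<bar> + \<bar>avg (Suc K) x - avg K x\<bar>)" by (intro ennreal_leI) linarith
        also have "\<dots> \<le> (ennreal \<bar>avg 0 x\<bar> + (\<Sum>k<K. Q k x)) + Q K x"
          using Suc Qd by (simp add: ennreal_plus add_mono)
        finally show ?case by (simp add: add.assoc)
      qed simp
      have "avg 0 x = avg 0 x - 0" by simp
      then have a0: "ennreal \<bar>avg 0 x\<bar> \<le> P x" using avg_dev[of 0 x 0] by (simp add: P_def)
      have "(\<lambda>K. avg K x) \<longlonglongrightarrow> f x"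
      proof (rule LIMSEQ_I)
        fix \<epsilon> :: real assume \<epsilon>: "0 < \<epsilon>"
        obtain d where d: "d > 0" "\<And>u. dist u x < d \<Longrightarrow> dist (f u) (f x) < \<epsilon> / 2"
          using cont \<epsilon> unfolding continuous_on_iff by (metis UNIV_I half_gt_zero)
        have "(\<lambda>k. rad * (1/2)^k) \<longlonglongrightarrow> rad * 0" by (intro tendsto_intros) auto
        then have "\<forall>\<^sub>F k in sequentially. \<rho> k < d" using order_tendstoD(2)[of \<rho> "rad * 0" sequentially d] d(1) unfolding \<rho>_def by simp
        then obtain K0 where K0: "\<And>k. K0 \<le> k \<Longrightarrow> \<rho> k < d" unfolding eventually_sequentially by blast
        have "norm (avg K x - f x) < \<epsilon>" if "K0 \<le> K" for K
        proof -
          have "ennreal \<bar>avg K x - f x\<bar> \<le> ennreal (1 / v K) * (\<integral>\<^sup>+u\<in>cball x (\<rho> K). ennreal \<bar>f u - f x\<bar> \<partial>lborel)"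
            by (rule avg_dev)
          also have "\<dots> \<le> ennreal (1 / v K) * (\<integral>\<^sup>+u. ennreal (\<epsilon> / 2) * indicator (cball x (\<rho> K)) u \<partial>lborel)"
          proof (intro mult_left_mono nn_integral_mono)
            fix u
            show "ennreal \<bar>f u - f x\<bar> * indicator (cball x (\<rho> K)) u \<le> ennreal (\<epsilon> / 2) * indicator (cball x (\<rho> K)) u"
              using K0[OF that] d(2)[of u] by (auto simp: indicator_def dist_real_def dist_commute intro!: ennreal_leI)
          qed simp
          also have "\<dots> = ennreal (\<epsilon> / 2)"
            using v[of K] \<epsilon> vol[OF \<rho>(1), of x K] by (simp add: nn_integral_cmult_indicator v_def[symmetric] ennreal_mult[symmetric])
          finally show ?thesis using \<epsilon> by (simp add: ennreal_le_iff)
        qed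
        then show "\<exists>no. \<forall>n\<ge>no. norm (avg n x - f x) < \<epsilon>" by blast
      qed
      then have lim: "(\<lambda>K. ennreal \<bar>avg K x\<bar>) \<longlonglongrightarrow> ennreal \<bar>f x\<bar>" by (intro tendsto_ennrealI tendsto_rabs)
      have "ennreal \<bar>avg K x\<bar> \<le> P x + (\<Sum>k. Q k x)" for K
      proof -
        have "(\<Sum>k<K. Q k x) \<le> (\<Sum>k. Q k x)" by (rule sum_le_suminf) auto
        then show ?thesis using step[of K] a0 by (meson add_mono order_trans)
      qed
      then show ?thesis by (intro tendsto_upperbound[OF lim always_eventually]) auto
    qed
    define F2 where "F2 = (\<integral>\<^sup>+x\<in>D. ennreal ((f x)\<^sup>2) \<partial>lborel)"
    define E where "E = (\<integral>\<^sup>+u. (\<integral>\<^sup>+y. ennreal ((f u - f y)\<^sup>2 * norm (u - y) powr (- b)) * indicator D y * indicator D u \<partial>lborel) \<partial>lborel)"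
    have E_eq: "E = (\<integral>\<^sup>+z\<in>D \<times> D. ennreal ((f (fst z) - f (snd z))\<^sup>2 * norm (fst z - snd z) powr (- b)) \<partial>(lborel \<Otimes>\<^sub>M lborel))"
    proof -
      have "(\<integral>\<^sup>+z\<in>D \<times> D. ennreal ((f (fst z) - f (snd z))\<^sup>2 * norm (fst z - snd z) powr (- b)) \<partial>(lborel \<Otimes>\<^sub>M lborel))
        = (\<integral>\<^sup>+z. ennreal ((f (fst z) - f (snd z))\<^sup>2 * norm (fst z - snd z) powr (- b)) * indicator D (snd z) * indicator D (fst z) \<partial>(lborel \<Otimes>\<^sub>M lborel))"
        by (intro nn_integral_cong) (auto simp: indicator_def)
      also have "\<dots> = E" unfolding E_def by (subst lborel.nn_integral_fst[symmetric]) auto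
      finally show ?thesis by (rule sym)
    qed
    \<comment> \<open>The coarsest average is handled by |f| <= T f^2 + 1 / T; \<open>supp\<close>
      keeps its ball inside \<open>D\<close>.\<close>
    have aP: "(\<integral>\<^sup>+x. P x * a x \<partial>lborel) \<le> ennreal (m / v 0) * (ennreal T * F2 + ennreal (dD / T))"
    proof -
      have F1: "(\<integral>\<^sup>+u\<in>D. ennreal \<bar>f u\<bar> \<partial>lborel) \<le> ennreal T * F2 + ennreal (dD / T)"
      proof -
        have "(\<integral>\<^sup>+u\<in>D. ennreal \<bar>f u\<bar> \<partial>lborel) \<le> (\<integral>\<^sup>+u. ennreal T * (ennreal ((f u)\<^sup>2) * indicator D u) + ennreal (1 / T) * indicator D u \<partial>lborel)"
        proof (rule nn_integral_mono)
          fix u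
          have "0 \<le> (T * \<bar>f u\<bar> - 1)\<^sup>2 / T" using T by simp
          also have "\<dots> = T * (f u)\<^sup>2 + 1 / T - 2 * \<bar>f u\<bar>" using T by (simp add: power2_eq_square field_simps)
          finally have "\<bar>f u\<bar> \<le> T * (f u)\<^sup>2 + 1 / T" by simp
          then have "ennreal \<bar>f u\<bar> \<le> ennreal (T * (f u)\<^sup>2 + 1 / T)" by (rule ennreal_leI)
          also have "\<dots> = ennreal T * ennreal ((f u)\<^sup>2) + ennreal (1 / T)" using T by (simp add: ennreal_plus ennreal_mult)
          finally show "ennreal \<bar>f u\<bar> * indicator D u \<le> ennreal T * (ennreal ((f u)\<^sup>2) * indicator D u) + ennreal (1 / T) * indicator D u"
            by (auto simp: indicator_def)
        qed
        also have "\<dots> = ennreal T * F2 + ennreal (1 / T) * ennreal dD"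
          by (subst nn_integral_add) (auto simp: nn_integral_cmult F2_def dD(1) nn_integral_cmult_indicator)
        also have "ennreal (1 / T) * ennreal dD = ennreal (dD / T)" using T dD by (simp add: ennreal_mult'[symmetric])
        finally show ?thesis .
      qed
      have "(\<integral>\<^sup>+x. P x * a x \<partial>lborel) \<le> (\<integral>\<^sup>+x. (ennreal (1 / v 0) * (ennreal T * F2 + ennreal (dD / T))) * a x \<partial>lborel)"
      proof (rule nn_integral_mono)
        fix x
        show "P x * a x \<le> (ennreal (1 / v 0) * (ennreal T * F2 + ennreal (dD / T))) * a x"
        proof (cases "a x = 0")
          case False
          then have "cball x (\<rho> 0) \<subseteq> D" using supp by (simp add: \<rho>_def)
          then have "(\<integral>\<^sup>+u\<in>cball x (\<rho> 0). ennreal \<bar>f u\<bar> \<partial>lborel) \<le> (\<integral>\<^sup>+u\<in>D. ennreal \<bar>f u\<bar> \<partial>lborel)"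
            by (intro nn_integral_mono) (auto simp: indicator_def)
          then show ?thesis unfolding P_def by (intro mult_right_mono mult_left_mono order_trans[OF _ F1]) auto
        qed simp
      qed
      also have "\<dots> = (ennreal (1 / v 0) * (ennreal T * F2 + ennreal (dD / T))) * ennreal m"
        by (subst nn_integral_cmult) (auto simp: m)
      also have "\<dots> = ennreal (m / v 0) * (ennreal T * F2 + ennreal (dD / T))"
      proof -
        have "ennreal (m / v 0) = ennreal (1 / v 0) * ennreal m" using m v[of 0] by (simp add: ennreal_mult'[symmetric])
        then show ?thesis by (simp add: mult_ac)
      qed
      finally show ?thesis .
    qed
    have aQ: "(\<integral>\<^sup>+x. Q k x * a x \<partial>lborel) \<le> ennreal (\<rho> k powr \<gamma>) * (ennreal (c1 * T) * E + ennreal (c2 / T))" for k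
    proof -
      let ?r = "\<rho> k"
      \<comment> \<open>Once the integral over \<open>x\<close> is innermost, the weight
        \<open>a\<close> enters only through its mass near \<open>u\<close>.\<close>
      define \<mu> where "\<mu> u = (\<integral>\<^sup>+x\<in>cball u ?r. a x \<partial>lborel)" for u
      have [measurable]: "\<mu> \<in> borel_measurable borel" unfolding \<mu>_def by measurable
      define \<nu> where "\<nu> = M * ?r powr \<beta>"
      have \<nu>: "0 \<le> \<nu>" using M by (simp add: \<nu>_def)
      have \<mu>\<nu>: "\<mu> u \<le> ennreal \<nu>" for u unfolding \<mu>_def \<nu>_def by (intro M \<rho>)
      define lam where "lam = T * ?r powr \<sigma>"
      have lam: "0 < lam" using T \<rho>(1)[of k] by (simp add: lam_def)
      let ?c = "1 / v (Suc k) * (1 / v k)"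
      have c0: "0 \<le> ?c" using v[of k] v[of "Suc k"] by simp
      have \<mu>_int: "(\<integral>\<^sup>+u. \<mu> u \<partial>lborel) = ennreal (m * (V * ?r powr n))"
      proof -
        have "(\<integral>\<^sup>+u. \<mu> u \<partial>lborel) = (\<integral>\<^sup>+x. (\<integral>\<^sup>+u. a x * indicator (cball u ?r) x \<partial>lborel) \<partial>lborel)"
          unfolding \<mu>_def by (intro lborel_pair.Fubini') measurable
        also have "\<dots> = (\<integral>\<^sup>+x. ennreal (V * ?r powr n) * a x \<partial>lborel)"
        proof (rule nn_integral_cong)
          fix x
          have "(\<integral>\<^sup>+u. a x * indicator (cball u ?r) x \<partial>lborel) = (\<integral>\<^sup>+u. a x * indicator (cball x ?r) u \<partial>lborel)"
            by (intro nn_integral_cong) (auto simp: indicator_def dist_commute)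
          then show "(\<integral>\<^sup>+u. a x * indicator (cball u ?r) x \<partial>lborel) = ennreal (V * ?r powr n) * a x"
            by (simp add: nn_integral_cmult_indicator vol[OF \<rho>(1)] mult.commute)
        qed
        also have "\<dots> = ennreal (V * ?r powr n) * ennreal m" by (subst nn_integral_cmult) (auto simp: m)
        finally show ?thesis using m V by (simp add: ennreal_mult'[symmetric] mult.commute)
      qed
      have "(\<integral>\<^sup>+x. Q k x * a x \<partial>lborel) = (\<integral>\<^sup>+x. ennreal ?c * (\<integral>\<^sup>+u. (\<integral>\<^sup>+y. ennreal \<bar>f u - f y\<bar> * indicator (cball x ?r) u * indicator (cball x ?r) y * a x \<partial>lborel) \<partial>lborel) \<partial>lborel)"
        unfolding Q_def
      proof (rule nn_integral_cong)
        fix x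
        have "(\<integral>\<^sup>+u. (\<integral>\<^sup>+y. ennreal \<bar>f u - f y\<bar> * indicator (cball x ?r) u * indicator (cball x ?r) y * a x \<partial>lborel) \<partial>lborel)
          = (\<integral>\<^sup>+u. (\<integral>\<^sup>+y. ennreal \<bar>f u - f y\<bar> * indicator (cball x ?r) u * indicator (cball x ?r) y \<partial>lborel) \<partial>lborel) * a x"
          by (simp add: nn_integral_multc)
        then show "ennreal ?c * (\<integral>\<^sup>+u. (\<integral>\<^sup>+y. ennreal \<bar>f u - f y\<bar> * indicator (cball x ?r) u * indicator (cball x ?r) y \<partial>lborel) \<partial>lborel) * a x
          = ennreal ?c * (\<integral>\<^sup>+u. (\<integral>\<^sup>+y. ennreal \<bar>f u - f y\<bar> * indicator (cball x ?r) u * indicator (cball x ?r) y * a x \<partial>lborel) \<partial>lborel)"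
          by (simp only: mult.assoc)
      qed
      also have "\<dots> = ennreal ?c * (\<integral>\<^sup>+x. (\<integral>\<^sup>+u. (\<integral>\<^sup>+y. ennreal \<bar>f u - f y\<bar> * indicator (cball x ?r) u * indicator (cball x ?r) y * a x \<partial>lborel) \<partial>lborel) \<partial>lborel)"
        by (rule nn_integral_cmult) measurable
      finally have Qc: "(\<integral>\<^sup>+x. Q k x * a x \<partial>lborel) = ennreal ?c * (\<integral>\<^sup>+x. (\<integral>\<^sup>+u. (\<integral>\<^sup>+y. ennreal \<bar>f u - f y\<bar> * indicator (cball x ?r) u * indicator (cball x ?r) y * a x \<partial>lborel) \<partial>lborel) \<partial>lborel)" .
      have "(\<integral>\<^sup>+x. (\<integral>\<^sup>+u. (\<integral>\<^sup>+y. ennreal \<bar>f u - f y\<bar> * indicator (cball x ?r) u * indicator (cball x ?r) y * a x \<partial>lborel) \<partial>lborel) \<partial>lborel)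
         = (\<integral>\<^sup>+u. (\<integral>\<^sup>+x. (\<integral>\<^sup>+y. ennreal \<bar>f u - f y\<bar> * indicator (cball x ?r) u * indicator (cball x ?r) y * a x \<partial>lborel) \<partial>lborel) \<partial>lborel)"
        by (intro lborel_pair.Fubini') measurable
      also have "\<dots> = (\<integral>\<^sup>+u. (\<integral>\<^sup>+y. (\<integral>\<^sup>+x. ennreal \<bar>f u - f y\<bar> * indicator (cball x ?r) u * indicator (cball x ?r) y * a x \<partial>lborel) \<partial>lborel) \<partial>lborel)"
        by (intro nn_integral_cong lborel_pair.Fubini') measurable
      also have "\<dots> \<le> (\<integral>\<^sup>+u. (\<integral>\<^sup>+y. ennreal (lam * (2 * ?r) powr b) * (ennreal ((f u - f y)\<^sup>2 * norm (u - y) powr (- b)) * indicator D y * indicator D u)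
           + ennreal (\<nu> / lam) * \<mu> u * indicator (cball u (2 * ?r)) y \<partial>lborel) \<partial>lborel)"
      proof (intro nn_integral_mono)
        fix u y
        let ?lhs = "\<integral>\<^sup>+x. ennreal \<bar>f u - f y\<bar> * indicator (cball x ?r) u * indicator (cball x ?r) y * a x \<partial>lborel"
        show "?lhs \<le> ennreal (lam * (2 * ?r) powr b) * (ennreal ((f u - f y)\<^sup>2 * norm (u - y) powr (- b)) * indicator D y * indicator D u)
           + ennreal (\<nu> / lam) * \<mu> u * indicator (cball u (2 * ?r)) y"
        proof (cases "\<exists>x. a x \<noteq> 0 \<and> u \<in> cball x ?r \<and> y \<in> cball x ?r")
          case True
          then obtain x where x: "a x \<noteq> 0" "u \<in> cball x ?r" "y \<in> cball x ?r" by blast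
          have "cball x ?r \<subseteq> D" using supp[OF x(1)] \<rho>(2)[of k] by auto
          then have uD: "u \<in> D" "y \<in> D" using x by auto
          have uy: "norm (u - y) \<le> 2 * ?r"
            using x dist_triangle[of u y x] by (simp add: dist_norm norm_minus_commute)
          have "?lhs \<le> (\<integral>\<^sup>+x. ennreal \<bar>f u - f y\<bar> * (a x * indicator (cball u ?r) x) \<partial>lborel)"
            by (intro nn_integral_mono) (auto simp: indicator_def dist_commute)
          also have "\<dots> = ennreal \<bar>f u - f y\<bar> * \<mu> u"
            unfolding \<mu>_def by (rule nn_integral_cmult) measurable
          \<comment> \<open>Young produces \<mu>^2 / lam. One factor \<mu> is replaced by its Morrey
            bound \<nu>; the other is kept, because its integral over \<open>u\<close> is the total
            mass times a volume.\<close>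
          also have "\<dots> \<le> ennreal (lam * (f u - f y)\<^sup>2) + ennreal (\<nu> / lam) * \<mu> u"
          proof -
            obtain t where t: "\<mu> u = ennreal t" "0 \<le> t" "t \<le> \<nu>"
              using \<mu>\<nu>[of u] \<nu> by (cases "\<mu> u") (auto simp: ennreal_le_iff top_unique)
            have "0 \<le> (lam * \<bar>f u - f y\<bar> - t)\<^sup>2 / lam" using lam by simp
            also have "\<dots> = lam * (f u - f y)\<^sup>2 + t * t / lam - 2 * (\<bar>f u - f y\<bar> * t)"
              using lam by (simp add: power2_diff power_mult_distrib field_simps) (simp add: power2_eq_square)
            finally have "2 * (\<bar>f u - f y\<bar> * t) \<le> lam * (f u - f y)\<^sup>2 + t * t / lam" by simp
            moreover have "t * t / lam \<le> \<nu> * t / lam" using t lam by (intro divide_right_mono mult_right_mono) auto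
            moreover have "0 \<le> \<bar>f u - f y\<bar> * t" using t by simp
            ultimately have "\<bar>f u - f y\<bar> * t \<le> lam * (f u - f y)\<^sup>2 + \<nu> / lam * t" by simp
            then have "ennreal (\<bar>f u - f y\<bar> * t) \<le> ennreal (lam * (f u - f y)\<^sup>2 + \<nu> / lam * t)" by (rule ennreal_leI)
            also have "\<dots> = ennreal (lam * (f u - f y)\<^sup>2) + ennreal (\<nu> / lam) * ennreal t"
            proof -
              have "0 \<le> lam * (f u - f y)\<^sup>2" "0 \<le> \<nu> / lam * t" using lam \<nu> t by auto
              moreover have "ennreal (\<nu> / lam * t) = ennreal (\<nu> / lam) * ennreal t"
                using lam \<nu> t by (intro ennreal_mult) auto
              ultimately show ?thesis by (simp only: ennreal_plus)
            qed
            finally show ?thesis using t by (simp add: ennreal_mult)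
          qed
          also have "ennreal (lam * (f u - f y)\<^sup>2) \<le> ennreal (lam * (2 * ?r) powr b) * (ennreal ((f u - f y)\<^sup>2 * norm (u - y) powr (- b)))"
          proof (cases "u = y")
            case False
            have "norm (u - y) powr b \<le> (2 * ?r) powr b" using uy b by (intro powr_mono2) auto
            then have "1 \<le> (2 * ?r) powr b * norm (u - y) powr (- b)" using False by (simp add: powr_minus field_simps)
            then have "lam * (f u - f y)\<^sup>2 * 1 \<le> lam * (f u - f y)\<^sup>2 * ((2 * ?r) powr b * norm (u - y) powr (- b))"
              using lam by (intro mult_left_mono) auto
            then show ?thesis using lam by (subst ennreal_mult[symmetric]) (auto simp: mult_ac intro!: ennreal_leI)
          qed simp
          finally show ?thesis using uD uy by (simp add: dist_norm add_right_mono)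
        next
          case False
          then have "?lhs = (\<integral>\<^sup>+x. 0 \<partial>(lborel :: 'a measure))" by (intro nn_integral_cong) (auto simp: indicator_def)
          then show ?thesis by simp
        qed
      qed
      also have "\<dots> = (\<integral>\<^sup>+u. ennreal (lam * (2 * ?r) powr b) * (\<integral>\<^sup>+y. ennreal ((f u - f y)\<^sup>2 * norm (u - y) powr (- b)) * indicator D y * indicator D u \<partial>lborel)
           + ennreal (\<nu> / lam) * ennreal (V * (2 * ?r) powr n) * \<mu> u \<partial>lborel)"
      proof (rule nn_integral_cong)
        fix u
        have "(\<integral>\<^sup>+y. ennreal (lam * (2 * ?r) powr b) * (ennreal ((f u - f y)\<^sup>2 * norm (u - y) powr (- b)) * indicator D y * indicator D u)
           + ennreal (\<nu> / lam) * \<mu> u * indicator (cball u (2 * ?r)) y \<partial>lborel)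
          = (\<integral>\<^sup>+y. ennreal (lam * (2 * ?r) powr b) * (ennreal ((f u - f y)\<^sup>2 * norm (u - y) powr (- b)) * indicator D y * indicator D u) \<partial>lborel)
           + (\<integral>\<^sup>+y. ennreal (\<nu> / lam) * \<mu> u * indicator (cball u (2 * ?r)) y \<partial>lborel)"
          by (rule nn_integral_add) measurable
        also have "(\<integral>\<^sup>+y. ennreal (lam * (2 * ?r) powr b) * (ennreal ((f u - f y)\<^sup>2 * norm (u - y) powr (- b)) * indicator D y * indicator D u) \<partial>lborel)
          = ennreal (lam * (2 * ?r) powr b) * (\<integral>\<^sup>+y. ennreal ((f u - f y)\<^sup>2 * norm (u - y) powr (- b)) * indicator D y * indicator D u \<partial>lborel)"
          by (rule nn_integral_cmult) measurable
        also have "(\<integral>\<^sup>+y. ennreal (\<nu> / lam) * \<mu> u * indicator (cball u (2 * ?r)) y \<partial>lborel) = ennreal (\<nu> / lam) * ennreal (V * (2 * ?r) powr n) * \<mu> u"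
          using \<rho>(1)[of k] by (subst nn_integral_cmult_indicator) (auto simp: vol mult_ac)
        finally show "(\<integral>\<^sup>+y. ennreal (lam * (2 * ?r) powr b) * (ennreal ((f u - f y)\<^sup>2 * norm (u - y) powr (- b)) * indicator D y * indicator D u)
           + ennreal (\<nu> / lam) * \<mu> u * indicator (cball u (2 * ?r)) y \<partial>lborel)
          = ennreal (lam * (2 * ?r) powr b) * (\<integral>\<^sup>+y. ennreal ((f u - f y)\<^sup>2 * norm (u - y) powr (- b)) * indicator D y * indicator D u \<partial>lborel)
           + ennreal (\<nu> / lam) * ennreal (V * (2 * ?r) powr n) * \<mu> u" .
      qed
      also have "\<dots> = ennreal (lam * (2 * ?r) powr b) * E + ennreal (\<nu> / lam * (V * (2 * ?r) powr n) * (m * (V * ?r powr n)))"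
      proof -
        have i1: "(\<integral>\<^sup>+u. ennreal (lam * (2 * ?r) powr b) * (\<integral>\<^sup>+y. ennreal ((f u - f y)\<^sup>2 * norm (u - y) powr (- b)) * indicator D y * indicator D u \<partial>lborel) \<partial>lborel)
          = ennreal (lam * (2 * ?r) powr b) * E" unfolding E_def by (rule nn_integral_cmult) measurable
        have i2: "(\<integral>\<^sup>+u. ennreal (\<nu> / lam) * ennreal (V * (2 * ?r) powr n) * \<mu> u \<partial>lborel) = ennreal (\<nu> / lam) * ennreal (V * (2 * ?r) powr n) * ennreal (m * (V * ?r powr n))"
          by (subst nn_integral_cmult) (auto simp: \<mu>_int)
        have i3: "ennreal (\<nu> / lam) * ennreal (V * (2 * ?r) powr n) * ennreal (m * (V * ?r powr n)) = ennreal (\<nu> / lam * (V * (2 * ?r) powr n) * (m * (V * ?r powr n)))"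
        proof -
          have nn: "0 \<le> \<nu> / lam" "0 \<le> V * (2 * ?r) powr n" "0 \<le> m * (V * ?r powr n)" using \<nu> lam V m by auto
          show ?thesis
            by (simp only: ennreal_mult[OF mult_nonneg_nonneg[OF nn(1,2)] nn(3)] ennreal_mult[OF nn(1,2)])
        qed
        show ?thesis
          by (subst i3[symmetric], subst i2[symmetric], subst i1[symmetric], rule nn_integral_add) measurable
      qed
      finally have QW: "(\<integral>\<^sup>+x. Q k x * a x \<partial>lborel) \<le> ennreal ?c * (ennreal (lam * (2 * ?r) powr b) * E + ennreal (\<nu> / lam * (V * (2 * ?r) powr n) * (m * (V * ?r powr n))))"
        unfolding Qc by (rule mult_left_mono) simp
      have vS: "v (Suc k) = V * (?r powr n / 2 powr n)"
        using \<rho>(1)[of k] by (simp add: v_def \<rho>_def powr_mult powr_divide)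
      have r2: "(2 * ?r) powr b = 2 powr b * ?r powr b" "(2 * ?r) powr n = 2 powr n * ?r powr n"
        using \<rho>(1)[of k] by (simp_all add: powr_mult)
      have rn: "?r powr n \<noteq> 0" "?r powr \<sigma> \<noteq> 0" using \<rho>(1)[of k] by simp_all
      have e1: "?c * (lam * (2 * ?r) powr b) = ?r powr \<gamma> * (c1 * T)"
      proof -
        have "\<gamma> = \<sigma> + b - (n + n)" by (simp add: \<gamma>_def \<sigma>_def field_simps)
        then have h: "?r powr \<gamma> = ?r powr \<sigma> * ?r powr b / (?r powr n * ?r powr n)"
          by (simp only: powr_add powr_diff)
        show ?thesis unfolding vS v_def[of k] lam_def c1_def r2 h using V rn by (simp add: power2_eq_square mult_ac)
      qed
      have e2: "?c * (\<nu> / lam * (V * (2 * ?r) powr n) * (m * (V * ?r powr n))) = ?r powr \<gamma> * (c2 / T)"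
      proof -
        have "\<gamma> = \<beta> - \<sigma>" by (simp add: \<gamma>_def \<sigma>_def field_simps)
        then have h: "?r powr \<gamma> = ?r powr \<beta> / ?r powr \<sigma>" by (simp only: powr_diff)
        show ?thesis unfolding vS v_def[of k] lam_def \<nu>_def c2_def r2 h using V T rn by (simp add: mult_ac)
      qed
      have "ennreal c * (ennreal A * E + ennreal B) = ennreal (c * A) * E + ennreal (c * B)" if "0 \<le> c" "0 \<le> A" "0 \<le> B" for c A B
        by (simp only: distrib_left ennreal_mult[OF that(1,2)] ennreal_mult[OF that(1,3)] mult.assoc)
      from this[OF c0, of "lam * (2 * ?r) powr b" "\<nu> / lam * (V * (2 * ?r) powr n) * (m * (V * ?r powr n))"]
      have "(\<integral>\<^sup>+x. Q k x * a x \<partial>lborel) \<le> ennreal (?r powr \<gamma> * (c1 * T)) * E + ennreal (?r powr \<gamma> * (c2 / T))"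
        using QW lam \<nu> V m unfolding e1 e2 by simp
      moreover have "ennreal (?r powr \<gamma> * (c1 * T)) = ennreal (?r powr \<gamma>) * ennreal (c1 * T)"
        by (rule ennreal_mult) (use c12 T in auto)
      moreover have "ennreal (?r powr \<gamma> * (c2 / T)) = ennreal (?r powr \<gamma>) * ennreal (c2 / T)"
        by (rule ennreal_mult) (use c12 T in auto)
      ultimately show ?thesis by (simp only: distrib_left mult.assoc)
    qed
    have sumS: "(\<Sum>k. ennreal (\<rho> k powr \<gamma>)) = ennreal S"
    proof (rule suminf_ennreal_eq)
      have "(\<lambda>k. rad powr \<gamma> * (2 powr (- \<gamma>)) ^ k) sums (rad powr \<gamma> * (1 / (1 - 2 powr (- \<gamma>))))"
        using two\<gamma> by (intro sums_mult geometric_sums) auto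
      moreover have "\<rho> k powr \<gamma> = rad powr \<gamma> * (2 powr (- \<gamma>)) ^ k" for k
        using rad by (simp add: \<rho>_def powr_mult power_powr_swap powr_minus_divide powr_divide)
      ultimately show "(\<lambda>k. \<rho> k powr \<gamma>) sums S" by (simp add: S_def)
    qed simp
    have "(\<integral>\<^sup>+x. ennreal \<bar>f x\<bar> * a x \<partial>lborel) \<le> (\<integral>\<^sup>+x. P x * a x + (\<Sum>k. Q k x * a x) \<partial>lborel)"
    proof (rule nn_integral_mono)
      fix x
      show "ennreal \<bar>f x\<bar> * a x \<le> P x * a x + (\<Sum>k. Q k x * a x)"
        using mult_right_mono[OF fx[of x], of "a x"] by (simp add: distrib_right ennreal_suminf_multc)
    qed
    also have "\<dots> = (\<integral>\<^sup>+x. P x * a x \<partial>lborel) + (\<integral>\<^sup>+x. (\<Sum>k. Q k x * a x) \<partial>lborel)"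
      by (rule nn_integral_add) measurable
    also have "(\<integral>\<^sup>+x. (\<Sum>k. Q k x * a x) \<partial>lborel) = (\<Sum>k. \<integral>\<^sup>+x. Q k x * a x \<partial>lborel)"
      by (rule nn_integral_suminf) measurable
    also have "(\<integral>\<^sup>+x. P x * a x \<partial>lborel) + \<dots> \<le> ennreal (m / v 0) * (ennreal T * F2 + ennreal (dD / T)) + (\<Sum>k. ennreal (\<rho> k powr \<gamma>) * (ennreal (c1 * T) * E + ennreal (c2 / T)))"
      by (intro add_mono aP suminf_le aQ) auto
    also have "\<dots> = ennreal (m / v 0) * (ennreal T * F2 + ennreal (dD / T)) + ennreal S * (ennreal (c1 * T) * E + ennreal (c2 / T))"
      by (simp add: ennreal_suminf_multc sumS)
    also have "\<dots> = ennreal (m / v 0) * (ennreal T * F2) + ennreal (S * c1) * (ennreal T * E) + (ennreal (m / v 0) * ennreal (dD / T) + ennreal S * ennreal (c2 / T))"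
      using S c12 T by (simp add: distrib_left ennreal_mult add_ac mult_ac)
    also have "\<dots> \<le> ennreal C * (ennreal T * F2) + ennreal C * (ennreal T * E) + ennreal C * ennreal (1 / T)"
    proof (intro add_mono mult_right_mono ennreal_leI)
      show "m / v 0 \<le> C" "S * c1 \<le> C" using C m v[of 0] dD S c12 by (auto simp: C_def)
      have "ennreal (m / v 0) * ennreal (dD / T) + ennreal S * ennreal (c2 / T) = ennreal ((m * dD / v 0 + S * c2) * (1 / T))"
        using m v[of 0] dD T S c12 by (simp add: ennreal_mult'[symmetric] ennreal_plus[symmetric] distrib_right add_divide_distrib del: ennreal_plus)
      also have "\<dots> \<le> ennreal (C * (1 / T))" using C T by (intro ennreal_leI mult_right_mono) auto
      also have "\<dots> = ennreal C * ennreal (1 / T)" using C T by (simp add: ennreal_mult'[symmetric])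
      finally show "ennreal (m / v 0) * ennreal (dD / T) + ennreal S * ennreal (c2 / T) \<le> ennreal C * ennreal (1 / T)" .
    qed auto
    also have "\<dots> = ennreal C * (ennreal T * (F2 + E) + ennreal (1 / T))" by (simp add: distrib_left)
    finally show "(\<integral>\<^sup>+x. ennreal \<bar>f x\<bar> * a x \<partial>lborel) \<le> ennreal C * (ennreal T * ((\<integral>\<^sup>+x\<in>D. ennreal ((f x)\<^sup>2) \<partial>lborel)
      + (\<integral>\<^sup>+z\<in>D \<times> D. ennreal ((f (fst z) - f (snd z))\<^sup>2 * norm (fst z - snd z) powr (- b)) \<partial>(lborel \<Otimes>\<^sub>M lborel))) + ennreal (1 / T))"
      by (simp add: F2_def E_eq)
  qed
qed

lemma has_bochner_integral_L1_limit:
  fixes F :: "'m \<Rightarrow> real"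
  assumes [measurable]: "F \<in> borel_measurable M"
    and approx: "\<And>\<epsilon>. 0 < \<epsilon> \<Longrightarrow> \<exists>f. has_bochner_integral M f 0 \<and> (\<integral>\<^sup>+x. ennreal \<bar>f x - F x\<bar> \<partial>M) \<le> ennreal \<epsilon>"
  shows "has_bochner_integral M F 0"
proof -
  have diff: "\<exists>f. has_bochner_integral M f 0 \<and> integrable M (\<lambda>x. f x - F x) \<and> (\<integral>x. \<bar>f x - F x\<bar> \<partial>M) \<le> \<epsilon>" if \<epsilon>: "0 < \<epsilon>" for \<epsilon>
  proof -
    obtain f where f: "has_bochner_integral M f 0" "(\<integral>\<^sup>+x. ennreal \<bar>f x - F x\<bar> \<partial>M) \<le> ennreal \<epsilon>"
      using approx[OF \<epsilon>] by blast
    have [measurable]: "f \<in> borel_measurable M" using f(1) by (auto simp: has_bochner_integral_iff)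
    have i: "integrable M (\<lambda>x. f x - F x)"
      using f(2) by (intro integrableI_bounded) (auto intro: le_less_trans)
    then have "ennreal (\<integral>x. \<bar>f x - F x\<bar> \<partial>M) \<le> ennreal \<epsilon>"
      using f(2) by (subst nn_integral_eq_integral[symmetric]) auto
    then show ?thesis using f i \<epsilon> by (auto simp: ennreal_le_iff)
  qed
  obtain f where f: "has_bochner_integral M f 0" "integrable M (\<lambda>x. f x - F x)" using diff[of 1] by auto
  have "integrable M (\<lambda>x. f x - (f x - F x))"
    by (rule Bochner_Integration.integrable_diff[OF _ f(2)]) (use f(1) in \<open>simp add: has_bochner_integral_iff\<close>)
  then have Fi: "integrable M F" by simp
  have "\<bar>\<integral>x. F x \<partial>M\<bar> \<le> \<epsilon>" if \<epsilon>: "0 < \<epsilon>" for \<epsilon>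
  proof -
    obtain f where f: "has_bochner_integral M f 0" "integrable M (\<lambda>x. f x - F x)" "(\<integral>x. \<bar>f x - F x\<bar> \<partial>M) \<le> \<epsilon>"
      using diff[OF \<epsilon>] by blast
    have "\<bar>\<integral>x. F x \<partial>M\<bar> = \<bar>\<integral>x. f x - F x \<partial>M\<bar>" using f Fi by (simp add: has_bochner_integral_iff)
    also have "\<dots> \<le> (\<integral>x. \<bar>f x - F x\<bar> \<partial>M)" by (rule integral_abs_bound)
    finally show ?thesis using f(3) by simp
  qed
  then have "\<bar>\<integral>x. F x \<partial>M\<bar> \<le> 0" by (rule field_le_epsilon[of _ 0, simplified])
  then show ?thesis using Fi by (simp add: has_bochner_integral_iff)
qed

context directed_solution
begin

lemma w_bounded: "AE x in lborel. \<bar>w x\<bar> \<le> L"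
  using w_AE
proof eventually_elim
  case (elim x)
  have "(\<lambda>k. \<bar>W (hseq k) x\<bar>) \<longlonglongrightarrow> \<bar>w x\<bar>" by (intro tendsto_rabs W_tendsto elim)
  then show ?case
    by (rule tendsto_upperbound) (auto intro!: always_eventually bl_funD(1)[OF W_bl[OF hseq(1)]])
qed

text \<open>The weight that the far interaction puts on the points of the ball of radius
  \<open>R2\<close>. A gap between \<open>R2\<close> and \<open>R3\<close> keeps |x - y| away from
  0, so that \<open>J_far\<close> gives the Morrey bound.\<close>

definition far_mass :: "real \<Rightarrow> real \<Rightarrow> 'a \<Rightarrow> ennreal" where
  "far_mass R2 R3 x = indicator (cball 0 R2) x * (\<integral>\<^sup>+y\<in>- ball 0 R3. ennreal (J x y) \<partial>lborel)"

lemma far_mass_meas [measurable]: "far_mass R2 R3 \<in> borel_measurable borel"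
  unfolding far_mass_def by measurable

lemma far_mass_bound:
  assumes R: "0 \<le> R2" "R2 < R3" "R2 < r0"
  obtains M where "0 \<le> M"
    "\<And>u r. 0 < r \<Longrightarrow> (\<integral>\<^sup>+x\<in>cball u r. far_mass R2 R3 x \<partial>lborel) \<le> ennreal (M * r powr (n + p - 2))"
    "(\<integral>\<^sup>+x. far_mass R2 R3 x \<partial>lborel) < \<infinity>"
proof -
  define M where "M = (p - 1) * slab_const * (1 - R2 / R3) powr (- N) * tail_const TYPE('a) N R3"
  have M0: "0 \<le> M" using p slab_const_nonneg by (simp add: M_def tail_const_def)
  have le: "(\<integral>\<^sup>+x\<in>cball u r. far_mass R2 R3 x \<partial>lborel) \<le> ennreal (M * r powr (n + p - 2))" if "0 < r" for u r
  proof -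
    have "(\<integral>\<^sup>+x\<in>cball u r. far_mass R2 R3 x \<partial>lborel)
        = (\<integral>\<^sup>+x\<in>cball 0 R2 \<inter> cball u r. (\<integral>\<^sup>+y\<in>- ball 0 R3. ennreal (J x y) \<partial>lborel) \<partial>lborel)"
      by (intro nn_integral_cong) (auto simp: far_mass_def indicator_def)
    also have "\<dots> \<le> ennreal (M * r powr (n + p - 2))"
      unfolding M_def by (rule J_far[where R = R2]) (use R that in auto)
    finally show ?thesis .
  qed
  have "(\<integral>\<^sup>+x. far_mass R2 R3 x \<partial>lborel) = (\<integral>\<^sup>+x\<in>cball 0 r0. far_mass R2 R3 x \<partial>lborel)"
    using R by (intro nn_integral_cong) (auto simp: far_mass_def indicator_def)
  also have "\<dots> < \<infinity>" by (rule le_less_trans[OF le[OF r0]]) simp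
  finally show ?thesis using that M0 le by blast
qed

text \<open>With b = n + \<tau> and \<beta> = n + p - 2 the requirement 2 n < b + \<beta> reads n <
  N, that is sp > 0: the far interaction is subcritical for the order \<tau>.\<close>

lemma far_pairing:
  assumes R: "0 \<le> R2" "R2 < R3" "R2 < r0"
  obtains C where "0 \<le> C" "\<And>f T. continuous_on UNIV f \<Longrightarrow> 0 < T \<Longrightarrow>
    (\<integral>\<^sup>+x. ennreal \<bar>f x\<bar> * far_mass R2 R3 x \<partial>lborel) \<le> ennreal C * (ennreal T * ((\<integral>\<^sup>+x\<in>ball 0 r0. ennreal ((f x)\<^sup>2) \<partial>lborel)
      + (\<integral>\<^sup>+z\<in>ball 0 r0 \<times> ball 0 r0. ennreal ((f (fst z) - f (snd z))\<^sup>2 * norm (fst z - snd z) powr (- (N - p + 2))) \<partial>(lborel \<Otimes>\<^sub>M lborel))) + ennreal (1 / T))"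
proof -
  obtain M where M: "0 \<le> M" "\<And>u r. 0 < r \<Longrightarrow> (\<integral>\<^sup>+x\<in>cball u r. far_mass R2 R3 x \<partial>lborel) \<le> ennreal (M * r powr (n + p - 2))"
    "(\<integral>\<^sup>+x. far_mass R2 R3 x \<partial>lborel) < \<infinity>"
    by (rule far_mass_bound[OF R], rule that)
  show ?thesis
  proof (rule morrey_kato_inequality[where a = "far_mass R2 R3" and D = "ball 0 r0" and b = "N - p + 2" and \<beta> = "n + p - 2" and rad = "(r0 - R2) / 2" and M = M])
    show "emeasure lborel (ball (0::'a) r0) < \<infinity>" using r0 by (simp add: emeasure_ball)
    show "0 < (r0 - R2) / 2" using R by simp
    show "cball x ((r0 - R2) / 2) \<subseteq> ball 0 r0" if "far_mass R2 R3 x \<noteq> 0" for x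
    proof
      fix y assume "y \<in> cball x ((r0 - R2) / 2)"
      moreover have "norm x \<le> R2" using that by (auto simp: far_mass_def indicator_def split: if_splits)
      moreover have "norm y \<le> norm x + dist x y" by (metis dist_norm norm_minus_commute norm_triangle_sub)
      ultimately show "y \<in> ball 0 r0" using R by simp
    qed
    show "0 \<le> N - p + 2" using sp_bounds p by linarith
    show "2 * real DIM('a) < N - p + 2 + (n + p - 2)" using sp_bounds by simp
  qed (use M that in auto)
qed

text \<open>Leibniz splitting into \<eta>(x) (h x - h y) and h(y) (\<eta>(x) - \<eta>(y)). The
  second part is integrated over \<open>x\<close> first, where \<open>J_mm_section\<close> bounds
  \<open>J\<close> against the squared increment of \<eta> uniformly in \<open>y\<close> and leaves
  the L^2 norm of \<open>h\<close>.\<close>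

lemma cutoff_energy:
  assumes bl: "bl_fun B K \<eta>" and supp: "\<And>x. r0 < norm x \<Longrightarrow> \<eta> x = 0"
  obtains C where "0 \<le> C" "\<And>h. h \<in> borel_measurable borel \<Longrightarrow>
    (\<integral>\<^sup>+z\<in>ball 0 r0 \<times> ball 0 r0. ennreal (J (fst z) (snd z) * (\<eta> (fst z) * h (fst z) - \<eta> (snd z) * h (snd z))\<^sup>2) \<partial>(lborel \<Otimes>\<^sub>M lborel))
      \<le> ennreal C * ((\<integral>\<^sup>+x\<in>ball 0 r0. ennreal ((h x)\<^sup>2) \<partial>lborel) +
        (\<integral>\<^sup>+z\<in>ball 0 r0 \<times> ball 0 r0. ennreal (J (fst z) (snd z) * (h (fst z) - h (snd z))\<^sup>2) \<partial>(lborel \<Otimes>\<^sub>M lborel)))"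
proof -
  let ?D = "ball (0::'a) r0"
  obtain C0 where C0: "0 \<le> C0" "\<And>y. (\<integral>\<^sup>+x\<in>cball 0 r0. ennreal (J x y * mm x y) \<partial>lborel) \<le> ennreal C0"
    by (rule J_mm_section, rule that)
  have [measurable]: "\<eta> \<in> borel_measurable borel" using bl_funD(5)[OF bl] by (rule borel_measurable_continuous_onI)
  define d where "d = 2 * (4 * B\<^sup>2 + K\<^sup>2)"
  have d: "0 \<le> d" by (simp add: d_def)
  define b2 where "b2 = 2 * B\<^sup>2"
  have b2: "0 \<le> b2" by (simp add: b2_def)
  show ?thesis
  proof (rule that[of "b2 + d * C0"])
    show "0 \<le> b2 + d * C0" using b2 d C0 by simp
    fix h :: "'a \<Rightarrow> real" assume [measurable]: "h \<in> borel_measurable borel"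
    define H where "H = (\<integral>\<^sup>+x\<in>?D. ennreal ((h x)\<^sup>2) \<partial>lborel)"
    define E where "E = (\<integral>\<^sup>+z\<in>?D \<times> ?D. ennreal (J (fst z) (snd z) * (h (fst z) - h (snd z))\<^sup>2) \<partial>(lborel \<Otimes>\<^sub>M lborel))"
    have pt: "ennreal (J x y * (\<eta> x * h x - \<eta> y * h y)\<^sup>2) \<le> ennreal b2 * ennreal (J x y * (h x - h y)\<^sup>2) + ennreal d * (ennreal ((h y)\<^sup>2) * ennreal (J x y * mm x y))"
      if "x \<in> ?D" for x y
    proof -
      have "(\<eta> x * h x - \<eta> y * h y)\<^sup>2 \<le> 2 * (\<eta> x * (h x - h y))\<^sup>2 + 2 * (h y * (\<eta> x - \<eta> y))\<^sup>2"
      proof -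
        have "\<eta> x * h x - \<eta> y * h y = \<eta> x * (h x - h y) + h y * (\<eta> x - \<eta> y)" by (simp add: algebra_simps)
        moreover have "(s + t)\<^sup>2 \<le> 2 * s\<^sup>2 + 2 * t\<^sup>2" for s t :: real
        proof -
          have "2 * s\<^sup>2 + 2 * t\<^sup>2 - (s + t)\<^sup>2 = (s - t)\<^sup>2" by (simp add: power2_eq_square algebra_simps)
          then show ?thesis by (smt (verit) zero_le_power2)
        qed
        ultimately show ?thesis by simp
      qed
      also have "\<dots> \<le> b2 * (h x - h y)\<^sup>2 + (h y)\<^sup>2 * (d * mm x y)"
      proof (rule add_mono)
        have "(\<eta> x)\<^sup>2 \<le> B\<^sup>2" using power_mono[OF bl_funD(1)[OF bl, of x] abs_ge_zero, of 2] by simp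
        then show "2 * (\<eta> x * (h x - h y))\<^sup>2 \<le> b2 * (h x - h y)\<^sup>2"
          unfolding b2_def power_mult_distrib by (simp add: mult_right_mono)
        have "(\<eta> x - \<eta> y)\<^sup>2 \<le> (4 * B\<^sup>2 + K\<^sup>2) * mm x y * of_bool (x \<in> cball 0 r0 \<or> y \<in> cball 0 r0)"
          by (rule square_diff_le_mm[OF bl supp])
        also have "\<dots> = (4 * B\<^sup>2 + K\<^sup>2) * mm x y" using that by simp
        finally have "(h y)\<^sup>2 * (2 * (\<eta> x - \<eta> y)\<^sup>2) \<le> (h y)\<^sup>2 * (d * mm x y)"
          unfolding d_def mult.assoc by (intro mult_left_mono zero_le_power2 zero_le_numeral)
        then show "2 * (h y * (\<eta> x - \<eta> y))\<^sup>2 \<le> (h y)\<^sup>2 * (d * mm x y)"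
          by (simp add: power_mult_distrib mult_ac)
      qed
      finally have "J x y * (\<eta> x * h x - \<eta> y * h y)\<^sup>2 \<le> J x y * (b2 * (h x - h y)\<^sup>2 + (h y)\<^sup>2 * (d * mm x y))"
        by (rule mult_left_mono) (rule J_nonneg)
      also have "\<dots> = b2 * (J x y * (h x - h y)\<^sup>2) + d * ((h y)\<^sup>2 * (J x y * mm x y))"
        by (simp add: algebra_simps)
      finally have "ennreal (J x y * (\<eta> x * h x - \<eta> y * h y)\<^sup>2) \<le> ennreal (b2 * (J x y * (h x - h y)\<^sup>2) + d * ((h y)\<^sup>2 * (J x y * mm x y)))"
        by (rule ennreal_leI)
      also have "\<dots> = ennreal b2 * ennreal (J x y * (h x - h y)\<^sup>2) + ennreal d * (ennreal ((h y)\<^sup>2) * ennreal (J x y * mm x y))"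
        using b2 d J_nonneg[of x y] mm_nonneg[of x y]
        by (subst ennreal_plus) (auto simp: ennreal_mult)
      finally show ?thesis .
    qed
    have "(\<integral>\<^sup>+z\<in>?D \<times> ?D. ennreal (J (fst z) (snd z) * (\<eta> (fst z) * h (fst z) - \<eta> (snd z) * h (snd z))\<^sup>2) \<partial>(lborel \<Otimes>\<^sub>M lborel))
      \<le> (\<integral>\<^sup>+z. ennreal b2 * (ennreal (J (fst z) (snd z) * (h (fst z) - h (snd z))\<^sup>2) * indicator (?D \<times> ?D) z)
           + ennreal d * (ennreal (J (fst z) (snd z) * mm (fst z) (snd z)) * indicator (cball 0 r0) (fst z) * (ennreal ((h (snd z))\<^sup>2) * indicator ?D (snd z))) \<partial>(lborel \<Otimes>\<^sub>M lborel))"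
    proof (rule nn_integral_mono)
      fix z :: "'a \<times> 'a"
      show "ennreal (J (fst z) (snd z) * (\<eta> (fst z) * h (fst z) - \<eta> (snd z) * h (snd z))\<^sup>2) * indicator (?D \<times> ?D) z
        \<le> ennreal b2 * (ennreal (J (fst z) (snd z) * (h (fst z) - h (snd z))\<^sup>2) * indicator (?D \<times> ?D) z)
           + ennreal d * (ennreal (J (fst z) (snd z) * mm (fst z) (snd z)) * indicator (cball 0 r0) (fst z) * (ennreal ((h (snd z))\<^sup>2) * indicator ?D (snd z)))"
      proof (cases "z \<in> ?D \<times> ?D")
        case True
        then have "fst z \<in> ?D" "snd z \<in> ?D" "fst z \<in> cball 0 r0" by auto
        then show ?thesis using pt[of "fst z" "snd z"] True by (simp add: mult_ac del: mem_ball mem_cball)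
      qed simp
    qed
    also have "\<dots> = ennreal b2 * E + ennreal d * (\<integral>\<^sup>+z. ennreal (J (fst z) (snd z) * mm (fst z) (snd z)) * indicator (cball 0 r0) (fst z) * (ennreal ((h (snd z))\<^sup>2) * indicator ?D (snd z)) \<partial>(lborel \<Otimes>\<^sub>M lborel))"
      unfolding E_def
      by (subst nn_integral_add, measurable, subst nn_integral_cmult, measurable, subst nn_integral_cmult) measurable
    also have "\<dots> \<le> ennreal b2 * E + ennreal d * (ennreal C0 * H)"
    proof (intro add_left_mono mult_left_mono)
      have "(\<integral>\<^sup>+z. ennreal (J (fst z) (snd z) * mm (fst z) (snd z)) * indicator (cball 0 r0) (fst z) * (ennreal ((h (snd z))\<^sup>2) * indicator ?D (snd z)) \<partial>(lborel \<Otimes>\<^sub>M lborel))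
        = (\<integral>\<^sup>+y. (\<integral>\<^sup>+x. ennreal (J x y * mm x y) * indicator (cball 0 r0) x * (ennreal ((h y)\<^sup>2) * indicator ?D y) \<partial>lborel) \<partial>lborel)"
        by (subst lborel_pair.nn_integral_snd[symmetric]) auto
      also have "\<dots> = (\<integral>\<^sup>+y. (\<integral>\<^sup>+x\<in>cball 0 r0. ennreal (J x y * mm x y) \<partial>lborel) * (ennreal ((h y)\<^sup>2) * indicator ?D y) \<partial>lborel)"
        by (intro nn_integral_cong nn_integral_multc) measurable
      also have "\<dots> \<le> (\<integral>\<^sup>+y. ennreal C0 * (ennreal ((h y)\<^sup>2) * indicator ?D y) \<partial>lborel)"
        by (intro nn_integral_mono mult_right_mono C0) simp
      also have "\<dots> = ennreal C0 * H" unfolding H_def by (rule nn_integral_cmult) measurable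
      finally show "(\<integral>\<^sup>+z. ennreal (J (fst z) (snd z) * mm (fst z) (snd z)) * indicator (cball 0 r0) (fst z) * (ennreal ((h (snd z))\<^sup>2) * indicator ?D (snd z)) \<partial>(lborel \<Otimes>\<^sub>M lborel))
        \<le> ennreal C0 * H" .
    qed simp
    also have "\<dots> \<le> ennreal (b2 + d * C0) * (H + E)"
    proof -
      have "ennreal (b2 + d * C0) = ennreal b2 + ennreal d * ennreal C0" using b2 d C0 by (simp add: ennreal_mult)
      then have "ennreal (b2 + d * C0) * (H + E) = (ennreal b2 * E + ennreal d * (ennreal C0 * H)) + (ennreal b2 * H + ennreal d * (ennreal C0 * E))"
        by (simp add: algebra_simps)
      then show ?thesis by simp
    qed
    finally show "(\<integral>\<^sup>+z\<in>?D \<times> ?D. ennreal (J (fst z) (snd z) * (\<eta> (fst z) * h (fst z) - \<eta> (snd z) * h (snd z))\<^sup>2) \<partial>(lborel \<Otimes>\<^sub>M lborel))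
      \<le> ennreal (b2 + d * C0) * ((\<integral>\<^sup>+x\<in>?D. ennreal ((h x)\<^sup>2) \<partial>lborel) +
        (\<integral>\<^sup>+z\<in>?D \<times> ?D. ennreal (J (fst z) (snd z) * (h (fst z) - h (snd z))\<^sup>2) \<partial>(lborel \<Otimes>\<^sub>M lborel)))"
      by (simp add: H_def E_def)
  qed
qed

text \<open>If both points lie within \<open>R3\<close>, Young's inequality uses the finite energy
  of \<open>w\<close> cut off beyond \<open>R3\<close>. Otherwise one point lies at distance at
  least \<open>R3\<close> from the origin, where \<open>g\<close> vanishes, and |w| <= L leaves the
  weight \<open>far_mass\<close>. The free \<open>T\<close> makes the energy of \<open>w\<close>,
  which is not small, negligible.\<close>

lemma pairing_bound:
  assumes R: "0 \<le> R2" "R2 < R3" "R3 < r0"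
  obtains C where "0 \<le> C" "\<And>g T. g \<in> borel_measurable borel \<Longrightarrow> (\<And>x. R2 < norm x \<Longrightarrow> g x = 0) \<Longrightarrow> 0 < T \<Longrightarrow>
    (\<integral>\<^sup>+z. ennreal \<bar>J (fst z) (snd z) * (w (fst z) - w (snd z)) * (g (fst z) - g (snd z))\<bar> \<partial>(lborel \<Otimes>\<^sub>M lborel))
      \<le> ennreal (C / T) + ennreal T * (\<integral>\<^sup>+z\<in>ball 0 r0 \<times> ball 0 r0. ennreal (J (fst z) (snd z) * (g (fst z) - g (snd z))\<^sup>2) \<partial>(lborel \<Otimes>\<^sub>M lborel))
        + ennreal C * (\<integral>\<^sup>+x. ennreal \<bar>g x\<bar> * far_mass R2 R3 x \<partial>lborel)"
proof -
  let ?D = "ball (0::'a) r0"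
  define \<eta> where "\<eta> x = max 0 (min 1 ((r0 - norm x) / (r0 - R3)))" for x :: 'a
  have \<eta>: "bl_fun 1 (1 / (r0 - R3)) \<eta>" unfolding \<eta>_def using R by (intro bl_fun_cutoff) auto
  have \<eta>0: "\<eta> x = 0" if "r0 < norm x" for x using that R by (simp add: \<eta>_def divide_nonpos_pos)
  have \<eta>1: "\<eta> x = 1" if "norm x \<le> R3" for x using that R by (simp add: \<eta>_def)
  have [measurable]: "\<eta> \<in> borel_measurable borel" using bl_funD(5)[OF \<eta>] by (rule borel_measurable_continuous_onI)
  define E where "E z = J (fst z) (snd z) * (\<eta> (fst z) * w (fst z) - \<eta> (snd z) * w (snd z))\<^sup>2" for z
  have E0: "0 \<le> E z" for z by (simp add: E_def J_nonneg)
  have [measurable]: "E \<in> borel_measurable (lborel \<Otimes>\<^sub>M lborel)" unfolding E_def by measurable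
  obtain Cw where Cw: "(\<integral>\<^sup>+z. ennreal (E z) \<partial>(lborel \<Otimes>\<^sub>M lborel)) = ennreal Cw" "0 \<le> Cw"
  proof -
    have "(\<integral>\<^sup>+z. ennreal (E z) \<partial>(lborel \<Otimes>\<^sub>M lborel)) < \<infinity>"
      unfolding E_def by (rule energy_finite[OF \<eta>], erule \<eta>0)
    then show ?thesis using that by (cases "\<integral>\<^sup>+z. ennreal (E z) \<partial>(lborel \<Otimes>\<^sub>M lborel)") auto
  qed
  show ?thesis
  \<comment> \<open>\<open>Cw\<close> is the energy of the cut-off \<open>w\<close>; 4 L is the
    bound 2 L for its increments, counted for the two symmetric far regions.\<close>
  proof (rule that[of "Cw + 4 * L"])
    show "0 \<le> Cw + 4 * L" using Cw L by simp
    fix g :: "'a \<Rightarrow> real" and T :: real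
    assume [measurable]: "g \<in> borel_measurable borel" and g0: "\<And>x. R2 < norm x \<Longrightarrow> g x = 0" and T: "0 < T"
    define G where "G z = ennreal (J (fst z) (snd z) * (g (fst z) - g (snd z))\<^sup>2) * indicator (?D \<times> ?D) z" for z
    define P where "P x y = ennreal \<bar>g x\<bar> * indicator (cball 0 R2) x * (ennreal (J x y) * indicator (- ball 0 R3) y)" for x y
    have [measurable]: "G \<in> borel_measurable (lborel \<Otimes>\<^sub>M lborel)" "(\<lambda>z. P (fst z) (snd z)) \<in> borel_measurable (lborel \<Otimes>\<^sub>M lborel)"
      "(\<lambda>z. P (snd z) (fst z)) \<in> borel_measurable (lborel \<Otimes>\<^sub>M lborel)"
      unfolding G_def P_def by measurable
    have Pint: "(\<integral>\<^sup>+x. (\<integral>\<^sup>+y. P x y \<partial>lborel) \<partial>lborel) = (\<integral>\<^sup>+x. ennreal \<bar>g x\<bar> * far_mass R2 R3 x \<partial>lborel)"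
    proof (rule nn_integral_cong)
      fix x
      have "(\<integral>\<^sup>+y. P x y \<partial>lborel) = (ennreal \<bar>g x\<bar> * indicator (cball 0 R2) x) * (\<integral>\<^sup>+y\<in>- ball 0 R3. ennreal (J x y) \<partial>lborel)"
        unfolding P_def by (rule nn_integral_cmult) measurable
      then show "(\<integral>\<^sup>+y. P x y \<partial>lborel) = ennreal \<bar>g x\<bar> * far_mass R2 R3 x" by (simp add: far_mass_def mult.assoc)
    qed
    have side: "ennreal \<bar>J x y * (w x - w y) * (g x - g y)\<bar> \<le> ennreal (2 * L) * P x y"
      if w: "\<bar>w x\<bar> \<le> L" "\<bar>w y\<bar> \<le> L" and y: "R3 \<le> norm y" for x y
    proof (cases "norm x \<le> R2")
      case True
      have gy: "g y = 0" using y R by (intro g0) simp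
      have "\<bar>w x - w y\<bar> \<le> 2 * L" using w by linarith
      then have "\<bar>w x - w y\<bar> * (\<bar>g x\<bar> * J x y) \<le> 2 * L * (\<bar>g x\<bar> * J x y)"
        by (rule mult_right_mono) (simp add: J_nonneg)
      then have "ennreal \<bar>J x y * (w x - w y) * (g x - g y)\<bar> \<le> ennreal (2 * L * (\<bar>g x\<bar> * J x y))"
        using gy by (intro ennreal_leI) (simp add: abs_mult J_nonneg mult_ac)
      also have "\<dots> = ennreal (2 * L) * (ennreal \<bar>g x\<bar> * ennreal (J x y))"
        using L J_nonneg[of x y] ennreal_mult[of "2 * L" "\<bar>g x\<bar> * J x y"] ennreal_mult[of "\<bar>g x\<bar>" "J x y"] by simp
      also have "\<dots> = ennreal (2 * L) * P x y" using True y by (simp add: P_def)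
      finally show ?thesis .
    next
      case False
      then have "g x = 0" "g y = 0" using y R by (auto intro!: g0)
      then show ?thesis by simp
    qed
    have "AE z in lborel \<Otimes>\<^sub>M lborel. ennreal \<bar>J (fst z) (snd z) * (w (fst z) - w (snd z)) * (g (fst z) - g (snd z))\<bar>
       \<le> ennreal (1 / T) * ennreal (E z) + ennreal T * G z + (ennreal (2 * L) * P (fst z) (snd z) + ennreal (2 * L) * P (snd z) (fst z))"
      using AE_lborel_pair[OF w_bounded]
    proof eventually_elim
      case (elim z)
      obtain x y where z: "z = (x, y)" by (cases z)
      consider "R3 \<le> norm y" | "R3 \<le> norm x" | "norm x < R3" "norm y < R3" by linarith
      then show ?case
      proof cases
        case 1
        then have "ennreal \<bar>J x y * (w x - w y) * (g x - g y)\<bar> \<le> ennreal (2 * L) * P x y" using elim by (intro side) (auto simp: z)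
        then show ?thesis by (simp add: z add_increasing add_increasing2)
      next
        case 2
        then have "ennreal \<bar>J y x * (w y - w x) * (g y - g x)\<bar> \<le> ennreal (2 * L) * P y x" using elim by (intro side) (auto simp: z)
        then have "ennreal \<bar>J x y * (w x - w y) * (g x - g y)\<bar> \<le> ennreal (2 * L) * P y x"
          by (simp add: J_sym[of y x] abs_mult abs_minus_commute)
        then show ?thesis by (simp add: z add_increasing add_increasing2)
      next
        case 3
        have "\<bar>s * t\<bar> \<le> s\<^sup>2 / T + T * t\<^sup>2" for s t :: real
        proof -
          have "0 \<le> (\<bar>s\<bar> / T - \<bar>t\<bar>)\<^sup>2 * T" using T by simp
          also have "\<dots> = s\<^sup>2 / T - 2 * \<bar>s * t\<bar> + T * t\<^sup>2"
            using T by (simp add: power2_eq_square field_simps abs_mult)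
          finally show ?thesis by simp
        qed
        then have "J x y * \<bar>(w x - w y) * (g x - g y)\<bar> \<le> J x y * ((w x - w y)\<^sup>2 / T + T * (g x - g y)\<^sup>2)"
          by (intro mult_left_mono J_nonneg)
        also have "\<dots> = 1 / T * E z + T * (J x y * (g x - g y)\<^sup>2)"
          using 3 \<eta>1[of x] \<eta>1[of y] by (simp add: z E_def distrib_left mult_ac)
        finally have "ennreal \<bar>J x y * (w x - w y) * (g x - g y)\<bar> \<le> ennreal (1 / T * E z + T * (J x y * (g x - g y)\<^sup>2))"
          by (intro ennreal_leI) (simp add: abs_mult J_nonneg mult.assoc)
        also have "\<dots> = ennreal (1 / T) * ennreal (E z) + ennreal T * ennreal (J x y * (g x - g y)\<^sup>2)"
        proof -
          have "ennreal (1 / T * E z) = ennreal (1 / T) * ennreal (E z)" using T E0 by (intro ennreal_mult) auto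
          moreover have "ennreal (T * (J x y * (g x - g y)\<^sup>2)) = ennreal T * ennreal (J x y * (g x - g y)\<^sup>2)"
            using T by (intro ennreal_mult) (auto simp: J_nonneg)
          moreover have "0 \<le> 1 / T * E z" "0 \<le> T * (J x y * (g x - g y)\<^sup>2)" using T E0[of z] by (auto simp: J_nonneg)
          ultimately show ?thesis by (simp only: ennreal_plus)
        qed
        also have "\<dots> = ennreal (1 / T) * ennreal (E z) + ennreal T * G z" using 3 R by (simp add: G_def z)
        finally show ?thesis by (simp add: z add_increasing2)
      qed
    qed
    then have "(\<integral>\<^sup>+z. ennreal \<bar>J (fst z) (snd z) * (w (fst z) - w (snd z)) * (g (fst z) - g (snd z))\<bar> \<partial>(lborel \<Otimes>\<^sub>M lborel))
      \<le> (\<integral>\<^sup>+z. ennreal (1 / T) * ennreal (E z) + ennreal T * G z + (ennreal (2 * L) * P (fst z) (snd z) + ennreal (2 * L) * P (snd z) (fst z)) \<partial>(lborel \<Otimes>\<^sub>M lborel))"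
      by (rule nn_integral_mono_AE)
    also have "\<dots> = (ennreal (1 / T) * (\<integral>\<^sup>+z. ennreal (E z) \<partial>(lborel \<Otimes>\<^sub>M lborel)) + ennreal T * (\<integral>\<^sup>+z. G z \<partial>(lborel \<Otimes>\<^sub>M lborel)))
       + (ennreal (2 * L) * (\<integral>\<^sup>+z. P (fst z) (snd z) \<partial>(lborel \<Otimes>\<^sub>M lborel)) + ennreal (2 * L) * (\<integral>\<^sup>+z. P (snd z) (fst z) \<partial>(lborel \<Otimes>\<^sub>M lborel)))"
      by (simp add: nn_integral_add nn_integral_cmult)
    also have "(\<integral>\<^sup>+z. P (fst z) (snd z) \<partial>(lborel \<Otimes>\<^sub>M lborel)) = (\<integral>\<^sup>+x. ennreal \<bar>g x\<bar> * far_mass R2 R3 x \<partial>lborel)"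
      unfolding Pint[symmetric] by (subst lborel.nn_integral_fst[symmetric]) auto
    also have "(\<integral>\<^sup>+z. P (snd z) (fst z) \<partial>(lborel \<Otimes>\<^sub>M lborel)) = (\<integral>\<^sup>+x. ennreal \<bar>g x\<bar> * far_mass R2 R3 x \<partial>lborel)"
      unfolding Pint[symmetric] by (subst lborel_pair.nn_integral_snd[symmetric]) auto
    finally have fin: "(\<integral>\<^sup>+z. ennreal \<bar>J (fst z) (snd z) * (w (fst z) - w (snd z)) * (g (fst z) - g (snd z))\<bar> \<partial>(lborel \<Otimes>\<^sub>M lborel))
      \<le> (ennreal (1 / T) * ennreal Cw + ennreal T * (\<integral>\<^sup>+z. G z \<partial>(lborel \<Otimes>\<^sub>M lborel)))
       + (ennreal (2 * L) * (\<integral>\<^sup>+x. ennreal \<bar>g x\<bar> * far_mass R2 R3 x \<partial>lborel) + ennreal (2 * L) * (\<integral>\<^sup>+x. ennreal \<bar>g x\<bar> * far_mass R2 R3 x \<partial>lborel))"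
      by (simp only: Cw(1))
    have "ennreal (1 / T) * ennreal Cw = ennreal (1 / T * Cw)" using T Cw by (intro ennreal_mult[symmetric]) auto
    also have "\<dots> \<le> ennreal ((Cw + 4 * L) / T)" using T L by (intro ennreal_leI) (simp add: divide_right_mono)
    finally have c1: "ennreal (1 / T) * ennreal Cw \<le> ennreal ((Cw + 4 * L) / T)" .
    have "ennreal (2 * L) * A + ennreal (2 * L) * A \<le> ennreal (Cw + 4 * L) * A" for A
    proof -
      have "ennreal (2 * L) * A + ennreal (2 * L) * A = (ennreal (2 * L) + ennreal (2 * L)) * A" by (simp add: distrib_right)
      also have "ennreal (2 * L) + ennreal (2 * L) = ennreal (4 * L)" using L by (subst ennreal_plus[symmetric]) auto
      also have "ennreal (4 * L) * A \<le> ennreal (Cw + 4 * L) * A" using Cw by (intro mult_right_mono ennreal_leI) auto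
      finally show ?thesis .
    qed
    from order_trans[OF fin add_mono[OF add_mono[OF c1 order_refl] this]]
    show "(\<integral>\<^sup>+z. ennreal \<bar>J (fst z) (snd z) * (w (fst z) - w (snd z)) * (g (fst z) - g (snd z))\<bar> \<partial>(lborel \<Otimes>\<^sub>M lborel))
      \<le> ennreal ((Cw + 4 * L) / T) + ennreal T * (\<integral>\<^sup>+z\<in>?D \<times> ?D. ennreal (J (fst z) (snd z) * (g (fst z) - g (snd z))\<^sup>2) \<partial>(lborel \<Otimes>\<^sub>M lborel))
        + ennreal (Cw + 4 * L) * (\<integral>\<^sup>+x. ennreal \<bar>g x\<bar> * far_mass R2 R3 x \<partial>lborel)"
      by (simp only: G_def)
  qed
qed

end

section \<open>Test functions of finite energy\<close>

lemma square_sum_le: "(a + b)\<^sup>2 \<le> 2 * a\<^sup>2 + 2 * b\<^sup>2" for a b :: real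
proof -
  have "2 * a\<^sup>2 + 2 * b\<^sup>2 - (a + b)\<^sup>2 = (a - b)\<^sup>2" by (simp add: power2_eq_square algebra_simps)
  then show ?thesis by (smt (verit) zero_le_power2)
qed

lemma nn_integral_square_diff_le:
  fixes f g k :: "'m \<Rightarrow> real"
  assumes [measurable]: "f \<in> borel_measurable M" "g \<in> borel_measurable M" "k \<in> borel_measurable M" "A \<in> sets M"
    and k: "\<And>x. 0 \<le> k x"
  shows "(\<integral>\<^sup>+x\<in>A. ennreal (k x * (f x - g x)\<^sup>2) \<partial>M)
    \<le> 2 * (\<integral>\<^sup>+x\<in>A. ennreal (k x * (f x)\<^sup>2) \<partial>M) + 2 * (\<integral>\<^sup>+x\<in>A. ennreal (k x * (g x)\<^sup>2) \<partial>M)"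
proof -
  have "(\<integral>\<^sup>+x\<in>A. ennreal (k x * (f x - g x)\<^sup>2) \<partial>M)
    \<le> (\<integral>\<^sup>+x. 2 * (ennreal (k x * (f x)\<^sup>2) * indicator A x) + 2 * (ennreal (k x * (g x)\<^sup>2) * indicator A x) \<partial>M)"
  proof (rule nn_integral_mono)
    fix x
    have "k x * (f x - g x)\<^sup>2 \<le> k x * (2 * (f x)\<^sup>2 + 2 * (g x)\<^sup>2)"
      using square_sum_le[of "f x" "- g x"] k by (intro mult_left_mono) auto
    also have "\<dots> = 2 * (k x * (f x)\<^sup>2) + 2 * (k x * (g x)\<^sup>2)" by (simp add: algebra_simps)
    finally have "ennreal (k x * (f x - g x)\<^sup>2) \<le> ennreal (2 * (k x * (f x)\<^sup>2) + 2 * (k x * (g x)\<^sup>2))" by (rule ennreal_leI)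
    also have "\<dots> = 2 * ennreal (k x * (f x)\<^sup>2) + 2 * ennreal (k x * (g x)\<^sup>2)"
      using k by (simp add: ennreal_plus ennreal_mult)
    finally show "ennreal (k x * (f x - g x)\<^sup>2) * indicator A x
      \<le> 2 * (ennreal (k x * (f x)\<^sup>2) * indicator A x) + 2 * (ennreal (k x * (g x)\<^sup>2) * indicator A x)"
      by (auto simp: indicator_def)
  qed
  also have "\<dots> = 2 * (\<integral>\<^sup>+x\<in>A. ennreal (k x * (f x)\<^sup>2) \<partial>M) + 2 * (\<integral>\<^sup>+x\<in>A. ennreal (k x * (g x)\<^sup>2) \<partial>M)"
    by (simp add: nn_integral_add nn_integral_cmult)
  finally show ?thesis .
qed

context directed_solution
begin

lemma J_lower_energy:
  assumes [measurable]: "f \<in> borel_measurable borel"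
  shows "(\<integral>\<^sup>+z\<in>ball 0 r0 \<times> ball 0 r0. ennreal ((f (fst z) - f (snd z))\<^sup>2 * norm (fst z - snd z) powr (- (N - p + 2))) \<partial>(lborel \<Otimes>\<^sub>M lborel))
    \<le> ennreal (1 / ((p - 1) * L powr (p - 2))) * (\<integral>\<^sup>+z\<in>ball 0 r0 \<times> ball 0 r0. ennreal (J (fst z) (snd z) * (f (fst z) - f (snd z))\<^sup>2) \<partial>(lborel \<Otimes>\<^sub>M lborel))"
proof -
  let ?D = "ball (0::'a) r0" and ?c = "1 / ((p - 1) * L powr (p - 2))"
  have "(\<integral>\<^sup>+z\<in>?D \<times> ?D. ennreal ((f (fst z) - f (snd z))\<^sup>2 * norm (fst z - snd z) powr (- (N - p + 2))) \<partial>(lborel \<Otimes>\<^sub>M lborel))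
    \<le> (\<integral>\<^sup>+z. ennreal ?c * (ennreal (J (fst z) (snd z) * (f (fst z) - f (snd z))\<^sup>2) * indicator (?D \<times> ?D) z) \<partial>(lborel \<Otimes>\<^sub>M lborel))"
  proof (rule nn_integral_mono_AE)
    show "AE z in lborel \<Otimes>\<^sub>M lborel. ennreal ((f (fst z) - f (snd z))\<^sup>2 * norm (fst z - snd z) powr (- (N - p + 2))) * indicator (?D \<times> ?D) z
      \<le> ennreal ?c * (ennreal (J (fst z) (snd z) * (f (fst z) - f (snd z))\<^sup>2) * indicator (?D \<times> ?D) z)"
      using AE_level
    proof eventually_elim
      case (elim z)
      show ?case
      proof (cases "z \<in> ?D \<times> ?D")
        case True
        then have "fst z \<in> cball 0 r0" by auto
        then have "norm (fst z - snd z) powr (- (N - p + 2)) \<le> ?c * J (fst z) (snd z)"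
          using elim by (intro J_lower) blast
        then have "(f (fst z) - f (snd z))\<^sup>2 * norm (fst z - snd z) powr (- (N - p + 2)) \<le> (f (fst z) - f (snd z))\<^sup>2 * (?c * J (fst z) (snd z))"
          by (rule mult_left_mono) simp
        then have "ennreal ((f (fst z) - f (snd z))\<^sup>2 * norm (fst z - snd z) powr (- (N - p + 2))) \<le> ennreal ?c * ennreal (J (fst z) (snd z) * (f (fst z) - f (snd z))\<^sup>2)"
          using p by (subst ennreal_mult[symmetric]) (auto simp: J_nonneg mult_ac intro!: ennreal_leI)
        then show ?thesis using True by simp
      qed simp
    qed
  qed
  also have "\<dots> = ennreal ?c * (\<integral>\<^sup>+z\<in>?D \<times> ?D. ennreal (J (fst z) (snd z) * (f (fst z) - f (snd z))\<^sup>2) \<partial>(lborel \<Otimes>\<^sub>M lborel))"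
    by (rule nn_integral_cmult) measurable
  finally show ?thesis .
qed

text \<open>The supports of approximating test functions may approach the sphere, where the far
  estimates degenerate. Multiplication by \<eta>, which is 1 on a ball carrying \<phi>, confines
  them to radius \<open>R2\<close> and keeps the approximation by \<open>cutoff_energy\<close>. The
  errors \<open>g k\<close> contain \<phi>, which is only measurable, whereas the far pairing is
  available for continuous functions: it is applied to f k - f (k + j), and Fatou lets
  \<open>j\<close> grow.\<close>

lemma energy_c_identity:
  assumes \<phi>: "\<phi> \<in> energy_space_c J (ball 0 r0)"
  shows "has_bochner_integral (lborel \<Otimes>\<^sub>M lborel)
    (\<lambda>z. J (fst z) (snd z) * (w (fst z) - w (snd z))
      * (zero_extension (ball 0 r0) \<phi> (fst z) - zero_extension (ball 0 r0) \<phi> (snd z))) 0"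
proof -
  let ?D = "ball (0::'a) r0" and ?M = "(lborel :: 'a measure) \<Otimes>\<^sub>M (lborel :: 'a measure)"
  define En where "En f = (\<integral>\<^sup>+z\<in>?D \<times> ?D. ennreal (J (fst z) (snd z) * (f (fst z) - f (snd z))\<^sup>2) \<partial>?M)" for f
  define H where "H f = (\<integral>\<^sup>+x\<in>?D. ennreal ((f x)\<^sup>2) \<partial>lborel)" for f
  define \<phi>t where "\<phi>t = zero_extension ?D \<phi>"
  have \<phi>t_eq: "\<phi>t x = (if x \<in> ?D then \<phi> x else 0)" for x by (simp add: \<phi>t_def zero_extension_def)
  have [measurable]: "\<phi>t \<in> borel_measurable borel"
  proof -
    have "(\<lambda>x. indicator ?D x *\<^sub>R \<phi> x) \<in> borel_measurable lborel"
      using \<phi> by (simp add: energy_space_c_def energy_space_def set_borel_measurable_def)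
    moreover have "(\<lambda>x. indicator ?D x *\<^sub>R \<phi> x) = \<phi>t" by (auto simp: \<phi>t_eq indicator_def)
    ultimately show ?thesis by simp
  qed
  obtain S where S: "compact S" "S \<subseteq> ?D" "AE x in lborel. x \<in> ?D - S \<longrightarrow> \<phi> x = 0"
    using \<phi> by (auto simp: energy_space_c_def)
  obtain R1 where R1: "0 \<le> R1" "R1 < r0" "S \<subseteq> cball 0 R1"
    by (rule compact_subset_ball_radius[OF S(1,2) r0], rule that)
  \<comment> \<open>\<phi> lives within \<open>R1\<close>, the cutoff falls from 1 to 0 between
    \<open>R1\<close> and \<open>R2\<close>, and the far interaction begins at
    \<open>R3\<close>.\<close>
  define R2 where "R2 = (R1 + r0) / 2"
  define R3 where "R3 = (R2 + r0) / 2"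
  have R: "R1 < R2" "R2 < R3" "R3 < r0" "0 \<le> R2" "R2 < r0" using R1 by (auto simp: R2_def R3_def)
  define \<eta> where "\<eta> x = max 0 (min 1 ((R2 - norm x) / (R2 - R1)))" for x :: 'a
  have \<eta>: "bl_fun 1 (1 / (R2 - R1)) \<eta>" unfolding \<eta>_def using R R1 by (intro bl_fun_cutoff) auto
  have \<eta>0: "\<eta> x = 0" if "R2 < norm x" for x using that R by (simp add: \<eta>_def divide_nonpos_pos)
  have \<eta>1: "\<eta> x = 1" if "norm x \<le> R1" for x using that R by (simp add: \<eta>_def)
  have [measurable]: "\<eta> \<in> borel_measurable borel" using bl_funD(5)[OF \<eta>] by (rule borel_measurable_continuous_onI)
  \<comment> \<open>Summable errors, so that the L^2 approximation also converges almost everywhere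
    along the whole sequence.\<close>
  define \<delta> where "\<delta> k = (1/2::real) ^ k" for k :: nat
  have \<delta>: "0 < \<delta> k" for k by (simp add: \<delta>_def)
  have "\<exists>\<psi>\<in>test_functions ?D. energy_norm2 J ?D (\<lambda>x. \<phi> x - \<psi> x) < ennreal (\<delta> k)" for k
    using \<phi> \<delta>[of k] by (auto simp: energy_space_c_def energy_space_def)
  then obtain \<psi> where \<psi>: "\<And>k. \<psi> k \<in> test_functions ?D" "\<And>k. energy_norm2 J ?D (\<lambda>x. \<phi> x - \<psi> k x) < ennreal (\<delta> k)"
    by metis
  define \<phi>' where "\<phi>' x = \<eta> x * \<phi>t x" for x
  define h where "h k x = \<psi> k x - \<phi>t x" for k x
  define f where "f k x = \<eta> x * \<psi> k x" for k x
  define g where "g k x = \<eta> x * h k x" for k x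
  have gf: "g k x = f k x - \<phi>' x" for k x by (simp add: g_def f_def h_def \<phi>'_def right_diff_distrib)
  have f_bl: "\<exists>B K. bl_fun B K (f k)" for k
  proof -
    obtain K where K: "K-lipschitz_on UNIV (\<psi> k)" using test_function_lipschitz[OF \<psi>(1)] .
    have "\<psi> k x = 0" if "r0 < norm x" for x
      using \<psi>(1)[of k] closure_subset[of "{x. \<psi> k x \<noteq> 0}"] that by (force simp: test_functions_def)
    then obtain B where "bl_fun B K (\<psi> k)" using bl_fun_if_lipschitz[OF K] by blast
    then show ?thesis unfolding f_def using bl_fun_mult[OF \<eta>] by blast
  qed
  have contf: "continuous_on UNIV (f k)" for k using f_bl bl_funD(5) by blast
  have \<psi>m [measurable]: "\<psi> k \<in> borel_measurable borel" for k
  proof -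
    have "Ck 0 (\<psi> k)" using \<psi>(1)[of k] unfolding test_functions_def by blast
    then show ?thesis by (auto intro: borel_measurable_continuous_onI)
  qed
  have [measurable]: "h k \<in> borel_measurable borel" "f k \<in> borel_measurable borel" "g k \<in> borel_measurable borel" "\<phi>' \<in> borel_measurable borel" for k
    unfolding h_def f_def g_def \<phi>'_def by measurable
  have A1: "H (h k) + En (h k) \<le> ennreal (\<delta> k)" for k
  proof -
    have "H (h k) = (\<integral>\<^sup>+x\<in>?D. ennreal ((\<phi> x - \<psi> k x)\<^sup>2) \<partial>lborel)"
      unfolding H_def by (intro nn_integral_cong) (auto simp: indicator_def h_def \<phi>t_eq power2_commute)
    moreover have "En (h k) = (\<integral>\<^sup>+z\<in>?D \<times> ?D. ennreal (J (fst z) (snd z) * ((\<phi> (fst z) - \<psi> k (fst z)) - (\<phi> (snd z) - \<psi> k (snd z)))\<^sup>2) \<partial>?M)"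
      unfolding En_def
    proof (rule nn_integral_cong)
      fix z :: "'a \<times> 'a"
      show "ennreal (J (fst z) (snd z) * (h k (fst z) - h k (snd z))\<^sup>2) * indicator (?D \<times> ?D) z
        = ennreal (J (fst z) (snd z) * ((\<phi> (fst z) - \<psi> k (fst z)) - (\<phi> (snd z) - \<psi> k (snd z)))\<^sup>2) * indicator (?D \<times> ?D) z"
      proof (cases "z \<in> ?D \<times> ?D")
        case True
        then have "h k (fst z) - h k (snd z) = - ((\<phi> (fst z) - \<psi> k (fst z)) - (\<phi> (snd z) - \<psi> k (snd z)))"
          by (auto simp: h_def \<phi>t_eq)
        then show ?thesis by (simp only: power2_minus)
      qed simp
    qed
    ultimately show ?thesis using \<psi>(2)[of k] by (simp add: energy_norm2_def less_imp_le)
  qed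
  have A1h: "H (h k) \<le> ennreal (\<delta> k)" for k using A1[of k] by (rule order_trans[rotated]) simp
  obtain C1 where C1: "0 \<le> C1" "\<And>h. h \<in> borel_measurable borel \<Longrightarrow>
      (\<integral>\<^sup>+z\<in>?D \<times> ?D. ennreal (J (fst z) (snd z) * (\<eta> (fst z) * h (fst z) - \<eta> (snd z) * h (snd z))\<^sup>2) \<partial>?M)
      \<le> ennreal C1 * ((\<integral>\<^sup>+x\<in>?D. ennreal ((h x)\<^sup>2) \<partial>lborel) +
        (\<integral>\<^sup>+z\<in>?D \<times> ?D. ennreal (J (fst z) (snd z) * (h (fst z) - h (snd z))\<^sup>2) \<partial>?M))"
    by (rule cutoff_energy[where \<eta> = \<eta>], rule \<eta>, rule \<eta>0, use R in linarith, rule that)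
  have A2: "En (g k) \<le> ennreal (C1 * \<delta> k)" for k
  proof -
    have "En (g k) \<le> ennreal C1 * (H (h k) + En (h k))"
      unfolding En_def H_def g_def by (rule C1(2)) measurable
    also have "\<dots> \<le> ennreal C1 * ennreal (\<delta> k)" by (intro mult_left_mono A1) simp
    also have "\<dots> = ennreal (C1 * \<delta> k)" using C1 \<delta>[of k] by (intro ennreal_mult[symmetric]) auto
    finally show ?thesis .
  qed
  have A2h: "H (g k) \<le> ennreal (\<delta> k)" for k
  proof -
    have "H (g k) \<le> H (h k)"
      unfolding H_def
    proof (intro nn_integral_mono mult_right_mono ennreal_leI)
      fix x
      have "\<bar>\<eta> x * h k x\<bar> \<le> 1 * \<bar>h k x\<bar>" unfolding abs_mult by (intro mult_right_mono bl_funD(1)[OF \<eta>]) auto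
      then show "(g k x)\<^sup>2 \<le> (h k x)\<^sup>2" by (simp add: g_def abs_le_square_iff[symmetric])
    qed simp
    then show ?thesis using A1h[of k] by (rule order_trans)
  qed
  define c3 where "c3 = 1 / ((p - 1) * L powr (p - 2))"
  have c3: "0 \<le> c3" using p by (simp add: c3_def)
  define c4 where "c4 = 4 + c3 * (4 * C1)"
  have c4: "0 \<le> c4" using c3 C1 by (simp add: c4_def)
  obtain C2 where C2: "0 \<le> C2" "\<And>f T. continuous_on UNIV f \<Longrightarrow> 0 < T \<Longrightarrow>
    (\<integral>\<^sup>+x. ennreal \<bar>f x\<bar> * far_mass R2 R3 x \<partial>lborel) \<le> ennreal C2 * (ennreal T * ((\<integral>\<^sup>+x\<in>?D. ennreal ((f x)\<^sup>2) \<partial>lborel)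
      + (\<integral>\<^sup>+z\<in>?D \<times> ?D. ennreal ((f (fst z) - f (snd z))\<^sup>2 * norm (fst z - snd z) powr (- (N - p + 2))) \<partial>?M)) + ennreal (1 / T))"
    by (rule far_pairing[OF R(4,2,5)], rule that)
  \<comment> \<open>\<phi> cancels in the difference of two approximants, which is therefore
    continuous; its squared L^2 norm and its energy are of order \<open>\<delta> k\<close> uniformly
    in \<open>j\<close>.\<close>
  have A3: "(\<integral>\<^sup>+x. ennreal \<bar>f k x - f (k + j) x\<bar> * far_mass R2 R3 x \<partial>lborel) \<le> ennreal (C2 * (T * (c4 * \<delta> k) + 1 / T))"
    if T: "0 < T" for k j T
  proof -
    have \<delta>j: "\<delta> (k + j) \<le> \<delta> k" by (simp add: \<delta>_def power_add mult_left_le power_le_one)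
    let ?f = "\<lambda>x. f k x - f (k + j) x"
    have fg: "?f x = g k x - g (k + j) x" for x by (simp add: gf)
    have Hf: "H ?f \<le> ennreal (4 * \<delta> k)"
    proof -
      have "H ?f \<le> 2 * H (g k) + 2 * H (g (k + j))"
        using nn_integral_square_diff_le[of "g k" lborel "g (k + j)" "\<lambda>_. 1" ?D] by (simp add: H_def fg)
      also have "\<dots> \<le> 2 * ennreal (\<delta> k) + 2 * ennreal (\<delta> k)"
        using A2h[of k] order_trans[OF A2h[of "k + j"] ennreal_leI[OF \<delta>j]] by (intro add_mono mult_left_mono) auto
      also have "\<dots> = ennreal (4 * \<delta> k)"
      proof -
        have "2 * ennreal (\<delta> k) = ennreal (2 * \<delta> k)" using \<delta>[of k] by (simp add: ennreal_mult)
        then show ?thesis using \<delta>[of k] by (simp flip: ennreal_plus)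
      qed
      finally show ?thesis .
    qed
    have Ef: "En ?f \<le> ennreal (4 * C1 * \<delta> k)"
    proof -
      have e: "?f (fst z) - ?f (snd z) = (g k (fst z) - g k (snd z)) - (g (k + j) (fst z) - g (k + j) (snd z))" for z
        by (simp add: gf)
      have "En ?f \<le> 2 * En (g k) + 2 * En (g (k + j))"
        unfolding En_def e by (rule nn_integral_square_diff_le) (auto simp: J_nonneg)
      also have "\<dots> \<le> 2 * ennreal (C1 * \<delta> k) + 2 * ennreal (C1 * \<delta> k)"
        using A2[of k] order_trans[OF A2[of "k + j"] ennreal_leI[OF mult_left_mono[OF \<delta>j C1(1)]]]
        by (intro add_mono mult_left_mono) auto
      also have "\<dots> = ennreal (4 * C1 * \<delta> k)"
      proof -
        have "2 * ennreal (C1 * \<delta> k) = ennreal (2 * (C1 * \<delta> k))" using \<delta>[of k] C1 by (simp add: ennreal_mult)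
        then show ?thesis using \<delta>[of k] C1 by (simp flip: ennreal_plus)
      qed
      finally show ?thesis .
    qed
    have "(\<integral>\<^sup>+x. ennreal \<bar>?f x\<bar> * far_mass R2 R3 x \<partial>lborel) \<le> ennreal C2 * (ennreal T * (H ?f
      + (\<integral>\<^sup>+z\<in>?D \<times> ?D. ennreal ((?f (fst z) - ?f (snd z))\<^sup>2 * norm (fst z - snd z) powr (- (N - p + 2))) \<partial>?M)) + ennreal (1 / T))"
      unfolding H_def by (rule C2(2)[OF _ T]) (intro continuous_intros contf)
    also have "\<dots> \<le> ennreal C2 * (ennreal T * (ennreal (4 * \<delta> k) + ennreal c3 * ennreal (4 * C1 * \<delta> k)) + ennreal (1 / T))"
    proof (intro mult_left_mono add_mono Hf order_refl)
      have "(\<integral>\<^sup>+z\<in>?D \<times> ?D. ennreal ((?f (fst z) - ?f (snd z))\<^sup>2 * norm (fst z - snd z) powr (- (N - p + 2))) \<partial>?M) \<le> ennreal c3 * En ?f"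
        unfolding En_def c3_def by (rule J_lower_energy) measurable
      also have "\<dots> \<le> ennreal c3 * ennreal (4 * C1 * \<delta> k)" by (intro mult_left_mono Ef) simp
      finally show "(\<integral>\<^sup>+z\<in>?D \<times> ?D. ennreal ((?f (fst z) - ?f (snd z))\<^sup>2 * norm (fst z - snd z) powr (- (N - p + 2))) \<partial>?M) \<le> ennreal c3 * ennreal (4 * C1 * \<delta> k)" .
    qed auto
    also have "\<dots> = ennreal (C2 * (T * (c4 * \<delta> k) + 1 / T))"
    proof -
      have nn: "0 \<le> 4 * \<delta> k" "0 \<le> c3 * (4 * C1 * \<delta> k)" "0 \<le> 4 * C1 * \<delta> k" "0 \<le> 1 / T" "0 \<le> T" using \<delta>[of k] c3 C1 T by auto
      have 1: "ennreal (4 * \<delta> k) + ennreal c3 * ennreal (4 * C1 * \<delta> k) = ennreal (c4 * \<delta> k)"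
      proof -
        have "ennreal (4 * \<delta> k) + ennreal c3 * ennreal (4 * C1 * \<delta> k) = ennreal (4 * \<delta> k + c3 * (4 * C1 * \<delta> k))"
          by (simp only: ennreal_mult[OF c3 nn(3), symmetric] ennreal_plus[OF nn(1,2)])
        then show ?thesis by (simp add: c4_def algebra_simps)
      qed
      have nn2: "0 \<le> c4 * \<delta> k" "0 \<le> T * (c4 * \<delta> k)" "0 \<le> T * (c4 * \<delta> k) + 1 / T" using \<delta>[of k] c4 T by auto
      show ?thesis
        unfolding 1 by (simp only: ennreal_mult[OF C2(1) nn2(3)] ennreal_plus[OF nn2(2) nn(4)] ennreal_mult[OF nn(5) nn2(1)])
    qed
    finally show ?thesis .
  qed
  have hlim: "AE x in lborel. x \<in> ?D \<longrightarrow> (\<lambda>j. h j x) \<longlonglongrightarrow> 0"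
  proof -
    have "(\<integral>\<^sup>+x. (\<Sum>j. ennreal ((h j x)\<^sup>2) * indicator ?D x) \<partial>lborel) = (\<Sum>j. H (h j))"
      unfolding H_def by (rule nn_integral_suminf) measurable
    also have "\<dots> \<le> (\<Sum>j. ennreal (\<delta> j))" by (intro suminf_le A1h) auto
    also have "\<dots> = ennreal 2"
    proof (rule suminf_ennreal_eq)
      show "\<delta> sums 2" unfolding \<delta>_def using geometric_sums[of "1/2 :: real"] by simp
    qed (simp add: \<delta>_def)
    also have "\<dots> < \<infinity>" by simp
    finally have "AE x in lborel. (\<Sum>j. ennreal ((h j x)\<^sup>2) * indicator ?D x) \<noteq> \<infinity>"
      by (intro nn_integral_noteq_infinite) auto
    then show ?thesis
    proof eventually_elim
      case (elim x)
      show ?case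
      proof
        assume "x \<in> ?D"
        then have "(\<Sum>j. ennreal ((h j x)\<^sup>2)) \<noteq> top" using elim by simp
        then have "summable (\<lambda>j. (h j x)\<^sup>2)" by (intro summable_suminf_not_top) auto
        then have "(\<lambda>j. (h j x)\<^sup>2) \<longlonglongrightarrow> 0" by (rule summable_LIMSEQ_zero)
        then have "(\<lambda>j. sqrt ((h j x)\<^sup>2)) \<longlonglongrightarrow> sqrt 0" by (rule tendsto_real_sqrt)
        then show "(\<lambda>j. h j x) \<longlonglongrightarrow> 0" by (simp add: tendsto_rabs_zero_iff)
      qed
    qed
  qed
  have A5: "(\<integral>\<^sup>+x. ennreal \<bar>g k x\<bar> * far_mass R2 R3 x \<partial>lborel) \<le> ennreal (C2 * (T * (c4 * \<delta> k) + 1 / T))"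
    if T: "0 < T" for k T
  proof -
    obtain M where "(\<integral>\<^sup>+x. far_mass R2 R3 x \<partial>lborel) < \<infinity>" by (rule far_mass_bound[OF R(4,2,5)], rule that)
    \<comment> \<open>Where the weight is infinite, the product in \<open>ennreal\<close> need not
      pass to the limit when the other factor tends to 0.\<close>
    then have afin: "AE x in lborel. far_mass R2 R3 x \<noteq> \<infinity>" by (intro nn_integral_noteq_infinite) auto
    have "(\<integral>\<^sup>+x. ennreal \<bar>g k x\<bar> * far_mass R2 R3 x \<partial>lborel)
       = (\<integral>\<^sup>+x. liminf (\<lambda>j. ennreal \<bar>f k x - f (k + j) x\<bar> * far_mass R2 R3 x) \<partial>lborel)"
    proof (rule nn_integral_cong_AE)
      show "AE x in lborel. ennreal \<bar>g k x\<bar> * far_mass R2 R3 x = liminf (\<lambda>j. ennreal \<bar>f k x - f (k + j) x\<bar> * far_mass R2 R3 x)"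
        using afin hlim
      proof eventually_elim
        case (elim x)
        have "(\<lambda>j. ennreal \<bar>f k x - f (k + j) x\<bar> * far_mass R2 R3 x) \<longlonglongrightarrow> ennreal \<bar>g k x\<bar> * far_mass R2 R3 x"
        proof (cases "norm x \<le> R2")
          case True
          then have "(\<lambda>j. h j x) \<longlonglongrightarrow> 0" using elim R by auto
          then have "(\<lambda>j. h (j + k) x) \<longlonglongrightarrow> 0" by (rule LIMSEQ_ignore_initial_segment)
          then have "(\<lambda>j. \<bar>g k x - \<eta> x * h (j + k) x\<bar>) \<longlonglongrightarrow> \<bar>g k x - \<eta> x * 0\<bar>" by (intro tendsto_intros)
          moreover have "g k x - \<eta> x * h (j + k) x = f k x - f (k + j) x" for j
            using gf[of k x] gf[of "k + j" x] by (simp add: g_def add.commute)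
          ultimately have lim: "(\<lambda>j. \<bar>f k x - f (k + j) x\<bar>) \<longlonglongrightarrow> \<bar>g k x\<bar>" by simp
          obtain t where t: "far_mass R2 R3 x = ennreal t" "0 \<le> t" using elim(1) by (cases "far_mass R2 R3 x") auto
          have "(\<lambda>j. ennreal (\<bar>f k x - f (k + j) x\<bar> * t)) \<longlonglongrightarrow> ennreal (\<bar>g k x\<bar> * t)"
            by (intro tendsto_ennrealI tendsto_intros lim)
          then show ?thesis using t by (simp add: ennreal_mult)
        next
          case False
          then show ?thesis by (simp add: far_mass_def)
        qed
        then show ?case using lim_imp_Liminf[OF sequentially_bot] by metis
      qed
    qed
    also have "\<dots> \<le> liminf (\<lambda>j. \<integral>\<^sup>+x. ennreal \<bar>f k x - f (k + j) x\<bar> * far_mass R2 R3 x \<partial>lborel)"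
      by (rule nn_integral_liminf) measurable
    also have "\<dots> \<le> ennreal (C2 * (T * (c4 * \<delta> k) + 1 / T))" by (rule liminf_le_bound) (rule A3[OF T])
    finally show ?thesis .
  qed
  obtain C3 where C3: "0 \<le> C3" "\<And>g T. g \<in> borel_measurable borel \<Longrightarrow> (\<And>x. R2 < norm x \<Longrightarrow> g x = 0) \<Longrightarrow> 0 < T \<Longrightarrow>
    (\<integral>\<^sup>+z. ennreal \<bar>J (fst z) (snd z) * (w (fst z) - w (snd z)) * (g (fst z) - g (snd z))\<bar> \<partial>?M)
      \<le> ennreal (C3 / T) + ennreal T * (\<integral>\<^sup>+z\<in>?D \<times> ?D. ennreal (J (fst z) (snd z) * (g (fst z) - g (snd z))\<^sup>2) \<partial>?M)
        + ennreal C3 * (\<integral>\<^sup>+x. ennreal \<bar>g x\<bar> * far_mass R2 R3 x \<partial>lborel)"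
    by (fact pairing_bound[OF R(4,2,3)])
  define K1 where "K1 = C3 + C3 * C2"
  define K2 where "K2 = C1 + C3 * (C2 * c4)"
  have K: "0 \<le> K1" "0 \<le> K2" using C1 C2 C3 c4 by (auto simp: K1_def K2_def)
  have A6: "(\<integral>\<^sup>+z. ennreal \<bar>J (fst z) (snd z) * (w (fst z) - w (snd z)) * (g k (fst z) - g k (snd z))\<bar> \<partial>?M)
    \<le> ennreal (K1 / T + T * (K2 * \<delta> k))" if T: "0 < T" for k T
  proof -
    have "(\<integral>\<^sup>+z. ennreal \<bar>J (fst z) (snd z) * (w (fst z) - w (snd z)) * (g k (fst z) - g k (snd z))\<bar> \<partial>?M)
      \<le> ennreal (C3 / T) + ennreal T * En (g k) + ennreal C3 * (\<integral>\<^sup>+x. ennreal \<bar>g k x\<bar> * far_mass R2 R3 x \<partial>lborel)"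
      unfolding En_def by (rule C3(2)[OF _ _ T]) (auto simp: g_def \<eta>0)
    also have "\<dots> \<le> ennreal (C3 / T) + ennreal T * ennreal (C1 * \<delta> k) + ennreal C3 * ennreal (C2 * (T * (c4 * \<delta> k) + 1 / T))"
      by (intro add_mono mult_left_mono A2 A5 T order_refl) auto
    also have "\<dots> = ennreal (C3 / T + T * (C1 * \<delta> k) + C3 * (C2 * (T * (c4 * \<delta> k) + 1 / T)))"
    proof -
      have nn: "0 \<le> C3 / T" "0 \<le> C1 * \<delta> k" "0 \<le> T" "0 \<le> T * (C1 * \<delta> k)" "0 \<le> C2 * (T * (c4 * \<delta> k) + 1 / T)"
        using C1 C2 C3 c4 T \<delta>[of k] by auto
      show ?thesis
        by (simp only: ennreal_plus[OF add_nonneg_nonneg[OF nn(1,4)] mult_nonneg_nonneg[OF C3(1) nn(5)]]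
            ennreal_plus[OF nn(1,4)] ennreal_mult[OF nn(3,2)] ennreal_mult[OF C3(1) nn(5)])
    qed
    also have "C3 / T + T * (C1 * \<delta> k) + C3 * (C2 * (T * (c4 * \<delta> k) + 1 / T)) = K1 / T + T * (K2 * \<delta> k)"
      using T by (simp add: K1_def K2_def field_simps)
    finally show ?thesis .
  qed
  have "has_bochner_integral ?M (\<lambda>z. J (fst z) (snd z) * (w (fst z) - w (snd z)) * (\<phi>' (fst z) - \<phi>' (snd z))) 0"
  proof (rule has_bochner_integral_L1_limit)
    fix \<epsilon> :: real assume \<epsilon>: "0 < \<epsilon>"
    \<comment> \<open>\<open>T\<close> first brings K1 / T, the part that does not shrink with
      \<open>k\<close>, below \<epsilon> / 2; then \<open>k\<close> is chosen to make the rest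
      small.\<close>
    define T where "T = 2 * K1 / \<epsilon> + 1"
    have T: "0 < T" using K \<epsilon> by (simp add: T_def add_nonneg_pos)
    have KT: "K1 / T \<le> \<epsilon> / 2" using T \<epsilon> K by (simp add: T_def field_simps)
    have "\<forall>\<^sub>F k in sequentially. T * (K2 * \<delta> k) < \<epsilon> / 2"
    proof -
      have "(\<lambda>k. T * (K2 * (1/2) ^ k)) \<longlonglongrightarrow> T * (K2 * 0)" by (intro tendsto_intros) auto
      from order_tendstoD(2)[OF this, of "\<epsilon> / 2"] show ?thesis using \<epsilon> by (simp add: \<delta>_def)
    qed
    then obtain k where k: "T * (K2 * \<delta> k) < \<epsilon> / 2" using eventually_happens'[OF sequentially_bot] by blast
    show "\<exists>F. has_bochner_integral ?M F 0 \<and> (\<integral>\<^sup>+z. ennreal \<bar>F z - J (fst z) (snd z) * (w (fst z) - w (snd z)) * (\<phi>' (fst z) - \<phi>' (snd z))\<bar> \<partial>?M) \<le> ennreal \<epsilon>"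
    proof (intro exI conjI)
      obtain B K where "bl_fun B K (f k)" using f_bl by blast
      then show "has_bochner_integral ?M (\<lambda>z. J (fst z) (snd z) * (w (fst z) - w (snd z)) * (f k (fst z) - f k (snd z))) 0"
        by (rule linearised_identity[OF _ _ R(4,5)]) (use R in \<open>auto simp: f_def \<eta>0\<close>)
      have "J (fst z) (snd z) * (w (fst z) - w (snd z)) * (f k (fst z) - f k (snd z)) - J (fst z) (snd z) * (w (fst z) - w (snd z)) * (\<phi>' (fst z) - \<phi>' (snd z))
        = J (fst z) (snd z) * (w (fst z) - w (snd z)) * (g k (fst z) - g k (snd z))" for z
        by (simp add: gf algebra_simps)
      then have "(\<integral>\<^sup>+z. ennreal \<bar>J (fst z) (snd z) * (w (fst z) - w (snd z)) * (f k (fst z) - f k (snd z)) - J (fst z) (snd z) * (w (fst z) - w (snd z)) * (\<phi>' (fst z) - \<phi>' (snd z))\<bar> \<partial>?M)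
        \<le> ennreal (K1 / T + T * (K2 * \<delta> k))" using A6[OF T, of k] by simp
      also have "\<dots> \<le> ennreal \<epsilon>" using KT k by (intro ennreal_leI) linarith
      finally show "(\<integral>\<^sup>+z. ennreal \<bar>J (fst z) (snd z) * (w (fst z) - w (snd z)) * (f k (fst z) - f k (snd z)) - J (fst z) (snd z) * (w (fst z) - w (snd z)) * (\<phi>' (fst z) - \<phi>' (snd z))\<bar> \<partial>?M) \<le> ennreal \<epsilon>" .
    qed
  qed measurable
  moreover have "AE z in ?M. J (fst z) (snd z) * (w (fst z) - w (snd z)) * (\<phi>' (fst z) - \<phi>' (snd z))
      = J (fst z) (snd z) * (w (fst z) - w (snd z)) * (\<phi>t (fst z) - \<phi>t (snd z))"
  proof -
    have "AE x in lborel. \<phi>' x = \<phi>t x"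
      using S(3)
    proof eventually_elim
      case (elim x)
      show ?case
      proof (cases "x \<in> S")
        case True
        then have "norm x \<le> R1" using R1(3) by auto
        then show ?thesis by (simp add: \<phi>'_def \<eta>1)
      next
        case False
        then show ?thesis using elim by (simp add: \<phi>'_def \<phi>t_eq)
      qed
    qed
    from AE_lborel_pair[OF this] show ?thesis by eventually_elim simp
  qed
  ultimately have "has_bochner_integral ?M (\<lambda>z. J (fst z) (snd z) * (w (fst z) - w (snd z)) * (\<phi>t (fst z) - \<phi>t (snd z))) 0"
    by (subst (asm) has_bochner_integral_cong_AE) auto
  then show ?thesis by (simp add: \<phi>t_def)
qed

section \<open>The Dirichlet kernel and the absorption bound\<close>

lemma Dirichlet_kernel: "symmetric_Dirichlet_kernel (ball 0 r0) J"
  unfolding symmetric_Dirichlet_kernel_def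
proof (intro conjI ballI)
  let ?D = "ball (0::'a) r0"
  show "set_borel_measurable (lborel \<Otimes>\<^sub>M lborel) (?D \<times> ?D) (\<lambda>(x, y). J x y)"
    unfolding set_borel_measurable_def split_beta by measurable
  show "0 \<le> J x y" "J x y = J y x" for x y by (rule J_nonneg, rule J_sym)
  fix \<phi> assume \<phi>: "\<phi> \<in> test_functions ?D"
  obtain R B K where R: "0 \<le> R" "R < r0" and supp: "\<And>x. R < norm x \<Longrightarrow> \<phi> x = 0" and bl: "bl_fun B K \<phi>"
    by (rule test_function_support[OF \<phi> r0], rule that)
  define d where "d = 4 * B\<^sup>2 + K\<^sup>2"
  have "(\<integral>\<^sup>+x\<in>?D. ennreal ((\<phi> x)\<^sup>2) \<partial>lborel) \<le> (\<integral>\<^sup>+x. ennreal (B\<^sup>2) * indicator ?D x \<partial>lborel)"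
  proof (intro nn_integral_mono mult_right_mono ennreal_leI)
    show "(\<phi> x)\<^sup>2 \<le> B\<^sup>2" for x using power_mono[OF bl_funD(1)[OF bl, of x] abs_ge_zero, of 2] by simp
  qed simp
  also have "\<dots> < \<infinity>" using r0 by (simp add: nn_integral_cmult_indicator emeasure_ball ennreal_mult_less_top)
  finally have 1: "(\<integral>\<^sup>+x\<in>?D. ennreal ((\<phi> x)\<^sup>2) \<partial>lborel) < \<infinity>" .
  have "(\<integral>\<^sup>+z\<in>?D \<times> ?D. ennreal (J (fst z) (snd z) * (\<phi> (fst z) - \<phi> (snd z))\<^sup>2) \<partial>(lborel \<Otimes>\<^sub>M lborel))
    \<le> (\<integral>\<^sup>+z. ennreal (norm (d * dom (fst z) (snd z))) \<partial>(lborel \<Otimes>\<^sub>M lborel))"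
  proof (rule nn_integral_mono)
    fix z :: "'a \<times> 'a"
    let ?o = "of_bool (fst z \<in> cball 0 r0 \<or> snd z \<in> cball 0 r0) :: real"
    have "(\<phi> (fst z) - \<phi> (snd z))\<^sup>2 \<le> d * mm (fst z) (snd z) * ?o"
      unfolding d_def by (rule square_diff_le_mm[OF bl]) (rule supp, use R in linarith)
    then have "J (fst z) (snd z) * (\<phi> (fst z) - \<phi> (snd z))\<^sup>2 \<le> J (fst z) (snd z) * (d * mm (fst z) (snd z) * ?o)"
      by (rule mult_left_mono) (rule J_nonneg)
    also have "\<dots> = d * dom (fst z) (snd z)" by (simp only: dom_def mult_ac)
    also have "\<dots> \<le> norm (d * dom (fst z) (snd z))" by simp
    finally show "ennreal (J (fst z) (snd z) * (\<phi> (fst z) - \<phi> (snd z))\<^sup>2) * indicator (?D \<times> ?D) z \<le> ennreal (norm (d * dom (fst z) (snd z)))"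
      by (auto simp: indicator_def intro!: ennreal_leI)
  qed
  also have "\<dots> < \<infinity>"
    using integrable_mult_right[OF integrable_dom, of d] unfolding integrable_iff_bounded by blast
  finally show "energy_norm2 J ?D \<phi> < \<infinity>" using 1 by (simp add: energy_norm2_def)
qed

text \<open>A function of the distance \<open>d\<close> alone, as the uniformity over the sets
  \<open>D0\<close> requires. The centre \<open>0 *\<^sub>R e\<close> is the origin, written through
  \<open>e\<close> so that it carries the type of the space.\<close>

definition AU_const :: "real \<Rightarrow> real" where
  "AU_const d = (p - 1) * slab_const * (1 - (r0 - d) / r0) powr (- N)
     * enn2real (\<integral>\<^sup>+y\<in>- ball (0 *\<^sub>R e) r0. ennreal (norm y powr (- N)) \<partial>lborel)"

text \<open>\<open>D0\<close> lies in the closed ball of radius r0 - d, where d is its distance from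
  the sphere, so \<open>J_far\<close> applies with R = r0 - d and r1 = r0.\<close>

lemma AU_morrey:
  assumes D0: "D0 \<Subset> ball 0 r0" and r: "0 < r" "ball x0 r \<subseteq> D0"
  shows "(\<integral>\<^sup>+x\<in>ball x0 r. AU s p U r0 x \<partial>lborel)
    \<le> ennreal (AU_const (setdist D0 (sphere 0 r0)) * r powr (n + p - 2))"
proof -
  define d where "d = setdist D0 (sphere 0 r0)"
  have x0: "x0 \<in> D0" using r by auto
  have le: "norm x \<le> r0 - d" if x: "x \<in> D0" for x
  proof -
    have xr: "norm x < r0" using D0 x closure_subset[of D0] by (auto simp: compactly_inside_def)
    \<comment> \<open>The radial projection of \<open>x\<close> to the sphere; at the origin any
      point of the sphere serves.\<close>
    define y where "y = (if x = 0 then r0 *\<^sub>R e else (r0 / norm x) *\<^sub>R x)"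
    have "y \<in> sphere 0 r0" using r0 e by (simp add: y_def)
    then have "d \<le> dist x y" unfolding d_def using x by (rule setdist_le_dist[rotated])
    also have "dist x y = r0 - norm x"
    proof (cases "x = 0")
      case False
      have "x - y = (1 - r0 / norm x) *\<^sub>R x" using False by (simp add: y_def scaleR_left_diff_distrib)
      then have "dist x y = \<bar>1 - r0 / norm x\<bar> * norm x" by (simp add: dist_norm)
      also have "\<dots> = \<bar>(1 - r0 / norm x) * norm x\<bar>" by (simp add: abs_mult)
      also have "(1 - r0 / norm x) * norm x = norm x - r0" using False by (simp add: field_simps)
      finally show ?thesis using xr by simp
    qed (use e r0 in \<open>simp add: y_def\<close>)
    finally show ?thesis by simp
  qed
  \<comment> \<open>The compact closure of \<open>D0\<close> sits in a closed ball of radius R' <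
    r0, so the distance is at least r0 - R'.\<close>
  have "0 < d"
  proof -
    obtain R' where R': "0 \<le> R'" "R' < r0" "closure D0 \<subseteq> cball 0 R'"
      using compact_subset_ball_radius[of "closure D0" r0] D0 r0 by (auto simp: compactly_inside_def)
    have "r0 - R' \<le> d"
      unfolding d_def
    proof (rule le_setdistI)
      show "D0 \<noteq> {}" using x0 by blast
      have "r0 *\<^sub>R e \<in> sphere 0 r0" using e r0 by simp
      then show "sphere (0::'a) r0 \<noteq> {}" by blast
      fix x y :: 'a assume "x \<in> D0" "y \<in> sphere 0 r0"
      then have "norm x \<le> R'" "norm y = r0" using R'(3) closure_subset[of D0] by auto
      then show "r0 - R' \<le> dist x y" using norm_triangle_ineq3[of x y] by (simp add: dist_norm)
    qed
    then show ?thesis using R' by simp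
  qed
  moreover have "0 \<le> r0 - d" using le[OF x0] norm_ge_zero[of x0] by linarith
  ultimately have "(\<integral>\<^sup>+x\<in>ball x0 r. (\<integral>\<^sup>+y\<in>- ball 0 r0. ennreal (J x y) \<partial>lborel) \<partial>lborel)
    \<le> ennreal ((p - 1) * slab_const * (1 - (r0 - d) / r0) powr (- N) * tail_const TYPE('a) N r0 * r powr (n + p - 2))"
  proof -
    assume d: "0 < d" and R: "0 \<le> r0 - d"
    show ?thesis
    proof (rule J_far[OF r0 R _ _ r(1) _ ball_subset_cball])
      show "ball x0 r \<subseteq> cball 0 (r0 - d)" using r(2) le by auto
    qed (use d in auto)
  qed
  then show ?thesis by (simp add: AU_def AU_const_def d_def tail_const_def)
qed

lemma AU_meas: "(\<lambda>x. indicator (ball 0 r0) x * AU s p U r0 x) \<in> borel_measurable lborel"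
  unfolding AU_def by measurable

end

section \<open>Gradients along lines\<close>

text \<open>The values of the differential on the standard basis are the coordinates of a gradient;
  \<open>grad\<close> is a choice, so existence is all that has to be shown.\<close>

lemma differentiable_imp_GDERIV:
  fixes f :: "'a::euclidean_space \<Rightarrow> real"
  assumes "f differentiable (at x)"
  shows "GDERIV f x :> grad f x"
proof -
  obtain f' where f': "(f has_derivative f') (at x)" using assms by (auto simp: differentiable_def)
  interpret f': bounded_linear f' using f' by (rule has_derivative_bounded_linear)
  have "f' = (\<lambda>h. h \<bullet> (\<Sum>b\<in>Basis. f' b *\<^sub>R b))"
  proof
    fix h
    have "f' h = f' (\<Sum>b\<in>Basis. (h \<bullet> b) *\<^sub>R b)" by (simp only: euclidean_representation)
    also have "\<dots> = (\<Sum>b\<in>Basis. (h \<bullet> b) * f' b)" by (simp only: f'.sum f'.scaleR real_scaleR_def)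
    also have "\<dots> = h \<bullet> (\<Sum>b\<in>Basis. f' b *\<^sub>R b)"
      unfolding inner_sum_right by (simp only: inner_scaleR_right mult.commute)
    finally show "f' h = h \<bullet> (\<Sum>b\<in>Basis. f' b *\<^sub>R b)" .
  qed
  then have "GDERIV f x :> (\<Sum>b\<in>Basis. f' b *\<^sub>R b)"
    unfolding gderiv_def by (rule has_derivative_eq_rhs[OF f'])
  then show ?thesis unfolding grad_def by (rule someI)
qed

lemma GDERIV_line:
  fixes f :: "'a::euclidean_space \<Rightarrow> real"
  assumes "f differentiable (at (x + t *\<^sub>R e))"
  shows "((\<lambda>t. f (x + t *\<^sub>R e)) has_real_derivative grad f (x + t *\<^sub>R e) \<bullet> e) (at t)"
proof -
  have "(f has_derivative (\<lambda>h. h \<bullet> grad f (x + t *\<^sub>R e))) (at (x + t *\<^sub>R e))"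
    using differentiable_imp_GDERIV[OF assms] unfolding gderiv_def .
  moreover have "((\<lambda>t. x + t *\<^sub>R e) has_derivative (\<lambda>h. h *\<^sub>R e)) (at t)"
    by (auto intro!: derivative_eq_intros)
  ultimately have "((\<lambda>t. f (x + t *\<^sub>R e)) has_derivative (\<lambda>h. (h *\<^sub>R e) \<bullet> grad f (x + t *\<^sub>R e))) (at t)"
    by (rule has_derivative_compose[rotated])
  then show ?thesis
    unfolding has_field_derivative_def
  proof (rule has_derivative_eq_rhs)
    show "(\<lambda>h. (h *\<^sub>R e) \<bullet> grad f (x + t *\<^sub>R e)) = (*) (grad f (x + t *\<^sub>R e) \<bullet> e)"
      by (rule ext) (simp only: inner_scaleR_left inner_commute[of e] mult.commute)
  qed
qed

text \<open>The Hoelder bound on a small closed ball about each point tends to 0 with the distance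
  since \<alpha> > 0.\<close>

lemma C1_holder_continuous_grad:
  fixes D :: "'a::euclidean_space set"
  assumes f: "f \<in> C1_holder \<alpha> D" and D: "open D" and \<alpha>: "0 < \<alpha>"
  shows "continuous_on D (grad f)"
proof (rule continuous_at_imp_continuous_on, rule ballI)
  fix x assume x: "x \<in> D"
  obtain d where d: "0 < d" "cball x d \<subseteq> D" using D x open_contains_cball by blast
  obtain C where C: "\<And>y. y \<in> cball x d \<Longrightarrow> norm (grad f y - grad f x) \<le> C * norm (y - x) powr \<alpha>"
  proof -
    have "compact (cball x d) \<and> cball x d \<subseteq> D" using d by simp
    then obtain C where "\<forall>y\<in>cball x d. \<forall>z\<in>cball x d. norm (grad f y - grad f z) \<le> C * norm (y - z) powr \<alpha>"
      using f unfolding C1_holder_def by blast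
    moreover have "x \<in> cball x d" using d by simp
    ultimately show ?thesis using that by blast
  qed
  have "((\<lambda>y. grad f y - grad f x) \<longlongrightarrow> 0) (at x)"
  proof (rule Lim_null_comparison)
    show "\<forall>\<^sub>F y in at x. norm (grad f y - grad f x) \<le> C * norm (y - x) powr \<alpha>"
      unfolding eventually_at using C d(1) by (intro exI[of _ d]) (auto simp: dist_commute)
    have "((\<lambda>y. norm (y - x)) \<longlongrightarrow> norm (x - x)) (at x)" by (intro tendsto_intros)
    then have "((\<lambda>y. norm (y - x) powr \<alpha>) \<longlongrightarrow> norm (x - x) powr \<alpha>) (at x)"
      using \<alpha> by (intro tendsto_powr') (auto simp: eventually_at intro!: exI[of _ 1])
    then show "((\<lambda>y. C * norm (y - x) powr \<alpha>) \<longlongrightarrow> 0) (at x)"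
      using tendsto_mult[OF tendsto_const, of "\<lambda>y. norm (y - x) powr \<alpha>"] by fastforce
  qed
  then show "isCont (grad f) x" unfolding isCont_def by (rule LIM_zero_cancel)
qed

text \<open>The set where a continuous function violates the bound is open, and a null open set is
  empty. This turns the essential bound on the gradient into a pointwise one.\<close>

lemma AE_ball_imp_all:
  fixes g :: "'a::euclidean_space \<Rightarrow> real"
  assumes cont: "continuous_on D g" and D: "open D" and ae: "AE x in lborel. x \<in> D \<longrightarrow> g x \<le> c" and x: "x \<in> D"
  shows "g x \<le> c"
proof (rule ccontr)
  assume "\<not> g x \<le> c"
  define V where "V = D \<inter> g -` {c<..}"
  have "open V" unfolding V_def by (rule continuous_open_preimage[OF cont D]) simp
  moreover have "x \<in> V" using x \<open>\<not> g x \<le> c\<close> by (simp add: V_def)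
  ultimately have "\<not> negligible V" using open_not_negligible by blast
  moreover have "AE x in lborel. x \<notin> V" using ae by eventually_elim (auto simp: V_def)
  then have "V \<in> null_sets lborel" using \<open>open V\<close> by (subst AE_iff_null_sets) auto
  then have "negligible V" using negligible_iff_null_sets null_sets_completionI by blast
  ultimately show False by blast
qed

theorem proposition4p9:
  fixes U :: "real ^ 'n \<Rightarrow> real" and q e :: "real ^ 'n"
    and s p L r0 \<alpha> \<tau> :: real
  assumes n: "2 \<le> CARD('n)"
    and p: "1 < p" "p < 2"
    and s: "0 < s" "s < 1"
    and sp: "p - 1 < s * p"
    and sol: "entire_weak_solution s p U"
    and lip: "L-lipschitz_on UNIV U"
    and q: "q \<noteq> 0"
    and e: "e = q /\<^sub>R norm q"
    and r0: "0 < r0"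
    and \<alpha>: "0 < \<alpha>" "\<alpha> < 1"
    and reg: "U \<in> C1_holder \<alpha> (ball 0 (2 * r0))"
    and grad: "AE x in lborel. x \<in> ball 0 (2 * r0) \<longrightarrow> norm (grad U x - q) \<le> norm q / 4"
    and \<tau>: "\<tau> = s * p - p + 2"
  shows
    "(\<forall>x\<in>ball 0 (2 * r0). dir_deriv U e x \<ge> 3 * norm q / 4)
   \<and> symmetric_Dirichlet_kernel (ball 0 r0) (JU s p U)
   \<and> (AE z in lborel \<Otimes>\<^sub>M lborel. fst z \<in> ball 0 r0 \<longrightarrow> U (fst z) \<noteq> U (snd z))
   \<and> (\<exists>C::real. \<forall>x0 r. 0 < r \<and> ball x0 r \<subseteq> ball 0 (r0 / 2) \<longrightarrow>
        (\<integral>\<^sup>+x\<in>ball x0 r. AU s p U r0 x \<partial>lborel) \<le> ennreal (C * r powr (real CARD('n) + p - 2)))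
   \<and> (\<exists>C::real \<Rightarrow> real. \<forall>D0. D0 \<Subset> ball 0 r0 \<longrightarrow>
        (\<forall>x0 r. 0 < r \<and> ball x0 r \<subseteq> D0 \<longrightarrow>
          (\<integral>\<^sup>+x\<in>ball x0 r. AU s p U r0 x \<partial>lborel)
            \<le> ennreal (C (setdist D0 (sphere 0 r0)) * r powr (real CARD('n) + p - 2))))
   \<and> morrey_kato_absorption (ball 0 r0) \<tau> (2 - p) (AU s p U r0)
   \<and> \<tau> - (2 - p) = s * p \<and> 0 < s * p
   \<and> (AE x in lborel. (\<lambda>t. U (x + t *\<^sub>R e)) differentiable (at 0))
   \<and> dir_deriv U e \<in> energy_space_loc (JU s p U) (ball 0 r0)
   \<and> (\<forall>\<phi>\<in>test_functions (ball 0 r0).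
        has_bochner_integral (lborel \<Otimes>\<^sub>M lborel)
          (\<lambda>(x, y). JU s p U x y * (dir_deriv U e x - dir_deriv U e y) * (\<phi> x - \<phi> y)) 0)
   \<and> (\<forall>\<phi>\<in>energy_space_c (JU s p U) (ball 0 r0).
        has_bochner_integral (lborel \<Otimes>\<^sub>M lborel)
          (\<lambda>(x, y). JU s p U x y * (dir_deriv U e x - dir_deriv U e y)
             * (zero_extension (ball 0 r0) \<phi> x - zero_extension (ball 0 r0) \<phi> y)) 0)"
proof -
  let ?B2 = "ball (0 :: real ^ 'n) (2 * r0)"
  have e1: "norm e = 1" using q by (simp add: e)
  have qe: "q \<bullet> e = norm q" using q by (simp add: e dot_square_norm power2_eq_square)
  have diff: "U differentiable (at x)" if "x \<in> ?B2" for x using reg that by (simp add: C1_holder_def)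
  have cg: "continuous_on ?B2 (grad U)" by (rule C1_holder_continuous_grad[OF reg _ \<alpha>(1)]) simp
  have gq: "norm (grad U x - q) \<le> norm q / 4" if "x \<in> ?B2" for x
    by (rule AE_ball_imp_all[OF _ _ grad that]) (auto intro!: continuous_intros cg)
  \<comment> \<open>Since q \<bullet> e = |q| and \<open>e\<close> is a unit vector, the deviation
    of the gradient from \<open>q\<close> costs at most |q| / 4.\<close>
  have ge: "3 * norm q / 4 \<le> grad U x \<bullet> e" if "x \<in> ?B2" for x
  proof -
    have "\<bar>(grad U x - q) \<bullet> e\<bar> \<le> norm (grad U x - q) * norm e" by (rule Cauchy_Schwarz_ineq2)
    then have "\<bar>(grad U x - q) \<bullet> e\<bar> \<le> norm q / 4" using gq[OF that] e1 by simp
    then have "- (norm q / 4) \<le> (grad U x - q) \<bullet> e" by linarith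
    then show ?thesis by (simp add: inner_diff_left qe)
  qed
  have line: "((\<lambda>t. U (x + t *\<^sub>R e)) has_real_derivative grad U x \<bullet> e) (at 0)" if "x \<in> ?B2" for x
    using GDERIV_line[of U x 0 e] diff[OF that] by simp
  have dd: "dir_deriv U e x = grad U x \<bullet> e" if "x \<in> ?B2" for x
    unfolding dir_deriv_def using line[OF that] by (rule DERIV_imp_deriv)
  have contU: "continuous_on UNIV U" using lip lipschitz_on_continuous_on by blast
  have sub: "ball 0 r0 \<subseteq> ?B2" using r0 by auto
  interpret directed_solution U "dir_deriv U e" e s p L r0 "3 * norm q / 4" "real CARD('n)" "real CARD('n) + s * p"
  proof
    show "real DIM(real ^ 'n) = real CARD('n)" by simp
    show "2 \<le> real CARD('n)" using n by simp
    show "0 < 3 * norm q / 4" using q by simp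
    show "3 * norm q / 4 * t \<le> U (x + t *\<^sub>R e) - U x"
      if t: "0 \<le> t" and x: "x \<in> ?B2" "x + t *\<^sub>R e \<in> ?B2" for x t
    proof (cases "t = 0")
      case False
      \<comment> \<open>The segment stays in the ball by convexity, so the mean value theorem along
        \<open>e\<close> is available.\<close>
      have in2: "x + u *\<^sub>R e \<in> ?B2" if "0 \<le> u" "u \<le> t" for u
      proof -
        have "x + u *\<^sub>R e = (1 - u / t) *\<^sub>R x + (u / t) *\<^sub>R (x + t *\<^sub>R e)"
          using False by (simp add: algebra_simps)
        then show ?thesis
          using convexD[OF convex_ball x, of "1 - u / t" "u / t"] that t False by simp
      qed
      have "\<exists>z. 0 < z \<and> z < t \<and> U (x + t *\<^sub>R e) - U (x + 0 *\<^sub>R e) = (t - 0) * (grad U (x + z *\<^sub>R e) \<bullet> e)"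
        using t False by (intro MVT2[where f = "\<lambda>t. U (x + t *\<^sub>R e)"] GDERIV_line diff in2) auto
      then obtain z where z: "0 < z" "z < t" "U (x + t *\<^sub>R e) - U x = t * (grad U (x + z *\<^sub>R e) \<bullet> e)" by auto
      have "3 * norm q / 4 \<le> grad U (x + z *\<^sub>R e) \<bullet> e" using z by (intro ge in2) auto
      from mult_left_mono[OF this t] show ?thesis unfolding z(3) by (simp only: mult.commute)
    qed simp
    show "has_bochner_integral (lborel \<Otimes>\<^sub>M lborel)
        (\<lambda>(x, y). Jp p (U x - U y) * (\<phi> x - \<phi> y) / norm (x - y) powr (real CARD('n) + s * p)) 0"
      if "\<phi> \<in> test_functions UNIV" for \<phi>
      using sol that by (simp add: entire_weak_solution_def)
    show "dir_deriv U e \<in> borel_measurable borel" by (rule borel_measurable_dir_deriv[OF contU])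
    show "AE x in lborel. ((\<lambda>t. U (x + t *\<^sub>R e)) has_real_derivative dir_deriv U e x) (at 0)"
      using AE_dir_differentiable[OF lip, of e]
      by eventually_elim (simp add: dir_deriv_def DERIV_deriv_iff_real_differentiable)
    show "((\<lambda>t. U (x + t *\<^sub>R e)) has_real_derivative dir_deriv U e x) (at 0)" if "x \<in> ball 0 r0" for x
      using line[of x] dd[of x] that sub by auto
    have "continuous_on (ball 0 r0) (\<lambda>x. grad U x \<bullet> e)"
      by (intro continuous_intros continuous_on_subset[OF cg sub])
    then show "continuous_on (ball 0 r0) (dir_deriv U e)"
      by (rule continuous_on_eq) (use dd sub in auto)
  qed (use p s sp lip e1 r0 in auto)
  have half: "ball 0 (r0 / 2) \<Subset> ball (0 :: real ^ 'n) r0"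
    using r0 by (auto simp: compactly_inside_def)
  \<comment> \<open>With \<kappa> = 2 - p the power n - \<kappa> is n + p - 2, and \<kappa> < \<tau>
    amounts to sp > 0.\<close>
  have mk: "morrey_kato_absorption (ball 0 r0) \<tau> (2 - p) (AU s p U r0)"
    unfolding morrey_kato_absorption_def
  proof (intro conjI allI impI)
    show "0 < 2 - p" "2 - p < \<tau>" using p sp_bounds by (auto simp: \<tau>)
    show "(\<lambda>x. indicator (ball 0 r0) x * AU s p U r0 x) \<in> borel_measurable lborel" by (rule AU_meas)
    fix D0 :: "(real ^ 'n) set" assume D0: "D0 \<Subset> ball 0 r0"
    have eq: "real DIM(real ^ 'n) - (2 - p) = real CARD('n) + p - 2" by simp
    show "\<exists>M::real. \<forall>x r. 0 < r \<and> ball x r \<subseteq> D0 \<longrightarrow>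
        (\<integral>\<^sup>+y\<in>ball x r. AU s p U r0 y \<partial>lborel) \<le> ennreal (M * r powr (real DIM(real ^ 'n) - (2 - p)))"
      unfolding eq using AU_morrey[OF D0] by blast
  qed
  show ?thesis
  proof (intro conjI)
    show "\<forall>x\<in>?B2. dir_deriv U e x \<ge> 3 * norm q / 4" using dd ge by simp
    show "symmetric_Dirichlet_kernel (ball 0 r0) J" by (rule Dirichlet_kernel)
    show "AE z in lborel \<Otimes>\<^sub>M lborel. fst z \<in> ball 0 r0 \<longrightarrow> U (fst z) \<noteq> U (snd z)"
      using AE_level by eventually_elim auto
    show "\<exists>C::real. \<forall>x0 r. 0 < r \<and> ball x0 r \<subseteq> ball 0 (r0 / 2) \<longrightarrow>
        (\<integral>\<^sup>+x\<in>ball x0 r. AU s p U r0 x \<partial>lborel) \<le> ennreal (C * r powr (real CARD('n) + p - 2))"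
      using AU_morrey[OF half] by blast
    show "\<exists>C::real \<Rightarrow> real. \<forall>D0. D0 \<Subset> ball 0 r0 \<longrightarrow>
        (\<forall>x0 r. 0 < r \<and> ball x0 r \<subseteq> D0 \<longrightarrow>
          (\<integral>\<^sup>+x\<in>ball x0 r. AU s p U r0 x \<partial>lborel)
            \<le> ennreal (C (setdist D0 (sphere 0 r0)) * r powr (real CARD('n) + p - 2)))"
      using AU_morrey by blast
    show "morrey_kato_absorption (ball 0 r0) \<tau> (2 - p) (AU s p U r0)" by (rule mk)
    show "\<tau> - (2 - p) = s * p" by (simp add: \<tau>)
    show "0 < s * p" using p s by simp
    show "AE x in lborel. (\<lambda>t. U (x + t *\<^sub>R e)) differentiable (at 0)" by (rule AE_dir_differentiable[OF lip])
    show "dir_deriv U e \<in> energy_space_loc J (ball 0 r0)" by (rule w_energy_space_loc)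
    show "\<forall>\<phi>\<in>test_functions (ball 0 r0). has_bochner_integral (lborel \<Otimes>\<^sub>M lborel)
          (\<lambda>(x, y). J x y * (dir_deriv U e x - dir_deriv U e y) * (\<phi> x - \<phi> y)) 0"
    proof
      fix \<phi> assume \<phi>: "\<phi> \<in> test_functions (ball (0 :: real ^ 'n) r0)"
      obtain R B K where "0 \<le> R" "R < r0" "\<And>x. R < norm x \<Longrightarrow> \<phi> x = 0" "bl_fun B K \<phi>"
        by (rule test_function_support[OF \<phi> r0], rule that)
      then show "has_bochner_integral (lborel \<Otimes>\<^sub>M lborel)
          (\<lambda>(x, y). J x y * (dir_deriv U e x - dir_deriv U e y) * (\<phi> x - \<phi> y)) 0"
        unfolding case_prod_unfold by (intro linearised_identity[of B K \<phi> R])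
    qed
    show "\<forall>\<phi>\<in>energy_space_c J (ball 0 r0). has_bochner_integral (lborel \<Otimes>\<^sub>M lborel)
          (\<lambda>(x, y). J x y * (dir_deriv U e x - dir_deriv U e y)
             * (zero_extension (ball 0 r0) \<phi> x - zero_extension (ball 0 r0) \<phi> y)) 0"
      unfolding case_prod_unfold by (intro ballI energy_c_identity)
  qed
qed

end
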